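(* Let $\beta>-1$ be real, let $m,m'\in\{0,1,2,\ldots\}$, and put $\mu:=m+m'$, $\nu:=m-m'$. All asymptotics are as $r\to+\infty$ with the parameters fixed. (i) If $\alpha>0$ and $\alpha\notin\mathbb{N}$, then with $\gamma:=\min\{\alpha+1,2\}$, $$\sum_{l=1}^{\infty}\frac{J_{l+m'}(r)J_{l+m}(r)}{(l+\beta)^\alpha}=\frac{c^1_{\alpha,\nu}}{r^\alpha}+\frac{c^2_{\alpha,\beta,\nu}+c^3_{\alpha,\beta}\sin\left(2r-\frac{\pi\mu}{2}\right)}{r}+O\left(\frac{1}{r^{\gamma}}\right).$$ (ii) If $\alpha=1$, then $$\sum_{l=1}^{\infty}\frac{J_{l+m'}(r)J_{l+m}(r)}{l+\beta}=\frac{c^4_\nu\log r}{r}+\frac{c^5_{\beta,\nu}+c^3_{1,\beta}\sin\left(2r-\frac{\pi\mu}{2}\right)}{r}+o\left(r^{-1}\right).$$ (iii) If $\alpha\in\mathbb{N}$ and $\alpha>1$, then for every $\gamma>0$ (arbitrarily small), $$\sum_{l=1}^{\infty}\frac{J_{l+m'}(r)J_{l+m}(r)}{(l+\beta)^\alpha}=\frac{c^2_{\alpha,\beta,\nu}+c^3_{\alpha,\beta}\sin\left(2r-\frac{\pi\mu}{2}\right)}{r}+O\left(\frac{1}{r^{2-\gamma}}\right).$$ Here the constants are $$c^1_{\alpha,\nu}=\frac{2^{\alpha-1}\Gamma(1-\alpha)}{\Gamma\left(\frac{\nu-\alpha+2}{2}\right)\Gamma\left(\frac{-\nu-\alpha+2}{2}\right)},\qquad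 c^2_{\alpha,\beta,\nu}=\frac1\pi\cos\left(\frac{\pi\nu}{2}\right)\zeta(\alpha,\beta+1),$$ $$c^3_{\alpha,\beta}=\frac{2^{-\alpha}}{\pi}\left(\zeta\left(\alpha,\tfrac{\beta+2}{2}\right)-\zeta\left(\alpha,\tfrac{\beta+1}{2}\right)\right)\ (\alpha\neq1),\qquad c^3_{1,\beta}=-\frac1\pi\Phi(-1,1,\beta+1),$$ $$c^4_\nu=\frac1\pi\cos\left(\frac{\pi\nu}{2}\right),\qquad c^5_{\beta,\nu}=\frac1\pi\left(-\cos\left(\frac{\pi\nu}{2}\right)\left(H_\beta+\psi\left(\tfrac{|\nu|+1}{2}\right)+\log 2\right)+\frac{\pi}{2}\sin\left(\frac{\pi|\nu|}{2}\right)\right).$$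
   Context: $J_n$ denotes the Bessel function of the first kind of order $n$. $\mathbb{N}=\{1,2,\ldots\}$. $\zeta(s,a)$ is the Hurwitz zeta function (analytically continued in $s$). $\Phi(-1,1,a)=\sum_{n\ge0}\frac{(-1)^n}{n+a}$ is the value at $z=-1$ of the Lerch transcendent $\Phi(z,s,a)=\sum_{n\ge0}\frac{z^n}{(n+a)^s}$. $\psi=\Gamma'/\Gamma$ is the digamma function and $H_\beta:=\psi(\beta+1)+\gamma_E$ are the extended harmonic numbers, where $\gamma_E$ is the Euler–Mascheroni constant. $1/\Gamma$ is interpreted as $0$ at the poles of $\Gamma$. *)

theory Defs
  imports "HOL-Analysis.Analysis" "HOL-Library.Landau_Symbols"
begin

text \<open>Bessel function of the first kind, of natural order, by its everywhere convergent power
  series.\<close>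

definition bessel_J :: "nat \<Rightarrow> real \<Rightarrow> real" where
  "bessel_J n x = (\<Sum>k. (-1) ^ k / (fact k * fact (n + k)) * (x / 2) ^ (2 * k + n))"

text \<open>Hurwitz zeta function for real \<open>a > 0\<close>: the analytic continuation of
  \<open>\<Sum>n. 1 / (n + a)\<^sup>s\<close> from \<open>Re s > 1\<close> to the plane without the point \<open>1\<close>. The chosen function is
  unique except for its irrelevant value at the pole \<open>s = 1\<close>.\<close>

definition hurwitz_zeta :: "complex \<Rightarrow> real \<Rightarrow> complex" where
  "hurwitz_zeta s a =
     (SOME f. f holomorphic_on (- {1}) \<and>
        (\<forall>z. Re z > 1 \<longrightarrow> f z = (\<Sum>n. 1 / complex_of_real (real n + a) powr z))) s"

text \<open>For \<open>a > 0\<close> and real \<open>s \<noteq> 1\<close> the value is real, so taking the real part loses nothing.\<close>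

definition hurwitz_zeta_real :: "real \<Rightarrow> real \<Rightarrow> real" where
  "hurwitz_zeta_real s a = Re (hurwitz_zeta (complex_of_real s) a)"

definition lerch_phi :: "real \<Rightarrow> real \<Rightarrow> real \<Rightarrow> real" where
  "lerch_phi z s a = (\<Sum>n. z ^ n / (real n + a) powr s)"

definition ext_harm :: "real \<Rightarrow> real" where
  "ext_harm \<beta> = Digamma (\<beta> + 1) + euler_mascheroni"

text \<open>\<^const>\<open>rGamma\<close> is \<open>1 / \<Gamma>\<close>, with value \<open>0\<close> at the poles of \<open>\<Gamma>\<close>.\<close>

definition c1 :: "real \<Rightarrow> real \<Rightarrow> real" where
  "c1 \<alpha> \<nu> = 2 powr (\<alpha> - 1) * Gamma (1 - \<alpha>)
     * rGamma ((\<nu> - \<alpha> + 2) / 2) * rGamma ((- \<nu> - \<alpha> + 2) / 2)"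

definition c2 :: "real \<Rightarrow> real \<Rightarrow> real \<Rightarrow> real" where
  "c2 \<alpha> \<beta> \<nu> = 1 / pi * cos (pi * \<nu> / 2) * hurwitz_zeta_real \<alpha> (\<beta> + 1)"

definition c3 :: "real \<Rightarrow> real \<Rightarrow> real" where
  "c3 \<alpha> \<beta> =
     (if \<alpha> = 1 then - (1 / pi) * lerch_phi (-1) 1 (\<beta> + 1)
      else 2 powr (- \<alpha>) / pi *
        (hurwitz_zeta_real \<alpha> ((\<beta> + 2) / 2) - hurwitz_zeta_real \<alpha> ((\<beta> + 1) / 2)))"

definition c4 :: "real \<Rightarrow> real" where
  "c4 \<nu> = 1 / pi * cos (pi * \<nu> / 2)"

definition c5 :: "real \<Rightarrow> real \<Rightarrow> real" where
  "c5 \<beta> \<nu> = 1 / pi *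
     (- cos (pi * \<nu> / 2) * (ext_harm \<beta> + Digamma ((\<bar>\<nu>\<bar> + 1) / 2) + ln 2)
      + pi / 2 * sin (pi * \<bar>\<nu>\<bar> / 2))"

text \<open>The series over \<open>l \<ge> 1\<close>, indexed from zero by \<open>l - 1\<close>.\<close>

definition bessel_sum :: "real \<Rightarrow> real \<Rightarrow> nat \<Rightarrow> nat \<Rightarrow> real \<Rightarrow> real" where
  "bessel_sum \<alpha> \<beta> m m' r =
     (\<Sum>i. let l = Suc i in bessel_J (l + m') r * bessel_J (l + m) r / (real l + \<beta>) powr \<alpha>)"

end

theory Submission
  imports Defs "HOL-Complex_Analysis.Complex_Analysis" "HOL-Real_Asymp.Real_Asymp"
begin

text \<open>With \<open>n = \<bar>m - m'\<bar>\<close> and a shift of the summation index, the series becomes a sum of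
  \<open>h l * J\<^sub>l(r) * J\<^sub>l\<^sub>+\<^sub>n(r)\<close> with \<open>h l = l\<^sup>-\<^sup>\<alpha> + c * l\<^sup>-\<^sup>\<alpha>\<^sup>-\<^sup>1 + O(l\<^sup>-\<^sup>\<alpha>\<^sup>-\<^sup>2)\<close>. Inserting the
  large-argument asymptotics of the Bessel functions, with an error explicit in the order, yields
  the terms of order \<open>1/r\<close> whenever \<open>h\<close> decays fast enough. The three-term recurrence lowers the
  required decay: it trades \<open>l\<^sup>-\<^sup>\<alpha>\<close> for weights decaying one power faster. For \<open>\<alpha> \<le> 1\<close> the sum
  satisfies, up to such fast decaying weights, the differential equation \<open>r S' = -\<alpha> S + \<dots>\<close>, whose
  homogeneous solution is the term of order \<open>r\<^sup>-\<^sup>\<alpha>\<close>. Its constant comes from the fact that the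
  weights \<open>J\<^sub>l(r)\<^sup>2\<close> on the points \<open>l/r\<close> converge to the arcsine law, together with a recursion in \<open>n\<close>.
  The constants of order \<open>1/r\<close> are identified through the continuation of the Hurwitz zeta
  function by partial sums corrected with \<open>L\<^sup>1\<^sup>-\<^sup>\<alpha> / (1 - \<alpha>)\<close>.\<close>

section \<open>Bessel functions of integer order\<close>

text \<open>Termwise, \<open>J_l(r) J_(l+n)(r)\<close> is
  \<open>(cn n + (-1)^l sn n r) / (pi r)\<close> up to \<open>O((l+1)^2 / r^2)\<close>. Summed
  against the weights, the constant part of the numerator yields the zeta value in
  \<open>c2\<close>, the alternating part yields \<open>c3\<close>. The growth of the error in
  \<open>l\<close> is the obstacle: it costs the weights two powers of decay, which the recurrences
  have to win back.

  The constant of \<open>r^(-\<alpha>)\<close> is half a negative moment of the arcsine law. Its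
  test function \<open>t^(-\<alpha>)\<close> at \<open>t = l / r\<close> is unbounded near 0, so
  weak convergence does not reach it. It is found from positive moments instead:
  \<open>t^(1-\<alpha>)\<close> belongs to order 1 and \<open>t^(2-\<alpha>)\<close> to the sum of
  the orders 0 and 2, and the two-step recursion in the order, which the Gamma quotient
  \<open>c1\<close> also satisfies, does the rest. At \<open>\<alpha> = 1\<close> the negative
  moment diverges; this is the logarithm, and the constant next to it comes from the test function
  \<open>t ln t\<close>.

  The arcsine law is available because \<open>J_0^2, 2 J_1^2, 2 J_2^2, ...\<close> are probability
  weights and their even central factorial moments solve elementary differential equations.\<close>

definition bessel_coeff :: "nat \<Rightarrow> nat \<Rightarrow> real" where
  "bessel_coeff n k = (-1) ^ k / (fact k * fact (n + k))"

text \<open>Factoring \<open>(x/2)^n\<close> out of \<open>J_n(x)\<close> leaves an entire series in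
  \<open>y = (x/2)^2\<close>, up to scaling the hypergeometric function 0F1. Differentiation only
  raises the order and flips the sign, so the classical recurrences become identities between
  coefficients.\<close>

definition bessel_G :: "nat \<Rightarrow> real \<Rightarrow> real" where
  "bessel_G n y = (\<Sum>k. bessel_coeff n k * y ^ k)"

lemma abs_bessel_coeff_le: "\<bar>bessel_coeff n k\<bar> \<le> 1 / (fact n * fact k)"
proof -
  have "(fact n :: real) \<le> fact (n + k)" by (rule fact_mono) simp
  thus ?thesis by (simp add: bessel_coeff_def abs_mult field_simps mult_left_mono)
qed

lemma summable_exp_bound: "summable (\<lambda>k. 1 / (fact n * fact k) * \<bar>y\<bar> ^ k :: real)"
  using summable_mult[OF summable_exp[of "\<bar>y\<bar>"], of "1 / fact n"]
  by (simp add: field_simps)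

lemma abs_bessel_term_le: "\<bar>bessel_coeff n k * y ^ k\<bar> \<le> 1 / (fact n * fact k) * \<bar>y\<bar> ^ k"
  using abs_bessel_coeff_le[of n k] by (simp add: abs_mult power_abs mult_right_mono del: times_divide_eq_left)

lemma summable_bessel_G: "summable (\<lambda>k. bessel_coeff n k * y ^ k)"
  by (rule summable_comparison_test'[OF summable_exp_bound[of n y], of 0])
     (use abs_bessel_term_le in auto)

lemma abs_bessel_G_le: "\<bar>bessel_G n y\<bar> \<le> exp \<bar>y\<bar> / fact n"
proof -
  have *: "summable (\<lambda>k. \<bar>bessel_coeff n k * y ^ k\<bar>)"
    by (rule summable_comparison_test'[OF summable_exp_bound[of n y], of 0])
       (use abs_bessel_term_le in auto)
  have "\<bar>bessel_G n y\<bar> \<le> (\<Sum>k. \<bar>bessel_coeff n k * y ^ k\<bar>)"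
    unfolding bessel_G_def by (rule summable_rabs[OF *])
  also have "\<dots> \<le> (\<Sum>k. 1 / (fact n * fact k) * \<bar>y\<bar> ^ k)"
    by (rule suminf_le[OF _ * summable_exp_bound]) (use abs_bessel_term_le in auto)
  also have "\<dots> = (\<Sum>k. (1 / fact n) * (inverse (fact k) * \<bar>y\<bar> ^ k))"
    by (simp add: field_simps)
  also have "\<dots> = exp \<bar>y\<bar> / fact n"
    by (subst suminf_mult[OF summable_exp]) (simp add: exp_def scaleR_conv_of_real)
  finally show ?thesis .
qed

lemma bessel_J_eq_G: "bessel_J n x = (x / 2) ^ n * bessel_G n ((x / 2) ^ 2)"
proof -
  have "(x / 2) ^ n * bessel_G n ((x / 2) ^ 2)
      = (\<Sum>k. (x / 2) ^ n * (bessel_coeff n k * ((x / 2) ^ 2) ^ k))"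
    unfolding bessel_G_def by (rule suminf_mult[symmetric, OF summable_bessel_G])
  also have "\<dots> = bessel_J n x"
    unfolding bessel_J_def bessel_coeff_def
    by (intro suminf_cong) (simp add: power_add power_mult)
  finally show ?thesis ..
qed

lemma diffs_bessel_coeff: "diffs (bessel_coeff n) k = - bessel_coeff (Suc n) k"
  by (simp add: diffs_def bessel_coeff_def field_simps del: of_nat_Suc)

lemma bessel_G_deriv: "(bessel_G n has_real_derivative - bessel_G (Suc n) y) (at y)"
proof -
  have "((\<lambda>x. \<Sum>k. bessel_coeff n k * x ^ k) has_real_derivative
      (\<Sum>k. diffs (bessel_coeff n) k * y ^ k)) (at y)"
    by (rule termdiffs_strong_converges_everywhere[OF summable_bessel_G])
  moreover have "(\<Sum>k. diffs (bessel_coeff n) k * y ^ k) = - bessel_G (Suc n) y"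
    unfolding bessel_G_def
    by (simp add: diffs_bessel_coeff suminf_minus[OF summable_bessel_G])
  ultimately show ?thesis by (simp add: bessel_G_def[abs_def])
qed

text \<open>A comparison of coefficients. The factor \<open>y\<close> shifts the last series by one
  place, so the coefficient at \<open>k = 0\<close> is split off and checked separately.\<close>

lemma bessel_G_rec: "bessel_G n y = real (Suc n) * bessel_G (Suc n) y - y * bessel_G (Suc (Suc n)) y"
proof -
  have 1: "bessel_coeff n (Suc k) * y ^ Suc k = real (Suc n) * (bessel_coeff (Suc n) (Suc k) * y ^ Suc k)
      - y * (bessel_coeff (Suc (Suc n)) k * y ^ k)" for k
  proof -
    have "bessel_coeff n (Suc k) = real (Suc n) * bessel_coeff (Suc n) (Suc k) - bessel_coeff (Suc (Suc n)) k"
      by (simp add: bessel_coeff_def divide_simps) (simp add: algebra_simps)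
    hence "y * y ^ k * bessel_coeff n (Suc k)
        = y * y ^ k * (real (Suc n) * bessel_coeff (Suc n) (Suc k) - bessel_coeff (Suc (Suc n)) k)"
      by simp
    thus ?thesis by (simp add: algebra_simps)
  qed
  have "bessel_G n y = bessel_coeff n 0 + (\<Sum>k. bessel_coeff n (Suc k) * y ^ Suc k)"
    unfolding bessel_G_def using suminf_split_head[OF summable_bessel_G[of n y]] by simp
  also have "(\<Sum>k. bessel_coeff n (Suc k) * y ^ Suc k)
     = (\<Sum>k. real (Suc n) * (bessel_coeff (Suc n) (Suc k) * y ^ Suc k)) - (\<Sum>k. y * (bessel_coeff (Suc (Suc n)) k * y ^ k))"
    unfolding 1
    by (rule suminf_diff[symmetric]; intro summable_mult summable_bessel_G)
       (use summable_Suc_iff[THEN iffD2, OF summable_bessel_G[of "Suc n" y]] in auto)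
  also have "(\<Sum>k. real (Suc n) * (bessel_coeff (Suc n) (Suc k) * y ^ Suc k))
     = real (Suc n) * (bessel_G (Suc n) y - bessel_coeff (Suc n) 0)"
    unfolding bessel_G_def
    using suminf_mult[OF summable_Suc_iff[THEN iffD2, OF summable_bessel_G[of "Suc n" y]], of "real (Suc n)"]
      suminf_split_head[OF summable_bessel_G[of "Suc n" y]] by simp
  also have "(\<Sum>k. y * (bessel_coeff (Suc (Suc n)) k * y ^ k)) = y * bessel_G (Suc (Suc n)) y"
    unfolding bessel_G_def by (rule suminf_mult[OF summable_bessel_G])
  also have "bessel_coeff n 0 = real (Suc n) * bessel_coeff (Suc n) 0"
    by (simp add: bessel_coeff_def divide_simps)
  finally show ?thesis by (simp add: algebra_simps)
qed

lemma bessel_J_rec: "x * (bessel_J n x + bessel_J (Suc (Suc n)) x) = 2 * real (Suc n) * bessel_J (Suc n) x"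
  unfolding bessel_J_eq_G bessel_G_rec[of n "(x / 2) ^ 2"]
  by (simp add: algebra_simps power2_eq_square)

lemma bessel_J_0_deriv: "(bessel_J 0 has_real_derivative - bessel_J 1 x) (at x)"
  unfolding bessel_J_eq_G[abs_def]
  by (rule derivative_eq_intros DERIV_chain2[OF bessel_G_deriv] refl | simp add: field_simps power2_eq_square)+

lemma bessel_J_Suc_deriv:
  "(bessel_J (Suc n) has_real_derivative (bessel_J n x - bessel_J (Suc (Suc n)) x) / 2) (at x)"
proof -
  have "(bessel_J (Suc n) has_real_derivative
     real (Suc n) * (x / 2) ^ n / 2 * bessel_G (Suc n) ((x/2)^2)
       - (x / 2) ^ Suc n * (x / 2) * bessel_G (Suc (Suc n)) ((x/2)^2)) (at x)"
    unfolding bessel_J_eq_G[abs_def]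
    by (rule derivative_eq_intros DERIV_chain2[OF bessel_G_deriv] refl | simp add: field_simps power2_eq_square)+
  also have "real (Suc n) * (x / 2) ^ n / 2 * bessel_G (Suc n) ((x/2)^2)
       - (x / 2) ^ Suc n * (x / 2) * bessel_G (Suc (Suc n)) ((x/2)^2)
     = (bessel_J n x - bessel_J (Suc (Suc n)) x) / 2"
    unfolding bessel_J_eq_G bessel_G_rec[of n "(x / 2) ^ 2"]
    by (simp add: algebra_simps power2_eq_square)
  finally show ?thesis .
qed

lemma bessel_J_deriv':
  assumes "x \<noteq> 0"
  shows "(bessel_J n has_real_derivative (real n / x * bessel_J n x - bessel_J (Suc n) x)) (at x)"
proof (cases n)
  case 0
  thus ?thesis using bessel_J_0_deriv[of x] by simp
next
  case (Suc k)
  have "(bessel_J k x - bessel_J (Suc (Suc k)) x) / 2 = real n / x * bessel_J n x - bessel_J (Suc n) x"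
    using bessel_J_rec[of x k] assms Suc by (simp add: field_simps)
  thus ?thesis using bessel_J_Suc_deriv[of k x] unfolding Suc by (simp only:)
qed

lemma bessel_J_Suc_deriv':
  assumes "x \<noteq> 0"
  shows "(bessel_J (Suc n) has_real_derivative (bessel_J n x - real (Suc n) / x * bessel_J (Suc n) x)) (at x)"
proof -
  have "(bessel_J n x - bessel_J (Suc (Suc n)) x) / 2 = bessel_J n x - real (Suc n) / x * bessel_J (Suc n) x"
    using bessel_J_rec[of x n] assms by (simp add: field_simps)
  thus ?thesis using bessel_J_Suc_deriv[of n x] by (simp only:)
qed

lemma continuous_on_bessel_J [continuous_intros]:
  assumes "continuous_on A f"
  shows "continuous_on A (\<lambda>x. bessel_J n (f x))"
proof -
  have "continuous_on UNIV (bessel_J n)"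
    by (cases n; intro continuous_at_imp_continuous_on ballI)
       (auto intro: DERIV_isCont bessel_J_0_deriv bessel_J_Suc_deriv)
  thus ?thesis using assms continuous_on_compose2 by blast
qed

lemma bessel_J_at_0: "bessel_J n 0 = (if n = 0 then 1 else 0)"
proof -
  have "bessel_G 0 0 = 1"
    unfolding bessel_G_def using powser_zero[of "bessel_coeff 0"] by (simp add: bessel_coeff_def)
  thus ?thesis by (simp add: bessel_J_eq_G)
qed

text \<open>Wasteful in \<open>R\<close>, but the factor \<open>1 / fact n\<close> is kept: on a
  bounded set of arguments the decay in the order is factorial and beats every exponentially growing
  weight.\<close>

lemma abs_bessel_J_le_crude:
  assumes "\<bar>x\<bar> \<le> 2 * R"
  shows "\<bar>bessel_J n x\<bar> \<le> exp (R ^ 2) * R ^ n / fact n"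
proof -
  have R: "R \<ge> 0" using assms by simp
  have 1: "\<bar>x / 2\<bar> \<le> R" using assms by simp
  have "(x / 2) ^ 2 \<le> R ^ 2" using 1 by (metis abs_ge_zero power2_abs power_mono)
  hence "exp \<bar>(x / 2) ^ 2\<bar> / fact n \<le> exp (R ^ 2) / fact n" by (simp add: divide_right_mono)
  hence 2: "\<bar>bessel_G n ((x / 2) ^ 2)\<bar> \<le> exp (R ^ 2) / fact n" using abs_bessel_G_le order_trans by blast
  have "\<bar>x / 2\<bar> ^ n \<le> R ^ n" by (rule power_mono[OF 1]) simp
  hence "\<bar>x / 2\<bar> ^ n * \<bar>bessel_G n ((x / 2) ^ 2)\<bar> \<le> R ^ n * (exp (R ^ 2) / fact n)"
    using 2 R by (intro mult_mono) auto
  thus ?thesis by (simp add: bessel_J_eq_G abs_mult power_abs mult.commute)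
qed

section \<open>Sums of products of Bessel functions\<close>

text \<open>The derivative of \<open>J_n\<close>. The case split stands for the convention
  \<open>J_(-1) = - J_1\<close>, which natural-number orders cannot express.\<close>

definition bessel_J' :: "nat \<Rightarrow> real \<Rightarrow> real" where
  "bessel_J' n x = (case n of 0 \<Rightarrow> - bessel_J 1 x | Suc k \<Rightarrow> (bessel_J k x - bessel_J (Suc (Suc k)) x) / 2)"

lemma bessel_J_deriv: "(bessel_J n has_real_derivative bessel_J' n x) (at x)"
  by (cases n) (auto simp: bessel_J'_def bessel_J_0_deriv[simplified] bessel_J_Suc_deriv)

lemma bessel_J'_eq:
  "x \<noteq> 0 \<Longrightarrow> bessel_J' n x = real n / x * bessel_J n x - bessel_J (Suc n) x"
  "x \<noteq> 0 \<Longrightarrow> bessel_J' (Suc n) x = bessel_J n x - real (Suc n) / x * bessel_J (Suc n) x"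
  using DERIV_unique[OF bessel_J_deriv bessel_J_deriv'] DERIV_unique[OF bessel_J_deriv bessel_J_Suc_deriv']
  by blast+

text \<open>The term of order \<open>n - 1\<close> is larger by a factor \<open>n\<close>; absorbing
  \<open>n\<close> into a power of 2 is what doubles the base \<open>R\<close>.\<close>

lemma abs_bessel_J'_le_crude:
  assumes "\<bar>x\<bar> \<le> 2 * R" "R \<ge> 1"
  shows "\<bar>bessel_J' n x\<bar> \<le> (1 + R) * exp (R ^ 2) * (2 * R) ^ n / fact n"
proof (cases n)
  case 0
  have "\<bar>bessel_J 1 x\<bar> \<le> exp (R ^ 2) * R ^ 1 / fact 1" by (rule abs_bessel_J_le_crude[OF assms(1)])
  also have "\<dots> \<le> (1 + R) * exp (R ^ 2)" by (simp add: algebra_simps)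
  finally show ?thesis using 0 by (simp add: bessel_J'_def)
next
  case (Suc k)
  have 1: "\<bar>bessel_J k x\<bar> \<le> exp (R ^ 2) * R ^ k / fact k" by (rule abs_bessel_J_le_crude[OF assms(1)])
  have 2: "\<bar>bessel_J (Suc (Suc k)) x\<bar> \<le> exp (R ^ 2) * R ^ (Suc (Suc k)) / fact (Suc (Suc k))"
    by (rule abs_bessel_J_le_crude[OF assms(1)])
  have k: "real k + 1 \<le> 2 ^ k" by (induction k) auto
  have "exp (R ^ 2) * R ^ k / fact k = exp (R ^ 2) * R ^ k * (real k + 1) / fact (Suc k)"
    using fact_gt_zero[of k, where 'a = real] by (simp add: divide_simps) (simp add: algebra_simps)?
  also have "\<dots> \<le> exp (R ^ 2) * R ^ Suc k * 2 ^ Suc k / fact (Suc k)"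
    using assms(2) k by (intro divide_right_mono mult_mono) (auto intro: order_trans[of _ 1])
  finally have 1: "\<bar>bessel_J k x\<bar> \<le> exp (R ^ 2) * (2 * R) ^ Suc k / fact (Suc k)" using 1
    by (simp add: power_mult_distrib mult_ac)
  have "exp (R ^ 2) * R ^ (Suc (Suc k)) / fact (Suc (Suc k)) \<le> exp (R ^ 2) * R ^ (Suc (Suc k)) / fact (Suc k)"
    using assms(2) by (intro divide_left_mono fact_mono mult_pos_pos) auto
  also have "\<dots> \<le> R * exp (R ^ 2) * (2 * R) ^ Suc k / fact (Suc k)"
    using assms(2) power_mono[of R "2 * R" "Suc k"] by (auto intro!: divide_right_mono simp: mult_ac)
  finally have "\<bar>bessel_J (Suc (Suc k)) x\<bar> \<le> R * exp (R ^ 2) * (2 * R) ^ Suc k / fact (Suc k)" using 2 by linarith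
  moreover have "\<bar>bessel_J' n x\<bar> \<le> \<bar>bessel_J k x\<bar> + \<bar>bessel_J (Suc (Suc k)) x\<bar>"
    using Suc by (simp add: bessel_J'_def)
  ultimately have "\<bar>bessel_J' n x\<bar> \<le> exp (R ^ 2) * (2 * R) ^ Suc k / fact (Suc k) + R * exp (R ^ 2) * (2 * R) ^ Suc k / fact (Suc k)"
    using 1 by linarith
  also have "\<dots> = (1 + R) * exp (R ^ 2) * (2 * R) ^ Suc k / fact (Suc k)"
    by (simp add: algebra_simps add_divide_distrib)
  finally show ?thesis unfolding Suc .
qed

definition bprod :: "nat \<Rightarrow> nat \<Rightarrow> real \<Rightarrow> real" where
  "bprod n l r = bessel_J l r * bessel_J (l + n) r"

definition bprod' :: "nat \<Rightarrow> nat \<Rightarrow> real \<Rightarrow> real" where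
  "bprod' n l r = bessel_J' l r * bessel_J (l + n) r + bessel_J l r * bessel_J' (l + n) r"

definition bsum :: "nat \<Rightarrow> (nat \<Rightarrow> real) \<Rightarrow> real \<Rightarrow> real" where
  "bsum n h r = (\<Sum>l. h l * bprod n l r)"

lemma bprod_deriv: "(bprod n l has_real_derivative bprod' n l r) (at r)"
  unfolding bprod_def[abs_def] bprod'_def
  by (auto intro!: derivative_eq_intros bessel_J_deriv)

lemma bprod_at_0: "bprod n l 0 = (if l = 0 \<and> n = 0 then 1 else 0)"
  by (auto simp: bprod_def bessel_J_at_0)

text \<open>The class of admissible weights. It is closed under sums, products and index shifts, and
  the factorial decay of \<open>bprod\<close> in \<open>l\<close> dominates it, so every
  rearrangement of the series below reduces to this one closure property.\<close>

definition exp_bdd :: "(nat \<Rightarrow> real) \<Rightarrow> bool" where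
  "exp_bdd h \<longleftrightarrow> (\<exists>C D. C \<ge> 0 \<and> D \<ge> 1 \<and> (\<forall>l. \<bar>h l\<bar> \<le> C * D ^ l))"

lemma exp_bddI: "D \<ge> 1 \<Longrightarrow> (\<And>l. \<bar>h l\<bar> \<le> C * D ^ l) \<Longrightarrow> exp_bdd h"
  unfolding exp_bdd_def by (metis abs_ge_zero mult.right_neutral order_trans power_0)

lemma exp_bdd_const [intro]: "exp_bdd (\<lambda>l. c)"
  by (rule exp_bddI[of 1 _ "\<bar>c\<bar>"]) auto

lemma exp_bdd_of_nat [intro]: "exp_bdd (\<lambda>l. real l)"
  by (rule exp_bddI[of 2 _ 1]) (auto simp: less_imp_le[OF of_nat_less_two_power])

lemma exp_bdd_add [intro]:
  assumes "exp_bdd f" "exp_bdd g" shows "exp_bdd (\<lambda>l. f l + g l)"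
proof -
  from assms obtain A B C D where *: "A \<ge> 0" "B \<ge> 1" "\<And>l. \<bar>f l\<bar> \<le> A * B ^ l"
    "C \<ge> 0" "D \<ge> 1" "\<And>l. \<bar>g l\<bar> \<le> C * D ^ l" unfolding exp_bdd_def by metis
  show ?thesis
  proof (rule exp_bddI[of "max B D" _ "A + C"])
    fix l
    have "A * B ^ l \<le> A * max B D ^ l" "C * D ^ l \<le> C * max B D ^ l"
      using * by (auto intro!: mult_left_mono power_mono)
    thus "\<bar>f l + g l\<bar> \<le> (A + C) * max B D ^ l" using *(3)[of l] *(6)[of l] by (simp add: algebra_simps)
  qed (use * in auto)
qed

lemma exp_bdd_mult [intro]:
  assumes "exp_bdd f" "exp_bdd g" shows "exp_bdd (\<lambda>l. f l * g l)"
proof -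
  from assms obtain A B C D where *: "A \<ge> 0" "B \<ge> 1" "\<And>l. \<bar>f l\<bar> \<le> A * B ^ l"
    "C \<ge> 0" "D \<ge> 1" "\<And>l. \<bar>g l\<bar> \<le> C * D ^ l" unfolding exp_bdd_def by metis
  show ?thesis
  proof (rule exp_bddI[of "B * D" _ "A * C"])
    fix l
    have "\<bar>f l\<bar> * \<bar>g l\<bar> \<le> (A * B ^ l) * (C * D ^ l)" using * by (intro mult_mono) auto
    thus "\<bar>f l * g l\<bar> \<le> (A * C) * (B * D) ^ l" by (simp add: abs_mult power_mult_distrib mult_ac)
  qed (use * mult_mono[of 1 B 1 D] in auto)
qed

lemma exp_bdd_cmult [intro]: "exp_bdd f \<Longrightarrow> exp_bdd (\<lambda>l. c * f l)" by auto
lemma exp_bdd_minus [intro]: "exp_bdd f \<Longrightarrow> exp_bdd (\<lambda>l. - f l)"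
  using exp_bdd_cmult[of f "-1"] by simp
lemma exp_bdd_diff [intro]: "exp_bdd f \<Longrightarrow> exp_bdd g \<Longrightarrow> exp_bdd (\<lambda>l. f l - g l)"
  using exp_bdd_add[of f "\<lambda>l. - g l"] by auto
lemma exp_bdd_divide [intro]: "exp_bdd f \<Longrightarrow> exp_bdd (\<lambda>l. f l / c)"
  using exp_bdd_cmult[of f "inverse c"] by (simp add: field_simps)
lemma exp_bdd_power [intro]: "exp_bdd f \<Longrightarrow> exp_bdd (\<lambda>l. f l ^ k)"
  by (induction k) auto

lemma exp_bdd_mono: "exp_bdd g \<Longrightarrow> (\<And>l. \<bar>f l\<bar> \<le> \<bar>g l\<bar>) \<Longrightarrow> exp_bdd f"
  unfolding exp_bdd_def by (meson order_trans)

lemma exp_bdd_abs [intro]: "exp_bdd f \<Longrightarrow> exp_bdd (\<lambda>l. \<bar>f l\<bar>)"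
  by (erule exp_bdd_mono) auto

lemma exp_bdd_Suc [intro]:
  assumes "exp_bdd f" shows "exp_bdd (\<lambda>l. f (Suc l))"
proof -
  from assms obtain C D where *: "C \<ge> 0" "D \<ge> 1" "\<And>l. \<bar>f l\<bar> \<le> C * D ^ l" unfolding exp_bdd_def by metis
  show ?thesis using *(3)[of "Suc _"] *(1,2) by (intro exp_bddI[of D _ "C * D"]) (auto simp: mult_ac)
qed

lemma exp_bdd_pred [intro]:
  assumes "exp_bdd f" shows "exp_bdd (\<lambda>l. f (l - 1))"
proof -
  from assms obtain C D where *: "C \<ge> 0" "D \<ge> 1" "\<And>l. \<bar>f l\<bar> \<le> C * D ^ l" unfolding exp_bdd_def by metis
  show ?thesis
  proof (rule exp_bddI[of D _ C])
    fix l
    have "C * D ^ (l - 1) \<le> C * D ^ l" using * by (intro mult_left_mono power_increasing) auto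
    thus "\<bar>f (l - 1)\<bar> \<le> C * D ^ l" using *(3)[of "l - 1"] by linarith
  qed (use * in auto)
qed

lemma exp_bdd_powr [intro]: "exp_bdd (\<lambda>l. real l powr x)"
proof (rule exp_bddI[of "exp \<bar>x\<bar>" _ 1])
  fix l :: nat
  show "\<bar>real l powr x\<bar> \<le> 1 * exp \<bar>x\<bar> ^ l"
  proof (cases "l = 0")
    case False
    have "real l powr x \<le> real l powr \<bar>x\<bar>" using False by (intro powr_mono) auto
    also have "\<dots> \<le> exp (real l) powr \<bar>x\<bar>"
      using exp_ge_add_one_self[of "real l"] by (intro powr_mono2) (auto intro: order_trans[of _ "1 + real l"])
    also have "\<dots> = exp \<bar>x\<bar> ^ l" by (simp add: powr_def exp_of_nat_mult[symmetric] mult.commute)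
    finally show ?thesis by simp
  qed auto
qed auto

lemma exp_bdd_ln [intro]: "exp_bdd (\<lambda>l. ln (real l))"
proof (rule exp_bdd_mono[OF exp_bdd_of_nat])
  fix l :: nat
  show "\<bar>ln (real l)\<bar> \<le> \<bar>real l\<bar>"
    using ln_le_minus_one[of "real l"] by (cases "l = 0") auto
qed

lemma exp_bdd_if [intro]: "exp_bdd f \<Longrightarrow> exp_bdd g \<Longrightarrow> exp_bdd (\<lambda>l. if P l then f l else g l)"
  by (rule exp_bdd_mono[of "\<lambda>l. \<bar>f l\<bar> + \<bar>g l\<bar>"]) auto

lemmas exp_bdd_intros = exp_bdd_const exp_bdd_of_nat exp_bdd_powr exp_bdd_ln exp_bdd_add exp_bdd_diff
  exp_bdd_minus exp_bdd_divide exp_bdd_mult exp_bdd_power exp_bdd_abs exp_bdd_if exp_bdd_Suc exp_bdd_pred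

lemma bprod_crude:
  assumes "\<bar>r\<bar> \<le> 2 * R" "R \<ge> 1"
  shows "\<bar>bprod n l r\<bar> \<le> (exp (R ^ 2) * exp (R ^ 2) * R ^ n) * ((R * R) ^ l / fact l)"
    and "\<bar>bprod' n l r\<bar> \<le> (2 * (1 + R) * exp (R ^ 2) * exp (R ^ 2) * (2 * R) ^ n) * ((2 * R * (2 * R)) ^ l / fact l)"
proof -
  have f: "(1::real) / fact (l + n) \<le> 1" by simp
  have J: "\<bar>bessel_J (l + n) r\<bar> \<le> exp (R ^ 2) * R ^ (l + n)"
  proof -
    have "\<bar>bessel_J (l + n) r\<bar> \<le> exp (R ^ 2) * R ^ (l + n) * (1 / fact (l + n))"
      using abs_bessel_J_le_crude[OF assms(1), of "l + n"] by simp
    also have "\<dots> \<le> exp (R ^ 2) * R ^ (l + n) * 1" using assms by (intro mult_left_mono f) auto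
    finally show ?thesis by simp
  qed
  have J': "\<bar>bessel_J' (l + n) r\<bar> \<le> (1 + R) * exp (R ^ 2) * (2 * R) ^ (l + n)"
  proof -
    have "\<bar>bessel_J' (l + n) r\<bar> \<le> (1 + R) * exp (R ^ 2) * (2 * R) ^ (l + n) * (1 / fact (l + n))"
      using abs_bessel_J'_le_crude[OF assms, of "l + n"] by simp
    also have "\<dots> \<le> (1 + R) * exp (R ^ 2) * (2 * R) ^ (l + n) * 1" using assms by (intro mult_left_mono f) auto
    finally show ?thesis by simp
  qed
  have "\<bar>bprod n l r\<bar> \<le> (exp (R ^ 2) * R ^ l / fact l) * (exp (R ^ 2) * R ^ (l + n))"
    unfolding bprod_def abs_mult using abs_bessel_J_le_crude[OF assms(1), of l] J assms
    by (intro mult_mono) auto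
  thus "\<bar>bprod n l r\<bar> \<le> (exp (R ^ 2) * exp (R ^ 2) * R ^ n) * ((R * R) ^ l / fact l)"
    by (simp add: power_add power_mult_distrib mult_ac)
  have "\<bar>bprod' n l r\<bar> \<le> \<bar>bessel_J' l r\<bar> * \<bar>bessel_J (l + n) r\<bar> + \<bar>bessel_J l r\<bar> * \<bar>bessel_J' (l + n) r\<bar>"
    unfolding bprod'_def using abs_triangle_ineq[of "bessel_J' l r * bessel_J (l + n) r" "bessel_J l r * bessel_J' (l + n) r"]
    by (simp add: abs_mult)
  also have "\<dots> \<le> ((1 + R) * exp (R ^ 2) * (2 * R) ^ l / fact l) * (exp (R ^ 2) * R ^ (l + n))
      + (exp (R ^ 2) * R ^ l / fact l) * ((1 + R) * exp (R ^ 2) * (2 * R) ^ (l + n))"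
    using abs_bessel_J_le_crude[OF assms(1), of l] abs_bessel_J'_le_crude[OF assms, of l] J J' assms
    by (intro add_mono mult_mono) auto
  also have "\<dots> \<le> ((1 + R) * exp (R ^ 2) * (2 * R) ^ l / fact l) * (exp (R ^ 2) * (2 * R) ^ (l + n))
      + (exp (R ^ 2) * (2 * R) ^ l / fact l) * ((1 + R) * exp (R ^ 2) * (2 * R) ^ (l + n))"
    using assms power_mono[of R "2 * R" "l + n"] power_mono[of R "2 * R" l]
    by (intro add_mono mult_mono divide_right_mono) auto
  also have "\<dots> = (2 * (1 + R) * exp (R ^ 2) * exp (R ^ 2) * (2 * R) ^ n) * ((2 * R * (2 * R)) ^ l / fact l)"
  proof -
    define S where "S = 2 * R"
    show ?thesis unfolding S_def[symmetric] by (simp add: power_add power_mult_distrib mult_ac)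
  qed
  finally show "\<bar>bprod' n l r\<bar> \<le> (2 * (1 + R) * exp (R ^ 2) * exp (R ^ 2) * (2 * R) ^ n) * ((2 * R * (2 * R)) ^ l / fact l)" .
qed

lemma summable_majorant: "summable (\<lambda>l. C * D ^ l * (K * (M ^ l / fact l)) :: real)"
  using summable_mult[OF summable_exp[of "D * M"], of "C * K"]
  by (simp add: field_simps power_mult_distrib)

lemma majorant_le:
  assumes "\<bar>h l\<bar> \<le> C * D ^ l" "\<bar>p\<bar> \<le> K * (M ^ l / fact l)" "C \<ge> 0" "D \<ge> (1::real)"
  shows "norm (h l * p) \<le> C * D ^ l * (K * (M ^ l / fact l))"
  using assms by (simp only: real_norm_def abs_mult, intro mult_mono) auto

lemma summable_bprod:
  assumes "exp_bdd h"
  shows "summable (\<lambda>l. h l * bprod n l r)" "summable (\<lambda>l. h l * bprod' n l r)"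
proof -
  from assms obtain C D where *: "C \<ge> 0" "D \<ge> 1" "\<And>l. \<bar>h l\<bar> \<le> C * D ^ l" unfolding exp_bdd_def by metis
  define R where "R = \<bar>r\<bar> + 1"
  have R: "\<bar>r\<bar> \<le> 2 * R" "R \<ge> 1" by (auto simp: R_def)
  show "summable (\<lambda>l. h l * bprod n l r)"
    by (rule summable_comparison_test'[OF summable_majorant, of 0])
       (rule majorant_le[OF *(3) bprod_crude(1)[OF R] *(1,2)])
  show "summable (\<lambda>l. h l * bprod' n l r)"
    by (rule summable_comparison_test'[OF summable_majorant, of 0])
       (rule majorant_le[OF *(3) bprod_crude(2)[OF R] *(1,2)])
qed

lemma summable_bprod_Suc:
  assumes "exp_bdd h"
  shows "summable (\<lambda>l. h l * bprod n (Suc l) r)" "summable (\<lambda>l. h l * bprod' n (Suc l) r)"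
  using summable_bprod[OF exp_bdd_pred[OF assms], of n r, THEN summable_Suc_iff[THEN iffD2]] by auto

lemma bsum_deriv:
  assumes "exp_bdd h"
  shows "(bsum n h has_real_derivative (\<Sum>l. h l * bprod' n l r)) (at r)"
proof -
  from assms obtain C D where *: "C \<ge> 0" "D \<ge> 1" "\<And>l. \<bar>h l\<bar> \<le> C * D ^ l" unfolding exp_bdd_def by metis
  \<comment> \<open>One \<open>R\<close> serves the whole unit ball around \<open>r\<close>; this
    makes the majorant uniform there, as the M-test demands.\<close>
  define R where "R = \<bar>r\<bar> + 1"
  have R: "\<bar>x\<bar> \<le> 2 * R" "R \<ge> 1" if "x \<in> ball r 1" for x
    using that by (auto simp: R_def dist_real_def)
  have "uniformly_convergent_on (ball r 1) (\<lambda>n' x. \<Sum>i<n'. h i * bprod' n i x)"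
  proof (rule Weierstrass_m_test')
    show "summable (\<lambda>l. C * D ^ l * ((2 * (1 + R) * exp (R ^ 2) * exp (R ^ 2) * (2 * R) ^ n) * ((2 * R * (2 * R)) ^ l / fact l)))"
      by (rule summable_majorant)
    show "norm (h l * bprod' n l x) \<le> C * D ^ l * ((2 * (1 + R) * exp (R ^ 2) * exp (R ^ 2) * (2 * R) ^ n) * ((2 * R * (2 * R)) ^ l / fact l))"
      if "x \<in> ball r 1" for l x
      by (rule majorant_le[OF *(3) bprod_crude(2)[OF R(1)[OF that] R(2)[OF that]] *(1,2)])
  qed
  hence "((\<lambda>x. \<Sum>l. h l * bprod n l x) has_real_derivative (\<Sum>l. h l * bprod' n l r)) (at r)"
    by (rule has_field_derivative_series'(2)[of "ball r 1" "\<lambda>l x. h l * bprod n l x" "\<lambda>l x. h l * bprod' n l x" r, rotated 2])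
       (auto intro: summable_bprod[OF assms] DERIV_cmult bprod_deriv has_field_derivative_at_within)
  thus ?thesis by (simp add: bsum_def[abs_def])
qed

section \<open>Linearity, index shifts and recurrences of the weighted sums\<close>

lemma bsum_add: "exp_bdd f \<Longrightarrow> exp_bdd g \<Longrightarrow> bsum n (\<lambda>l. f l + g l) r = bsum n f r + bsum n g r"
  unfolding bsum_def by (subst suminf_add) (auto intro!: summable_bprod suminf_cong simp: algebra_simps)

lemma bsum_cmult: "exp_bdd f \<Longrightarrow> bsum n (\<lambda>l. c * f l) r = c * bsum n f r"
  unfolding bsum_def by (subst suminf_mult[symmetric]) (auto intro!: summable_bprod suminf_cong simp: algebra_simps)

lemma bsum_diff: "exp_bdd f \<Longrightarrow> exp_bdd g \<Longrightarrow> bsum n (\<lambda>l. f l - g l) r = bsum n f r - bsum n g r"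
  unfolding bsum_def by (subst suminf_diff) (auto intro!: summable_bprod suminf_cong simp: algebra_simps)

text \<open>Natural subtraction gives \<open>0 - 1 = 0\<close>, so the shifted weight at
  \<open>l = 0\<close> is \<open>f 0\<close>; the hypothesis \<open>f 0 = 0\<close> removes that
  spurious term.\<close>

lemma suminf_shift_bprod:
  assumes "f 0 = 0" "exp_bdd f"
  shows "(\<Sum>l. f l * bprod n (Suc l) r) = bsum n (\<lambda>l. f (l - 1)) r"
  using suminf_split_head[OF summable_bprod(1)[OF exp_bdd_pred[OF assms(2)], of n r]] assms(1)
  by (simp add: bsum_def)

lemma suminf_shift_bprod':
  assumes "f 0 = 0" "exp_bdd f"
  shows "(\<Sum>l. f l * bprod' n (Suc l) r) = (\<Sum>l. f (l - 1) * bprod' n l r)"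
  using suminf_split_head[OF summable_bprod(2)[OF exp_bdd_pred[OF assms(2)], of n r]] assms(1)
  by simp

text \<open>The recurrence is applied to the second factor \<open>J_(l+n)\<close>, with
  \<open>J_l\<close> fixed; the order of the middle term explains the factor
  \<open>l + n + 1\<close>.\<close>

lemma bsum_three_term:
  assumes "exp_bdd F" "r \<noteq> 0"
  shows "bsum (n + 2) F r + bsum n F r = 2 / r * bsum (n + 1) (\<lambda>l. (real l + real n + 1) * F l) r"
proof -
  have 1: "bprod (n + 2) l r + bprod n l r = 2 / r * ((real l + real n + 1) * bprod (n + 1) l r)" for l
  proof -
    have "bprod (n + 2) l r + bprod n l r = bessel_J l r * (r * (bessel_J (l + n) r + bessel_J (Suc (Suc (l + n))) r)) / r"
      using assms(2) by (simp add: bprod_def field_simps)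
    also have "\<dots> = 2 / r * ((real l + real n + 1) * bprod (n + 1) l r)"
      unfolding bessel_J_rec by (simp add: bprod_def add_ac)
    finally show ?thesis .
  qed
  have "bsum (n + 2) F r + bsum n F r = (\<Sum>l. F l * (bprod (n + 2) l r + bprod n l r))"
    unfolding bsum_def by (subst suminf_add) (auto intro!: summable_bprod assms simp: algebra_simps)
  also have "\<dots> = (\<Sum>l. 2 / r * ((real l + real n + 1) * F l * bprod (n + 1) l r))"
    unfolding 1 by (intro suminf_cong) simp
  also have "\<dots> = 2 / r * bsum (n + 1) (\<lambda>l. (real l + real n + 1) * F l) r"
    unfolding bsum_def by (intro suminf_mult summable_bprod exp_bdd_intros assms(1))
  finally show ?thesis .
qed

text \<open>Here the recurrence is applied to the first factor, which moves the weights one step in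
  either direction and produces the factor \<open>l\<close> instead of \<open>l + n + 1\<close>. In
  the difference of the two versions the growing factor \<open>l\<close> cancels.\<close>

lemma bsum_three_term':
  assumes "exp_bdd F" "F 0 = 0" "r \<noteq> 0"
  shows "bsum (n + 2) (\<lambda>l. F (Suc l)) r + bsum n (\<lambda>l. F (l - 1)) r = 2 / r * bsum (n + 1) (\<lambda>l. real l * F l) r"
proof -
  have 1: "bprod (n + 2) l r + bprod n (Suc (Suc l)) r = 2 / r * (real (Suc l) * bprod (n + 1) (Suc l) r)" for l
  proof -
    have "bprod (n + 2) l r + bprod n (Suc (Suc l)) r = (r * (bessel_J l r + bessel_J (Suc (Suc l)) r)) * bessel_J (l + n + 2) r / r"
      using assms(3) by (simp add: bprod_def field_simps)
    also have "\<dots> = 2 / r * (real (Suc l) * bprod (n + 1) (Suc l) r)"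
      unfolding bessel_J_rec by (simp add: bprod_def)
    finally show ?thesis .
  qed
  define f where "f = (\<lambda>l. F (l - 1))"
  have f: "exp_bdd f" "f 0 = 0" using assms exp_bdd_pred[OF assms(1)] by (simp_all add: f_def)
  have "2 / r * bsum (n + 1) (\<lambda>l. real l * F l) r = (\<Sum>l. 2 / r * (real l * F l * bprod (n + 1) l r))"
    unfolding bsum_def using assms(1) by (intro suminf_mult[symmetric] summable_bprod) auto
  also have "\<dots> = (\<Sum>l. 2 / r * (real (Suc l) * F (Suc l) * bprod (n + 1) (Suc l) r))"
    using assms(1) by (subst suminf_split_head) (auto intro!: summable_mult summable_bprod)
  also have "\<dots> = (\<Sum>l. F (Suc l) * bprod (n + 2) l r + F (Suc l) * bprod n (Suc (Suc l)) r)"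
  proof (intro suminf_cong)
    fix l
    have "2 / r * (real (Suc l) * F (Suc l) * bprod (n + 1) (Suc l) r)
      = F (Suc l) * (2 / r * (real (Suc l) * bprod (n + 1) (Suc l) r))" by simp
    thus "2 / r * (real (Suc l) * F (Suc l) * bprod (n + 1) (Suc l) r)
      = F (Suc l) * bprod (n + 2) l r + F (Suc l) * bprod n (Suc (Suc l)) r"
      unfolding 1[symmetric] by (simp add: algebra_simps)
  qed
  also have "\<dots> = bsum (n + 2) (\<lambda>l. F (Suc l)) r + (\<Sum>l. F (Suc l) * bprod n (Suc (Suc l)) r)"
    unfolding bsum_def
    by (rule suminf_add[symmetric])
       (auto intro!: summable_bprod assms summable_bprod_Suc(1)[THEN summable_Suc_iff[THEN iffD2, of "\<lambda>l. F l * bprod n (Suc l) r"]])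
  also have "(\<Sum>l. F (Suc l) * bprod n (Suc (Suc l)) r) = (\<Sum>l. F l * bprod n (Suc l) r)"
    using suminf_split_head[OF summable_bprod_Suc(1)[OF assms(1), of n r]] assms(2) by simp
  also have "\<dots> = bsum n (\<lambda>l. F (l - 1)) r" by (rule suminf_shift_bprod[OF assms(2,1)])
  finally show ?thesis ..
qed

text \<open>Each of the two derivatives contains the mixed products \<open>J_(l+1) J_(l+n)\<close>
  and \<open>J_l J_(l+n+1)\<close>, with opposite signs. Only the sum over neighbours is free of
  them, which is why the differential equation below concerns averaged weights.\<close>

lemma bprod'_adjacent:
  assumes "r \<noteq> 0"
  shows "r * (bprod' n l r + bprod' n (Suc l) r) = (2 * real l + real n) * bprod n l r - (2 * real l + 2 + real n) * bprod n (Suc l) r"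
  unfolding bprod_def bprod'_def bessel_J'_eq(1)[OF assms, of l] bessel_J'_eq(1)[OF assms, of "l + n"]
    bessel_J'_eq(2)[OF assms, of l] add_Suc bessel_J'_eq(2)[OF assms, of "l + n"]
  using assms by (simp add: field_simps)

lemma bprod'_1:
  assumes "r \<noteq> 0"
  shows "r * bprod' 1 l r + bprod 1 l r = r * (bprod 0 l r - bprod 0 (Suc l) r)"
  unfolding bprod_def bprod'_def bessel_J'_eq(1)[OF assms, of l]
  using assms by (simp add: bessel_J'_eq(2)[OF assms, of l] field_simps)

lemma bprod'_0: "bprod' 0 (Suc l) r = bprod 1 l r - bprod 1 (Suc l) r" "bprod' 0 0 r = - 2 * bprod 1 0 r"
  by (simp_all add: bprod_def bprod'_def bessel_J'_def field_simps)

text \<open>The weights \<open>f l + f (l - 1)\<close> pair every term with its neighbour. Summation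
  by parts moves the difference onto \<open>f\<close>; for power weights it gains one power of decay
  and so compensates the factor \<open>2 l + n\<close>.\<close>

lemma bsum_ode:
  assumes f: "exp_bdd f" "f 0 = 0" and r: "r \<noteq> 0"
  shows "(bsum n (\<lambda>l. f l + f (l - 1)) has_real_derivative
           bsum n (\<lambda>l. (2 * real l + real n) * (f l - f (l - 1))) r / r) (at r)"
proof -
  let ?k = "\<lambda>l. 2 * real l + real n"
  have "(\<Sum>l. (f l + f (l - 1)) * bprod' n l r) = (\<Sum>l. f l * bprod' n l r) + (\<Sum>l. f (l - 1) * bprod' n l r)"
    unfolding distrib_right by (rule suminf_add[symmetric]) (intro summable_bprod f exp_bdd_pred)+
  also have "(\<Sum>l. f (l - 1) * bprod' n l r) = (\<Sum>l. f l * bprod' n (Suc l) r)"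
    by (rule suminf_shift_bprod'[symmetric, OF f(2,1)])
  also have "(\<Sum>l. f l * bprod' n l r) + (\<Sum>l. f l * bprod' n (Suc l) r) = (\<Sum>l. f l * (bprod' n l r + bprod' n (Suc l) r))"
    by (subst suminf_add) (auto intro!: summable_bprod summable_bprod_Suc f simp: algebra_simps)
  also have "\<dots> = (\<Sum>l. (f l * (2 * real l + real n) * bprod n l r - f l * (2 * real l + 2 + real n) * bprod n (Suc l) r) / r)"
  proof (intro suminf_cong)
    fix l
    have "bprod' n l r + bprod' n (Suc l) r = ((2 * real l + real n) * bprod n l r - (2 * real l + 2 + real n) * bprod n (Suc l) r) / r"
      using bprod'_adjacent[OF r, of n l] r by (simp add: field_simps)
    thus "f l * (bprod' n l r + bprod' n (Suc l) r) = (f l * (2 * real l + real n) * bprod n l r - f l * (2 * real l + 2 + real n) * bprod n (Suc l) r) / r"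
      by (simp add: algebra_simps)
  qed
  also have "\<dots> = (\<Sum>l. f l * (2 * real l + real n) * bprod n l r - f l * (2 * real l + 2 + real n) * bprod n (Suc l) r) / r"
    by (rule suminf_divide, rule summable_diff) (intro summable_bprod summable_bprod_Suc exp_bdd_mult exp_bdd_add f exp_bdd_const exp_bdd_of_nat)+
  also have "(\<Sum>l. f l * (2 * real l + real n) * bprod n l r - f l * (2 * real l + 2 + real n) * bprod n (Suc l) r)
    = bsum n (\<lambda>l. f l * (2 * real l + real n)) r - (\<Sum>l. f l * (2 * real l + 2 + real n) * bprod n (Suc l) r)"
    unfolding bsum_def by (rule suminf_diff[symmetric]) (intro summable_bprod summable_bprod_Suc exp_bdd_mult exp_bdd_add f exp_bdd_const exp_bdd_of_nat)+
  also have "(\<Sum>l. f l * (2 * real l + 2 + real n) * bprod n (Suc l) r) = bsum n (\<lambda>l. f (l - 1) * (2 * real (l - 1) + 2 + real n)) r"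
    by (rule suminf_shift_bprod[where f = "\<lambda>l. f l * (2 * real l + 2 + real n)"])
       (auto simp: f intro!: exp_bdd_intros)
  also have "bsum n (\<lambda>l. f (l - 1) * (2 * real (l - 1) + 2 + real n)) r = bsum n (\<lambda>l. f (l - 1) * (2 * real l + real n)) r"
  proof -
    have "f (l - 1) * (2 * real (l - 1) + 2 + real n) = f (l - 1) * (2 * real l + real n)" for l
      using f(2) by (cases l) auto
    thus ?thesis by presburger
  qed
  also have "bsum n (\<lambda>l. f l * (2 * real l + real n)) r - \<dots> = bsum n (\<lambda>l. (2 * real l + real n) * (f l - f (l - 1))) r"
    by (subst bsum_diff[symmetric], (intro exp_bdd_intros f)+) (simp add: algebra_simps)
  finally show ?thesis using bsum_deriv[OF exp_bdd_add[OF f(1) exp_bdd_pred[OF f(1)]], of n r] by simp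
qed

text \<open>Since \<open>(r J_l J_(l+1))' = r (J_l^2 - J_(l+1)^2)\<close>, summation by parts turns
  the weights into backward differences. At \<open>l = 0\<close> the value \<open>f 0\<close> is
  written out, because \<open>f 0 - f (0 - 1)\<close> would be 0.\<close>

lemma bsum_1_deriv:
  assumes f: "exp_bdd f" and r: "r \<noteq> 0"
  shows "((\<lambda>r. r * bsum 1 f r) has_real_derivative
           r * bsum 0 (\<lambda>l. if l = 0 then f 0 else f l - f (l - 1)) r) (at r)"
proof -
  have "((\<lambda>r. r * bsum 1 f r) has_real_derivative (r * (\<Sum>l. f l * bprod' 1 l r) + bsum 1 f r)) (at r)"
    by (auto intro!: derivative_eq_intros bsum_deriv f)
  also have "r * (\<Sum>l. f l * bprod' 1 l r) + bsum 1 f r = (\<Sum>l. f l * (r * bprod' 1 l r + bprod 1 l r))"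
  proof -
    have "(\<Sum>l. f l * (r * bprod' 1 l r + bprod 1 l r)) = (\<Sum>l. r * (f l * bprod' 1 l r) + f l * bprod 1 l r)"
      by (simp add: algebra_simps)
    also have "\<dots> = (\<Sum>l. r * (f l * bprod' 1 l r)) + (\<Sum>l. f l * bprod 1 l r)"
      by (rule suminf_add[symmetric]) (intro summable_mult summable_bprod f)+
    also have "(\<Sum>l. r * (f l * bprod' 1 l r)) = r * (\<Sum>l. f l * bprod' 1 l r)"
      by (intro suminf_mult summable_bprod f)
    finally show ?thesis by (simp add: bsum_def)
  qed
  also have "\<dots> = (\<Sum>l. r * (f l * bprod 0 l r - f l * bprod 0 (Suc l) r))"
    unfolding bprod'_1[OF r] by (simp add: algebra_simps)
  also have "\<dots> = r * (\<Sum>l. f l * bprod 0 l r - f l * bprod 0 (Suc l) r)"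
    by (rule suminf_mult) (intro summable_diff summable_bprod summable_bprod_Suc f)
  also have "(\<Sum>l. f l * bprod 0 l r - f l * bprod 0 (Suc l) r) = bsum 0 f r - (\<Sum>l. f l * bprod 0 (Suc l) r)"
    unfolding bsum_def by (rule suminf_diff[symmetric]) (intro summable_bprod summable_bprod_Suc f)+
  also have "(\<Sum>l. f l * bprod 0 (Suc l) r) = bsum 0 (\<lambda>l. if l = 0 then 0 else f (l - 1)) r"
  proof -
    have "exp_bdd (\<lambda>l. if l = 0 then 0 else f (l - 1))" by (intro exp_bdd_intros f)
    from suminf_split_head[OF summable_bprod(1)[OF this, of 0 r]] show ?thesis
      by (simp add: bsum_def)
  qed
  also have "bsum 0 f r - \<dots> = bsum 0 (\<lambda>l. if l = 0 then f 0 else f l - f (l - 1)) r"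
    by (subst bsum_diff[symmetric]) (use f in \<open>auto intro!: arg_cong[where f = "\<lambda>h. bsum 0 h r"]\<close>)
  finally show ?thesis .
qed

text \<open>For \<open>l > 0\<close> the derivative of \<open>J_l^2\<close> is a difference of
  neighbouring products, hence the forward differences. The derivative \<open>- 2 J_0 J_1\<close> at
  \<open>l = 0\<close> leaves a boundary term; it disappears as soon as \<open>J_0^2\<close> is
  counted with half weight, as in \<open>wsum\<close>.\<close>

lemma bsum_0_deriv:
  assumes f: "exp_bdd f"
  shows "(bsum 0 f has_real_derivative (bsum 1 (\<lambda>l. f (Suc l) - f l) r - f 0 * bprod 1 0 r)) (at r)"
proof -
  have s: "summable (\<lambda>l. f (Suc l) * bprod 1 l r)" "summable (\<lambda>l. f l * bprod 1 l r)"
      "summable (\<lambda>l. f (Suc l) * bprod 1 (Suc l) r)"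
    using summable_bprod(1)[of f 1 r] summable_bprod(1)[of "\<lambda>l. f (Suc l)" 1 r] f
      summable_bprod_Suc(1)[of "\<lambda>l. f (Suc l)" 1 r] by auto
  have "(\<Sum>l. f l * bprod' 0 l r) = f 0 * bprod' 0 0 r + (\<Sum>l. f (Suc l) * bprod' 0 (Suc l) r)"
    using suminf_split_head[OF summable_bprod(2)[OF f, of 0 r]] by simp
  also have "(\<Sum>l. f (Suc l) * bprod' 0 (Suc l) r) = (\<Sum>l. f (Suc l) * bprod 1 l r) - (\<Sum>l. f (Suc l) * bprod 1 (Suc l) r)"
    unfolding bprod'_0 using s by (subst suminf_diff) (auto simp: algebra_simps)
  also have "(\<Sum>l. f (Suc l) * bprod 1 (Suc l) r) = (\<Sum>l. f l * bprod 1 l r) - f 0 * bprod 1 0 r"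
    using suminf_split_head[OF s(2)] by simp
  also have "f 0 * bprod' 0 0 r + ((\<Sum>l. f (Suc l) * bprod 1 l r) - ((\<Sum>l. f l * bprod 1 l r) - f 0 * bprod 1 0 r))
    = bsum 1 (\<lambda>l. f (Suc l) - f l) r - f 0 * bprod 1 0 r"
    unfolding bsum_def left_diff_distrib suminf_diff[OF s(1,2), symmetric] by (simp add: bprod'_0)
  finally show ?thesis using bsum_deriv[OF f, of 0 r] by simp
qed

lemma bsum_at_0: "exp_bdd f \<Longrightarrow> bsum n f 0 = (if n = 0 then f 0 else 0)"
  using suminf_split_head[OF summable_bprod(1), of f n 0] by (auto simp: bsum_def bprod_at_0)

text \<open>The constant weight has zero forward difference and the boundary terms cancel, so the
  left-hand side is constant; at \<open>r = 0\<close> it is 1.\<close>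

lemma bessel_J_sum_squares: "2 * bsum 0 (\<lambda>_. 1) r - bprod 0 0 r = 1"
proof -
  have "((\<lambda>r. 2 * bsum 0 (\<lambda>_. 1) r - bprod 0 0 r) has_real_derivative 0) (at r)" for r
  proof -
    have "bsum 1 (\<lambda>l. 0) r = 0" by (simp add: bsum_def)
    thus ?thesis
      by (auto intro!: derivative_eq_intros bprod_deriv bsum_0_deriv simp: bprod'_0)
  qed
  from DERIV_isconst_all[OF allI[OF this], of r 0] show ?thesis
    by (simp add: bsum_at_0 exp_bdd_const bprod_at_0)
qed

section \<open>Large-argument asymptotics, uniformly in the order\<close>

text \<open>With \<open>e x = K / p * x powr (- p)\<close>, whose derivative is minus the bound on
  \<open>Y'\<close>, the function \<open>Y - e\<close> increases and \<open>Y + e\<close> decreases.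
  Their common limit \<open>L\<close>, taken as the supremum of the lower one, is enclosed between
  them.\<close>

lemma convergence_rate:
  fixes Y :: "real \<Rightarrow> real"
  assumes "R > 0" "p > 0" "K \<ge> 0"
    and der: "\<And>x. x \<ge> R \<Longrightarrow> (Y has_real_derivative Y' x) (at x)"
    and bd: "\<And>x. x \<ge> R \<Longrightarrow> \<bar>Y' x\<bar> \<le> K * x powr (- p - 1)"
  obtains L where "\<And>x. x \<ge> R \<Longrightarrow> \<bar>Y x - L\<bar> \<le> K / p * x powr (- p)"
proof -
  define e where "e = (\<lambda>x. K / p * x powr (- p))"
  have e': "(e has_real_derivative - (K * x powr (- p - 1))) (at x)" if "x \<ge> R" for x
    unfolding e_def using that assms(1,2) by (auto intro!: derivative_eq_intros)
  have e0: "e x \<ge> 0" for x using assms by (auto simp: e_def)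
  have inc: "Y x - e x \<le> Y y - e y" if "R \<le> x" "x \<le> y" for x y
  proof (rule DERIV_nonneg_imp_nondecreasing[OF that(2)])
    fix z assume z: "x \<le> z" "z \<le> y"
    show "\<exists>d. ((\<lambda>x. Y x - e x) has_real_derivative d) (at z) \<and> 0 \<le> d"
      using DERIV_diff[OF der[of z] e'[of z]] bd[of z] z that by (intro exI[of _ "Y' z - - (K * z powr (- p - 1))"]) auto
  qed
  have dec: "Y y + e y \<le> Y x + e x" if "R \<le> x" "x \<le> y" for x y
  proof (rule DERIV_nonpos_imp_nonincreasing[OF that(2)])
    fix z assume z: "x \<le> z" "z \<le> y"
    show "\<exists>d. ((\<lambda>x. Y x + e x) has_real_derivative d) (at z) \<and> d \<le> 0"
      using DERIV_add[OF der[of z] e'[of z]] bd[of z] z that by (intro exI[of _ "Y' z + - (K * z powr (- p - 1))"]) auto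
  qed
  have le: "Y x - e x \<le> Y y + e y" if "R \<le> x" "R \<le> y" for x y
    using inc[of x "max x y"] dec[of y "max x y"] e0[of "max x y"] that by linarith
  define L where "L = (SUP x\<in>{R..}. Y x - e x)"
  have bdd: "bdd_above ((\<lambda>x. Y x - e x) ` {R..})"
    using le[of _ R] by (intro bdd_aboveI2[of _ _ "Y R + e R"]) auto
  show ?thesis
  proof (rule that[of L])
    fix x assume x: "x \<ge> R"
    have "Y x - e x \<le> L" unfolding L_def using x by (intro cSUP_upper[OF _ bdd]) auto
    moreover have "L \<le> Y x + e x" unfolding L_def using x le by (intro cSUP_least) auto
    ultimately show "\<bar>Y x - L\<bar> \<le> K / p * x powr (- p)" by (simp add: e_def abs_le_iff)
  qed
qed

lemma convergence_rate_to:
  fixes Y :: "real \<Rightarrow> real"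
  assumes "R > 0" "p > 0" "K \<ge> 0"
    and der: "\<And>x. x \<ge> R \<Longrightarrow> (Y has_real_derivative Y' x) (at x)"
    and bd: "\<And>x. x \<ge> R \<Longrightarrow> \<bar>Y' x\<bar> \<le> K * x powr (- p - 1)"
    and lim: "(Y \<longlongrightarrow> L) at_top" and x: "x \<ge> R"
  shows "\<bar>Y x - L\<bar> \<le> K / p * x powr (- p)"
proof -
  obtain L' where L': "\<And>x. x \<ge> R \<Longrightarrow> \<bar>Y x - L'\<bar> \<le> K / p * x powr (- p)"
    using convergence_rate[OF assms(1-5)] by blast
  have "((\<lambda>x. K / p * x powr (- p)) \<longlongrightarrow> 0) at_top" using assms(2) by real_asymp
  hence "((\<lambda>x. Y x - L') \<longlongrightarrow> 0) at_top"
    by (rule Lim_null_comparison[rotated])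
       (use L' in \<open>auto intro!: eventually_mono[OF eventually_ge_at_top[of R]]\<close>)
  hence "(Y \<longlongrightarrow> L') at_top" using Lim_null by blast
  hence "L = L'" using lim tendsto_unique trivial_limit_at_top_linorder by blast
  thus ?thesis using L' x by blast
qed

section \<open>Uniform bounds from the sum of squares\<close>

lemma bsum_0_one_le: "bsum 0 (\<lambda>_. 1) r \<le> 1" and abs_bessel_J_le_1: "\<bar>bessel_J n r\<bar> \<le> 1"
proof -
  have s: "summable (\<lambda>l. 1 * bprod 0 l r)" by (intro summable_bprod exp_bdd_intros)
  have nn: "1 * bprod 0 l r \<ge> 0" for l by (simp add: bprod_def)
  have ss: "2 * bsum 0 (\<lambda>_. 1) r = 1 + bprod 0 0 r" using bessel_J_sum_squares[of r] by simp
  have "(\<Sum>l\<in>{0}. 1 * bprod 0 l r) \<le> bsum 0 (\<lambda>_. 1) r"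
    unfolding bsum_def by (rule sum_le_suminf[OF s]) (use nn in auto)
  hence J0: "bprod 0 0 r \<le> 1" using ss by simp
  thus b: "bsum 0 (\<lambda>_. 1) r \<le> 1" using ss by simp
  have "(\<Sum>l\<in>{n}. 1 * bprod 0 l r) \<le> bsum 0 (\<lambda>_. 1) r"
    unfolding bsum_def by (rule sum_le_suminf[OF s]) (use nn in auto)
  hence "bessel_J n r ^ 2 \<le> 1" using b by (simp add: bprod_def power2_eq_square)
  thus "\<bar>bessel_J n r\<bar> \<le> 1" by (simp add: abs_square_le_1)
qed

lemma abs_bprod_le_1: "\<bar>bprod n l r\<bar> \<le> 1"
  using mult_mono[OF abs_bessel_J_le_1[of l r] abs_bessel_J_le_1[of "l + n" r]] by (simp add: bprod_def abs_mult)

text \<open>The arithmetic-geometric inequality reduces the products to squares. The bound does not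
  depend on \<open>r\<close>; it controls the range of large \<open>l\<close>, where no pointwise
  decay in \<open>r\<close> is available.\<close>

lemma abs_bprod_sum:
  shows "summable (\<lambda>l. \<bar>bprod n l r\<bar>)" "(\<Sum>l. \<bar>bprod n l r\<bar>) \<le> 1"
proof -
  have s: "summable (\<lambda>l. bprod 0 l r)" using summable_bprod(1)[OF exp_bdd_const, of 1 0 r] by simp
  have s': "summable (\<lambda>l. bprod 0 (l + n) r)" using summable_iff_shift[of "\<lambda>l. bprod 0 l r" n] s by simp
  have le: "\<bar>bprod n l r\<bar> \<le> (bprod 0 l r + bprod 0 (l + n) r) / 2" for l
    using sum_squares_bound[of "\<bar>bessel_J l r\<bar>" "\<bar>bessel_J (l + n) r\<bar>"]
    by (simp add: bprod_def abs_mult power2_eq_square)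
  have s2: "summable (\<lambda>l. (bprod 0 l r + bprod 0 (l + n) r) / 2)" by (intro summable_divide summable_add s s')
  show 1: "summable (\<lambda>l. \<bar>bprod n l r\<bar>)"
    by (rule summable_comparison_test'[OF s2, of 0]) (use le in auto)
  have "(\<Sum>l. \<bar>bprod n l r\<bar>) \<le> (\<Sum>l. (bprod 0 l r + bprod 0 (l + n) r) / 2)"
    by (rule suminf_le[OF le 1 s2])
  also have "\<dots> = ((\<Sum>l. bprod 0 l r) + (\<Sum>l. bprod 0 (l + n) r)) / 2"
    by (simp add: suminf_divide summable_add s s' suminf_add[symmetric])
  also have "(\<Sum>l. bprod 0 (l + n) r) \<le> (\<Sum>l. bprod 0 l r)"
    unfolding suminf_minus_initial_segment[OF s] by (simp add: sum_nonneg bprod_def)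
  also have "((\<Sum>l. bprod 0 l r) + (\<Sum>l. bprod 0 l r)) / 2 \<le> 1"
    using bsum_0_one_le[of r] by (simp add: bsum_def)
  finally show "(\<Sum>l. \<bar>bprod n l r\<bar>) \<le> 1" by simp
qed

text \<open>Liouville normal form: the factor \<open>sqrt r\<close> removes the first-order term of
  Bessel's equation, leaving a perturbed oscillator with coefficient
  \<open>1 - (n^2 - 1/4) / r^2\<close>. \<open>bw\<close> is the derivative of
  \<open>bv\<close>.\<close>

definition bv :: "nat \<Rightarrow> real \<Rightarrow> real" where "bv n r = sqrt r * bessel_J n r"
definition bw :: "nat \<Rightarrow> real \<Rightarrow> real" where "bw n r = bessel_J n r / (2 * sqrt r) + sqrt r * bessel_J' n r"

lemma bessel_J'_deriv:
  assumes "r > 0"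
  shows "(bessel_J' n has_real_derivative ((real n ^ 2 / r ^ 2 - 1) * bessel_J n r - bessel_J' n r / r)) (at r)"
proof -
  have "((\<lambda>x. real n / x * bessel_J n x - bessel_J (Suc n) x) has_real_derivative
      ((real n ^ 2 / r ^ 2 - 1) * bessel_J n r - bessel_J' n r / r)) (at r)"
    using assms
    by (auto intro!: derivative_eq_intros bessel_J_deriv simp: bessel_J'_eq(2)[of r n] bessel_J'_eq(1)[of r n] field_simps power2_eq_square)
  thus ?thesis
    by (rule DERIV_cong_ev[OF refl _ refl, THEN iffD1, rotated])
       (use assms in \<open>auto intro!: eventually_mono[OF eventually_nhds_in_open[of "{0<..}" r]] simp: bessel_J'_eq(1)\<close>)
qed

lemma bv_deriv: "r > 0 \<Longrightarrow> (bv n has_real_derivative bw n r) (at r)"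
  unfolding bv_def[abs_def] bw_def
  by (auto intro!: derivative_eq_intros bessel_J_deriv simp: field_simps)

lemma bw_deriv:
  assumes "r > 0"
  shows "(bw n has_real_derivative - (1 - (real n ^ 2 - 1/4) / r ^ 2) * bv n r) (at r)"
proof -
  have s: "sqrt r * sqrt r = r" "r * r = r ^ 2" "sqrt r > 0" using assms by (auto simp: power2_eq_square)
  have "(bw n has_real_derivative
     ((bessel_J' n r * (2 * sqrt r) - bessel_J n r * (2 * (inverse (sqrt r) / 2))) / ((2 * sqrt r) * (2 * sqrt r))
      + (inverse (sqrt r) / 2 * bessel_J' n r + ((real n ^ 2 / r ^ 2 - 1) * bessel_J n r - bessel_J' n r / r) * sqrt r))) (at r)"
    unfolding bw_def[abs_def]
    by (rule derivative_eq_intros bessel_J_deriv bessel_J'_deriv refl | use assms in \<open>simp\<close>)+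
  also have "(bessel_J' n r * (2 * sqrt r) - bessel_J n r * (2 * (inverse (sqrt r) / 2))) / ((2 * sqrt r) * (2 * sqrt r))
      + (inverse (sqrt r) / 2 * bessel_J' n r + ((real n ^ 2 / r ^ 2 - 1) * bessel_J n r - bessel_J' n r / r) * sqrt r)
    = - (1 - (real n ^ 2 - 1/4) / r ^ 2) * bv n r"
  proof -
    define q where "q = sqrt r"
    have q: "q > 0" "r = q ^ 2" using assms by (auto simp: q_def)
    show ?thesis unfolding bv_def q_def[symmetric] unfolding q(2) using q(1)
      by (simp add: field_simps power2_eq_square)
  qed
  finally show ?thesis .
qed

text \<open>Variation of constants: the solution rotated back by the free oscillation. Without the
  perturbation it would be constant, so its derivative contains only the term of size
  \<open>n^2 / r^2\<close>. It equals \<open>bv n r\<close> at \<open>\<theta> = r\<close>, and the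
  angles 0 and \<open>pi/2\<close> give the two amplitudes.\<close>

definition bF :: "nat \<Rightarrow> real \<Rightarrow> real \<Rightarrow> real" where
  "bF n \<theta> r = bv n r * cos (r - \<theta>) - bw n r * sin (r - \<theta>)"

lemma bF_deriv:
  assumes "r > 0"
  shows "(bF n \<theta> has_real_derivative - ((real n ^ 2 - 1/4) / r ^ 2 * bv n r * sin (r - \<theta>))) (at r)"
  unfolding bF_def[abs_def]
  by (rule derivative_eq_intros bv_deriv bw_deriv refl assms | simp add: algebra_simps)+

lemma bv_bw_eq: "bv n r = bF n 0 r * cos r + bF n (pi/2) r * sin r"
  "bw n r = bF n (pi/2) r * cos r - bF n 0 r * sin r"
proof -
  have c: "cos (r - pi/2) = sin r" "sin (r - pi/2) = - cos r"
    by (simp_all add: cos_diff sin_diff)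
  have "bF n 0 r * cos r + bF n (pi/2) r * sin r = bv n r * ((cos r)^2 + (sin r)^2)"
    unfolding bF_def c diff_zero by algebra
  thus "bv n r = bF n 0 r * cos r + bF n (pi/2) r * sin r" by simp
  have "bF n (pi/2) r * cos r - bF n 0 r * sin r = bw n r * ((cos r)^2 + (sin r)^2)"
    unfolding bF_def c diff_zero by algebra
  thus "bw n r = bF n (pi/2) r * cos r - bF n 0 r * sin r" by simp
qed

text \<open>For order 0 the energy \<open>v^2 + w^2\<close> has derivative
  \<open>- v w / (2 x^2)\<close>, of no fixed sign. The factor \<open>exp (1 / (4 r))\<close>
  completes this to minus a square, so the corrected energy decreases.\<close>

lemma bv_0_bounded: "\<exists>M>0. \<forall>r\<ge>1. \<bar>bv 0 r\<bar> \<le> M"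
proof -
  define G where "G = (\<lambda>r. ((bv 0 r)^2 + (bw 0 r)^2) * exp (1 / (4 * r)))"
  have dec: "G r \<le> G 1" if "r \<ge> 1" for r
  proof (rule DERIV_nonpos_imp_nonincreasing[OF that])
    fix x :: real assume x: "1 \<le> x" "x \<le> r"
    let ?v = "bv 0 x" and ?w = "bw 0 x"
    have "(G has_real_derivative
        ((2 * ?v * ?w + 2 * ?w * (- (1 + 1 / (4 * x^2)) * ?v)) * exp (1 / (4 * x))
          + (?v^2 + ?w^2) * (exp (1 / (4 * x)) * (- 1 / (4 * x^2))))) (at x)"
      unfolding G_def using x
      by (auto intro!: derivative_eq_intros bv_deriv bw_deriv simp: field_simps power2_eq_square)
    moreover have "(2 * ?v * ?w + 2 * ?w * (- (1 + 1 / (4 * x^2)) * ?v)) * exp (1 / (4 * x))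
          + (?v^2 + ?w^2) * (exp (1 / (4 * x)) * (- 1 / (4 * x^2))) = - ((?v + ?w)^2 * exp (1 / (4 * x)) / (4 * x^2))"
      using x by (simp add: field_simps power2_eq_square)
    moreover have "- ((?v + ?w)^2 * exp (1 / (4 * x)) / (4 * x^2)) \<le> 0" by simp
    ultimately show "\<exists>d. (G has_real_derivative d) (at x) \<and> d \<le> 0" by metis
  qed
  have G0: "G r \<ge> 0" for r by (simp add: G_def)
  show ?thesis
  proof (intro exI[of _ "sqrt (G 1) + 1"] conjI allI impI)
    show "sqrt (G 1) + 1 > 0" using G0[of 1] by (simp add: add_nonneg_pos)
    fix r :: real assume r: "r \<ge> 1"
    have "(bv 0 r)^2 \<le> (bv 0 r)^2 + (bw 0 r)^2" by simp
    also have "\<dots> \<le> G r" unfolding G_def using r mult_left_mono[of 1 "exp (1 / (4 * r))" "(bv 0 r)^2 + (bw 0 r)^2"] by simp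
    also have "\<dots> \<le> G 1" using dec r by blast
    finally have "sqrt ((bv 0 r)^2) \<le> sqrt (G 1)" by (rule real_sqrt_le_mono)
    thus "\<bar>bv 0 r\<bar> \<le> sqrt (G 1) + 1" by simp
  qed
qed

lemma bv_0_asymp:
  obtains A B C where "\<And>r. r \<ge> 1 \<Longrightarrow> \<bar>bv 0 r - (A * cos r + B * sin r)\<bar> \<le> C / r"
    "\<And>r. r \<ge> 1 \<Longrightarrow> \<bar>bw 0 r - (B * cos r - A * sin r)\<bar> \<le> C / r" "C \<ge> 0"
proof -
  obtain M where M: "M > 0" "\<And>r. r \<ge> 1 \<Longrightarrow> \<bar>bv 0 r\<bar> \<le> M" using bv_0_bounded by blast
  have bd: "\<bar>- ((real 0 ^ 2 - 1/4) / x ^ 2 * bv 0 x * sin (x - \<theta>))\<bar> \<le> M * x powr (-1 - 1)" if "x \<ge> 1" for x \<theta> :: real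
  proof -
    have "\<bar>- ((real 0 ^ 2 - 1/4) / x ^ 2 * bv 0 x * sin (x - \<theta>))\<bar> = (1/4) / x^2 * \<bar>bv 0 x\<bar> * \<bar>sin (x - \<theta>)\<bar>"
      by (simp add: abs_mult)
    also have "\<dots> \<le> 1 / x^2 * M * 1"
      using M that by (intro mult_mono divide_right_mono) auto
    also have "\<dots> = M * x powr (-1 - 1)" using that by (simp add: powr_minus powr_numeral field_simps)
    finally show ?thesis .
  qed
  have "\<exists>L. \<forall>r\<ge>1. \<bar>bF 0 \<theta> r - L\<bar> \<le> M / r" for \<theta>
    by (rule convergence_rate[of 1 1 M "bF 0 \<theta>" "\<lambda>x. - ((real 0 ^ 2 - 1/4) / x ^ 2 * bv 0 x * sin (x - \<theta>))"])
       (use M bd bF_deriv[of _ 0 \<theta>] in \<open>auto simp: powr_minus field_simps intro!: exI\<close>)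
  then obtain A B where AB: "\<And>r. r \<ge> 1 \<Longrightarrow> \<bar>bF 0 0 r - A\<bar> \<le> M / r" "\<And>r. r \<ge> 1 \<Longrightarrow> \<bar>bF 0 (pi/2) r - B\<bar> \<le> M / r"
    by metis
  have tri: "\<bar>x * c + y * s\<bar> \<le> 2 * K" if "\<bar>x\<bar> \<le> K" "\<bar>y\<bar> \<le> K" "\<bar>c\<bar> \<le> 1" "\<bar>s\<bar> \<le> 1" for x y c s K :: real
  proof -
    have "\<bar>x * c\<bar> \<le> K * 1" "\<bar>y * s\<bar> \<le> K * 1"
      unfolding abs_mult using that mult_mono[of "\<bar>x\<bar>" K "\<bar>c\<bar>" 1] mult_mono[of "\<bar>y\<bar>" K "\<bar>s\<bar>" 1] by auto
    thus ?thesis by linarith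
  qed
  show ?thesis
  proof (rule that[of A B "2 * M"])
    fix r :: real assume r: "r \<ge> 1"
    show "\<bar>bv 0 r - (A * cos r + B * sin r)\<bar> \<le> 2 * M / r"
      using tri[OF AB(1)[OF r] AB(2)[OF r], of "cos r" "sin r"] by (simp add: bv_bw_eq algebra_simps)
    show "\<bar>bw 0 r - (B * cos r - A * sin r)\<bar> \<le> 2 * M / r"
      using tri[OF AB(2)[OF r] AB(1)[OF r], of "cos r" "- sin r"] by (simp add: bv_bw_eq algebra_simps)
  qed (use M in auto)
qed

text \<open>The constants in the asymptotics of \<open>J\<^sub>0\<close> are read off from the truncated Laplace transform
  near the point \<open>-\<i>\<close>. For the full transform \<open>L\<close>, Bessel's equation makes
  \<open>L(p) \<surd>(1 + p\<^sup>2)\<close> constant; truncation adds an exponentially small boundary term.\<close>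

definition laplace_J0 :: "real \<Rightarrow> complex \<Rightarrow> complex" where
  "laplace_J0 N p = integral {0..N} (\<lambda>r. exp (- p * of_real r) * of_real (bessel_J 0 r))"

definition laplace_J0' :: "real \<Rightarrow> complex \<Rightarrow> complex" where
  "laplace_J0' N p = integral {0..N} (\<lambda>r. - of_real r * exp (- p * of_real r) * of_real (bessel_J 0 r))"

lemma laplace_J0_deriv: "(laplace_J0 N has_field_derivative laplace_J0' N p) (at p)"
proof -
  have "((\<lambda>p. integral (cbox 0 N) (\<lambda>r. exp (- p * of_real r) * of_real (bessel_J 0 r))) has_field_derivative
      integral (cbox 0 N) (\<lambda>r. - of_real r * exp (- p * of_real r) * of_real (bessel_J 0 r))) (at p within UNIV)"
  proof (rule leibniz_rule_field_derivative)
    show "continuous_on (UNIV \<times> cbox 0 N) (\<lambda>(x, t). - complex_of_real t * exp (- x * complex_of_real t) * complex_of_real (bessel_J 0 t))"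
      unfolding split_def by (intro continuous_intros)
    show "(\<lambda>r. exp (- x * complex_of_real r) * complex_of_real (bessel_J 0 r)) integrable_on cbox 0 N" for x
      by (intro integrable_continuous continuous_intros)
  qed (auto intro!: derivative_eq_intros)
  thus ?thesis by (simp add: laplace_J0_def[abs_def] laplace_J0'_def)
qed

text \<open>The right-hand side is the boundary value \<open>W N\<close> of an exact derivative:
  Bessel's equation enters as \<open>J_0' = - J_1\<close> and \<open>(r J_1)' = r J_0\<close>, and
  \<open>W 0 = 0\<close>.\<close>

lemma laplace_J0_ode:
  assumes "N \<ge> 0"
  shows "(1 + p ^ 2) * laplace_J0' N p + p * laplace_J0 N p
    = exp (- p * of_real N) * of_real N * (p * of_real (bessel_J 0 N) - of_real (bessel_J 1 N))"
proof -
  define W where "W = (\<lambda>r. exp (- p * of_real r) * of_real r * (p * of_real (bessel_J 0 r) - of_real (bessel_J 1 r)))"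
  have J0: "((\<lambda>r. complex_of_real (bessel_J 0 r)) has_vector_derivative of_real (- bessel_J 1 r)) (at r within S)" for r S
    by (rule has_vector_derivative_of_real[OF has_field_derivative_at_within[OF bessel_J_0_deriv]])
  have rJ1: "((\<lambda>r. r * bessel_J 1 r) has_real_derivative r * bessel_J 0 r) (at r)" for r
  proof (cases "r = 0")
    case True
    have "((\<lambda>r. r * bessel_J 1 r) has_real_derivative (1 * bessel_J 1 r + (bessel_J 0 r - bessel_J 2 r) / 2 * r)) (at r)"
      using bessel_J_Suc_deriv[of 0 r] by (auto intro!: derivative_eq_intros simp: numeral_2_eq_2)
    thus ?thesis using True by (simp add: bessel_J_at_0)
  next
    case False
    have "((\<lambda>r. r * bessel_J 1 r) has_real_derivative (1 * bessel_J 1 r + (bessel_J 0 r - 1 / r * bessel_J 1 r) * r)) (at r)"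
      using bessel_J_Suc_deriv'[OF False, of 0] by (auto intro!: derivative_eq_intros)
    thus ?thesis using False by (simp add: field_simps)
  qed
  have rJ1': "((\<lambda>r. complex_of_real (r * bessel_J 1 r)) has_vector_derivative of_real (r * bessel_J 0 r)) (at r within S)" for r S
    by (rule has_vector_derivative_of_real[OF has_field_derivative_at_within[OF rJ1]])
  have ex: "((\<lambda>r. exp (- p * of_real r)) has_vector_derivative (- p * exp (- p * of_real r))) (at r within S)" for r :: real and S
    by (rule has_vector_derivative_real_field) (auto intro!: derivative_eq_intros)
  have rr: "((\<lambda>r. complex_of_real r) has_vector_derivative 1) (at r within S)" for r S
    using has_vector_derivative_of_real[OF DERIV_ident] by auto
  have "((\<lambda>r. exp (- p * of_real r) * (p * (of_real r * of_real (bessel_J 0 r)) - of_real (r * bessel_J 1 r))) has_vector_derivative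
      (exp (- p * of_real r) * (p * (of_real r * of_real (- bessel_J 1 r) + 1 * of_real (bessel_J 0 r)) - of_real (r * bessel_J 0 r))
       + (- p * exp (- p * of_real r)) * (p * (of_real r * of_real (bessel_J 0 r)) - of_real (r * bessel_J 1 r)))) (at r within S)" for r S
    by (intro has_vector_derivative_mult has_vector_derivative_diff has_vector_derivative_mult_right J0 rJ1' ex rr)
  moreover have "W = (\<lambda>r. exp (- p * of_real r) * (p * (of_real r * of_real (bessel_J 0 r)) - of_real (r * bessel_J 1 r)))"
    unfolding W_def fun_eq_iff of_real_mult by algebra
  moreover have "exp (- p * of_real r) * (p * (of_real r * of_real (- bessel_J 1 r) + 1 * of_real (bessel_J 0 r)) - of_real (r * bessel_J 0 r))
       + (- p * exp (- p * of_real r)) * (p * (of_real r * of_real (bessel_J 0 r)) - of_real (r * bessel_J 1 r))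
     = (1 + p ^ 2) * (- of_real r * exp (- p * of_real r) * of_real (bessel_J 0 r))
        + p * (exp (- p * of_real r) * of_real (bessel_J 0 r))" for r
    unfolding of_real_mult of_real_minus by algebra
  ultimately have W': "(W has_vector_derivative
      ((1 + p ^ 2) * (- of_real r * exp (- p * of_real r) * of_real (bessel_J 0 r))
        + p * (exp (- p * of_real r) * of_real (bessel_J 0 r)))) (at r within S)" for r S
    by (simp only:)
  have "((\<lambda>r. (1 + p ^ 2) * (- of_real r * exp (- p * of_real r) * of_real (bessel_J 0 r))
        + p * (exp (- p * of_real r) * of_real (bessel_J 0 r))) has_integral W N - W 0) {0..N}"
    by (rule fundamental_theorem_of_calculus[OF assms W'])
  moreover have "((\<lambda>r. (1 + p ^ 2) * (- of_real r * exp (- p * of_real r) * of_real (bessel_J 0 r))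
        + p * (exp (- p * of_real r) * of_real (bessel_J 0 r))) has_integral
        (1 + p ^ 2) * laplace_J0' N p + p * laplace_J0 N p) {0..N}"
    unfolding laplace_J0_def laplace_J0'_def
    by (intro has_integral_add has_integral_mult_right integrable_integral integrable_continuous_interval continuous_intros)
  ultimately have "(1 + p ^ 2) * laplace_J0' N p + p * laplace_J0 N p = W N - W 0"
    using has_integral_unique by blast
  thus ?thesis by (simp add: W_def)
qed

text \<open>A branch of the square root of \<open>1 + p^2\<close>, holomorphic for positive real
  part. The product form isolates the factor \<open>csqrt (p + \<i>)\<close>, which alone vanishes
  at \<open>- \<i>\<close>.\<close>

definition laplace_q :: "complex \<Rightarrow> complex" where
  "laplace_q p = csqrt (p + \<i>) * csqrt (p - \<i>)"

lemma laplace_q_power2: "laplace_q p ^ 2 = 1 + p ^ 2"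
  by (simp add: laplace_q_def power_mult_distrib algebra_simps) (simp add: power2_eq_square)

lemma laplace_q_deriv:
  assumes "Re p > 0"
  shows "(laplace_q has_field_derivative p / laplace_q p) (at p)"
proof -
  have "p + \<i> \<noteq> 0" "p - \<i> \<noteq> 0" using assms by (auto simp: complex_eq_iff)
  hence nz: "csqrt (p + \<i>) \<noteq> 0" "csqrt (p - \<i>) \<noteq> 0" by simp_all
  have n: "p + \<i> \<notin> \<real>\<^sub>\<le>\<^sub>0" "p - \<i> \<notin> \<real>\<^sub>\<le>\<^sub>0" using assms by (auto simp: complex_nonpos_Reals_iff)
  have "(laplace_q has_field_derivative
     (csqrt (p - \<i>) / (2 * csqrt (p + \<i>)) + csqrt (p + \<i>) / (2 * csqrt (p - \<i>)))) (at p)"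
    unfolding laplace_q_def[abs_def]
    by (rule derivative_eq_intros refl n | simp)+
  also have "csqrt (p - \<i>) / (2 * csqrt (p + \<i>)) + csqrt (p + \<i>) / (2 * csqrt (p - \<i>))
     = ((csqrt (p - \<i>))^2 + (csqrt (p + \<i>))^2) / (2 * (csqrt (p + \<i>) * csqrt (p - \<i>)))"
    using nz by (simp add: field_simps power2_eq_square del: power2_csqrt)
  also have "\<dots> = p / laplace_q p" by (simp add: laplace_q_def field_simps)
  finally show ?thesis .
qed

text \<open>The derivative of the product is the boundary term divided by \<open>laplace_q\<close>.
  On the horizontal segment through \<open>- \<i>\<close> the modulus of \<open>laplace_q\<close> is
  at least \<open>sqrt a\<close> and the exponential at most \<open>exp (- a N)\<close>, so the mean
  value inequality applies.\<close>

lemma laplace_J0_constant: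
  assumes "N \<ge> 0" "0 < a" "a \<le> b"
  shows "norm (laplace_J0 N (of_real b - \<i>) * laplace_q (of_real b - \<i>)
     - laplace_J0 N (of_real a - \<i>) * laplace_q (of_real a - \<i>))
    \<le> exp (- a * N) * N * (2 + b) / sqrt a * (b - a)"
proof -
  let ?S = "closed_segment (of_real a - \<i>) (of_real b - \<i>)"
  let ?H = "\<lambda>p. laplace_J0 N p * laplace_q p"
  let ?W = "\<lambda>p. exp (- p * of_real N) * of_real N * (p * of_real (bessel_J 0 N) - of_real (bessel_J 1 N))"
  have S: "\<exists>x. a \<le> x \<and> x \<le> b \<and> p = of_real x - \<i>" if p: "p \<in> ?S" for p
  proof -
    from p obtain u where u: "0 \<le> u" "u \<le> 1" "p = (1 - u) *\<^sub>R (of_real a - \<i>) + u *\<^sub>R (of_real b - \<i>)"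
      unfolding closed_segment_def by auto
    have "a \<le> (1 - u) * a + u * b"  "(1 - u) * a + u * b \<le> b"
      using u(1,2) assms(3) mult_left_mono[of a b u] mult_left_mono[of a b "1 - u"] by (auto simp: algebra_simps)
    thus ?thesis
      using u by (intro exI[of _ "(1 - u) * a + u * b"]) (auto simp: complex_eq_iff algebra_simps)
  qed
  have "norm (?H (of_real b - \<i>) - ?H (of_real a - \<i>))
      \<le> exp (- a * N) * N * (2 + b) / sqrt a * norm ((of_real b - \<i>) - (of_real a - \<i>))"
  proof (rule field_differentiable_bound[where S = ?S and f' = "\<lambda>p. ?W p / laplace_q p"])
    fix p assume p: "p \<in> ?S"
    obtain x where x: "a \<le> x" "x \<le> b" "p = of_real x - \<i>" using S[OF p] by blast
    have Re: "Re p > 0" using x assms by simp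
    have "p + \<i> \<noteq> 0" "p - \<i> \<noteq> 0" using Re by (auto simp: complex_eq_iff)
    hence q0: "laplace_q p \<noteq> 0" by (simp add: laplace_q_def)
    have "(?H has_field_derivative (laplace_J0' N p * laplace_q p + p / laplace_q p * laplace_J0 N p)) (at p)"
      by (rule DERIV_mult laplace_J0_deriv laplace_q_deriv Re)+
    also have "laplace_J0' N p * laplace_q p + p / laplace_q p * laplace_J0 N p = (laplace_q p ^ 2 * laplace_J0' N p + p * laplace_J0 N p) / laplace_q p"
      using q0 by (simp add: field_simps power2_eq_square)
    also have "\<dots> = ?W p / laplace_q p"
      unfolding laplace_q_power2 laplace_J0_ode[OF assms(1)] ..
    finally show "(?H has_field_derivative ?W p / laplace_q p) (at p within ?S)"
      by (rule has_field_derivative_at_within)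
    have "norm p \<le> 1 + b" using norm_triangle_ineq4[of "of_real x" \<i>] x assms by simp
    have "norm (p * of_real (bessel_J 0 N) - of_real (bessel_J 1 N)) \<le> norm p * \<bar>bessel_J 0 N\<bar> + \<bar>bessel_J 1 N\<bar>"
      by (rule order_trans[OF norm_triangle_ineq4]) (simp add: norm_mult)
    also have "\<dots> \<le> (1 + b) * 1 + 1"
      using abs_bessel_J_le_1[of 0 N] abs_bessel_J_le_1[of 1 N] \<open>norm p \<le> 1 + b\<close> assms
      by (intro add_mono mult_mono) auto
    finally have 1: "norm (p * of_real (bessel_J 0 N) - of_real (bessel_J 1 N)) \<le> 2 + b" by simp
    have 2: "norm (exp (- p * of_real N)) \<le> exp (- a * N)"
      using x assms by (simp add: norm_exp_eq_Re mult_right_mono)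
    have "norm (?W p) \<le> exp (- a * N) * N * (2 + b)"
      unfolding norm_mult using 1 2 assms by (intro mult_mono) auto
    moreover have "sqrt a \<le> norm (laplace_q p)"
    proof -
      have "norm (p - \<i>) \<ge> 1" using abs_Im_le_cmod[of "p - \<i>"] x by simp
      hence "sqrt a * 1 \<le> sqrt (norm (p + \<i>)) * sqrt (norm (p - \<i>))"
        using x assms by (intro mult_mono) auto
      thus ?thesis by (simp add: laplace_q_def norm_mult)
    qed
    ultimately show "norm (?W p / laplace_q p) \<le> exp (- a * N) * N * (2 + b) / sqrt a"
      unfolding norm_divide using assms by (intro frac_le) auto
  qed auto
  moreover have "norm ((of_real b - \<i>) - (of_real a - \<i>)) = b - a"
    using assms norm_of_real[of "b - a", where 'a = complex] by simp
  ultimately show ?thesis by (simp only:)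
qed

lemma exp_real_integral:
  assumes "E \<noteq> 0" "a \<le> N"
  shows "((\<lambda>r. exp (- E * r)) has_integral (exp (- E * a) - exp (- E * N)) / E) {a..N::real}"
proof -
  have "((\<lambda>r. exp (- E * r)) has_integral (- exp (- E * N) / E - (- exp (- E * a) / E))) {a..N}"
    by (rule fundamental_theorem_of_calculus[OF assms(2)])
       (use assms in \<open>auto intro!: derivative_eq_intros simp: has_real_derivative_iff_has_vector_derivative[symmetric]\<close>)
  thus ?thesis by (simp add: diff_divide_distrib)
qed

text \<open>Integration by parts against \<open>\<phi>\<close>, which is 1 at the origin and has
  derivative bounded by 2. This fixes the constant value of the transform times
  \<open>laplace_q\<close> from its behaviour at infinity.\<close>

lemma laplace_J0_large:
  assumes "E > 0" "N \<ge> 0"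
  shows "norm (of_real E * laplace_J0 N (of_real E - \<i>) - 1) \<le> exp (- E * N) + 2 / E"
proof -
  define \<phi> where "\<phi> = (\<lambda>r. exp (\<i> * of_real r) * complex_of_real (bessel_J 0 r))"
  define \<phi>' where "\<phi>' = (\<lambda>r. exp (\<i> * of_real r) * complex_of_real (- bessel_J 1 r) + \<i> * exp (\<i> * of_real r) * complex_of_real (bessel_J 0 r))"
  have J0: "((\<lambda>r. complex_of_real (bessel_J 0 r)) has_vector_derivative of_real (- bessel_J 1 r)) (at r within S)" for r S
    by (rule has_vector_derivative_of_real[OF has_field_derivative_at_within[OF bessel_J_0_deriv]])
  have ei: "((\<lambda>r. exp (\<i> * of_real r)) has_vector_derivative (\<i> * exp (\<i> * of_real r))) (at r within S)" for r :: real and S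
    by (rule has_vector_derivative_real_field) (auto intro!: derivative_eq_intros)
  have \<phi>: "(\<phi> has_vector_derivative \<phi>' r) (at r within S)" for r S
    unfolding \<phi>_def \<phi>'_def by (intro has_vector_derivative_mult J0 ei)
  have ex: "((\<lambda>r. exp (- of_real E * of_real r) :: complex) has_vector_derivative (- of_real E * exp (- of_real E * of_real r))) (at r within S)" for r :: real and S
    by (rule has_vector_derivative_real_field) (auto intro!: derivative_eq_intros)
  have "((\<lambda>r. exp (- of_real E * of_real r) * \<phi>' r + (- of_real E * exp (- of_real E * of_real r)) * \<phi> r) has_integral
      exp (- of_real E * of_real N) * \<phi> N - exp (- of_real E * of_real 0) * \<phi> 0) {0..N}"
    by (intro fundamental_theorem_of_calculus has_vector_derivative_mult \<phi> ex assms)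
  moreover have "((\<lambda>r. of_real E * (exp (- (of_real E - \<i>) * of_real r) * of_real (bessel_J 0 r))) has_integral of_real E * laplace_J0 N (of_real E - \<i>)) {0..N}"
    unfolding laplace_J0_def
    by (intro has_integral_mult_right integrable_integral integrable_continuous_interval continuous_intros)
  ultimately have "((\<lambda>r. (exp (- of_real E * of_real r) * \<phi>' r + (- of_real E * exp (- of_real E * of_real r)) * \<phi> r)
      + of_real E * (exp (- (of_real E - \<i>) * of_real r) * of_real (bessel_J 0 r))) has_integral
      (exp (- of_real E * of_real N) * \<phi> N - exp (- of_real E * of_real 0) * \<phi> 0) + of_real E * laplace_J0 N (of_real E - \<i>)) {0..N}"
    by (rule has_integral_add)
  moreover have "(exp (- of_real E * of_real r) * \<phi>' r + (- of_real E * exp (- of_real E * of_real r)) * \<phi> r)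
      + of_real E * (exp (- (of_real E - \<i>) * of_real r) * of_real (bessel_J 0 r)) = exp (- of_real E * of_real r) * \<phi>' r" for r
  proof -
    have "exp (- (of_real E - \<i>) * of_real r) = exp (- of_real E * of_real r) * exp (\<i> * of_real r)"
      unfolding exp_add[symmetric] by (rule arg_cong[where f = exp]) (simp add: algebra_simps)
    thus ?thesis unfolding \<phi>_def by algebra
  qed
  moreover have "exp (- of_real E * of_real 0) * \<phi> 0 = 1" by (simp add: \<phi>_def bessel_J_at_0)
  ultimately have I: "((\<lambda>r. exp (- of_real E * of_real r) * \<phi>' r) has_integral
      (exp (- of_real E * of_real N) * \<phi> N - 1) + of_real E * laplace_J0 N (of_real E - \<i>)) {0..N}"
    by (simp only:)
  have n\<phi>': "norm (\<phi>' r) \<le> 2" for r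
  proof -
    have "norm (\<phi>' r) \<le> norm (exp (\<i> * of_real r) * complex_of_real (- bessel_J 1 r)) + norm (\<i> * exp (\<i> * of_real r) * complex_of_real (bessel_J 0 r))"
      unfolding \<phi>'_def by (rule norm_triangle_ineq)
    also have "\<dots> = \<bar>bessel_J 1 r\<bar> + \<bar>bessel_J 0 r\<bar>" by (simp add: norm_mult)
    finally show ?thesis using abs_bessel_J_le_1[of 0 r] abs_bessel_J_le_1[of 1 r] by linarith
  qed
  have "norm (exp (- of_real E * of_real r) * \<phi>' r) \<le> 2 * exp (- E * r)" for r
    using n\<phi>'[of r] by (simp add: norm_mult norm_exp_eq_Re)
  moreover have "((\<lambda>r. 2 * exp (- E * r)) has_integral 2 * ((exp (- E * 0) - exp (- E * N)) / E)) {0..N}"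
    by (intro has_integral_mult_right exp_real_integral) (use assms in auto)
  ultimately have "norm (exp (- of_real E * of_real N) * \<phi> N - 1 + of_real E * laplace_J0 N (of_real E - \<i>))
      \<le> 2 * ((exp (- E * 0) - exp (- E * N)) / E)"
    using integral_norm_bound_integral[of "\<lambda>r. exp (- of_real E * of_real r) * \<phi>' r" "{0..N}" "\<lambda>r. 2 * exp (- E * r)"] I
    by (auto simp: has_integral_iff)
  also have "\<dots> \<le> 2 / E" using assms by (simp add: field_simps)
  finally have 1: "norm (exp (- of_real E * of_real N) * \<phi> N - 1 + of_real E * laplace_J0 N (of_real E - \<i>)) \<le> 2 / E" .
  have 2: "norm (exp (- of_real E * of_real N) * \<phi> N) \<le> exp (- E * N)"
    using mult_left_mono[OF abs_bessel_J_le_1[of 0 N], of "exp (- E * N)"]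
    by (simp add: \<phi>_def norm_mult norm_exp_eq_Re)
  have "of_real E * laplace_J0 N (of_real E - \<i>) - 1 = (exp (- of_real E * of_real N) * \<phi> N - 1 + of_real E * laplace_J0 N (of_real E - \<i>)) - exp (- of_real E * of_real N) * \<phi> N"
    by simp
  hence "norm (of_real E * laplace_J0 N (of_real E - \<i>) - 1)
      \<le> norm (exp (- of_real E * of_real N) * \<phi> N - 1 + of_real E * laplace_J0 N (of_real E - \<i>)) + norm (exp (- of_real E * of_real N) * \<phi> N)"
    by (simp only: norm_triangle_ineq4)
  thus ?thesis using 1 2 by linarith
qed

lemma csqrt_of_real_mult:
  assumes "x > 0"
  shows "csqrt (of_real x * z) = of_real (sqrt x) * csqrt z"
proof -
  have "Arg (of_real x) + Arg z \<in> {-pi<..pi}"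
    using assms Arg_bounded[of z] by (simp add: Arg_of_real)
  from csqrt_mult[OF this] show ?thesis unfolding of_real_sqrt[OF less_imp_le[OF assms]] .
qed

text \<open>The truncation \<open>k^2\<close> is coupled to the endpoints \<open>1/k\<close> and
  \<open>k\<close>: the boundary error is \<open>exp (- k)\<close> times a power of
  \<open>k\<close>, so the value 1 at the far end carries over to the near end. There
  \<open>laplace_q\<close> is about
  \<open>sqrt (1/k) * csqrt (- 2 \<i>) = sqrt (1/k) * (1 - \<i>)\<close>, whose inverse gives the
  limit.\<close>

lemma laplace_J0_limit:
  "(\<lambda>k. of_real (sqrt (1 / real k)) * laplace_J0 (real k ^ 2) (of_real (1 / real k) - \<i>)) \<longlonglongrightarrow> (1 + \<i>) / 2"
proof -
  define H where "H = (\<lambda>k x. laplace_J0 (real k ^ 2) (of_real x - \<i>) * laplace_q (of_real x - \<i>))"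
  have 1: "(\<lambda>k. H k (real k) - H k (1 / real k)) \<longlonglongrightarrow> 0"
  proof (rule Lim_null_comparison)
    show "\<forall>\<^sub>F k in sequentially. norm (H k (real k) - H k (1 / real k)) \<le>
       exp (- (1 / real k) * real k ^ 2) * real k ^ 2 * (2 + real k) / sqrt (1 / real k) * (real k - 1 / real k)"
      using eventually_ge_at_top[of 1]
    proof eventually_elim
      case (elim k)
      have "1 / real k \<le> real k" using elim mult_mono[of 1 "real k" 1 "real k"] by (simp add: divide_le_eq)
      thus ?case unfolding H_def using elim by (intro laplace_J0_constant) auto
    qed
    show "(\<lambda>k. exp (- (1 / real k) * real k ^ 2) * real k ^ 2 * (2 + real k) / sqrt (1 / real k) * (real k - 1 / real k)) \<longlonglongrightarrow> 0"
      by real_asymp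
  qed
  have 2: "(\<lambda>k. of_real (real k) * laplace_J0 (real k ^ 2) (of_real (real k) - \<i>) - 1) \<longlonglongrightarrow> 0"
  proof (rule Lim_null_comparison)
    show "\<forall>\<^sub>F k in sequentially. norm (of_real (real k) * laplace_J0 (real k ^ 2) (of_real (real k) - \<i>) - 1) \<le> exp (- real k * real k ^ 2) + 2 / real k"
      using eventually_ge_at_top[of 1] by eventually_elim (rule laplace_J0_large, auto)
    show "(\<lambda>k. exp (- real k * real k ^ 2) + 2 / real k) \<longlonglongrightarrow> 0" by real_asymp
  qed
  have q: "laplace_q (of_real x - \<i>) = of_real (sqrt x) * csqrt (of_real x - 2 * \<i>)" if "x > 0" for x
  proof -
    have 1: "csqrt (of_real x) = of_real (sqrt x)" using that by (intro of_real_sqrt[symmetric]) simp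
    have 2: "of_real x - \<i> + \<i> = complex_of_real x" "of_real x - \<i> - \<i> = complex_of_real x - 2 * \<i>" by simp_all
    show ?thesis unfolding laplace_q_def 1 2 ..
  qed
  have qk: "(\<lambda>k. laplace_q (of_real (real k) - \<i>) / of_real (real k)) \<longlonglongrightarrow> 1"
  proof -
    have "(\<lambda>k. csqrt (1 - 2 * \<i> * of_real (1 / real k))) \<longlonglongrightarrow> csqrt (1 - 2 * \<i> * of_real 0)"
      by (rule isCont_tendsto_compose[OF continuous_at_csqrt]; (intro tendsto_intros lim_1_over_n)?) (simp add: complex_nonpos_Reals_iff)
    moreover have "\<forall>\<^sub>F k in sequentially. csqrt (1 - 2 * \<i> * of_real (1 / real k)) = laplace_q (of_real (real k) - \<i>) / of_real (real k)"
      using eventually_ge_at_top[of 1]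
    proof eventually_elim
      case (elim k)
      have "laplace_q (of_real (real k) - \<i>) = of_real (sqrt (real k)) * csqrt (of_real (real k) * (1 - 2 * \<i> * of_real (1 / real k)))"
        using elim by (subst q) (auto simp: algebra_simps)
      also have "csqrt (of_real (real k) * (1 - 2 * \<i> * of_real (1 / real k))) = of_real (sqrt (real k)) * csqrt (1 - 2 * \<i> * of_real (1 / real k))"
        by (subst csqrt_of_real_mult) (use elim in auto)
      also have "of_real (sqrt (real k)) * (of_real (sqrt (real k)) * csqrt (1 - 2 * \<i> * of_real (1 / real k))) = of_real (real k) * csqrt (1 - 2 * \<i> * of_real (1 / real k))"
        by (simp add: mult.assoc[symmetric] of_real_mult[symmetric] del: of_real_mult)
      finally show ?case using elim by simp
    qed
    ultimately show ?thesis by (simp add: tendsto_cong)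
  qed
  have "(\<lambda>k. of_real (real k) * laplace_J0 (real k ^ 2) (of_real (real k) - \<i>) * (laplace_q (of_real (real k) - \<i>) / of_real (real k))) \<longlonglongrightarrow> 1 * 1"
    using 2 by (intro tendsto_mult qk) (simp add: Lim_null[symmetric])
  from this[unfolded mult_1_right] have "(\<lambda>k. H k (real k)) \<longlonglongrightarrow> 1"
    by (rule Lim_transform_eventually) (rule eventually_mono[OF eventually_gt_at_top[of 0]], simp add: H_def)
  from tendsto_diff[OF this 1] have 3: "(\<lambda>k. H k (1 / real k)) \<longlonglongrightarrow> 1" by simp
  have c: "csqrt (- (2 * \<i>)) = 1 - \<i>"
    by (rule csqrt_unique) (auto simp: power2_eq_square algebra_simps)
  have "(\<lambda>k. csqrt (of_real (1 / real k) - 2 * \<i>)) \<longlonglongrightarrow> csqrt (of_real 0 - 2 * \<i>)"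
    by (rule isCont_tendsto_compose[OF continuous_at_csqrt]; (intro tendsto_intros lim_1_over_n)?) (simp add: complex_nonpos_Reals_iff)
  hence 4: "(\<lambda>k. csqrt (of_real (1 / real k) - 2 * \<i>)) \<longlonglongrightarrow> 1 - \<i>" by (simp add: c)
  have "(\<lambda>k. H k (1 / real k) / csqrt (of_real (1 / real k) - 2 * \<i>)) \<longlonglongrightarrow> 1 / (1 - \<i>)"
    by (rule tendsto_divide[OF 3 4]) (auto simp: complex_eq_iff)
  moreover have "1 / (1 - \<i>) = (1 + \<i>) / 2" by (simp add: complex_eq_iff Re_divide Im_divide)
  moreover have "\<forall>\<^sub>F k in sequentially. H k (1 / real k) / csqrt (of_real (1 / real k) - 2 * \<i>) = of_real (sqrt (1 / real k)) * laplace_J0 (real k ^ 2) (of_real (1 / real k) - \<i>)"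
    using eventually_ge_at_top[of 1]
  proof eventually_elim
    case (elim k)
    have "csqrt (of_real (1 / real k) - 2 * \<i>) \<noteq> 0" by (auto simp: complex_eq_iff)
    thus ?case unfolding H_def using elim by (subst q) (auto simp: field_simps)
  qed
  ultimately show ?thesis using tendsto_cong[of "\<lambda>k. H k (1 / real k) / csqrt (of_real (1 / real k) - 2 * \<i>)"] by simp
qed

section \<open>The transform of the leading asymptotics of the Bessel function of order 0\<close>

lemma Gamma_half_truncated:
  "(\<lambda>k. integral {1 / real k..real k} (\<lambda>t. t powr (-1/2) / exp t)) \<longlonglongrightarrow> sqrt pi"
proof -
  let ?f = "\<lambda>t::real. t powr (-1/2) / exp t"
  have G: "(?f has_integral sqrt pi) {0..}"
    using Gamma_integral_real[of "1/2"] by (simp add: Gamma_one_half_real)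
  define g where "g = (\<lambda>k::nat. \<lambda>t. if t \<in> {1 / real k..real k} then ?f t else 0)"
  have sub: "{1 / real k..real k} \<subseteq> {0..}" for k by (auto intro: order_trans[rotated])
  have int: "?f integrable_on {1 / real k..real k}" for k
    using integrable_on_subinterval[of ?f "{0..}" "1 / real k" "real k"] G sub[of k] by auto
  have "(\<lambda>k. integral {0..} (g k)) \<longlonglongrightarrow> integral {0..} ?f"
  proof (rule dominated_convergence(2)[where h = ?f])
    show "g k integrable_on {0..}" for k
      unfolding g_def using int[of k] sub[of k] by (subst integrable_restrict_Int) (simp add: Int_absorb2)
    show "?f integrable_on {0..}" using G by blast
    show "norm (g k x) \<le> ?f x" for k x
    proof -
      have "?f x \<ge> 0" by (intro divide_nonneg_nonneg) auto
      thus ?thesis unfolding g_def real_norm_def by (cases "x \<in> {1 / real k..real k}") (simp_all only: if_True if_False abs_of_nonneg abs_zero order_refl)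
    qed
    show "(\<lambda>k. g k x) \<longlonglongrightarrow> ?f x" if "x \<in> {0..}" for x
    proof (cases "x = 0")
      case True
      have "g k x = ?f x" for k unfolding g_def True by simp
      thus ?thesis by simp
    next
      case False
      have x: "x > 0" using False that by simp
      have "\<forall>\<^sub>F k in sequentially. g k x = ?f x"
        using eventually_ge_at_top[of "nat \<lceil>1 / x\<rceil>"] eventually_ge_at_top[of "nat \<lceil>x\<rceil>"] eventually_gt_at_top[of 0]
      proof eventually_elim
        case (elim k)
        have "1 / x \<le> real k" "x \<le> real k" using elim by linarith+
        hence "1 / real k \<le> x" using x elim by (simp add: field_simps)
        hence "x \<in> {1 / real k..real k}" using \<open>x \<le> real k\<close> by simp
        thus ?case by (simp only: g_def if_True)
      qed
      thus ?thesis by (rule tendsto_eventually)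
    qed
  qed
  moreover have "integral {0..} (g k) = integral {1 / real k..real k} ?f" for k
    unfolding g_def using sub[of k] by (subst integral_restrict_Int) (simp add: Int_absorb2)
  ultimately show ?thesis using G by (simp add: integral_unique)
qed

text \<open>Substitution \<open>r = k t\<close>: the interval from \<open>1/k\<close> to
  \<open>k\<close> in \<open>t\<close> is exactly the interval from 1 to \<open>k^2\<close> of the
  truncated transform.\<close>

lemma Gamma_half_scaled:
  assumes "k \<ge> 1"
  shows "((\<lambda>r. r powr (-1/2) * exp (- r / real k)) has_integral
     sqrt (real k) * integral {1 / real k..real k} (\<lambda>t. t powr (-1/2) / exp t)) {1..real k ^ 2}"
proof -
  let ?f = "\<lambda>t::real. t powr (-1/2) / exp t"
  define I where "I = integral {1 / real k..real k} ?f"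
  have k: "real k > 0" using assms by simp
  have "?f integrable_on {1 / real k..real k}"
    using k by (intro integrable_continuous_interval continuous_intros) auto
  hence "(?f has_integral I) (cbox (1 / real k) (real k))" by (simp add: I_def integrable_integral)
  from has_integral_affinity'[OF this, of "1 / real k" 0]
  have "((\<lambda>r. ?f (r / real k)) has_integral I * real k) {1..real k ^ 2}"
    using k by (simp add: field_simps power2_eq_square)
  hence "((\<lambda>r. 1 / sqrt (real k) * ?f (r / real k)) has_integral 1 / sqrt (real k) * (I * real k)) {1..real k ^ 2}"
    by (rule has_integral_mult_right)
  moreover have "1 / sqrt (real k) * (I * real k) = sqrt (real k) * I"
    using k by (simp add: field_simps)
  moreover have "1 / sqrt (real k) * ?f (r / real k) = r powr (-1/2) * exp (- r / real k)" if "r \<in> {1..real k ^ 2}" for r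
  proof -
    have 1: "(r / real k) powr (-1/2) = r powr (-1/2) / real k powr (-1/2)"
      by (rule powr_divide)
    have 2: "real k powr (-1/2) = 1 / sqrt (real k)"
      using powr_minus_divide[of "real k" "1/2"] powr_half_sqrt[of "real k"] k by simp
    have 3: "exp (- r / real k) = 1 / exp (r / real k)" by (simp add: exp_minus inverse_eq_divide)
    show ?thesis unfolding 1 2 3 using k by simp
  qed
  ultimately show ?thesis unfolding I_def[symmetric] by (metis (lifting) has_integral_eq)
qed

lemma integral_powr_three_halves:
  assumes "N \<ge> 1"
  shows "((\<lambda>r::real. r powr (-3/2)) has_integral (2 - 2 * N powr (-1/2))) {1..N}"
proof -
  have "((\<lambda>r. r powr (-3/2)) has_integral (- 2 * N powr (-1/2) - (- 2 * 1 powr (-1/2)))) {1..N}"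
    by (rule fundamental_theorem_of_calculus[OF assms])
       (auto intro!: derivative_eq_intros simp: has_real_derivative_iff_has_vector_derivative[symmetric])
  thus ?thesis by simp
qed

text \<open>One integration by parts. The exponent \<open>2 \<i> - \<epsilon>\<close> has modulus at
  least 2, so the bound is uniform in \<open>\<epsilon>\<close> and \<open>N\<close>, whereas the
  integral without oscillation grows like \<open>sqrt k\<close>.\<close>

lemma oscillating_integral_bound:
  assumes "\<epsilon> \<ge> 0" "N \<ge> 1"
  shows "norm (integral {1..N} (\<lambda>r. of_real (r powr (-1/2)) * exp ((2 * \<i> - of_real \<epsilon>) * of_real r))) \<le> 2"
proof -
  define c where "c = 2 * \<i> - of_real \<epsilon>"
  have c: "norm c \<ge> 2" using abs_Im_le_cmod[of c] by (simp add: c_def)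
  hence c0: "c \<noteq> 0" by auto
  have Rc: "Re c \<le> 0" using assms by (simp add: c_def)
  define W where "W = (\<lambda>r. of_real (r powr (-1/2)) * (exp (c * of_real r) / c))"
  have p: "((\<lambda>r. complex_of_real (r powr (-1/2))) has_vector_derivative of_real (-1/2 * r powr (-3/2))) (at r within S)"
    if "r \<ge> 1" for r S
    by (rule has_vector_derivative_of_real[OF has_field_derivative_at_within])
       (use that in \<open>auto intro!: derivative_eq_intros\<close>)
  have e: "((\<lambda>r. exp (c * of_real r) / c) has_vector_derivative exp (c * of_real r)) (at r within S)" for r :: real and S
    by (rule has_vector_derivative_real_field) (use c0 in \<open>auto intro!: derivative_eq_intros\<close>)
  have ftc: "((\<lambda>r. of_real (r powr (-1/2)) * exp (c * of_real r) + of_real (-1/2 * r powr (-3/2)) * (exp (c * of_real r) / c)) has_integral W N - W 1) {1..N}"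
    unfolding W_def by (rule fundamental_theorem_of_calculus[OF assms(2)], rule has_vector_derivative_mult[OF p e]) auto
  have i1: "(\<lambda>r. of_real (r powr (-1/2)) * exp (c * of_real r)) integrable_on {1..N}"
    by (intro integrable_continuous_interval continuous_intros) auto
  have i2: "(\<lambda>r. of_real (-1/2 * r powr (-3/2)) * (exp (c * of_real r) / c)) integrable_on {1..N}"
    by (intro integrable_continuous_interval continuous_intros) (auto simp: c0)
  have eq: "integral {1..N} (\<lambda>r. of_real (r powr (-1/2)) * exp (c * of_real r))
      = W N - W 1 - integral {1..N} (\<lambda>r. of_real (-1/2 * r powr (-3/2)) * (exp (c * of_real r) / c))"
    using has_integral_unique[OF ftc has_integral_add[OF integrable_integral[OF i1] integrable_integral[OF i2]]]
    by (simp only: eq_diff_eq)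
  have ec: "norm (exp (c * of_real r) / c) \<le> 1/2" if "r \<ge> 0" for r
  proof -
    have "norm (exp (c * of_real r)) \<le> 1" using Rc that by (simp add: norm_exp_eq_Re mult_nonpos_nonneg)
    thus ?thesis using c frac_le[of 1 "norm (exp (c * of_real r))" 2 "norm c"] by (simp add: norm_divide)
  qed
  have W: "norm (W r) \<le> 1/2" if "r \<ge> 1" for r
  proof -
    have "r powr (-1/2) \<le> 1" using that powr_mono[of "-1/2" 0 r] by simp
    hence "norm (W r) \<le> 1 * (1/2)" unfolding W_def norm_mult using ec[of r] that by (intro mult_mono) auto
    thus ?thesis by simp
  qed
  have i3: "norm (integral {1..N} (\<lambda>r. of_real (-1/2 * r powr (-3/2)) * (exp (c * of_real r) / c))) \<le> integral {1..N} (\<lambda>r. 1/4 * r powr (-3/2))"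
  proof (rule integral_norm_bound_integral[OF i2])
    show "(\<lambda>r. 1/4 * r powr (-3/2)) integrable_on {1..N}"
      by (intro integrable_continuous_interval continuous_intros) auto
    fix r assume "r \<in> {1..N}"
    have "norm (complex_of_real (-1/2 * r powr (-3/2)) * (exp (c * of_real r) / c)) \<le> 1/2 * r powr (-3/2) * (1/2)"
      unfolding norm_mult using ec[of r] \<open>r \<in> {1..N}\<close> by (intro mult_mono) auto
    thus "norm (complex_of_real (-1/2 * r powr (-3/2)) * (exp (c * of_real r) / c)) \<le> 1/4 * r powr (-3/2)" by simp
  qed
  also have "integral {1..N} (\<lambda>r. 1/4 * r powr (-3/2)) = 1/4 * (2 - 2 * N powr (-1/2))"
    by (rule integral_unique, rule has_integral_mult_right, rule integral_powr_three_halves[OF assms(2)])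
  also have "\<dots> \<le> 1" using powr_ge_zero[of N "-1/2"] by (simp del: powr_ge_zero)
  finally have "norm (W N - W 1 - integral {1..N} (\<lambda>r. of_real (-1/2 * r powr (-3/2)) * (exp (c * of_real r) / c))) \<le> 1/2 + 1/2 + 1"
    using W[of N] W[of 1] assms(2) by (intro norm_triangle_le_diff add_mono order_trans[OF norm_triangle_ineq4]) auto
  thus ?thesis unfolding eq[symmetric] c_def[symmetric] by simp
qed

text \<open>At \<open>\<epsilon> - \<i>\<close> the factor \<open>exp (\<i> r)\<close> turns
  \<open>A cos r + B sin r\<close> into \<open>Z + Z' exp (2 \<i> r)\<close>. Only the resonant
  constant \<open>Z\<close> is amplified; after scaling it contributes \<open>Z sqrt pi\<close>, and
  comparison with the known limit \<open>(1 + \<i>) / 2\<close> reads off \<open>A\<close> and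
  \<open>B\<close> as real and imaginary parts.\<close>

lemma bessel_J_0_constants:
  assumes AB: "\<And>r. r \<ge> 1 \<Longrightarrow> \<bar>bv 0 r - (A * cos r + B * sin r)\<bar> \<le> C / r" and C: "C \<ge> 0"
  shows "A = 1 / sqrt pi" "B = 1 / sqrt pi"
proof -
  define Z where "Z = (of_real A + \<i> * of_real B) / 2"
  define Z' where "Z' = (of_real A - \<i> * of_real B) / 2"
  define I where "I = (\<lambda>k. integral {1 / real k..real k} (\<lambda>t. t powr (-1/2) / exp t))"
  define rem where "rem = (\<lambda>\<epsilon> r. exp (- (of_real \<epsilon> - \<i>) * of_real r) * of_real (bessel_J 0 r - r powr (-1/2) * (A * cos r + B * sin r)))"
  define T where "T = (\<lambda>k. integral {1..real k ^ 2} (\<lambda>r. of_real (r powr (-1/2)) * exp ((2 * \<i> - of_real (1 / real k)) * of_real r)))"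
  have split: "exp (- (of_real \<epsilon> - \<i>) * of_real r) * of_real (bessel_J 0 r)
     = Z * of_real (r powr (-1/2) * exp (- \<epsilon> * r)) + Z' * (of_real (r powr (-1/2)) * exp ((2 * \<i> - of_real \<epsilon>) * of_real r)) + rem \<epsilon> r" for \<epsilon> r
  proof -
    have e1: "exp (- (of_real \<epsilon> - \<i>) * of_real r) = of_real (exp (- \<epsilon> * r)) * exp (\<i> * of_real r)"
      unfolding exp_of_real[symmetric] exp_add[symmetric] by (rule arg_cong[where f = exp]) (simp add: algebra_simps)
    have e2: "exp ((2 * \<i> - of_real \<epsilon>) * of_real r) = of_real (exp (- \<epsilon> * r)) * (exp (\<i> * of_real r) * exp (\<i> * of_real r))"
      unfolding exp_of_real[symmetric] exp_add[symmetric] by (rule arg_cong[where f = exp]) (simp add: algebra_simps)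
    have e3: "exp (\<i> * of_real r) * of_real (A * cos r + B * sin r) = Z + Z' * (exp (\<i> * of_real r) * exp (\<i> * of_real r))"
    proof -
      have E: "exp (\<i> * of_real r) = Complex (cos r) (sin r)"
        by (simp add: complex_eq_iff Re_exp Im_exp)
      have h: "cos r * cos r + sin r * sin r = 1"
        using sin_cos_squared_add[of r] by (simp add: power2_eq_square)
      have "Re (exp (\<i> * of_real r) * of_real (A * cos r + B * sin r)) = Re (Z + Z' * (exp (\<i> * of_real r) * exp (\<i> * of_real r)))"
        unfolding E by (simp add: Z_def Z'_def field_simps) (use h in algebra)
      moreover have "Im (exp (\<i> * of_real r) * of_real (A * cos r + B * sin r)) = Im (Z + Z' * (exp (\<i> * of_real r) * exp (\<i> * of_real r)))"
        unfolding E by (simp add: Z_def Z'_def field_simps) (use h in algebra)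
      ultimately show ?thesis by (rule complex_eqI)
    qed
    show ?thesis unfolding rem_def e1 e2 of_real_mult of_real_diff using e3[unfolded of_real_mult of_real_diff] by algebra
  qed
  have cont: "continuous_on {1..N} (rem \<epsilon>)" for \<epsilon> N
    unfolding rem_def by (intro continuous_intros) auto
  have rem: "norm (integral {1..real k ^ 2} (rem (1 / real k))) \<le> 2 * C" if k: "k \<ge> 1" for k
  proof -
    have "norm (integral {1..real k ^ 2} (rem (1 / real k))) \<le> integral {1..real k ^ 2} (\<lambda>r. C * r powr (-3/2))"
    proof (rule integral_norm_bound_integral)
      show "rem (1 / real k) integrable_on {1..real k ^ 2}" by (intro integrable_continuous_interval cont)
      show "(\<lambda>r. C * r powr (-3/2)) integrable_on {1..real k ^ 2}"
        by (intro integrable_continuous_interval continuous_intros) auto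
      fix r assume r: "r \<in> {1..real k ^ 2}"
      have r0: "r > 0" using r by auto
      have "bessel_J 0 r - r powr (-1/2) * (A * cos r + B * sin r) = r powr (-1/2) * (bv 0 r - (A * cos r + B * sin r))"
        using r0 by (simp add: bv_def powr_minus powr_half_sqrt field_simps)
      hence "\<bar>bessel_J 0 r - r powr (-1/2) * (A * cos r + B * sin r)\<bar> \<le> r powr (-1/2) * (C / r)"
        using mult_left_mono[OF AB[of r], of "r powr (-1/2)"] r by (simp add: abs_mult)
      also have "r powr (-1/2) * (C / r) = C * r powr (-3/2)"
      proof -
        have "r powr (-3/2) = r powr (-1/2 + (-1))" by simp
        also have "\<dots> = r powr (-1/2) * r powr (-1)" by (rule powr_add)
        also have "r powr (-1) = 1 / r" using r0 by (simp add: powr_minus_divide)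
        finally show ?thesis by simp
      qed
      finally have 1: "\<bar>bessel_J 0 r - r powr (-1/2) * (A * cos r + B * sin r)\<bar> \<le> C * r powr (-3/2)" .
      have 2: "norm (exp (- (of_real (1 / real k) - \<i>) * of_real r)) \<le> 1"
        using r0 by (simp add: norm_exp_eq_Re)
      have "norm (rem (1 / real k) r) \<le> 1 * (C * r powr (-3/2))"
        unfolding rem_def norm_mult norm_of_real using 1 2 by (intro mult_mono) auto
      thus "norm (rem (1 / real k) r) \<le> C * r powr (-3/2)" by simp
    qed
    also have "\<dots> = C * (2 - 2 * (real k ^ 2) powr (-1/2))"
      by (rule integral_unique, rule has_integral_mult_right, rule integral_powr_three_halves) (use k in auto)
    also have "\<dots> \<le> C * 2" using C by (intro mult_left_mono) auto
    finally show ?thesis by simp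
  qed
  have decomp: "laplace_J0 (real k ^ 2) (of_real (1 / real k) - \<i>) = laplace_J0 1 (of_real (1 / real k) - \<i>)
      + Z * of_real (sqrt (real k) * I k) + Z' * T k + integral {1..real k ^ 2} (rem (1 / real k))" if k: "k \<ge> 1" for k
  proof -
    let ?f = "\<lambda>r. exp (- (of_real (1 / real k) - \<i>) * of_real r) * complex_of_real (bessel_J 0 r)"
    have "(?f has_integral laplace_J0 1 (of_real (1 / real k) - \<i>)) {0..1}"
      unfolding laplace_J0_def by (intro integrable_integral integrable_continuous_interval continuous_intros)
    moreover have "(?f has_integral (Z * of_real (sqrt (real k) * I k) + Z' * T k + integral {1..real k ^ 2} (rem (1 / real k)))) {1..real k ^ 2}"
      unfolding split
    proof (intro has_integral_add has_integral_mult_right)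
      show "((\<lambda>r. complex_of_real (r powr (- 1 / 2) * exp (- (1 / real k) * r))) has_integral complex_of_real (sqrt (real k) * I k)) {1..(real k)\<^sup>2}"
        using has_integral_linear[OF Gamma_half_scaled[OF k] bounded_linear_of_real[where 'a = complex]]
        by (simp add: o_def I_def)
      show "((\<lambda>r. complex_of_real (r powr (- 1 / 2)) * exp ((2 * \<i> - complex_of_real (1 / real k)) * complex_of_real r)) has_integral T k) {1..(real k)\<^sup>2}"
        unfolding T_def by (intro integrable_integral integrable_continuous_interval continuous_intros) auto
      show "(rem (1 / real k) has_integral integral {1..(real k)\<^sup>2} (rem (1 / real k))) {1..(real k)\<^sup>2}"
        by (intro integrable_integral integrable_continuous_interval cont)
    qed
    ultimately have "(?f has_integral (laplace_J0 1 (of_real (1 / real k) - \<i>) + (Z * of_real (sqrt (real k) * I k) + Z' * T k + integral {1..real k ^ 2} (rem (1 / real k))))) {0..real k ^ 2}"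
      by (rule has_integral_combine[rotated 2]) (use k in auto)
    thus ?thesis unfolding laplace_J0_def[of "real k ^ 2"] by (simp add: integral_unique add.assoc)
  qed
  have first: "norm (laplace_J0 1 (of_real (1 / real k) - \<i>)) \<le> 1" for k
  proof -
    have "norm (laplace_J0 1 (of_real (1 / real k) - \<i>)) \<le> integral {0..1} (\<lambda>r::real. 1)"
      unfolding laplace_J0_def
    proof (rule integral_norm_bound_integral)
      fix r :: real assume r: "r \<in> {0..1}"
      have "norm (exp (- (of_real (1 / real k) - \<i>) * of_real r)) \<le> 1"
        using r by (simp add: norm_exp_eq_Re)
      from mult_mono[OF this abs_bessel_J_le_1[of 0 r]]
      show "norm (exp (- (complex_of_real (1 / real k) - \<i>) * complex_of_real r) * complex_of_real (bessel_J 0 r)) \<le> 1"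
        by (simp add: norm_mult)
    qed (intro integrable_continuous_interval continuous_intros)+
    thus ?thesis by simp
  qed
  \<comment> \<open>The scaling factor \<open>sqrt (1/k)\<close> kills everything bounded: the part
    over the unit interval, the oscillating part and the remainder.\<close>
  have z: "(\<lambda>k. complex_of_real (sqrt (1 / real k)) * Q k) \<longlonglongrightarrow> 0" if "\<And>k. k \<ge> 1 \<Longrightarrow> norm (Q k) \<le> K" for Q and K :: real
  proof (rule Lim_null_comparison)
    show "\<forall>\<^sub>F k in sequentially. norm (complex_of_real (sqrt (1 / real k)) * Q k) \<le> sqrt (1 / real k) * K"
      using eventually_ge_at_top[of 1]
    proof eventually_elim
      case (elim k)
      show ?case unfolding norm_mult norm_of_real using that[OF elim] by (intro mult_mono) auto
    qed
    show "(\<lambda>k. sqrt (1 / real k) * K) \<longlonglongrightarrow> 0" by real_asymp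
  qed
  have "(\<lambda>k. of_real (sqrt (1 / real k)) * laplace_J0 1 (of_real (1 / real k) - \<i>)
      + Z * of_real (I k) + Z' * (of_real (sqrt (1 / real k)) * T k) + of_real (sqrt (1 / real k)) * integral {1..real k ^ 2} (rem (1 / real k)))
     \<longlonglongrightarrow> 0 + Z * of_real (sqrt pi) + Z' * 0 + 0"
  proof (intro tendsto_add tendsto_mult tendsto_const tendsto_of_real)
    show "I \<longlonglongrightarrow> sqrt pi" using Gamma_half_truncated by (simp add: I_def[abs_def])
    show "(\<lambda>k. complex_of_real (sqrt (1 / real k)) * T k) \<longlonglongrightarrow> 0"
      unfolding T_def by (rule z, rule oscillating_integral_bound) auto
    show "(\<lambda>k. complex_of_real (sqrt (1 / real k)) * laplace_J0 1 (complex_of_real (1 / real k) - \<i>)) \<longlonglongrightarrow> 0"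
      by (rule z[OF first])
    show "(\<lambda>k. complex_of_real (sqrt (1 / real k)) * integral {1..(real k)\<^sup>2} (rem (1 / real k))) \<longlonglongrightarrow> 0"
      by (rule z[OF rem])
  qed
  moreover have "\<forall>\<^sub>F k in sequentially. of_real (sqrt (1 / real k)) * laplace_J0 1 (of_real (1 / real k) - \<i>)
      + Z * of_real (I k) + Z' * (of_real (sqrt (1 / real k)) * T k) + of_real (sqrt (1 / real k)) * integral {1..real k ^ 2} (rem (1 / real k))
     = of_real (sqrt (1 / real k)) * laplace_J0 (real k ^ 2) (of_real (1 / real k) - \<i>)"
    using eventually_ge_at_top[of 1]
  proof eventually_elim
    case (elim k)
    have "complex_of_real (sqrt (1 / real k)) * of_real (sqrt (real k)) = 1"
      using elim by (simp add: of_real_mult[symmetric] real_sqrt_mult[symmetric] del: of_real_mult)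
    thus ?case unfolding decomp[OF elim] of_real_mult by algebra
  qed
  ultimately have "(\<lambda>k. of_real (sqrt (1 / real k)) * laplace_J0 (real k ^ 2) (of_real (1 / real k) - \<i>)) \<longlonglongrightarrow> Z * of_real (sqrt pi)"
    by (simp add: tendsto_cong)
  hence "Z * of_real (sqrt pi) = (1 + \<i>) / 2" using laplace_J0_limit LIMSEQ_unique by blast
  hence "A * sqrt pi = 1" "B * sqrt pi = 1" by (auto simp: Z_def complex_eq_iff)
  thus "A = 1 / sqrt pi" "B = 1 / sqrt pi" by (auto simp: field_simps)
qed

lemma tendsto_zero_mult_bounded:
  fixes f g :: "'a \<Rightarrow> real"
  assumes "(f \<longlongrightarrow> 0) F" "\<And>x. \<bar>g x\<bar> \<le> B"
  shows "((\<lambda>x. f x * g x) \<longlongrightarrow> 0) F"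
proof (rule Lim_null_comparison)
  show "\<forall>\<^sub>F x in F. norm (f x * g x) \<le> \<bar>f x\<bar> * B"
    using assms(2) by (intro always_eventually allI) (simp add: abs_mult mult_left_mono)
  show "((\<lambda>x. \<bar>f x\<bar> * B) \<longlongrightarrow> 0) F"
    using tendsto_mult_left_zero[OF tendsto_rabs_zero[OF assms(1)]] .
qed

section \<open>Asymptotics for every fixed order\<close>

definition bphase :: "nat \<Rightarrow> real \<Rightarrow> real" where
  "bphase n r = r - real n * pi / 2 - pi / 4"

text \<open>The derivative is expressed through the next order, so the limits of \<open>bw\<close>
  follow from those of \<open>bv\<close> alone.\<close>

lemma bw_eq:
  assumes "r > 0"
  shows "bw n r = (1 / 2 + real n) * (bv n r / r) - bv (Suc n) r"
proof -
  define q where "q = sqrt r"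
  have q: "q > 0" "r = q ^ 2" using assms by (auto simp: q_def)
  have J: "bessel_J' n r = real n / r * bessel_J n r - bessel_J (Suc n) r"
    using assms by (intro bessel_J'_eq) simp
  show ?thesis unfolding bw_def bv_def J q_def[symmetric] unfolding q(2) using q(1)
    by (simp add: field_simps power2_eq_square)
qed

lemma cos_bphase_0: "sqrt (2 / pi) * cos (bphase 0 r) = 1 / sqrt pi * cos r + 1 / sqrt pi * sin r"
proof -
  have "cos (bphase 0 r) = sqrt 2 / 2 * (cos r + sin r)"
    by (simp add: bphase_def cos_diff cos_45 sin_45 algebra_simps)
  moreover have "sqrt (2 / pi) * (sqrt 2 / 2) = 1 / sqrt pi" by (simp add: real_sqrt_divide)
  ultimately show ?thesis by (metis (no_types, lifting) distrib_left mult.assoc)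
qed

lemma cos_bphase_1: "sqrt (2 / pi) * cos (bphase 1 r) = 1 / sqrt pi * sin r - 1 / sqrt pi * cos r"
proof -
  have "bphase 1 r = bphase 0 (r - pi / 2)" by (simp add: bphase_def)
  hence "sqrt (2 / pi) * cos (bphase 1 r) = 1 / sqrt pi * cos (r - pi / 2) + 1 / sqrt pi * sin (r - pi / 2)"
    using cos_bphase_0[of "r - pi / 2"] by (simp only:)
  thus ?thesis by (simp add: cos_diff sin_diff)
qed

lemma cos_bphase_Suc_Suc: "cos (bphase (Suc (Suc n)) r) = - cos (bphase n r)"
proof -
  have "bphase (Suc (Suc n)) r = bphase n r - pi" by (simp add: bphase_def field_simps)
  thus ?thesis by (simp add: cos_diff)
qed

lemma sqrt_2_pi: "0 < sqrt (2 / pi)" "sqrt (2 / pi) \<le> 1" using pi_ge_two by simp_all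

text \<open>Induction over two orders by the three-term recurrence. Every step multiplies the error
  by the order, so the constant depends on \<open>n\<close> without control; the lemma serves to
  identify limits for fixed order.\<close>

lemma bv_asymp: "\<exists>C\<ge>0. \<forall>r\<ge>1. \<bar>bv n r - sqrt (2 / pi) * cos (bphase n r)\<bar> \<le> C / r"
proof (induction n rule: induct_nat_012)
  case 0
  obtain A B C where AB: "\<And>r. r \<ge> 1 \<Longrightarrow> \<bar>bv 0 r - (A * cos r + B * sin r)\<bar> \<le> C / r"
     "\<And>r. r \<ge> 1 \<Longrightarrow> \<bar>bw 0 r - (B * cos r - A * sin r)\<bar> \<le> C / r" "C \<ge> 0"
    by (rule bv_0_asymp) (rule that)
  have c: "A = 1 / sqrt pi" "B = 1 / sqrt pi" using bessel_J_0_constants[OF AB(1,3)] by auto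
  show ?case
  proof (intro exI[of _ C] conjI allI impI)
    show "\<bar>bv 0 r - sqrt (2 / pi) * cos (bphase 0 r)\<bar> \<le> C / r" if "r \<ge> 1" for r
      using AB(1)[OF that] unfolding c cos_bphase_0 .
  qed (rule AB(3))
next
  case 1
  obtain A B C where AB: "\<And>r. r \<ge> 1 \<Longrightarrow> \<bar>bv 0 r - (A * cos r + B * sin r)\<bar> \<le> C / r"
     "\<And>r. r \<ge> 1 \<Longrightarrow> \<bar>bw 0 r - (B * cos r - A * sin r)\<bar> \<le> C / r" "C \<ge> 0"
    by (rule bv_0_asymp) (rule that)
  have c: "A = 1 / sqrt pi" "B = 1 / sqrt pi" using bessel_J_0_constants[OF AB(1,3)] by auto
  obtain M where M0: "M > 0" and M1: "\<forall>r\<ge>1. \<bar>bv 0 r\<bar> \<le> M"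
    using bv_0_bounded by (elim exE conjE) (rule that)
  note M = M0 M1[rule_format]
  show ?case
  proof (intro exI[of _ "M + C"] conjI allI impI)
    fix r :: real assume r: "r \<ge> 1"
    have "bv (Suc 0) r = bv 0 r / (2 * r) - bw 0 r"
      using bw_eq[of r 0] r by simp
    hence "bv (Suc 0) r - sqrt (2 / pi) * cos (bphase (Suc 0) r) = bv 0 r / (2 * r) - (bw 0 r - (B * cos r - A * sin r))"
      using cos_bphase_1[of r] c by simp
    moreover have "\<bar>bv 0 r / (2 * r)\<bar> \<le> M / r"
      using M(2)[OF r] M(1) r by (simp add: abs_divide divide_simps) 
    ultimately show "\<bar>bv (Suc 0) r - sqrt (2 / pi) * cos (bphase (Suc 0) r)\<bar> \<le> (M + C) / r"
      using AB(2)[OF r] unfolding add_divide_distrib by linarith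
  qed (use M AB in auto)
next
  case (ge2 n)
  obtain C1 C2 where C: "C1 \<ge> 0" "\<And>r. r \<ge> 1 \<Longrightarrow> \<bar>bv n r - sqrt (2 / pi) * cos (bphase n r)\<bar> \<le> C1 / r"
      "C2 \<ge> 0" "\<And>r. r \<ge> 1 \<Longrightarrow> \<bar>bv (Suc n) r - sqrt (2 / pi) * cos (bphase (Suc n) r)\<bar> \<le> C2 / r"
    using ge2 by blast
  show ?case
  proof (intro exI[of _ "C1 + 2 * real (Suc n) * (C2 + 1)"] conjI allI impI)
    fix r :: real assume r: "r \<ge> 1"
    have "\<bar>sqrt (2 / pi) * cos (bphase (Suc n) r)\<bar> \<le> 1 * 1"
      unfolding abs_mult using sqrt_2_pi by (intro mult_mono) auto
    moreover have "C2 / r \<le> C2" using C(3) r by (simp add: divide_le_eq mult_left_mono[of 1 r C2, simplified])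
    ultimately have b: "\<bar>bv (Suc n) r\<bar> \<le> C2 + 1" using C(4)[OF r] by linarith
    have "bv (Suc (Suc n)) r = 2 * real (Suc n) / r * bv (Suc n) r - bv n r"
    proof -
      have "bessel_J (Suc (Suc n)) r = 2 * real (Suc n) / r * bessel_J (Suc n) r - bessel_J n r"
        using bessel_J_rec[of r n] r by (simp add: field_simps)
      thus ?thesis unfolding bv_def by (simp only: right_diff_distrib mult_ac)
    qed
    hence eq: "bv (Suc (Suc n)) r - sqrt (2 / pi) * cos (bphase (Suc (Suc n)) r)
      = 2 * real (Suc n) / r * bv (Suc n) r - (bv n r - sqrt (2 / pi) * cos (bphase n r))"
      by (simp add: cos_bphase_Suc_Suc)
    have bX: "\<bar>2 * real (Suc n) / r * bv (Suc n) r\<bar> \<le> 2 * real (Suc n) / r * (C2 + 1)"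
      unfolding abs_mult[of "2 * real (Suc n) / r"] using b r by (intro mult_mono) auto
    have "\<bar>bv (Suc (Suc n)) r - sqrt (2 / pi) * cos (bphase (Suc (Suc n)) r)\<bar> \<le> 2 * real (Suc n) / r * (C2 + 1) + C1 / r"
      unfolding eq by (rule order_trans[OF abs_triangle_ineq4 add_mono[OF bX C(2)[OF r]]])
    thus "\<bar>bv (Suc (Suc n)) r - sqrt (2 / pi) * cos (bphase (Suc (Suc n)) r)\<bar> \<le> (C1 + 2 * real (Suc n) * (C2 + 1)) / r"
      by (simp only: add_divide_distrib times_divide_eq_left times_divide_eq_right add.commute)
  qed (use C in auto)
qed

lemma bv_bounded: "\<exists>C\<ge>0. \<forall>r\<ge>1. \<bar>bv n r\<bar> \<le> C"
proof -
  obtain C where C: "C \<ge> 0" "\<And>r. r \<ge> 1 \<Longrightarrow> \<bar>bv n r - sqrt (2 / pi) * cos (bphase n r)\<bar> \<le> C / r"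
    using bv_asymp by blast
  show ?thesis
  proof (intro exI[of _ "C + 1"] conjI allI impI)
    fix r :: real assume r: "r \<ge> 1"
    have "\<bar>sqrt (2 / pi) * cos (bphase n r)\<bar> \<le> 1 * 1"
      unfolding abs_mult using sqrt_2_pi by (intro mult_mono) auto
    moreover have "C / r \<le> C" using C(1) r by (simp add: divide_le_eq mult_left_mono[of 1 r C, simplified])
    ultimately show "\<bar>bv n r\<bar> \<le> C + 1" using C(2)[OF r] by linarith
  qed (use C in auto)
qed

lemma bv_limit: "((\<lambda>r. bv n r - sqrt (2 / pi) * cos (bphase n r)) \<longlongrightarrow> 0) at_top"
proof -
  obtain C where C: "C \<ge> 0" "\<And>r. r \<ge> 1 \<Longrightarrow> \<bar>bv n r - sqrt (2 / pi) * cos (bphase n r)\<bar> \<le> C / r"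
    using bv_asymp by blast
  show ?thesis
  proof (rule Lim_null_comparison)
    show "\<forall>\<^sub>F r in at_top. norm (bv n r - sqrt (2 / pi) * cos (bphase n r)) \<le> C / r"
      using eventually_ge_at_top[of 1] by eventually_elim (use C in auto)
    show "((\<lambda>r. C / r) \<longlongrightarrow> 0) at_top" by real_asymp
  qed
qed

lemma bv_div_limit: "((\<lambda>r. bv n r / r) \<longlongrightarrow> 0) at_top"
proof -
  obtain C where C: "C \<ge> 0" "\<And>r. r \<ge> 1 \<Longrightarrow> \<bar>bv n r\<bar> \<le> C" using bv_bounded by blast
  show ?thesis
  proof (rule Lim_null_comparison)
    show "\<forall>\<^sub>F r in at_top. norm (bv n r / r) \<le> C / r"
      using eventually_ge_at_top[of 1]
    proof eventually_elim
      case (elim r) thus ?case using C(2)[of r] by (simp add: abs_divide divide_right_mono)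
    qed
    show "((\<lambda>r. C / r) \<longlongrightarrow> 0) at_top" by real_asymp
  qed
qed


lemma bw_limit: "((\<lambda>r. bw n r + sqrt (2 / pi) * sin (bphase n r)) \<longlongrightarrow> 0) at_top"
proof -
  have s: "cos (bphase (Suc n) r) = sin (bphase n r)" for r
  proof -
    have "bphase (Suc n) r = bphase n r - pi / 2" by (simp add: bphase_def field_simps)
    thus ?thesis by (simp add: cos_diff)
  qed
  have "((\<lambda>r. (1 / 2 + real n) * (bv n r / r) - (bv (Suc n) r - sqrt (2 / pi) * cos (bphase (Suc n) r))) \<longlongrightarrow> (1 / 2 + real n) * 0 - 0) at_top"
    by (intro tendsto_intros bv_limit bv_div_limit)
  moreover have "\<forall>\<^sub>F r in at_top. (1 / 2 + real n) * (bv n r / r) - (bv (Suc n) r - sqrt (2 / pi) * cos (bphase (Suc n) r)) = bw n r + sqrt (2 / pi) * sin (bphase n r)"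
    using eventually_gt_at_top[of 0] by eventually_elim (simp add: bw_eq s)
  ultimately show ?thesis by (simp add: tendsto_cong)
qed

text \<open>The phase of the oscillation and the angle of the rotation both advance with
  \<open>r\<close>; only their difference, the phase at \<open>\<theta>\<close>, survives.\<close>

lemma bF_limit: "(bF n \<theta> \<longlongrightarrow> sqrt (2 / pi) * cos (bphase n \<theta>)) at_top"
proof -
  have 1: "((\<lambda>r. (bv n r - sqrt (2 / pi) * cos (bphase n r)) * cos (r - \<theta>)) \<longlongrightarrow> 0) at_top"
    by (rule tendsto_zero_mult_bounded[OF bv_limit abs_cos_le_one])
  have 2: "((\<lambda>r. (bw n r + sqrt (2 / pi) * sin (bphase n r)) * sin (r - \<theta>)) \<longlongrightarrow> 0) at_top"
    by (rule tendsto_zero_mult_bounded[OF bw_limit abs_sin_le_one])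
  have "(\<lambda>r. (bv n r - sqrt (2 / pi) * cos (bphase n r)) * cos (r - \<theta>) - (bw n r + sqrt (2 / pi) * sin (bphase n r)) * sin (r - \<theta>))
     = (\<lambda>r. bF n \<theta> r - sqrt (2 / pi) * cos (bphase n \<theta>))"
  proof
    fix r
    have "bphase n \<theta> = bphase n r - (r - \<theta>)" by (simp add: bphase_def)
    hence "cos (bphase n \<theta>) = cos (bphase n r) * cos (r - \<theta>) + sin (bphase n r) * sin (r - \<theta>)"
      by (simp only: cos_diff)
    thus "(bv n r - sqrt (2 / pi) * cos (bphase n r)) * cos (r - \<theta>) - (bw n r + sqrt (2 / pi) * sin (bphase n r)) * sin (r - \<theta>)
     = bF n \<theta> r - sqrt (2 / pi) * cos (bphase n \<theta>)"
      unfolding bF_def by algebra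
  qed
  with tendsto_diff[OF 1 2] have "((\<lambda>r. bF n \<theta> r - sqrt (2 / pi) * cos (bphase n \<theta>)) \<longlongrightarrow> 0) at_top" by simp
  thus ?thesis using Lim_null by blast
qed

text \<open>The energy \<open>w^2 + (1 - N / r^2) v^2\<close> increases, and the asymptotics show
  that its limit is \<open>2 / pi\<close>, which is below \<open>2/3\<close>. For
  \<open>r \<ge> 2 n\<close> the coefficient of \<open>v^2\<close> is at least \<open>3/4\<close>,
  so \<open>v^2\<close> is at most \<open>8/9\<close>. Nothing here depends on the order.\<close>

lemma abs_bv_le_1:
  assumes n: "n \<ge> 1" and r: "r \<ge> 2 * real n"
  shows "\<bar>bv n r\<bar> \<le> 1"
proof -
  define N where "N = real n ^ 2 - 1/4"
  define E where "E = (\<lambda>r. (bw n r)^2 + (1 - N / r^2) * (bv n r)^2)"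
  have "1 \<le> real n" using n by simp
  from one_le_power[OF this, of 2] have N: "N \<ge> 0" "N \<le> real n ^ 2" by (auto simp: N_def)
  have r0: "r > 0" using n r by linarith
  have inc: "E r \<le> E x" if "r \<le> x" for x
  proof (rule DERIV_nonneg_imp_nondecreasing[OF that])
    fix y assume y: "r \<le> y" "y \<le> x"
    hence y0: "y > 0" using r0 by linarith
    have "(E has_real_derivative (2 * bw n y * (- (1 - N / y^2) * bv n y) + ((1 - N / y^2) * (2 * bv n y * bw n y) + (2 * N / y^3) * (bv n y)^2))) (at y)"
      unfolding E_def N_def using y0
      by (auto intro!: derivative_eq_intros bv_deriv bw_deriv simp: field_simps power2_eq_square power3_eq_cube)
    moreover have "2 * bw n y * (- (1 - N / y^2) * bv n y) + ((1 - N / y^2) * (2 * bv n y * bw n y) + (2 * N / y^3) * (bv n y)^2) = (2 * N / y^3) * (bv n y)^2"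
      by algebra
    moreover have "(2 * N / y^3) * (bv n y)^2 \<ge> 0" using N y0 by simp
    ultimately show "\<exists>d. (E has_real_derivative d) (at y) \<and> 0 \<le> d" by metis
  qed
  have lim: "(E \<longlongrightarrow> 2 / pi) at_top"
  proof -
    let ?q = "sqrt (2 / pi)"
    have sq: "?q ^ 2 = 2 / pi" by simp
    have b1: "((\<lambda>r. (bv n r - ?q * cos (bphase n r)) * (?q * cos (bphase n r))) \<longlongrightarrow> 0) at_top"
      by (rule tendsto_zero_mult_bounded[OF bv_limit, where B = "sqrt (2 / pi)"]) (use sqrt_2_pi in \<open>auto simp: abs_mult intro: mult_left_le\<close>)
    have b2: "((\<lambda>r. (bw n r + ?q * sin (bphase n r)) * (?q * sin (bphase n r))) \<longlongrightarrow> 0) at_top"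
      by (rule tendsto_zero_mult_bounded[OF bw_limit, where B = "sqrt (2 / pi)"]) (use sqrt_2_pi in \<open>auto simp: abs_mult intro: mult_left_le\<close>)
    have b3: "((\<lambda>r. (bv n r / r)^2) \<longlongrightarrow> 0) at_top" using tendsto_power[OF bv_div_limit, of n 2] by simp
    have "((\<lambda>r. (bv n r - ?q * cos (bphase n r))^2 + 2 * ((bv n r - ?q * cos (bphase n r)) * (?q * cos (bphase n r)))
         + (bw n r + ?q * sin (bphase n r))^2 - 2 * ((bw n r + ?q * sin (bphase n r)) * (?q * sin (bphase n r))) + 2 / pi - N * (bv n r / r)^2)
        \<longlongrightarrow> 0^2 + 2 * 0 + 0^2 - 2 * 0 + 2 / pi - N * 0) at_top"
      by (intro tendsto_intros bv_limit bw_limit b1 b2 b3)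
    moreover have "\<forall>\<^sub>F r in at_top. (bv n r - ?q * cos (bphase n r))^2 + 2 * ((bv n r - ?q * cos (bphase n r)) * (?q * cos (bphase n r)))
         + (bw n r + ?q * sin (bphase n r))^2 - 2 * ((bw n r + ?q * sin (bphase n r)) * (?q * sin (bphase n r))) + 2 / pi - N * (bv n r / r)^2 = E r"
      using eventually_gt_at_top[of 0]
    proof eventually_elim
      case (elim r)
      have "2 / pi = ?q^2 * ((cos (bphase n r))^2 + (sin (bphase n r))^2)" by simp
      moreover have "N / r^2 * (bv n r)^2 = N * (bv n r / r)^2" by (simp add: power_divide)
      ultimately show ?case unfolding E_def by algebra
    qed
    ultimately show ?thesis by (simp add: tendsto_cong)
  qed
  have "\<forall>\<^sub>F x in at_top. E r \<le> E x" using eventually_ge_at_top[of r] by eventually_elim (rule inc)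
  hence "E r \<le> 2 / pi" by (rule tendsto_lowerbound[OF lim]) simp
  also have "2 / pi \<le> 2/3" using pi_gt3 by (simp add: divide_le_eq)
  finally have Er: "E r \<le> 2/3" .
  have "N / r^2 \<le> 1/4"
  proof -
    have "4 * real n ^ 2 \<le> r^2" using power_mono[OF r, of 2] n by (simp add: power_mult_distrib)
    thus ?thesis using N r0 by (simp add: divide_le_eq)
  qed
  hence "(3/4) * (bv n r)^2 \<le> (1 - N / r^2) * (bv n r)^2" by (intro mult_right_mono) auto
  also have "\<dots> \<le> E r" by (simp add: E_def)
  finally have "(bv n r)^2 \<le> 1" using Er by simp
  thus ?thesis by (simp add: abs_square_le_1)
qed

text \<open>The error is obtained by integrating the perturbation from \<open>r\<close> to infinity
  rather than by induction on the order; the bound on \<open>bv\<close> there is uniform, so only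
  the factor \<open>n^2\<close> remains. Order 0 is separate because its perturbation has the other
  sign.\<close>

lemma bv_uniform:
  "\<exists>C\<ge>1. \<forall>n. \<forall>r\<ge>1. r \<ge> 2 * real n \<longrightarrow>
     \<bar>bv n r - sqrt (2 / pi) * cos (bphase n r)\<bar> \<le> C * (real n + 1) ^ 2 / r \<and> \<bar>bv n r\<bar> \<le> C"
proof -
  obtain C0 where C00: "C0 \<ge> 0" and C01: "\<forall>r\<ge>1. \<bar>bv 0 r - sqrt (2 / pi) * cos (bphase 0 r)\<bar> \<le> C0 / r"
    using bv_asymp[of 0] by (elim exE conjE) (rule that)
  obtain C1 where C10: "C1 \<ge> 0" and C11: "\<forall>r\<ge>1. \<bar>bv 0 r\<bar> \<le> C1"
    using bv_bounded[of 0] by (elim exE conjE) (rule that)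
  note C0 = C00 C01[rule_format] and C1 = C10 C11[rule_format]
  show ?thesis
  proof (intro exI[of _ "C0 + C1 + 1"] conjI allI impI)
    fix n and r :: real assume r: "r \<ge> 1" "r \<ge> 2 * real n"
    show "\<bar>bv n r\<bar> \<le> C0 + C1 + 1"
      using C1(2)[OF r(1)] abs_bv_le_1[OF _ r(2)] C0(1) C1(1) by (cases "n = 0") (auto intro: order_trans)
    show "\<bar>bv n r - sqrt (2 / pi) * cos (bphase n r)\<bar> \<le> (C0 + C1 + 1) * (real n + 1) ^ 2 / r"
    proof (cases "n = 0")
      case True
      have "C0 / r \<le> (C0 + C1 + 1) / r" using C1 r by (intro divide_right_mono) auto
      thus ?thesis using C0(2)[OF r(1)] True by simp
    next
      case False
      hence n: "n \<ge> 1" by simp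
      have "1 \<le> real n" using n by simp
      from one_le_power[OF this, of 2] have N: "\<bar>real n ^ 2 - 1/4\<bar> \<le> real n ^ 2" by simp
      \<comment> \<open>The rotation angle is the base point \<open>r\<close> itself: as a function
        of \<open>x\<close>, \<open>bF n r x\<close> starts at \<open>bv n r\<close> and tends to
        the asserted main term.\<close>
      have "\<bar>bF n r r - sqrt (2 / pi) * cos (bphase n r)\<bar> \<le> real n ^ 2 / 1 * r powr (-1)"
      proof (rule convergence_rate_to[where R = r and Y = "bF n r" and K = "real n ^ 2" and p = 1
            and Y' = "\<lambda>x. - ((real n ^ 2 - 1/4) / x ^ 2 * bv n x * sin (x - r))"])
        fix x assume x: "x \<ge> r"
        have x0: "x > 0" using x r by linarith
        show "(bF n r has_real_derivative - ((real n ^ 2 - 1/4) / x ^ 2 * bv n x * sin (x - r))) (at x)"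
          by (rule bF_deriv[OF x0])
        have "\<bar>- ((real n ^ 2 - 1/4) / x ^ 2 * bv n x * sin (x - r))\<bar> = \<bar>real n ^ 2 - 1/4\<bar> / x ^ 2 * \<bar>bv n x\<bar> * \<bar>sin (x - r)\<bar>"
          by (simp add: abs_mult abs_divide)
        also have "\<dots> \<le> real n ^ 2 / x ^ 2 * 1 * 1"
          using N abs_bv_le_1[OF n, of x] x r by (intro mult_mono divide_right_mono) auto
        also have "\<dots> = real n ^ 2 * x powr (- 1 - 1)"
          using x0 by (simp add: powr_minus powr_numeral divide_inverse)
        finally show "\<bar>- ((real n ^ 2 - 1/4) / x ^ 2 * bv n x * sin (x - r))\<bar> \<le> real n ^ 2 * x powr (- 1 - 1)" .
      qed (use r bF_limit in auto)
      moreover have "bF n r r = bv n r" by (simp add: bF_def)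
      moreover have "real n ^ 2 / 1 * r powr (-1) = 1 * real n ^ 2 / r" using r by (simp add: powr_minus_divide)
      moreover have "1 * real n ^ 2 / r \<le> (C0 + C1 + 1) * (real n + 1) ^ 2 / r"
        using C0 C1 r by (intro divide_right_mono mult_mono power_mono) auto
      ultimately show ?thesis by linarith
    qed
  qed (use C0 C1 in auto)
qed

definition cn :: "nat \<Rightarrow> real" where "cn n = cos (real n * pi / 2)"
definition sn :: "nat \<Rightarrow> real \<Rightarrow> real" where "sn n r = sin (2 * r - real n * pi / 2)"

lemma abs_cn_le_1: "\<bar>cn n\<bar> \<le> 1" and abs_sn_le_1: "\<bar>sn n r\<bar> \<le> 1"
  by (simp_all add: cn_def sn_def)

lemma cos_bphase_mult:
  "sqrt (2 / pi) * cos (bphase l r) * (sqrt (2 / pi) * cos (bphase (l + n) r)) = (cn n + (-1) ^ l * sn n r) / pi"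
proof -
  have "cos (bphase l r) * cos (bphase (l + n) r) = (cos (bphase l r - bphase (l + n) r) + cos (bphase l r + bphase (l + n) r)) / 2"
    by (rule cos_times_cos)
  also have "bphase l r - bphase (l + n) r = real n * pi / 2" by (simp add: bphase_def field_simps)
  also have "bphase l r + bphase (l + n) r = (2 * r - real n * pi / 2) - pi / 2 - real l * pi"
    by (simp add: bphase_def field_simps)
  also have "cos ((2 * r - real n * pi / 2) - pi / 2 - real l * pi) = (-1) ^ l * sn n r"
    by (simp add: cos_diff[of "_ - pi/2"] cos_diff[of _ "pi/2"] sn_def mult.commute)
  also have "cos (real n * pi / 2) = cn n" by (simp add: cn_def)
  finally have 1: "cos (bphase l r) * cos (bphase (l + n) r) = (cn n + (-1) ^ l * sn n r) / 2" .
  have 2: "sqrt (2 / pi) * sqrt (2 / pi) = 2 / pi" by simp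
  have "sqrt (2 / pi) * cos (bphase l r) * (sqrt (2 / pi) * cos (bphase (l + n) r)) = (sqrt (2 / pi) * sqrt (2 / pi)) * (cos (bphase l r) * cos (bphase (l + n) r))"
    by (simp only: mult_ac)
  thus ?thesis unfolding 1 2 by (simp add: field_simps)
qed

text \<open>For \<open>r \<ge> 2 (l + n)\<close> the two uniform asymptotics are multiplied.
  Otherwise product and main term are merely bounded, but then \<open>(l + 1)^2 / r^2\<close> is
  bounded below and the claim is trivial.\<close>

lemma bprod_uniform:
  obtains C where "C > 0"
    "\<And>l r. r \<ge> 1 \<Longrightarrow> \<bar>bprod n l r - (cn n + (-1) ^ l * sn n r) / (pi * r)\<bar> \<le> C * (real l + 1) ^ 2 / r ^ 2"
    "\<And>l r. r \<ge> 1 \<Longrightarrow> r \<ge> 2 * real (l + n) \<Longrightarrow> \<bar>bprod n l r\<bar> \<le> C / r"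
proof -
  obtain C where C: "C \<ge> 1"
    and C': "\<forall>n. \<forall>r\<ge>1. r \<ge> 2 * real n \<longrightarrow>
     \<bar>bv n r - sqrt (2 / pi) * cos (bphase n r)\<bar> \<le> C * (real n + 1) ^ 2 / r \<and> \<bar>bv n r\<bar> \<le> C"
    using bv_uniform by (elim exE conjE) (rule that)
  note C = C C'[rule_format, THEN conjunct1] C'[rule_format, THEN conjunct2]
  have bp: "bprod n l r = bv l r * bv (l + n) r / r" if "r \<ge> 1" for l r
  proof -
    have "bv l r * bv (l + n) r = (sqrt r * sqrt r) * bprod n l r"
      unfolding bv_def bprod_def by (simp only: mult_ac)
    thus ?thesis using that by simp
  qed
  define K where "K = 2 * C * C * (real n + 1) ^ 2"
  have K: "K > 0" using C by (auto simp: K_def)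
  have CC: "C \<le> C * C" "1 \<le> C * C" using C(1) mult_mono[of 1 C 1 C] mult_left_mono[of 1 C C] by auto
  show ?thesis
  proof (rule that[of "8 * (real n + 1) ^ 2 + K + C * C"])
    fix l and r :: real assume r: "r \<ge> 1"
    show "\<bar>bprod n l r\<bar> \<le> (8 * (real n + 1) ^ 2 + K + C * C) / r" if r': "r \<ge> 2 * real (l + n)"
    proof -
      have "\<bar>bv l r * bv (l + n) r\<bar> \<le> C * C" unfolding abs_mult
        using C r r' by (intro mult_mono) auto
      also have "\<dots> \<le> 8 * (real n + 1) ^ 2 + K + C * C" using K by simp
      finally show ?thesis using r by (simp add: bp[OF r] abs_divide divide_right_mono)
    qed
    show "\<bar>bprod n l r - (cn n + (-1) ^ l * sn n r) / (pi * r)\<bar> \<le> (8 * (real n + 1) ^ 2 + K + C * C) * (real l + 1) ^ 2 / r ^ 2"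
    proof (cases "r \<ge> 2 * real (l + n)")
      case True
      let ?a = "sqrt (2 / pi) * cos (bphase l r)" and ?b = "sqrt (2 / pi) * cos (bphase (l + n) r)"
      have b1: "\<bar>?b\<bar> \<le> 1 * 1" unfolding abs_mult using sqrt_2_pi by (intro mult_mono) auto
      have ln: "(real l + real n + 1) \<le> (real n + 1) * (real l + 1)" by (simp add: algebra_simps)
      have l1: "(real l + 1) ^ 2 \<le> ((real n + 1) * (real l + 1)) ^ 2" by (intro power_mono) (auto simp: algebra_simps)
      have l2: "(real (l + n) + 1) ^ 2 \<le> ((real n + 1) * (real l + 1)) ^ 2" using ln by (intro power_mono) auto
      have "bv l r * bv (l + n) r - ?a * ?b = (bv l r - ?a) * ?b + bv l r * (bv (l + n) r - ?b)" by (simp add: algebra_simps)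
      also have "\<bar>\<dots>\<bar> \<le> \<bar>bv l r - ?a\<bar> * \<bar>?b\<bar> + \<bar>bv l r\<bar> * \<bar>bv (l + n) r - ?b\<bar>"
        by (rule order_trans[OF abs_triangle_ineq]) (simp only: abs_mult order_refl)
      also have "\<dots> \<le> C * (real l + 1) ^ 2 / r * 1 + C * (C * (real (l + n) + 1) ^ 2 / r)"
        using C(2)[of r l] C(2)[of r "l + n"] C(3)[of r l] C(1) b1 True r by (intro add_mono mult_mono) auto
      also have "\<dots> = (C * (real l + 1) ^ 2 + C * C * (real (l + n) + 1) ^ 2) / r" by (simp add: add_divide_distrib)
      also have "\<dots> \<le> (C * C * ((real n + 1) * (real l + 1)) ^ 2 + C * C * ((real n + 1) * (real l + 1)) ^ 2) / r"
        using l1 l2 CC C(1) r by (intro divide_right_mono add_mono mult_mono) auto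
      also have "\<dots> = K * (real l + 1) ^ 2 / r" by (simp add: K_def power_mult_distrib)
      finally have "\<bar>bv l r * bv (l + n) r - ?a * ?b\<bar> / r \<le> K * (real l + 1) ^ 2 / r / r"
        using r by (intro divide_right_mono) auto
      also have "\<bar>bv l r * bv (l + n) r - ?a * ?b\<bar> / r = \<bar>bprod n l r - (cn n + (-1) ^ l * sn n r) / (pi * r)\<bar>"
        proof -
          have "bv l r * bv (l + n) r / r - (cn n + (-1) ^ l * sn n r) / (pi * r) = (bv l r * bv (l + n) r - (cn n + (-1) ^ l * sn n r) / pi) / r"
            by (simp add: diff_divide_distrib)
          thus ?thesis unfolding cos_bphase_mult bp[OF r] using r by (simp only: abs_divide abs_of_pos)
        qed
      also have "K * (real l + 1) ^ 2 / r / r = K * (real l + 1) ^ 2 / r ^ 2" by (simp add: power2_eq_square)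
      also have "\<dots> \<le> (8 * (real n + 1) ^ 2 + K + C * C) * (real l + 1) ^ 2 / r ^ 2"
        using K CC by (intro divide_right_mono mult_right_mono) auto
      finally show ?thesis .
    next
      case False
      have a: "\<bar>cn n + (-1) ^ l * sn n r\<bar> \<le> 2"
        using abs_cn_le_1[of n] abs_sn_le_1[of n r] abs_triangle_ineq[of "cn n" "(-1) ^ l * sn n r"] by (simp add: abs_mult)
      have "\<bar>(cn n + (-1) ^ l * sn n r) / (pi * r)\<bar> = \<bar>cn n + (-1) ^ l * sn n r\<bar> / (pi * r)" using r by (simp add: abs_divide)
      also have "\<dots> \<le> 2 / (2 * 1)" using a r pi_ge_two by (intro frac_le mult_mono) auto
      finally have "\<bar>bprod n l r - (cn n + (-1) ^ l * sn n r) / (pi * r)\<bar> \<le> 2"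
        using abs_bprod_le_1[of n l r] by linarith
      \<comment> \<open>The inequality \<open>r \<le> 2 (n + 1) (l + 1)\<close> squares to a factor
        4, and the bound 2 on the left doubles it.\<close>
      also have "2 \<le> 8 * (real n + 1) ^ 2 * (real l + 1) ^ 2 / r ^ 2"
      proof -
        define x where "x = real n * real l"
        have x: "x \<ge> 0" by (simp add: x_def)
        have eq: "(real n + 1) * (real l + 1) = x + real n + real l + 1" by (simp add: x_def algebra_simps)
        have "r \<le> 2 * ((real n + 1) * (real l + 1))" unfolding eq using False x by simp
        hence "r ^ 2 \<le> (2 * ((real n + 1) * (real l + 1))) ^ 2" using r by (intro power_mono) auto
        hence "2 * r ^ 2 \<le> 8 * (real n + 1) ^ 2 * (real l + 1) ^ 2" by (simp add: power_mult_distrib mult_ac)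
        thus ?thesis using r by (simp add: le_divide_eq)
      qed
      also have "\<dots> \<le> (8 * (real n + 1) ^ 2 + K + C * C) * (real l + 1) ^ 2 / r ^ 2"
        using K CC by (intro divide_right_mono mult_right_mono) auto
      finally show ?thesis .
    qed
  qed (use K CC in \<open>auto simp: add_pos_pos add_nonneg_pos\<close>)
qed

section \<open>Decay of the weights and decay of the sums\<close>

lemma powr_diff_ge:
  assumes "0 \<le> \<kappa>" "\<kappa> < 1" "x \<ge> (1::real)"
  shows "(1 - \<kappa>) * x powr (-\<kappa>) \<le> x powr (1 - \<kappa>) - (x - 1) powr (1 - \<kappa>)"
proof (cases "x = 1")
  case True
  thus ?thesis using assms by simp
next
  case False
  hence x: "x - 1 > 0" using assms by simp
  have "\<exists>z. x - 1 < z \<and> z < x \<and> x powr (1 - \<kappa>) - (x - 1) powr (1 - \<kappa>) = (x - (x - 1)) * ((1 - \<kappa>) * z powr (- \<kappa>))"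
    by (rule MVT2) (use x in \<open>auto intro!: derivative_eq_intros\<close>)
  then obtain z where z: "x - 1 < z" "z < x" "x powr (1 - \<kappa>) - (x - 1) powr (1 - \<kappa>) = (1 - \<kappa>) * z powr (- \<kappa>)"
    by auto
  have "x powr (- \<kappa>) \<le> z powr (- \<kappa>)" using z x assms by (intro powr_mono2') auto
  thus ?thesis using z assms by (simp add: mult_left_mono)
qed

lemma powr_diff_ge':
  assumes "\<theta> > 0" "x \<ge> (1::real)"
  shows "\<theta> * (x + 1) powr (- 1 - \<theta>) \<le> x powr (-\<theta>) - (x + 1) powr (-\<theta>)"
proof -
  have "\<exists>z. x < z \<and> z < x + 1 \<and> (x + 1) powr (-\<theta>) - x powr (-\<theta>) = ((x + 1) - x) * (- \<theta> * z powr (- \<theta> - 1))"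
    by (rule MVT2) (use assms in \<open>auto intro!: derivative_eq_intros\<close>)
  then obtain z where z: "x < z" "z < x + 1" "x powr (-\<theta>) - (x + 1) powr (-\<theta>) = \<theta> * z powr (- \<theta> - 1)"
    by force
  have "(x + 1) powr (- 1 - \<theta>) \<le> z powr (- 1 - \<theta>)" using z assms by (intro powr_mono2') auto
  hence "\<theta> * (x + 1) powr (- 1 - \<theta>) \<le> \<theta> * z powr (- 1 - \<theta>)" using assms by simp
  also have "\<theta> * z powr (- 1 - \<theta>) = x powr (-\<theta>) - (x + 1) powr (-\<theta>)"
  proof -
    have "- 1 - \<theta> = - \<theta> - 1" by simp
    thus ?thesis using z(3) by (simp only:)
  qed
  finally show ?thesis .
qed

lemma sum_powr_le:
  assumes "\<kappa> < (1::real)"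
  shows "(\<Sum>l<N. (real l + 1) powr (-\<kappa>)) \<le> max 1 (1 / (1 - \<kappa>)) * real N powr (1 - \<kappa>)"
proof (cases "\<kappa> \<ge> 0")
  case True
  have "(1 - \<kappa>) * (\<Sum>l<N. (real l + 1) powr (-\<kappa>)) \<le> real N powr (1 - \<kappa>)"
  proof (induction N)
    case (Suc N)
    have "(1 - \<kappa>) * (real N + 1) powr (-\<kappa>) \<le> (real N + 1) powr (1 - \<kappa>) - real N powr (1 - \<kappa>)"
      using powr_diff_ge[OF True assms, of "real N + 1"] by simp
    thus ?case using Suc by (simp add: algebra_simps)
  qed auto
  hence "(\<Sum>l<N. (real l + 1) powr (-\<kappa>)) \<le> 1 / (1 - \<kappa>) * real N powr (1 - \<kappa>)"
    using assms by (simp add: field_simps)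
  also have "\<dots> \<le> max 1 (1 / (1 - \<kappa>)) * real N powr (1 - \<kappa>)" by (intro mult_right_mono) auto
  finally show ?thesis .
next
  case False
  have "(\<Sum>l<N. (real l + 1) powr (-\<kappa>)) \<le> (\<Sum>l<N. real N powr (-\<kappa>))"
    using False by (intro sum_mono powr_mono2) auto
  also have "\<dots> = real N powr (1 - \<kappa>)"
    by (cases "N = 0") (auto simp: powr_diff powr_minus field_simps)
  also have "\<dots> \<le> max 1 (1 / (1 - \<kappa>)) * real N powr (1 - \<kappa>)" 
    using mult_right_mono[of 1 "max 1 (1 / (1 - \<kappa>))" "real N powr (1 - \<kappa>)"] by simp
  finally show ?thesis .
qed

lemma summable_powr_Suc: "x < -1 \<Longrightarrow> summable (\<lambda>l. (real l + 1) powr x)"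
  using summable_real_powr_iff[of x, THEN iffD2, THEN summable_Suc_iff[THEN iffD2]] by (simp add: add.commute)

lemma suminf_powr_tail_le:
  assumes "\<theta> > 0" "N \<ge> 1"
  shows "(\<Sum>l. (real (l + N) + 1) powr (- 1 - \<theta>)) \<le> real N powr (-\<theta>) / \<theta>"
proof (rule suminf_le_const)
  show "summable (\<lambda>l. (real (l + N) + 1) powr (- 1 - \<theta>))"
    using summable_ignore_initial_segment[OF summable_powr_Suc[of "- 1 - \<theta>"], of N] assms by simp
  fix M
  have "\<theta> * (\<Sum>l<M. (real (l + N) + 1) powr (- 1 - \<theta>)) \<le> real N powr (-\<theta>) - real (N + M) powr (-\<theta>)"
  proof (induction M)
    case (Suc M)
    have "\<theta> * (real (M + N) + 1) powr (- 1 - \<theta>) \<le> real (M + N) powr (-\<theta>) - (real (M + N) + 1) powr (-\<theta>)"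
      by (rule powr_diff_ge'[OF assms(1)]) (use assms in auto)
    thus ?case using Suc by (simp add: algebra_simps)
  qed auto
  also have "\<dots> \<le> real N powr (-\<theta>)" by simp
  finally show "(\<Sum>l<M. (real (l + N) + 1) powr (- 1 - \<theta>)) \<le> real N powr (-\<theta>) / \<theta>"
    using assms by (simp add: field_simps)
qed

lemma floor_bounds:
  fixes r :: real
  assumes "r \<ge> 1"
  defines "N \<equiv> nat \<lfloor>r\<rfloor>"
  shows "N \<ge> 1" "real N \<le> r" "r \<le> 2 * real N"
proof -
  have "\<lfloor>r\<rfloor> \<ge> 1" using assms by simp
  thus "N \<ge> 1" "real N \<le> r" "r \<le> 2 * real N" unfolding N_def by (simp_all, linarith+)
qed

text \<open>The series is cut at \<open>l = r\<close>. The quadratic factor governs the head and the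
  plain power the tail; \<open>\<theta> < 2\<close> makes both of size
  \<open>r powr (-\<theta>)\<close>.\<close>

lemma suminf_powr_min_le:
  assumes "0 < \<theta>" "\<theta> < 2"
  obtains K where "K > 0"
    "\<And>r. r \<ge> 1 \<Longrightarrow> (\<Sum>l. (real l + 1) powr (- 1 - \<theta>) * min 1 (((real l + 1) / r) ^ 2)) \<le> K * r powr (-\<theta>)"
proof
  define K where "K = max 1 (1 / (2 - \<theta>)) + 2 powr \<theta> / \<theta>"
  show "K > 0" unfolding K_def using assms by (simp add: add_pos_pos less_max_iff_disj)
  fix r :: real assume r: "r \<ge> 1"
  define N where "N = nat \<lfloor>r\<rfloor>"
  have N: "N \<ge> 1" "real N \<le> r" "r \<le> 2 * real N" using floor_bounds[OF r] by (auto simp: N_def)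
  let ?f = "\<lambda>l. (real l + 1) powr (- 1 - \<theta>) * min 1 (((real l + 1) / r) ^ 2)"
  have le1: "?f l \<le> (real l + 1) powr (- 1 - \<theta>)" for l by (rule mult_left_le) auto
  have nn: "?f l \<ge> 0" for l by (intro mult_nonneg_nonneg) auto
  have s1: "summable (\<lambda>l. (real l + 1) powr (- 1 - \<theta>))" by (rule summable_powr_Suc) (use assms in auto)
  have s: "summable ?f"
    by (rule summable_comparison_test'[OF s1, of 0]) (use le1 nn in auto)
  have "(\<Sum>l. ?f l) = (\<Sum>l. ?f (l + N)) + (\<Sum>l<N. ?f l)" by (rule suminf_split_initial_segment[OF s])
  also have "(\<Sum>l<N. ?f l) \<le> (\<Sum>l<N. (real l + 1) powr (- (\<theta> - 1)) / r ^ 2)"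
  proof (rule sum_mono)
    fix l
    have "?f l \<le> (real l + 1) powr (- 1 - \<theta>) * ((real l + 1) / r) ^ 2" by (intro mult_left_mono) auto
    also have "\<dots> = (real l + 1) powr (- 1 - \<theta>) * (real l + 1) powr 2 / r ^ 2"
    proof -
      have "(real l + 1) ^ 2 = (real l + 1) powr 2" by (simp add: powr_numeral)
      thus ?thesis unfolding power_divide by (simp only: times_divide_eq_right)
    qed
    also have "\<dots> = (real l + 1) powr (- (\<theta> - 1)) / r ^ 2" unfolding powr_add[symmetric] by (simp add: algebra_simps)
    finally show "?f l \<le> (real l + 1) powr (- (\<theta> - 1)) / r ^ 2" .
  qed
  also have "\<dots> = (\<Sum>l<N. (real l + 1) powr (- (\<theta> - 1))) / r ^ 2" by (simp add: sum_divide_distrib)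
  also have "\<dots> \<le> max 1 (1 / (2 - \<theta>)) * r powr (-\<theta>)"
  proof -
    have "(\<Sum>l<N. (real l + 1) powr (- (\<theta> - 1))) \<le> max 1 (1 / (2 - \<theta>)) * real N powr (2 - \<theta>)"
      using sum_powr_le[of "\<theta> - 1" N] assms by simp
    also have "\<dots> \<le> max 1 (1 / (2 - \<theta>)) * r powr (2 - \<theta>)"
      using N assms by (intro mult_left_mono powr_mono2) auto
    finally have "(\<Sum>l<N. (real l + 1) powr (- (\<theta> - 1))) / r ^ 2 \<le> max 1 (1 / (2 - \<theta>)) * r powr (2 - \<theta>) / r ^ 2"
      by (rule divide_right_mono) simp
    also have "\<dots> = max 1 (1 / (2 - \<theta>)) * (r powr (2 - \<theta>) / r powr 2)" using r by (simp add: powr_numeral)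
    also have "r powr (2 - \<theta>) / r powr 2 = r powr (-\<theta>)" by (simp add: powr_diff[symmetric])
    finally show ?thesis .
  qed
  also have "(\<Sum>l. ?f (l + N)) \<le> (\<Sum>l. (real (l + N) + 1) powr (- 1 - \<theta>))"
    by (rule suminf_le) (use le1 s s1 in \<open>auto intro: summable_ignore_initial_segment simp del: of_nat_add\<close>)
  also have "\<dots> \<le> real N powr (-\<theta>) / \<theta>" by (rule suminf_powr_tail_le[OF assms(1) N(1)])
  also have "\<dots> \<le> 2 powr \<theta> / \<theta> * r powr (-\<theta>)"
  proof -
    have "(2 * real N) powr (-\<theta>) \<le> r powr (-\<theta>)" using N r assms by (intro powr_mono2') auto
    hence "2 powr (-\<theta>) * real N powr (-\<theta>) \<le> r powr (-\<theta>)" using N by (simp add: powr_mult)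
    hence "2 powr \<theta> * (2 powr (-\<theta>) * real N powr (-\<theta>)) \<le> 2 powr \<theta> * r powr (-\<theta>)"
      by (rule mult_left_mono) simp
    hence "real N powr (-\<theta>) \<le> 2 powr \<theta> * r powr (-\<theta>)" by (simp add: mult.assoc[symmetric] powr_add[symmetric])
    thus ?thesis using assms by (simp add: divide_right_mono)
  qed
  finally show "(\<Sum>l. ?f l) \<le> K * r powr (-\<theta>)" by (simp add: K_def algebra_simps)
qed

text \<open>An eventual bound becomes one for all \<open>l\<close> by adding the finitely many
  initial values to the constant. The base \<open>l + 1\<close> avoids the value 0 of the power at
  \<open>l = 0\<close>.\<close>

lemma bigo_powr_bound:
  assumes "h \<in> O(\<lambda>l. real l powr (-\<delta>))" "\<delta> \<ge> 0"
  obtains C where "C > 0" "\<And>l. \<bar>h l\<bar> \<le> C * (real l + 1) powr (-\<delta>)"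
proof -
  obtain c where c: "c > 0" "\<forall>\<^sub>F l in sequentially. norm (h l) \<le> c * norm (real l powr (-\<delta>))"
    using landau_o.bigE[OF assms(1)] by blast
  then obtain L0 where L0: "\<And>l. l \<ge> L0 \<Longrightarrow> \<bar>h l\<bar> \<le> c * real l powr (-\<delta>)"
    unfolding eventually_sequentially by auto
  define L where "L = max 1 L0"
  define C where "C = c * 2 powr \<delta> + (\<Sum>l<L. \<bar>h l\<bar> * (real l + 1) powr \<delta>)"
  have S: "(\<Sum>l<L. \<bar>h l\<bar> * (real l + 1) powr \<delta>) \<ge> 0" by (intro sum_nonneg) auto
  show ?thesis
  proof (rule that[of C])
    show "C > 0" unfolding C_def using S c by (intro add_pos_nonneg) auto
    fix l
    show "\<bar>h l\<bar> \<le> C * (real l + 1) powr (-\<delta>)"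
    proof (cases "l < L")
      case True
      have "\<bar>h l\<bar> = \<bar>h l\<bar> * (real l + 1) powr \<delta> * (real l + 1) powr (-\<delta>)"
        by (simp add: powr_minus field_simps)
      also have "\<bar>h l\<bar> * (real l + 1) powr \<delta> \<le> (\<Sum>l<L. \<bar>h l\<bar> * (real l + 1) powr \<delta>)"
        using True by (intro member_le_sum) auto
      also have "\<dots> \<le> C" unfolding C_def using c by simp
      finally show ?thesis by (simp add: mult_right_mono)
    next
      case False
      hence l: "l \<ge> 1" "l \<ge> L0" by (auto simp: L_def)
      have "(2 * real l) powr (-\<delta>) \<le> (real l + 1) powr (-\<delta>)" using l assms(2) by (intro powr_mono2') auto
      hence "2 powr (-\<delta>) * real l powr (-\<delta>) \<le> (real l + 1) powr (-\<delta>)" by (simp add: powr_mult)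
      hence "2 powr \<delta> * (2 powr (-\<delta>) * real l powr (-\<delta>)) \<le> 2 powr \<delta> * (real l + 1) powr (-\<delta>)"
        by (rule mult_left_mono) simp
      hence "real l powr (-\<delta>) \<le> 2 powr \<delta> * (real l + 1) powr (-\<delta>)" by (simp add: mult.assoc[symmetric] powr_add[symmetric])
      hence "c * real l powr (-\<delta>) \<le> c * (2 powr \<delta> * (real l + 1) powr (-\<delta>))" using c by simp
      also have "\<dots> \<le> C * (real l + 1) powr (-\<delta>)" unfolding C_def using S by (simp add: mult_right_mono algebra_simps)
      finally show ?thesis using L0[OF l(2)] by linarith
    qed
  qed
qed

lemma bigo_exp_bdd:
  assumes "h \<in> O(\<lambda>l. real l powr (-\<delta>))" "\<delta> \<ge> 0"
  shows "exp_bdd h"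
proof -
  obtain C where C: "C > 0" "\<And>l. \<bar>h l\<bar> \<le> C * (real l + 1) powr (-\<delta>)" by (rule bigo_powr_bound[OF assms]) (rule that)
  have "(real l + 1) powr (-\<delta>) \<le> 1" for l using assms powr_mono[of "-\<delta>" 0 "real l + 1"] by simp
  hence "\<bar>h l\<bar> \<le> C * 1 ^ l" for l
    using order_trans[OF C(2)[of l] mult_left_mono[OF _ less_imp_le[OF C(1)], of _ 1]] by simp
  thus ?thesis by (intro exp_bddI[of 1 _ C]) auto
qed

lemma bigo_summable:
  assumes "h \<in> O(\<lambda>l. real l powr (-\<delta>))" "\<delta> > 1"
  shows "summable (\<lambda>l. \<bar>h l\<bar>)" "summable h" "summable (\<lambda>l. (-1) ^ l * h l)"
proof -
  obtain C where C: "C > 0" "\<And>l. \<bar>h l\<bar> \<le> C * (real l + 1) powr (-\<delta>)" 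
    by (rule bigo_powr_bound[OF assms(1)]) (use assms(2) in simp, rule that)
  have s: "summable (\<lambda>l. C * (real l + 1) powr (-\<delta>))" by (intro summable_mult summable_powr_Suc) (use assms in auto)
  show "summable (\<lambda>l. \<bar>h l\<bar>)" by (rule summable_comparison_test'[OF s, of 0]) (use C in auto)
  show "summable h" by (rule summable_comparison_test'[OF s, of 0]) (use C in auto)
  show "summable (\<lambda>l. (-1) ^ l * h l)" by (rule summable_comparison_test'[OF s, of 0]) (use C in \<open>auto simp: abs_mult\<close>)
qed

lemma bigo_powr_weaken:
  assumes "h \<in> O(\<lambda>l. real l powr (-\<delta>))" "\<delta>' \<le> \<delta>"
  shows "h \<in> O(\<lambda>l. real l powr (-\<delta>'))"
proof (rule landau_o.big_trans[OF assms(1)], rule landau_o.bigI[of 1])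
  show "\<forall>\<^sub>F l in sequentially. norm (real l powr (-\<delta>)) \<le> 1 * norm (real l powr (-\<delta>'))"
    using eventually_ge_at_top[of 1]
  proof eventually_elim
    case (elim l)
    thus ?case using assms(2) by (simp add: powr_mono)
  qed
qed auto

text \<open>For \<open>r \<ge> 2 (l + n)\<close> every product is \<open>O(1/r)\<close> and the
  weights are summed; for larger \<open>l\<close> the weight itself is
  \<open>O(r powr (-\<theta>))\<close> and the absolute sum of the products is at most 1.\<close>

lemma bsum_bigo:
  assumes h: "h \<in> O(\<lambda>l. real l powr (-\<delta>))" and t: "0 < \<theta>" "\<theta> \<le> 1" "\<theta> \<le> \<delta>" "\<theta> = 1 \<Longrightarrow> \<delta> > 1"
  shows "bsum n h \<in> O[at_top](\<lambda>r. r powr (-\<theta>))"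
proof -
  \<comment> \<open>At \<open>\<theta> = 1\<close> the weight exponent must stay above 1, since
    exponent 1 would bring in a logarithm; elsewhere the decay is weakened to exactly
    \<open>\<theta>\<close>.\<close>
  define \<kappa> where "\<kappa> = (if \<theta> = 1 then \<delta> else \<theta>)"
  have \<kappa>: "\<kappa> > 0" "\<kappa> \<le> \<delta>" "\<theta> \<le> \<kappa>" using t by (auto simp: \<kappa>_def)
  have "h \<in> O(\<lambda>l. real l powr (-\<kappa>))" by (rule bigo_powr_weaken[OF h]) (use t in \<open>auto simp: \<kappa>_def\<close>)
  then obtain A where A: "A > 0" "\<And>l. \<bar>h l\<bar> \<le> A * (real l + 1) powr (-\<kappa>)" 
    by (rule bigo_powr_bound) (use \<kappa> in simp, rule that)
  obtain C where C: "C > 0"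
    "\<And>l r. r \<ge> 1 \<Longrightarrow> \<bar>bprod n l r - (cn n + (-1) ^ l * sn n r) / (pi * r)\<bar> \<le> C * (real l + 1) ^ 2 / r ^ 2"
    "\<And>l r. r \<ge> 1 \<Longrightarrow> r \<ge> 2 * real (l + n) \<Longrightarrow> \<bar>bprod n l r\<bar> \<le> C / r"
    by (rule bprod_uniform[of n]) (rule that)
  obtain B where B: "\<And>N. N \<ge> 1 \<Longrightarrow> (\<Sum>l<N. (real l + 1) powr (-\<kappa>)) \<le> B * real N powr (1 - \<theta>)" "B > 0"
  proof (cases "\<theta> = 1")
    case True
    have s: "summable (\<lambda>l. (real l + 1) powr (-\<kappa>))" by (rule summable_powr_Suc) (use t True \<kappa>_def in auto)
    show ?thesis
    proof (rule that[of "(\<Sum>l. (real l + 1) powr (-\<kappa>)) + 1"])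
      show "(\<Sum>l<N. (real l + 1) powr (-\<kappa>)) \<le> ((\<Sum>l. (real l + 1) powr (-\<kappa>)) + 1) * real N powr (1 - \<theta>)" if "N \<ge> 1" for N
        using sum_le_suminf[OF s, of "{..<N}"] True that by simp
      show "(\<Sum>l. (real l + 1) powr (-\<kappa>)) + 1 > 0" using suminf_nonneg[OF s] by (simp add: add_nonneg_pos)
    qed
  next
    case False
    hence "\<kappa> = \<theta>" "\<theta> < 1" using t by (auto simp: \<kappa>_def)
    thus ?thesis using that[of "max 1 (1 / (1 - \<kappa>))"] sum_powr_le[of \<kappa>] by (simp add: less_max_iff_disj)
  qed
  define D where "D = (2 * (real n + 1)) powr \<kappa>"
  have hb: "exp_bdd h" by (rule bigo_exp_bdd[OF h]) (use t in auto)
  show ?thesis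
  proof (rule landau_o.bigI[of "A * (C * B + D)"])
    show "A * (C * B + D) > 0" using A B C by (auto simp: D_def intro!: mult_pos_pos add_pos_nonneg)
    show "\<forall>\<^sub>F r in at_top. norm (bsum n h r) \<le> A * (C * B + D) * norm (r powr (-\<theta>))"
      using eventually_ge_at_top[of "1::real"]
    proof eventually_elim
      case (elim r)
      define N where "N = nat \<lfloor>r\<rfloor>"
      have N: "N \<ge> 1" "real N \<le> r" "r \<le> 2 * real N" using floor_bounds[OF elim] by (auto simp: N_def)
      let ?a = "\<lambda>l. if l < N then A * C / r * (real l + 1) powr (-\<kappa>) else 0"
      let ?b = "\<lambda>l. A * D * r powr (-\<theta>) * \<bar>bprod n l r\<bar>"
      have le: "\<bar>h l * bprod n l r\<bar> \<le> ?a l + ?b l" for l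
      proof (cases "r \<ge> 2 * real (l + n)")
        case True
        have "\<bar>h l * bprod n l r\<bar> \<le> (A * (real l + 1) powr (-\<kappa>)) * (C / r)"
          unfolding abs_mult using A C(3)[OF elim True] by (intro mult_mono) auto
        also have "\<dots> = A * C / r * (real l + 1) powr (-\<kappa>)" by (simp add: mult_ac)
        finally have "\<bar>h l * bprod n l r\<bar> \<le> A * C / r * (real l + 1) powr (-\<kappa>)" .
        moreover have "l < N"
        proof (cases "l = 0")
          case False
          hence "real (l + 1) \<le> r" using True by simp
          thus ?thesis unfolding N_def by linarith
        qed (use N in auto)
        moreover have "?b l \<ge> 0" using A by (auto simp: D_def)
        ultimately show ?thesis by simp
      next
        case False
        define x where "x = real n * real l"
        have x: "x \<ge> 0" by (simp add: x_def)
        have eq: "2 * (real n + 1) * (real l + 1) = 2 * (x + real n + real l + 1)" by (simp add: x_def algebra_simps)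
        have "r \<le> 2 * (real n + 1) * (real l + 1)" unfolding eq using False x by simp
        hence "(real l + 1) powr (-\<kappa>) \<le> (r / (2 * (real n + 1))) powr (-\<kappa>)"
          using elim \<kappa> by (intro powr_mono2') (auto simp: field_simps)
        also have "\<dots> = D * r powr (-\<kappa>)" using elim by (simp add: D_def powr_divide powr_minus field_simps)
        also have "\<dots> \<le> D * r powr (-\<theta>)" using \<kappa> elim by (intro mult_left_mono powr_mono) (auto simp: D_def)
        finally have "\<bar>h l\<bar> \<le> A * (D * r powr (-\<theta>))" using A by (meson less_imp_le mult_left_mono order_trans)
        hence "\<bar>h l\<bar> * \<bar>bprod n l r\<bar> \<le> A * (D * r powr (-\<theta>)) * \<bar>bprod n l r\<bar>" by (rule mult_right_mono) simp
        hence "\<bar>h l * bprod n l r\<bar> \<le> ?b l" unfolding abs_mult by (simp only: mult.assoc)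
        moreover have "?a l \<ge> 0" using A C elim by auto
        ultimately show ?thesis by linarith
      qed
      have sa: "summable ?a" by (rule summable_finite[of "{..<N}"]) auto
      have sb: "summable ?b" by (intro summable_mult abs_bprod_sum)
      have sl: "summable (\<lambda>l. \<bar>h l * bprod n l r\<bar>)"
        by (rule summable_comparison_test'[OF summable_add[OF sa sb], of 0]) (use le in auto)
      have "\<bar>bsum n h r\<bar> \<le> (\<Sum>l. \<bar>h l * bprod n l r\<bar>)" unfolding bsum_def by (rule summable_rabs[OF sl])
      also have "\<dots> \<le> (\<Sum>l. ?a l + ?b l)" by (rule suminf_le[OF le sl summable_add[OF sa sb]])
      also have "\<dots> = (\<Sum>l. ?a l) + (\<Sum>l. ?b l)" by (rule suminf_add[OF sa sb, symmetric])
      also have "(\<Sum>l. ?a l) = (\<Sum>l<N. A * C / r * (real l + 1) powr (-\<kappa>))"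
        by (subst suminf_finite[of "{..<N}"]) auto
      also have "\<dots> = A * C / r * (\<Sum>l<N. (real l + 1) powr (-\<kappa>))" by (rule sum_distrib_left[symmetric])
      also have "\<dots> \<le> A * C / r * (B * r powr (1 - \<theta>))"
      proof (intro mult_left_mono order_trans[OF B(1)[OF N(1)]])
        show "real N powr (1 - \<theta>) \<le> r powr (1 - \<theta>)" using N t by (intro powr_mono2) auto
      qed (use A B C elim in auto)
      also have "\<dots> = A * C * B * r powr (-\<theta>)"
        using elim by (simp add: powr_diff powr_minus field_simps)
      also have "(\<Sum>l. ?b l) = A * D * r powr (-\<theta>) * (\<Sum>l. \<bar>bprod n l r\<bar>)" by (intro suminf_mult abs_bprod_sum)
      also have "\<dots> \<le> A * D * r powr (-\<theta>) * 1" using A by (intro mult_left_mono abs_bprod_sum) (auto simp: D_def)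
      finally show ?case by (simp add: algebra_simps)
    qed
  qed
qed

text \<open>The term of order \<open>1/r\<close> that the main term of \<open>bprod\<close> produces
  when \<open>A\<close> and \<open>B\<close> are the plain and the alternating sum of the
  weights.\<close>

definition blead :: "nat \<Rightarrow> real \<Rightarrow> real \<Rightarrow> real \<Rightarrow> real" where
  "blead n A B r = (cn n * A + sn n r * B) / (pi * r)"

text \<open>The error of the main term of \<open>bprod\<close> is both bounded and
  \<open>O((l + 1)^2 / r^2)\<close>; the minimum of the two is summed against the weights. The
  quadratic growth is the reason for demanding \<open>\<delta> - 1 \<ge> \<theta>\<close>.\<close>

lemma bsum_asymp:
  assumes h: "h \<in> O(\<lambda>l. real l powr (-\<delta>))" and t: "0 < \<theta>" "\<theta> \<le> 2" "\<theta> \<le> \<delta> - 1" "\<theta> = 2 \<Longrightarrow> \<delta> > 3"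
  shows "(\<lambda>r. bsum n h r - blead n (\<Sum>l. h l) (\<Sum>l. (-1) ^ l * h l) r) \<in> O[at_top](\<lambda>r. r powr (-\<theta>))"
proof -
  \<comment> \<open>In the borderline case \<open>\<theta> = 2\<close> the sum of
    \<open>(l + 1) powr (2 - \<kappa>)\<close> must converge, so the full decay
    \<open>\<delta> > 3\<close> is kept.\<close>
  define \<kappa> where "\<kappa> = (if \<theta> = 2 then \<delta> else 1 + \<theta>)"
  have \<kappa>: "\<kappa> > 1" "\<kappa> \<le> \<delta>" using t by (auto simp: \<kappa>_def)
  have h': "h \<in> O(\<lambda>l. real l powr (-\<kappa>))" by (rule bigo_powr_weaken[OF h \<kappa>(2)])
  obtain A where A: "A > 0" "\<And>l. \<bar>h l\<bar> \<le> A * (real l + 1) powr (-\<kappa>)" 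
    by (rule bigo_powr_bound[OF h']) (use \<kappa> in simp, rule that)
  obtain C where C: "C > 0"
    "\<And>l r. r \<ge> 1 \<Longrightarrow> \<bar>bprod n l r - (cn n + (-1) ^ l * sn n r) / (pi * r)\<bar> \<le> C * (real l + 1) ^ 2 / r ^ 2"
    "\<And>l r. r \<ge> 1 \<Longrightarrow> r \<ge> 2 * real (l + n) \<Longrightarrow> \<bar>bprod n l r\<bar> \<le> C / r"
    by (rule bprod_uniform[of n]) (rule that)
  obtain B where B: "B > 0" "\<And>r. r \<ge> 1 \<Longrightarrow> (\<Sum>l. (real l + 1) powr (-\<kappa>) * min 1 (((real l + 1) / r) ^ 2)) \<le> B * r powr (-\<theta>)"
  proof (cases "\<theta> = 2")
    case True
    hence \<kappa>3: "\<kappa> > 3" using t by (simp add: \<kappa>_def)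
    have s: "summable (\<lambda>l. (real l + 1) powr (2 - \<kappa>))" by (rule summable_powr_Suc) (use \<kappa>3 in auto)
    show ?thesis
    proof (rule that[of "(\<Sum>l. (real l + 1) powr (2 - \<kappa>)) + 1"])
      show "(\<Sum>l. (real l + 1) powr (2 - \<kappa>)) + 1 > 0" using suminf_nonneg[OF s] by (simp add: add_nonneg_pos)
      fix r :: real assume r: "r \<ge> 1"
      let ?f = "\<lambda>l. (real l + 1) powr (-\<kappa>) * min 1 (((real l + 1) / r) ^ 2)"
      have s': "summable (\<lambda>l. (real l + 1) powr (2 - \<kappa>) * r powr (-2))" by (rule summable_mult2[OF s])
      have le: "?f l \<le> (real l + 1) powr (2 - \<kappa>) * r powr (-2)" for l
      proof -
        have "?f l \<le> (real l + 1) powr (-\<kappa>) * ((real l + 1) / r) ^ 2" by (intro mult_left_mono) auto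
        also have "\<dots> = (real l + 1) powr (-\<kappa>) * (real l + 1) powr 2 * r powr (-2)"
        proof -
          have "(real l + 1) ^ 2 = (real l + 1) powr 2" "r ^ 2 = r powr 2" using r by (simp_all add: powr_numeral)
          thus ?thesis unfolding power_divide powr_minus by (simp only: divide_inverse mult.assoc)
        qed
        also have "(real l + 1) powr (-\<kappa>) * (real l + 1) powr 2 = (real l + 1) powr (2 - \<kappa>)" unfolding powr_add[symmetric] by (simp add: algebra_simps)
        finally show ?thesis .
      qed
      have sf: "summable ?f"
        by (rule summable_comparison_test'[OF s', of 0]) (use le in \<open>auto simp: abs_mult\<close>)
      have "(\<Sum>l. ?f l) \<le> (\<Sum>l. (real l + 1) powr (2 - \<kappa>) * r powr (-2))" by (rule suminf_le[OF le sf s'])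
      also have "\<dots> = (\<Sum>l. (real l + 1) powr (2 - \<kappa>)) * r powr (-2)" by (rule suminf_mult2[OF s, symmetric])
      also have "\<dots> \<le> ((\<Sum>l. (real l + 1) powr (2 - \<kappa>)) + 1) * r powr (-\<theta>)" unfolding True by (intro mult_right_mono) auto
      finally show "(\<Sum>l. ?f l) \<le> ((\<Sum>l. (real l + 1) powr (2 - \<kappa>)) + 1) * r powr (-\<theta>)" .
    qed
  next
    case False
    hence t2: "\<theta> < 2" and eq: "- \<kappa> = - 1 - \<theta>" using t by (auto simp: \<kappa>_def)
    obtain K where K: "K > 0"
      "\<And>r. r \<ge> 1 \<Longrightarrow> (\<Sum>l. (real l + 1) powr (- 1 - \<theta>) * min 1 (((real l + 1) / r) ^ 2)) \<le> K * r powr (-\<theta>)"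
      by (rule suminf_powr_min_le[OF t(1) t2]) (rule that)
    show ?thesis unfolding eq by (rule that[OF K(1), unfolded eq], rule K(2))
  qed
  \<comment> \<open>The 2 bounds the error trivially: the product and its main term are each at most
    1.\<close>
  define K where "K = max C 2"
  show ?thesis
  proof (rule landau_o.bigI[of "A * K * B"])
    show "A * K * B > 0" using A B by (auto simp: K_def less_max_iff_disj)
    show "\<forall>\<^sub>F r in at_top. norm (bsum n h r - blead n (\<Sum>l. h l) (\<Sum>l. (-1) ^ l * h l) r) \<le> A * K * B * norm (r powr (-\<theta>))"
      using eventually_ge_at_top[of "1::real"]
    proof eventually_elim
      case (elim r)
      define e where "e = (\<lambda>l. bprod n l r - (cn n + (-1) ^ l * sn n r) / (pi * r))"
      have e: "\<bar>e l\<bar> \<le> K * min 1 (((real l + 1) / r) ^ 2)" for l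
      proof -
        have a: "\<bar>cn n + (-1) ^ l * sn n r\<bar> \<le> 2"
          using abs_cn_le_1[of n] abs_sn_le_1[of n r] abs_triangle_ineq[of "cn n" "(-1) ^ l * sn n r"] by (simp add: abs_mult)
        have "\<bar>(cn n + (-1) ^ l * sn n r) / (pi * r)\<bar> = \<bar>cn n + (-1) ^ l * sn n r\<bar> / (pi * r)" using elim by (simp add: abs_divide)
        also have "\<dots> \<le> 2 / (2 * 1)" using a elim pi_ge_two by (intro frac_le mult_mono) auto
        finally have "\<bar>e l\<bar> \<le> 2" unfolding e_def using abs_bprod_le_1[of n l r] by linarith
        hence 1: "\<bar>e l\<bar> \<le> K * 1" by (simp add: K_def)
        have "\<bar>e l\<bar> \<le> C * ((real l + 1) / r) ^ 2" using C(2)[OF elim, of l] by (simp add: e_def power_divide)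
        also have "\<dots> \<le> K * ((real l + 1) / r) ^ 2" by (intro mult_right_mono) (auto simp: K_def)
        finally show ?thesis using 1 by (simp add: min_def)
      qed
      have le: "\<bar>h l * e l\<bar> \<le> A * K * ((real l + 1) powr (-\<kappa>) * min 1 (((real l + 1) / r) ^ 2))" for l
      proof -
        have "\<bar>h l * e l\<bar> \<le> (A * (real l + 1) powr (-\<kappa>)) * (K * min 1 (((real l + 1) / r) ^ 2))"
          unfolding abs_mult using A e[of l] by (intro mult_mono) auto
        thus ?thesis by (simp only: mult_ac)
      qed
      have s0: "summable (\<lambda>l. (real l + 1) powr (-\<kappa>) * min 1 (((real l + 1) / r) ^ 2))"
        by (rule summable_comparison_test'[OF summable_powr_Suc[of "-\<kappa>"], of 0]) (use \<kappa> in \<open>auto simp: abs_mult intro!: mult_left_le\<close>)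
      have sl: "summable (\<lambda>l. \<bar>h l * e l\<bar>)"
        by (rule summable_comparison_test'[OF summable_mult[OF s0, of "A * K"], of 0]) (use le in auto)
      have sh: "summable h" "summable (\<lambda>l. (-1) ^ l * h l)" using bigo_summable[OF h' \<kappa>(1)] by auto
      have hb: "exp_bdd h" by (rule bigo_exp_bdd[OF h']) (use \<kappa> in auto)
      have "(\<lambda>l. h l * (cn n / (pi * r)) + (-1) ^ l * h l * (sn n r / (pi * r))) sums
          ((\<Sum>l. h l) * (cn n / (pi * r)) + (\<Sum>l. (-1) ^ l * h l) * (sn n r / (pi * r)))"
        by (intro sums_add sums_mult2 summable_sums sh)
      from sums_diff[OF summable_sums[OF summable_bprod(1)[OF hb, of n r]] this]
      have "(\<lambda>l. h l * bprod n l r - (h l * (cn n / (pi * r)) + (-1) ^ l * h l * (sn n r / (pi * r)))) sums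
          (bsum n h r - blead n (\<Sum>l. h l) (\<Sum>l. (-1) ^ l * h l) r)"
        by (simp add: bsum_def blead_def add_divide_distrib mult_ac)
      moreover have "h l * bprod n l r - (h l * (cn n / (pi * r)) + (-1) ^ l * h l * (sn n r / (pi * r))) = h l * e l" for l
        unfolding e_def add_divide_distrib by algebra
      ultimately have "bsum n h r - blead n (\<Sum>l. h l) (\<Sum>l. (-1) ^ l * h l) r = (\<Sum>l. h l * e l)"
        by (simp add: sums_iff)
      also have "\<bar>\<dots>\<bar> \<le> (\<Sum>l. \<bar>h l * e l\<bar>)" by (rule summable_rabs[OF sl])
      also have "\<dots> \<le> (\<Sum>l. A * K * ((real l + 1) powr (-\<kappa>) * min 1 (((real l + 1) / r) ^ 2)))"
        by (rule suminf_le[OF le sl summable_mult[OF s0]])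
      also have "\<dots> = A * K * (\<Sum>l. (real l + 1) powr (-\<kappa>) * min 1 (((real l + 1) / r) ^ 2))" by (rule suminf_mult[OF s0])
      also have "\<dots> \<le> A * K * (B * r powr (-\<theta>))" using A B(2)[OF elim] by (intro mult_left_mono) (auto simp: K_def)
      finally show ?case by (simp add: mult.assoc)
    qed
  qed
qed

section \<open>Power weights\<close>

text \<open>As \<open>0 powr x = 0\<close>, the term \<open>l = 0\<close> is absent.\<close>

definition pw :: "real \<Rightarrow> nat \<Rightarrow> real" where "pw \<delta> l = real l powr (-\<delta>)"

lemma pw_0 [simp]: "pw \<delta> 0 = 0" by (simp add: pw_def)
lemma exp_bdd_pw [intro]: "exp_bdd (pw \<delta>)" unfolding pw_def[abs_def] by (rule exp_bdd_powr)
lemma pw_mult: "real l * pw \<delta> l = pw (\<delta> - 1) l"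
  by (cases "l = 0") (auto simp: pw_def powr_diff powr_minus field_simps)
lemma pw_bigo: "pw \<delta> \<in> O(\<lambda>l. real l powr (-\<delta>))" by (simp add: pw_def[abs_def])

text \<open>The natural and the real predecessor agree from \<open>l = 1\<close> on;
  \<open>real_asymp\<close> can then treat the real expression.\<close>

lemma bigo_pred_transform:
  assumes "(\<lambda>l. f (real l - 1) l) \<in> O(g)"
  shows "(\<lambda>l. f (real (l - 1)) l) \<in> O(g :: nat \<Rightarrow> real)"
proof -
  have "\<forall>\<^sub>F l in sequentially. f (real (l - 1)) l = f (real l - 1) l"
    using eventually_ge_at_top[of 1] by eventually_elim (simp add: of_nat_diff)
  thus ?thesis using assms by (simp add: landau_o.big.in_cong)
qed

lemma bigo_ev_cong:
  assumes "f \<in> O[F](g)" "\<forall>\<^sub>F x in F. f x = h x"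
  shows "h \<in> O[F](g)"
  using assms landau_o.big.in_cong[OF assms(2), of g] by simp

text \<open>\<open>kp\<close> and \<open>km\<close> are the forward and backward differences of
  \<open>l powr (1 - \<delta>)\<close>, minus their common leading term
  \<open>(\<delta> - 1) l powr (-\<delta>)\<close>. They decay one power faster than
  \<open>pw \<delta>\<close>, and their next coefficients are opposite.\<close>

definition kp :: "real \<Rightarrow> nat \<Rightarrow> real" where
  "kp \<delta> l = pw (\<delta> - 1) l - pw (\<delta> - 1) (Suc l) - (\<delta> - 1) * pw \<delta> l"
definition km :: "real \<Rightarrow> nat \<Rightarrow> real" where
  "km \<delta> l = pw (\<delta> - 1) (l - 1) - pw (\<delta> - 1) l - (\<delta> - 1) * pw \<delta> l"

lemma exp_bdd_pw_Suc: "exp_bdd (\<lambda>l. pw \<delta> (Suc l))" and exp_bdd_pw_pred: "exp_bdd (\<lambda>l. pw \<delta> (l - 1))"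
  by (rule exp_bdd_Suc exp_bdd_pred; rule exp_bdd_pw)+

lemma powr_shift_expansion:
  "(\<lambda>l. (1 + real l) powr s - real l powr s - s * real l powr (s - 1) - s * (s - 1) / 2 * real l powr (s - 2))
     \<in> O(\<lambda>l. real l powr (s - 3))"
  "(\<lambda>l. (real l - 1) powr s - real l powr s + s * real l powr (s - 1) - s * (s - 1) / 2 * real l powr (s - 2))
     \<in> O(\<lambda>l. real l powr (s - 3))"
  by real_asymp+

lemma pw_pred_expansion:
  "(\<lambda>l. pw \<delta> (l - 1) - pw \<delta> l - \<delta> * pw (\<delta> + 1) l - \<delta> * (\<delta> + 1) / 2 * pw (\<delta> + 2) l) \<in> O(\<lambda>l. real l powr (-(\<delta> + 3)))"
proof -
  have "(\<lambda>l. (real l - 1) powr (-\<delta>) - pw \<delta> l - \<delta> * pw (\<delta> + 1) l - \<delta> * (\<delta> + 1) / 2 * pw (\<delta> + 2) l) \<in> O(\<lambda>l. real l powr (-(\<delta> + 3)))"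
  proof -
    have e: "- \<delta> - 1 = - (\<delta> + 1)" "- \<delta> - 2 = - (\<delta> + 2)" "- \<delta> - 3 = - (\<delta> + 3)" by simp_all
    have "(real l - 1) powr (-\<delta>) - pw \<delta> l - \<delta> * pw (\<delta> + 1) l - \<delta> * (\<delta> + 1) / 2 * pw (\<delta> + 2) l
      = (real l - 1) powr (-\<delta>) - real l powr (-\<delta>) + (-\<delta>) * real l powr (-(\<delta> + 1)) - (-\<delta>) * (-(\<delta> + 1)) / 2 * real l powr (-(\<delta> + 2))" for l
      unfolding pw_def by (simp only: mult_minus_left mult_minus_right minus_minus add_uminus_conv_diff)
    thus ?thesis using powr_shift_expansion(2)[of "-\<delta>"] unfolding e by (simp only:)
  qed
  thus ?thesis unfolding pw_def[of \<delta> "_ - 1"] by (rule bigo_pred_transform)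
qed

lemma kp_bigo: "kp \<delta> \<in> O(\<lambda>l. real l powr (-(\<delta> + 1)))"
  unfolding kp_def[abs_def] pw_def of_nat_Suc by real_asymp

lemma kp_bigo2: "(\<lambda>l. kp \<delta> l - (- (\<delta> * (\<delta> - 1) / 2)) * pw (\<delta> + 1) l) \<in> O(\<lambda>l. real l powr (-(\<delta> + 1 + 1)))"
proof -
  have "(\<lambda>l. - 1 * ((1 + real l) powr (1 - \<delta>) - real l powr (1 - \<delta>) - (1 - \<delta>) * real l powr (1 - \<delta> - 1) - (1 - \<delta>) * (1 - \<delta> - 1) / 2 * real l powr (1 - \<delta> - 2)))
     \<in> O(\<lambda>l. real l powr (1 - \<delta> - 3))"
    by (subst landau_o.big.cmult_in_iff) (use powr_shift_expansion(1)[of "1 - \<delta>"] in auto)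
  moreover have "kp \<delta> l - (- (\<delta> * (\<delta> - 1) / 2)) * pw (\<delta> + 1) l
    = - 1 * ((1 + real l) powr (1 - \<delta>) - real l powr (1 - \<delta>) - (1 - \<delta>) * real l powr (1 - \<delta> - 1) - (1 - \<delta>) * (1 - \<delta> - 1) / 2 * real l powr (1 - \<delta> - 2))" for l
  proof -
    have "- (\<delta> - 1) = 1 - \<delta>" "1 - \<delta> - 1 = - \<delta>" "1 - \<delta> - 2 = - (\<delta> + 1)" by simp_all
    thus ?thesis unfolding kp_def pw_def of_nat_Suc by (simp only:) (simp add: field_simps)
  qed
  moreover have "1 - \<delta> - 3 = - (\<delta> + 1 + 1)" by simp
  ultimately show ?thesis by (simp only:)
qed

lemma km_bigo: "km \<delta> \<in> O(\<lambda>l. real l powr (-(\<delta> + 1)))"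
  unfolding km_def[abs_def] pw_def by (rule bigo_pred_transform, real_asymp)

lemma km_bigo2: "(\<lambda>l. km \<delta> l - (\<delta> * (\<delta> - 1) / 2) * pw (\<delta> + 1) l) \<in> O(\<lambda>l. real l powr (-(\<delta> + 1 + 1)))"
proof -
  have "\<delta> - 1 + 1 = \<delta>" "\<delta> - 1 + 2 = \<delta> + 1" "\<delta> - 1 + 3 = \<delta> + 1 + 1" by simp_all
  moreover have "km \<delta> l - (\<delta> * (\<delta> - 1) / 2) * pw (\<delta> + 1) l = pw (\<delta> - 1) (l - 1) - pw (\<delta> - 1) l - (\<delta> - 1) * pw \<delta> l - (\<delta> - 1) * \<delta> / 2 * pw (\<delta> + 1) l" for l
    by (simp add: km_def algebra_simps)
  ultimately show ?thesis using pw_pred_expansion[of "\<delta> - 1"] by (simp only:)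
qed

section \<open>Trading decay of the weights for powers of \<open>1/r\<close>\<close>

lemma bsum_pw_sum:
  assumes "r \<noteq> 0"
  shows "bsum (n + 2) (pw \<delta>) r + bsum n (pw \<delta>) r
    = 2 / r * (bsum (n + 1) (pw (\<delta> - 1)) r + (real n + 1) * bsum (n + 1) (pw \<delta>) r)"
proof -
  have eq: "(real l + real n + 1) * pw \<delta> l = pw (\<delta> - 1) l + (real n + 1) * pw \<delta> l" for l
    unfolding pw_mult[symmetric] by (simp add: algebra_simps)
  show ?thesis unfolding bsum_three_term[OF exp_bdd_pw assms] eq
    by (subst bsum_add) (auto intro: exp_bdd_intros simp: bsum_cmult exp_bdd_pw)
qed

text \<open>Both forms of the three-term recurrence are applied to
  \<open>l powr (1 - \<delta>)\<close> and subtracted. The growing factor \<open>l\<close> cancels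
  on the right, and on the left the differences of the weights appear, that is
  \<open>pw \<delta>\<close> up to \<open>kp\<close> and \<open>km\<close>.\<close>

lemma bsum_pw_diff:
  assumes "r \<noteq> 0"
  shows "bsum (n + 2) (kp \<delta>) r - bsum n (km \<delta>) r + (\<delta> - 1) * (bsum (n + 2) (pw \<delta>) r - bsum n (pw \<delta>) r)
    = 2 * (real n + 1) / r * bsum (n + 1) (pw (\<delta> - 1)) r"
proof -
  let ?F = "pw (\<delta> - 1)"
  have F: "exp_bdd ?F" "exp_bdd (\<lambda>l. ?F (Suc l))" "exp_bdd (\<lambda>l. ?F (l - 1))"
    by (rule exp_bdd_pw exp_bdd_pw_Suc exp_bdd_pw_pred)+
  have 1: "bsum (n + 2) ?F r + bsum n ?F r = 2 / r * bsum (n + 1) (\<lambda>l. (real l + real n + 1) * ?F l) r"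
    by (rule bsum_three_term[OF F(1) assms])
  have 2: "bsum (n + 2) (\<lambda>l. ?F (Suc l)) r + bsum n (\<lambda>l. ?F (l - 1)) r = 2 / r * bsum (n + 1) (\<lambda>l. real l * ?F l) r"
    by (rule bsum_three_term'[OF F(1) _ assms]) simp
  have 3: "bsum (n + 1) (\<lambda>l. (real l + real n + 1) * ?F l) r = bsum (n + 1) (\<lambda>l. real l * ?F l) r + (real n + 1) * bsum (n + 1) ?F r"
  proof -
    have "(\<lambda>l. (real l + real n + 1) * ?F l) = (\<lambda>l. real l * ?F l + (real n + 1) * ?F l)" by (auto simp: algebra_simps)
    thus ?thesis
      using bsum_add[OF exp_bdd_mult[OF exp_bdd_of_nat F(1)] exp_bdd_cmult[OF F(1)], of "n + 1" "real n + 1" r]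
        bsum_cmult[OF F(1), of "n + 1" "real n + 1" r] by simp
  qed
  have k: "bsum N (kp \<delta>) r = bsum N ?F r - bsum N (\<lambda>l. ?F (Suc l)) r - (\<delta> - 1) * bsum N (pw \<delta>) r"
    "bsum N (km \<delta>) r = bsum N (\<lambda>l. ?F (l - 1)) r - bsum N ?F r - (\<delta> - 1) * bsum N (pw \<delta>) r" for N
    unfolding kp_def[abs_def] km_def[abs_def]
    by (simp_all only: bsum_diff bsum_cmult F exp_bdd_pw exp_bdd_diff exp_bdd_cmult)
  have "bsum (n + 2) (kp \<delta>) r - bsum n (km \<delta>) r + (\<delta> - 1) * (bsum (n + 2) (pw \<delta>) r - bsum n (pw \<delta>) r)
     = (bsum (n + 2) ?F r + bsum n ?F r) - (bsum (n + 2) (\<lambda>l. ?F (Suc l)) r + bsum n (\<lambda>l. ?F (l - 1)) r)"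
    unfolding k by (simp add: algebra_simps)
  also have "\<dots> = 2 * (real n + 1) / r * bsum (n + 1) ?F r"
    unfolding 1 2 3 by (simp add: algebra_simps add_divide_distrib)
  finally show ?thesis .
qed

text \<open>Sum and difference of the orders \<open>n + 2\<close> and \<open>n\<close> are both
  known, so order \<open>n\<close> can be solved for. The price is a weight with one power less
  decay, but divided by \<open>r\<close>.\<close>

lemma bsum_pw_rel_down:
  assumes "r \<noteq> 0"
  shows "2 * (\<delta> - 1) * bsum n (pw \<delta>) r
     = 2 / r * (\<delta> - 1 - (real n + 1)) * bsum (n + 1) (pw (\<delta> - 1)) r + 2 * (\<delta> - 1) * (real n + 1) / r * bsum (n + 1) (pw \<delta>) r
       + bsum (n + 2) (kp \<delta>) r - bsum n (km \<delta>) r"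
proof -
  define S0 S1 S2 T1 where "S0 = bsum n (pw \<delta>) r" "S1 = bsum (n + 1) (pw \<delta>) r" "S2 = bsum (n + 2) (pw \<delta>) r"
    "T1 = bsum (n + 1) (pw (\<delta> - 1)) r"
  note d = this
  have "2 * (\<delta> - 1) * S0 = (\<delta> - 1) * (S2 + S0) - (\<delta> - 1) * (S2 - S0)" by (simp add: algebra_simps)
  also have "(\<delta> - 1) * (S2 - S0) = 2 * (real n + 1) / r * T1 - (bsum (n + 2) (kp \<delta>) r - bsum n (km \<delta>) r)"
    using bsum_pw_diff[OF assms, of n \<delta>] unfolding d[symmetric] by linarith
  also have "S2 + S0 = 2 / r * (T1 + (real n + 1) * S1)"
    using bsum_pw_sum[OF assms, of n \<delta>] unfolding d[symmetric] .
  finally show ?thesis unfolding d[symmetric] by (simp add: algebra_simps diff_divide_distrib add_divide_distrib)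
qed

text \<open>Instead of the order \<open>n + 2\<close>, the slowly decaying sum of order
  \<open>n + 1\<close> is eliminated. At leading order this is a two-term recursion in steps of 2,
  the one that determines the constants \<open>c1\<close>.\<close>

lemma bsum_pw_rel_order:
  assumes "r \<noteq> 0"
  shows "(real n + 2 - \<delta>) * bsum (n + 2) (pw \<delta>) r + (real n + \<delta>) * bsum n (pw \<delta>) r
     = bsum (n + 2) (kp \<delta>) r - bsum n (km \<delta>) r + 2 * (real n + 1) ^ 2 / r * bsum (n + 1) (pw \<delta>) r"
proof -
  define S0 S1 S2 T1 where "S0 = bsum n (pw \<delta>) r" "S1 = bsum (n + 1) (pw \<delta>) r" "S2 = bsum (n + 2) (pw \<delta>) r"
    "T1 = bsum (n + 1) (pw (\<delta> - 1)) r"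
  note d = this
  have "(real n + 2 - \<delta>) * S2 + (real n + \<delta>) * S0 = (real n + 1) * (S2 + S0) - (\<delta> - 1) * (S2 - S0)" by (simp add: algebra_simps)
  also have "(\<delta> - 1) * (S2 - S0) = 2 * (real n + 1) / r * T1 - (bsum (n + 2) (kp \<delta>) r - bsum n (km \<delta>) r)"
    using bsum_pw_diff[OF assms, of n \<delta>] unfolding d[symmetric] by linarith
  also have "S2 + S0 = 2 / r * (T1 + (real n + 1) * S1)"
    using bsum_pw_sum[OF assms, of n \<delta>] unfolding d[symmetric] .
  finally show ?thesis unfolding d[symmetric] by (simp add: algebra_simps diff_divide_distrib add_divide_distrib power2_eq_square)
qed

lemma blead_Suc_Suc: "blead (n + 2) A B r = - blead n A B r"
proof -
  have 1: "cn (n + 2) = - cn n"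
  proof -
    have "real (n + 2) * pi / 2 = real n * pi / 2 + pi" by (simp add: field_simps)
    thus ?thesis unfolding cn_def by (simp only: cos_periodic_pi)
  qed
  have 2: "sn (n + 2) r = - sn n r"
  proof -
    have "2 * r - real (n + 2) * pi / 2 = (2 * r - real n * pi / 2) - pi" by (simp add: field_simps)
    thus ?thesis unfolding sn_def by (simp only: sin_minus_pi)
  qed
  have "blead (n + 2) A B r = - (cn n * A + sn n r * B) / (pi * r)" unfolding blead_def 1 2 by simp
  thus ?thesis by (simp only: blead_def minus_divide_left)
qed

lemma blead_add: "blead n (A + A') (B + B') r = blead n A B r + blead n A' B' r"
  and blead_cmult: "blead n (c * A) (c * B) r = c * blead n A B r"
  by (simp_all add: blead_def algebra_simps add_divide_distrib diff_divide_distrib)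

lemma pw_tendsto_0: "\<delta> > 0 \<Longrightarrow> pw \<delta> \<longlonglongrightarrow> 0" "\<delta> > 0 \<Longrightarrow> (\<lambda>l. pw \<delta> (l - 1)) \<longlonglongrightarrow> 0"
proof -
  assume d: "\<delta> > 0"
  show 1: "pw \<delta> \<longlonglongrightarrow> 0" unfolding pw_def[abs_def] using d by real_asymp
  have "(\<lambda>l. pw \<delta> (Suc l - 1)) \<longlonglongrightarrow> 0" using 1 by simp
  thus "(\<lambda>l. pw \<delta> (l - 1)) \<longlonglongrightarrow> 0" by (rule LIMSEQ_imp_Suc)
qed

text \<open>In \<open>kp + km\<close> the differences combine to
  \<open>F (l - 1) - F (l + 1)\<close>, which telescopes to 0, also with alternating signs, since
  \<open>F\<close> vanishes at 0 and at infinity. What remains is the subtracted leading term,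
  twice.\<close>

lemma kp_km_sums:
  assumes "\<delta> > 1"
  shows "(\<Sum>l. kp \<delta> l) + (\<Sum>l. km \<delta> l) = - (2 * (\<delta> - 1) * (\<Sum>l. pw \<delta> l))"
    "(\<Sum>l. (-1) ^ l * kp \<delta> l) + (\<Sum>l. (-1) ^ l * km \<delta> l) = - (2 * (\<delta> - 1) * (\<Sum>l. (-1) ^ l * pw \<delta> l))"
proof -
  let ?F = "pw (\<delta> - 1)"
  have sk: "summable (kp \<delta>)" "summable (km \<delta>)" "summable (\<lambda>l. (-1) ^ l * kp \<delta> l)" "summable (\<lambda>l. (-1) ^ l * km \<delta> l)"
    using bigo_summable[OF kp_bigo] bigo_summable[OF km_bigo] assms by auto
  have sp: "summable (pw \<delta>)" "summable (\<lambda>l. (-1) ^ l * pw \<delta> l)" using bigo_summable[OF pw_bigo] assms by auto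
  have F0: "?F \<longlonglongrightarrow> 0" "(\<lambda>l. ?F (l - 1)) \<longlonglongrightarrow> 0" using pw_tendsto_0[of "\<delta> - 1"] assms by auto
  have "(\<lambda>l. (?F (l - 1) + ?F l) - (?F (Suc l - 1) + ?F (Suc l))) sums ((?F (0 - 1) + ?F 0) - (0 + 0))"
    by (rule telescope_sums'[OF tendsto_add[OF F0(2,1)]])
  hence 1: "(\<lambda>l. ?F (l - 1) - ?F (Suc l)) sums 0" by simp
  have "(\<lambda>l. kp \<delta> l + km \<delta> l) sums (0 - 2 * (\<delta> - 1) * (\<Sum>l. pw \<delta> l))"
  proof -
    have e: "(\<lambda>l. kp \<delta> l + km \<delta> l) = (\<lambda>l. (?F (l - 1) - ?F (Suc l)) - 2 * (\<delta> - 1) * pw \<delta> l)"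
      by (rule ext) (simp add: kp_def km_def algebra_simps)
    show ?thesis unfolding e by (rule sums_diff[OF 1 sums_mult[OF summable_sums[OF sp(1)]]])
  qed
  moreover have "(\<lambda>l. kp \<delta> l + km \<delta> l) sums ((\<Sum>l. kp \<delta> l) + (\<Sum>l. km \<delta> l))"
    by (intro sums_add summable_sums sk)
  ultimately have "0 - 2 * (\<delta> - 1) * (\<Sum>l. pw \<delta> l) = (\<Sum>l. kp \<delta> l) + (\<Sum>l. km \<delta> l)"
    by (rule sums_unique2)
  thus "(\<Sum>l. kp \<delta> l) + (\<Sum>l. km \<delta> l) = - (2 * (\<delta> - 1) * (\<Sum>l. pw \<delta> l))" by simp
  have a0: "(\<lambda>l. (-1) ^ l * (?F (l - 1) - ?F l)) \<longlonglongrightarrow> 0"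
  proof (rule tendsto_rabs_zero_cancel)
    have "(\<lambda>l. ?F (l - 1) - ?F l) \<longlonglongrightarrow> 0" using tendsto_diff[OF F0(2,1)] by simp
    from tendsto_rabs_zero[OF this] show "(\<lambda>l. \<bar>(-1) ^ l * (?F (l - 1) - ?F l)\<bar>) \<longlonglongrightarrow> 0" by (simp add: abs_mult)
  qed
  have "(\<lambda>l. (-1) ^ l * (?F (l - 1) - ?F l) - (-1) ^ Suc l * (?F (Suc l - 1) - ?F (Suc l))) sums ((-1) ^ 0 * (?F (0 - 1) - ?F 0) - 0)"
    by (rule telescope_sums'[OF a0])
  hence 2: "(\<lambda>l. (-1) ^ l * (?F (l - 1) - ?F (Suc l))) sums 0" by (simp add: algebra_simps)
  have "(\<lambda>l. (-1) ^ l * kp \<delta> l + (-1) ^ l * km \<delta> l) sums (0 - 2 * (\<delta> - 1) * (\<Sum>l. (-1) ^ l * pw \<delta> l))"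
  proof -
    have e: "(\<lambda>l. (-1) ^ l * kp \<delta> l + (-1) ^ l * km \<delta> l) = (\<lambda>l. (-1) ^ l * (?F (l - 1) - ?F (Suc l)) - 2 * (\<delta> - 1) * ((-1) ^ l * pw \<delta> l))"
      by (rule ext) (simp add: kp_def km_def algebra_simps)
    show ?thesis unfolding e by (rule sums_diff[OF 2 sums_mult[OF summable_sums[OF sp(2)]]])
  qed
  moreover have "(\<lambda>l. (-1) ^ l * kp \<delta> l + (-1) ^ l * km \<delta> l) sums ((\<Sum>l. (-1) ^ l * kp \<delta> l) + (\<Sum>l. (-1) ^ l * km \<delta> l))"
    by (intro sums_add summable_sums sk)
  ultimately have "0 - 2 * (\<delta> - 1) * (\<Sum>l. (-1) ^ l * pw \<delta> l) = (\<Sum>l. (-1) ^ l * kp \<delta> l) + (\<Sum>l. (-1) ^ l * km \<delta> l)"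
    by (rule sums_unique2)
  thus "(\<Sum>l. (-1) ^ l * kp \<delta> l) + (\<Sum>l. (-1) ^ l * km \<delta> l) = - (2 * (\<delta> - 1) * (\<Sum>l. (-1) ^ l * pw \<delta> l))" by simp
qed

lemma bigo_at_top_weaken:
  assumes "f \<in> O[at_top](\<lambda>r::real. r powr (-a))" "b \<le> a"
  shows "f \<in> O[at_top](\<lambda>r. r powr (-b))"
proof (rule landau_o.big_trans[OF assms(1)], rule landau_o.bigI[of 1])
  show "\<forall>\<^sub>F r in at_top. norm (r powr (-a)) \<le> 1 * norm (r powr (-b))"
    using eventually_ge_at_top[of "1::real"] by eventually_elim (use assms(2) in \<open>simp add: powr_mono\<close>)
qed auto

lemma bigo_at_top_div:
  assumes "f \<in> O[at_top](\<lambda>r::real. r powr (-a))"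
  shows "(\<lambda>r. c / r * f r) \<in> O[at_top](\<lambda>r. r powr (-(a + 1)))"
proof -
  have "(\<lambda>r::real. c / r) \<in> O[at_top](\<lambda>r. r powr (-1))" by real_asymp
  from landau_o.big.mult[OF this assms] have "(\<lambda>r. c / r * f r) \<in> O[at_top](\<lambda>r. r powr (-1 + -a))"
    unfolding powr_add .
  moreover have "-1 + -a = -(a + 1)" by simp
  ultimately show ?thesis by (simp only:)
qed

text \<open>The sum minus its candidate leading term. All later gains are stated for this quantity,
  because relations between sums carry over to it once their leading terms match.\<close>

definition berr :: "nat \<Rightarrow> (nat \<Rightarrow> real) \<Rightarrow> real \<Rightarrow> real" where
  "berr n h r = bsum n h r - blead n (\<Sum>l. h l) (\<Sum>l. (-1) ^ l * h l) r"

text \<open>Subtracting leading terms from \<open>bsum_pw_rel_down\<close>: since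
  \<open>blead\<close> changes sign from order \<open>n\<close> to \<open>n + 2\<close>, those of
  \<open>kp\<close> and \<open>km\<close> add up, and \<open>kp_km_sums\<close> identifies the
  result with that of \<open>pw \<delta>\<close>. Only errors and terms divided by \<open>r\<close>
  are left.\<close>

lemma berr_pw_rel:
  assumes \<delta>: "\<delta> > 1" and \<theta>: "\<theta> \<le> 2"
    and k: "berr (n + 2) (kp \<delta>) \<in> O[at_top](\<lambda>r. r powr (-\<theta>))" "berr n (km \<delta>) \<in> O[at_top](\<lambda>r. r powr (-\<theta>))"
  shows "(\<lambda>r. berr n (pw \<delta>) r - (1 - (real n + 1) / (\<delta> - 1)) / r * bsum (n + 1) (pw (\<delta> - 1)) r) \<in> O[at_top](\<lambda>r. r powr (-\<theta>))"
proof -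
  have S: "bsum (n + 1) (pw \<delta>) \<in> O[at_top](\<lambda>r. r powr (-1))"
    by (rule bsum_bigo[OF pw_bigo]) (use \<delta> in auto)
  have b: "(\<lambda>r. (real n + 1) / r * bsum (n + 1) (pw \<delta>) r) \<in> O[at_top](\<lambda>r. r powr (-\<theta>))"
    using bigo_at_top_weaken[OF bigo_at_top_div[OF S], of \<theta> "real n + 1"] \<theta> by simp
  have "(\<lambda>r. (real n + 1) / r * bsum (n + 1) (pw \<delta>) r + (1 / (2 * (\<delta> - 1))) * (berr (n + 2) (kp \<delta>) r - berr n (km \<delta>) r)) \<in> O[at_top](\<lambda>r. r powr (-\<theta>))"
    by (intro sum_in_bigo landau_o.big.cmult_in_iff[THEN iffD2] b k) (use \<delta> in auto)
  moreover have "\<forall>\<^sub>F r in at_top. (real n + 1) / r * bsum (n + 1) (pw \<delta>) r + (1 / (2 * (\<delta> - 1))) * (berr (n + 2) (kp \<delta>) r - berr n (km \<delta>) r)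
     = berr n (pw \<delta>) r - (1 - (real n + 1) / (\<delta> - 1)) / r * bsum (n + 1) (pw (\<delta> - 1)) r"
    using eventually_gt_at_top[of "0::real"]
  proof eventually_elim
    case (elim r)
    define S0 S1 T1 K L where "S0 = bsum n (pw \<delta>) r" "S1 = bsum (n + 1) (pw \<delta>) r" "T1 = bsum (n + 1) (pw (\<delta> - 1)) r"
       "K = bsum (n + 2) (kp \<delta>) r" "L = bsum n (km \<delta>) r"
    note d = this
    define e where "e = \<delta> - 1"
    have e0: "e \<noteq> 0" using \<delta> by (simp add: e_def)
    have rel: "2 * e * S0 = 2 / r * (e - (real n + 1)) * T1 + 2 * e * (real n + 1) / r * S1 + K - L"
      using bsum_pw_rel_down[of r \<delta> n] elim unfolding d[symmetric] e_def by simp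
    have "blead (n + 2) (\<Sum>l. kp \<delta> l) (\<Sum>l. (-1) ^ l * kp \<delta> l) r - blead n (\<Sum>l. km \<delta> l) (\<Sum>l. (-1) ^ l * km \<delta> l) r
       = - blead n ((\<Sum>l. kp \<delta> l) + (\<Sum>l. km \<delta> l)) ((\<Sum>l. (-1) ^ l * kp \<delta> l) + (\<Sum>l. (-1) ^ l * km \<delta> l)) r"
      by (simp only: blead_Suc_Suc blead_add)
    also have "\<dots> = 2 * e * blead n (\<Sum>l. pw \<delta> l) (\<Sum>l. (-1) ^ l * pw \<delta> l) r"
      unfolding kp_km_sums[OF \<delta>] e_def[symmetric] using blead_cmult[of n "- (2 * e)" "\<Sum>l. pw \<delta> l" "\<Sum>l. (-1) ^ l * pw \<delta> l" r] by simp
    finally have kk: "berr (n + 2) (kp \<delta>) r - berr n (km \<delta>) r = K - L - 2 * e * blead n (\<Sum>l. pw \<delta> l) (\<Sum>l. (-1) ^ l * pw \<delta> l) r"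
      unfolding berr_def d by linarith
    have "S0 = (2 / r * (e - (real n + 1)) * T1 + 2 * e * (real n + 1) / r * S1 + (K - L)) / (2 * e)"
      using rel e0 by (simp add: field_simps)
    also have "\<dots> = (1 - (real n + 1) / e) / r * T1 + (real n + 1) / r * S1 + (K - L) / (2 * e)"
      using e0 elim by (simp add: field_simps)
    finally have S0: "S0 = (1 - (real n + 1) / e) / r * T1 + (real n + 1) / r * S1 + (K - L) / (2 * e)" .
    have B: "1 / (2 * e) * (K - L - 2 * e * Q) = (K - L) / (2 * e) - Q" for Q using e0 by (simp add: field_simps)
    show ?case unfolding kk berr_def[of n "pw \<delta>"] d[symmetric] unfolding e_def[symmetric] B using S0 by linarith
  qed
  ultimately show ?thesis by (rule bigo_ev_cong)
qed

lemma berr_bigo: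
  assumes "h \<in> O(\<lambda>l. real l powr (-\<delta>))" "0 < \<theta>" "\<theta> \<le> 2" "\<theta> \<le> \<delta> - 1" "\<theta> = 2 \<Longrightarrow> \<delta> > 3"
  shows "berr n h \<in> O[at_top](\<lambda>r. r powr (-\<theta>))"
  unfolding berr_def[abs_def] by (rule bsum_asymp[OF assms])

text \<open>For pure powers the condition of \<open>berr_bigo\<close> improves by one: decay
  \<open>\<delta> \<ge> \<theta>\<close> suffices, because \<open>kp\<close> and \<open>km\<close>
  have decay \<open>\<delta> + 1\<close> and the sum with weight \<open>pw (\<delta> - 1)\<close> is
  divided by \<open>r\<close>.\<close>

lemma berr_pw:
  assumes \<theta>: "1 < \<theta>" "\<theta> \<le> 2" "\<theta> \<le> \<delta>" "\<theta> = 2 \<Longrightarrow> \<delta> > 2"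
  shows "berr n (pw \<delta>) \<in> O[at_top](\<lambda>r. r powr (-\<theta>))"
proof -
  have k: "berr (n + 2) (kp \<delta>) \<in> O[at_top](\<lambda>r. r powr (-\<theta>))" "berr n (km \<delta>) \<in> O[at_top](\<lambda>r. r powr (-\<theta>))"
    by (rule berr_bigo[OF kp_bigo] berr_bigo[OF km_bigo]; use \<theta> in auto)+
  have "bsum (n + 1) (pw (\<delta> - 1)) \<in> O[at_top](\<lambda>r. r powr (-(\<theta> - 1)))"
    by (rule bsum_bigo[OF pw_bigo]) (use \<theta> in auto)
  from bigo_at_top_div[OF this, of "1 - (real n + 1) / (\<delta> - 1)"]
  have "(\<lambda>r. (1 - (real n + 1) / (\<delta> - 1)) / r * bsum (n + 1) (pw (\<delta> - 1)) r) \<in> O[at_top](\<lambda>r. r powr (-\<theta>))" by simp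
  from sum_in_bigo(1)[OF berr_pw_rel[OF _ \<theta>(2) k] this] \<theta> show ?thesis by simp
qed

lemma berr_linear:
  assumes "exp_bdd f" "exp_bdd g" "summable f" "summable g" "summable (\<lambda>l. (-1) ^ l * f l)" "summable (\<lambda>l. (-1) ^ l * g l)"
  shows "berr n (\<lambda>l. f l + c * g l) r = berr n f r + c * berr n g r"
proof -
  have "(\<Sum>l. f l + c * g l) = (\<Sum>l. f l) + c * (\<Sum>l. g l)"
    using suminf_add[OF assms(3) summable_mult[OF assms(4), of c]] suminf_mult[OF assms(4), of c] by simp
  moreover have "(\<Sum>l. (-1) ^ l * (f l + c * g l)) = (\<Sum>l. (-1) ^ l * f l) + c * (\<Sum>l. (-1) ^ l * g l)"
    using suminf_add[OF assms(5) summable_mult[OF assms(6), of c]] suminf_mult[OF assms(6), of c] by (simp add: algebra_simps)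
  moreover have "bsum n (\<lambda>l. f l + c * g l) r = bsum n f r + c * bsum n g r"
    using assms by (subst bsum_add) (auto simp: bsum_cmult)
  ultimately show ?thesis by (simp add: berr_def blead_add blead_cmult algebra_simps)
qed

text \<open>The gain for pure powers extends to weights with a one-term expansion: the remainder
  decays one power faster and is covered by \<open>berr_bigo\<close>.\<close>

lemma berr_expand:
  assumes h: "(\<lambda>l. h l - c * pw \<epsilon> l) \<in> O(\<lambda>l. real l powr (-(\<epsilon> + 1)))"
    and \<theta>: "1 < \<theta>" "\<theta> \<le> 2" "\<theta> \<le> \<epsilon>" "\<theta> = 2 \<Longrightarrow> \<epsilon> > 2"
  shows "berr n h \<in> O[at_top](\<lambda>r. r powr (-\<theta>))"
proof -
  define h' where "h' = (\<lambda>l. h l - c * pw \<epsilon> l)"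
  have h': "h' \<in> O(\<lambda>l. real l powr (-(\<epsilon> + 1)))" using h by (simp add: h'_def)
  have "berr n h' \<in> O[at_top](\<lambda>r. r powr (-\<theta>))" by (rule berr_bigo[OF h']) (use \<theta> in auto)
  moreover have "(\<lambda>r. c * berr n (pw \<epsilon>) r) \<in> O[at_top](\<lambda>r. r powr (-\<theta>))"
    using berr_pw[OF \<theta>] by simp
  ultimately have "(\<lambda>r. berr n h' r + c * berr n (pw \<epsilon>) r) \<in> O[at_top](\<lambda>r. r powr (-\<theta>))" by (rule sum_in_bigo)
  moreover have "berr n h' r + c * berr n (pw \<epsilon>) r = berr n (\<lambda>l. h' l + c * pw \<epsilon> l) r" for r
    by (rule berr_linear[symmetric]) (use \<theta> bigo_exp_bdd[OF h'] bigo_summable[OF h'] bigo_summable[OF pw_bigo] in auto)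
  moreover have "(\<lambda>l. h' l + c * pw \<epsilon> l) = h" by (simp add: h'_def)
  ultimately show ?thesis by simp
qed

text \<open>For \<open>1 < \<delta> < 2\<close> the error of order \<open>n\<close> is not
  \<open>O(r powr (-2))\<close> by itself; the sum of order \<open>n + 1\<close> with weight
  \<open>pw (\<delta> - 1)\<close> is kept explicitly and later supplies the term
  \<open>r powr (-\<delta>)\<close>.\<close>

lemma berr_pw_strong:
  assumes "1 < \<delta>"
  shows "(\<lambda>r. berr n (pw \<delta>) r - (1 - (real n + 1) / (\<delta> - 1)) / r * bsum (n + 1) (pw (\<delta> - 1)) r) \<in> O[at_top](\<lambda>r. r powr (-2))"
  by (rule berr_pw_rel[OF assms]; (rule berr_expand[OF kp_bigo2] berr_expand[OF km_bigo2])?; use assms in simp)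

section \<open>The differential equation for slowly decaying weights\<close>

text \<open>The weights of the form \<open>f l + f (l - 1)\<close> for which \<open>bsum_ode\<close>
  gives a differential equation.\<close>

definition avg_pw :: "real \<Rightarrow> nat \<Rightarrow> real" where
  "avg_pw \<alpha> l = 1 / 2 * pw \<alpha> l + 1 / 2 * pw \<alpha> (l - 1)"

text \<open>The inhomogeneity in \<open>r S' = - \<alpha> S + ...\<close>. The first summand is
  about \<open>- \<alpha> l powr (-\<alpha>)\<close>; adding \<open>\<alpha> * avg_pw\<close>
  cancels this, so the remaining weights decay like \<open>l powr (-\<alpha> - 1)\<close> and are
  summable.\<close>

definition ode_rhs :: "real \<Rightarrow> nat \<Rightarrow> nat \<Rightarrow> real" where
  "ode_rhs \<alpha> n l = (2 * real l + real n) * (1 / 2 * pw \<alpha> l - 1 / 2 * pw \<alpha> (l - 1)) + \<alpha> * avg_pw \<alpha> l"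

definition pw_pred_err :: "real \<Rightarrow> nat \<Rightarrow> real" where
  "pw_pred_err \<alpha> l = pw \<alpha> (l - 1) - pw \<alpha> l - \<alpha> * pw (\<alpha> + 1) l - \<alpha> * (\<alpha> + 1) / 2 * pw (\<alpha> + 2) l"

lemma pw_pred_err_bigo:
  "pw_pred_err \<alpha> \<in> O(\<lambda>l. real l powr (-(\<alpha> + 2)))"
  "(\<lambda>l. real l * pw_pred_err \<alpha> l) \<in> O(\<lambda>l. real l powr (-(\<alpha> + 2)))"
proof -
  have e: "pw_pred_err \<alpha> \<in> O(\<lambda>l. real l powr (-(\<alpha> + 3)))"
    unfolding pw_pred_err_def[abs_def] by (rule pw_pred_expansion)
  thus "pw_pred_err \<alpha> \<in> O(\<lambda>l. real l powr (-(\<alpha> + 2)))" by (rule bigo_powr_weaken) simp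
  have "(\<lambda>l. real l) \<in> O(\<lambda>l. real l powr 1)" by real_asymp
  from landau_o.big.mult[OF this e] have "(\<lambda>l. real l * pw_pred_err \<alpha> l) \<in> O(\<lambda>l. real l powr (1 + -(\<alpha> + 3)))"
    unfolding powr_add .
  moreover have "1 + -(\<alpha> + 3) = -(\<alpha> + 2)" by simp
  ultimately show "(\<lambda>l. real l * pw_pred_err \<alpha> l) \<in> O(\<lambda>l. real l powr (-(\<alpha> + 2)))" by (simp only:)
qed

lemma exp_bdd_avg_pw: "exp_bdd (avg_pw \<alpha>)"
  unfolding avg_pw_def[abs_def] by (intro exp_bdd_add exp_bdd_cmult exp_bdd_pw exp_bdd_pw_pred)

lemma ode_rhs_bigo:
  "(\<lambda>l. ode_rhs \<alpha> n l - (- (\<alpha> / 2 * (real n + 1))) * pw (\<alpha> + 1) l) \<in> O(\<lambda>l. real l powr (-(\<alpha> + 1 + 1)))"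
proof -
  let ?e = "pw_pred_err \<alpha>" and ?k = "\<alpha> * (\<alpha> + 1) / 2"
  have e: "\<alpha> + 1 + 1 = \<alpha> + 2" by simp
  have p2: "pw (\<alpha> + 2) \<in> O(\<lambda>l. real l powr (-(\<alpha> + 2)))" by (rule pw_bigo)
  have "(\<lambda>l. ((\<alpha> - real n) / 2 * ?k) * pw (\<alpha> + 2) l + (\<alpha> - real n) / 2 * ?e l - real l * ?e l) \<in> O(\<lambda>l. real l powr (-(\<alpha> + 2)))"
    by (intro sum_in_bigo landau_o.big.cmult_in_iff'[THEN iffD2] pw_pred_err_bigo landau_o.big.mult_in_1 p2 landau_o.big.cmult) (use p2 pw_pred_err_bigo in auto)
  moreover have "ode_rhs \<alpha> n l - (- (\<alpha> / 2 * (real n + 1))) * pw (\<alpha> + 1) l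
     = ((\<alpha> - real n) / 2 * ?k) * pw (\<alpha> + 2) l + (\<alpha> - real n) / 2 * ?e l - real l * ?e l" for l
  proof -
    have pp: "pw \<alpha> (l - 1) = pw \<alpha> l + \<alpha> * pw (\<alpha> + 1) l + ?k * pw (\<alpha> + 2) l + ?e l" by (simp add: pw_pred_err_def)
    have m: "pw \<alpha> l = real l * pw (\<alpha> + 1) l" "pw (\<alpha> + 1) l = real l * pw (\<alpha> + 2) l"
    proof -
      have "\<alpha> + 1 - 1 = \<alpha>" "\<alpha> + 2 - 1 = \<alpha> + 1" by simp_all
      thus "pw \<alpha> l = real l * pw (\<alpha> + 1) l" "pw (\<alpha> + 1) l = real l * pw (\<alpha> + 2) l"
        using pw_mult[of l "\<alpha> + 1"] pw_mult[of l "\<alpha> + 2"] by (simp_all only:)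
    qed
    show ?thesis unfolding ode_rhs_def avg_pw_def pp unfolding m(1) unfolding m(2) by (simp add: field_simps)
  qed
  ultimately show ?thesis unfolding e by (simp only:)
qed

lemma avg_diff_bigo:
  "(\<lambda>l. (avg_pw \<alpha> l - pw \<alpha> l) - (\<alpha> / 2) * pw (\<alpha> + 1) l) \<in> O(\<lambda>l. real l powr (-(\<alpha> + 1 + 1)))"
proof -
  have e: "\<alpha> + 1 + 1 = \<alpha> + 2" by simp
  have "(\<lambda>l. (\<alpha> * (\<alpha> + 1) / 4) * pw (\<alpha> + 2) l + (1 / 2) * pw_pred_err \<alpha> l) \<in> O(\<lambda>l. real l powr (-(\<alpha> + 2)))"
    by (intro sum_in_bigo) (use pw_bigo[of "\<alpha> + 2"] pw_pred_err_bigo in auto)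
  moreover have "(avg_pw \<alpha> l - pw \<alpha> l) - (\<alpha> / 2) * pw (\<alpha> + 1) l = (\<alpha> * (\<alpha> + 1) / 4) * pw (\<alpha> + 2) l + (1 / 2) * pw_pred_err \<alpha> l" for l
    unfolding avg_pw_def pw_pred_err_def by (simp add: field_simps)
  ultimately show ?thesis unfolding e by (simp only:)
qed

lemma expand_bigo:
  assumes "(\<lambda>l. h l - c * pw \<epsilon> l) \<in> O(\<lambda>l. real l powr (-(\<epsilon> + 1)))"
  shows "h \<in> O(\<lambda>l. real l powr (-\<epsilon>))"
proof -
  have "(\<lambda>l. (h l - c * pw \<epsilon> l) + c * pw \<epsilon> l) \<in> O(\<lambda>l. real l powr (-\<epsilon>))"
    by (intro sum_in_bigo bigo_powr_weaken[OF assms]) (use pw_bigo[of \<epsilon>] in auto)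
  thus ?thesis by simp
qed

text \<open>A closed form that produces the zeta value: \<open>M * pw \<alpha> M\<close> is exactly
  the correction needed to make the divergent partial sums of \<open>pw \<alpha>\<close>
  converge.\<close>

lemma ode_rhs_partial_sum:
  "(\<Sum>l\<le>M. ode_rhs \<alpha> n l) = (\<alpha> - 1) * (\<Sum>l<M. pw \<alpha> l) + (real M + real n / 2 + \<alpha> / 2) * pw \<alpha> M"
  by (induction M) (simp_all add: ode_rhs_def avg_pw_def field_simps)

lemma avg_diff_partial_sum:
  "(\<Sum>l\<le>M. avg_pw \<alpha> l - pw \<alpha> l) = - pw \<alpha> M / 2"
  "(\<Sum>l\<le>M. (-1) ^ l * (avg_pw \<alpha> l - pw \<alpha> l)) = - (\<Sum>l<M. (-1) ^ l * pw \<alpha> l) - (-1) ^ M * pw \<alpha> M / 2"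
  by (induction M) (simp_all add: avg_pw_def field_simps)

text \<open>The alternating sum of the averages telescopes to 0 and the plain sum of the differences
  does too. Averaging thus leaves the non-oscillating leading term unchanged and moves the
  alternating sum of \<open>pw\<close> entirely into the difference.\<close>

lemma pw_alternating_sums:
  assumes "\<alpha> > 0"
  shows "(\<lambda>l. (-1) ^ l * pw \<alpha> l) sums (- (\<Sum>l. (-1) ^ l * (avg_pw \<alpha> l - pw \<alpha> l)))"
    and "(\<Sum>l. avg_pw \<alpha> l - pw \<alpha> l) = 0"
proof -
  have d: "(\<lambda>l. avg_pw \<alpha> l - pw \<alpha> l) \<in> O(\<lambda>l. real l powr (-(\<alpha> + 1)))" by (rule expand_bigo[OF avg_diff_bigo])
  have s: "summable (\<lambda>l. avg_pw \<alpha> l - pw \<alpha> l)" "summable (\<lambda>l. (-1) ^ l * (avg_pw \<alpha> l - pw \<alpha> l))"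
    using bigo_summable[OF d] assms by auto
  have p0: "pw \<alpha> \<longlonglongrightarrow> 0" by (rule pw_tendsto_0[OF assms])
  have p1: "(\<lambda>M. (-1) ^ M * pw \<alpha> M / 2) \<longlonglongrightarrow> 0"
  proof (rule tendsto_rabs_zero_cancel)
    show "(\<lambda>M. \<bar>(-1) ^ M * pw \<alpha> M / 2\<bar>) \<longlonglongrightarrow> 0"
      using tendsto_divide_zero[OF tendsto_rabs_zero[OF p0], of 2] by (simp add: abs_mult)
  qed
  have "(\<lambda>M. - (\<Sum>l\<le>M. (-1) ^ l * (avg_pw \<alpha> l - pw \<alpha> l)) - (-1) ^ M * pw \<alpha> M / 2) \<longlonglongrightarrow> - (\<Sum>l. (-1) ^ l * (avg_pw \<alpha> l - pw \<alpha> l)) - 0"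
    using summable_sums[OF s(2)] by (intro tendsto_diff tendsto_minus p1) (simp add: sums_def_le)
  thus "(\<lambda>l. (-1) ^ l * pw \<alpha> l) sums (- (\<Sum>l. (-1) ^ l * (avg_pw \<alpha> l - pw \<alpha> l)))"
    unfolding avg_diff_partial_sum(2) sums_def by simp
  have "(\<lambda>M. \<Sum>l\<le>M. avg_pw \<alpha> l - pw \<alpha> l) \<longlonglongrightarrow> (\<Sum>l. avg_pw \<alpha> l - pw \<alpha> l)"
    using summable_sums[OF s(1)] by (simp add: sums_def_le)
  moreover have "(\<lambda>M. \<Sum>l\<le>M. avg_pw \<alpha> l - pw \<alpha> l) \<longlonglongrightarrow> 0"
    unfolding avg_diff_partial_sum(1) using tendsto_divide[OF tendsto_minus[OF p0] tendsto_const[of 2]] by simp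
  ultimately show "(\<Sum>l. avg_pw \<alpha> l - pw \<alpha> l) = 0" using LIMSEQ_unique by blast
qed

text \<open>The total is \<open>\<alpha> - 1\<close> times the regularised sum of
  \<open>pw \<alpha>\<close>, whatever \<open>n\<close> is. At \<open>\<alpha> = 1\<close> only the
  correction term survives, with value 1, the residue of the zeta function; this is the source of
  \<open>ln r / r\<close>.\<close>

lemma ode_rhs_sum:
  assumes "0 < \<alpha>"
  shows "\<alpha> = 1 \<Longrightarrow> (\<Sum>l. ode_rhs \<alpha> n l) = 1"
    and "\<alpha> \<noteq> 1 \<Longrightarrow> (\<lambda>M. (\<Sum>l<M. pw \<alpha> l) - real M powr (1 - \<alpha>) / (1 - \<alpha>)) \<longlonglongrightarrow> (\<Sum>l. ode_rhs \<alpha> n l) / (\<alpha> - 1)"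
proof -
  have s: "summable (ode_rhs \<alpha> n)"
    using bigo_summable[OF expand_bigo[OF ode_rhs_bigo[of \<alpha> n]]] assms by auto
  have lim: "(\<lambda>M. \<Sum>l\<le>M. ode_rhs \<alpha> n l) \<longlonglongrightarrow> (\<Sum>l. ode_rhs \<alpha> n l)"
    using summable_sums[OF s] by (simp add: sums_def_le)
  have p0: "pw \<alpha> \<longlonglongrightarrow> 0" by (rule pw_tendsto_0[OF assms])
  have Mp: "real M * pw \<alpha> M = real M powr (1 - \<alpha>)" if "M \<ge> 1" for M
    using that by (simp add: pw_def powr_diff powr_minus field_simps)
  have "(\<lambda>M. (\<Sum>l\<le>M. ode_rhs \<alpha> n l) - (real n / 2 + \<alpha> / 2) * pw \<alpha> M) \<longlonglongrightarrow> (\<Sum>l. ode_rhs \<alpha> n l) - (real n / 2 + \<alpha> / 2) * 0"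
    by (intro tendsto_intros lim p0)
  hence A: "(\<lambda>M. (\<Sum>l\<le>M. ode_rhs \<alpha> n l) - (real n / 2 + \<alpha> / 2) * pw \<alpha> M) \<longlonglongrightarrow> (\<Sum>l. ode_rhs \<alpha> n l)" by simp
  have B: "\<forall>\<^sub>F M in sequentially. (\<Sum>l\<le>M. ode_rhs \<alpha> n l) - (real n / 2 + \<alpha> / 2) * pw \<alpha> M = (\<alpha> - 1) * (\<Sum>l<M. pw \<alpha> l) + real M powr (1 - \<alpha>)"
    using eventually_ge_at_top[of 1]
  proof eventually_elim
    case (elim M)
    show ?case unfolding ode_rhs_partial_sum Mp[OF elim, symmetric] by (simp add: algebra_simps)
  qed
  have C: "(\<lambda>M. (\<alpha> - 1) * (\<Sum>l<M. pw \<alpha> l) + real M powr (1 - \<alpha>)) \<longlonglongrightarrow> (\<Sum>l. ode_rhs \<alpha> n l)"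
    by (rule Lim_transform_eventually[OF A B])
  show "(\<Sum>l. ode_rhs \<alpha> n l) = 1" if "\<alpha> = 1"
  proof -
    have "\<forall>\<^sub>F M in sequentially. (\<alpha> - 1) * (\<Sum>l<M. pw \<alpha> l) + real M powr (1 - \<alpha>) = 1"
      using eventually_ge_at_top[of 1] by eventually_elim (use that in simp)
    from Lim_transform_eventually[OF C this] have "(\<lambda>M::nat. 1) \<longlonglongrightarrow> (\<Sum>l. ode_rhs \<alpha> n l)" .
    thus ?thesis by (metis LIMSEQ_const_iff)
  qed
  show "(\<lambda>M. (\<Sum>l<M. pw \<alpha> l) - real M powr (1 - \<alpha>) / (1 - \<alpha>)) \<longlonglongrightarrow> (\<Sum>l. ode_rhs \<alpha> n l) / (\<alpha> - 1)" if "\<alpha> \<noteq> 1"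
  proof -
    have "(\<lambda>M. ((\<alpha> - 1) * (\<Sum>l<M. pw \<alpha> l) + real M powr (1 - \<alpha>)) / (\<alpha> - 1)) \<longlonglongrightarrow> (\<Sum>l. ode_rhs \<alpha> n l) / (\<alpha> - 1)"
      by (intro tendsto_divide C tendsto_const) (use that in auto)
    moreover have "((\<alpha> - 1) * S + Q) / (\<alpha> - 1) = S - Q / (1 - \<alpha>)" for S Q :: real
    proof -
      have "Q / (1 - \<alpha>) = - (Q / (\<alpha> - 1))" by (metis minus_diff_eq minus_divide_right)
      thus ?thesis using that by (simp add: add_divide_distrib)
    qed
    ultimately show ?thesis by (simp only:)
  qed
qed

text \<open>The primitive of \<open>r powr (\<alpha> - 2)\<close>, which the integrating factor
  \<open>r powr \<alpha>\<close> makes out of a right-hand side of order \<open>1/r\<close>.\<close>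

definition ode_profile :: "real \<Rightarrow> real \<Rightarrow> real" where
  "ode_profile \<alpha> r = (if \<alpha> = 1 then ln r else r powr (\<alpha> - 1) / (\<alpha> - 1))"

lemma ode_profile_deriv:
  "r > 0 \<Longrightarrow> (ode_profile \<alpha> has_real_derivative r powr (\<alpha> - 2)) (at r)"
proof (cases "\<alpha> = 1")
  case True
  assume "r > 0"
  moreover have "ode_profile \<alpha> = ln" using True by (auto simp: ode_profile_def)
  ultimately show ?thesis using True DERIV_ln_divide[of r] by (simp add: powr_minus_divide)
next
  case False
  assume r: "r > 0"
  have "((\<lambda>r. r powr (\<alpha> - 1) / (\<alpha> - 1)) has_real_derivative ((\<alpha> - 1) * r powr (\<alpha> - 1 - 1)) / (\<alpha> - 1)) (at r)"
    using r by (auto intro!: derivative_eq_intros)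
  moreover have "ode_profile \<alpha> = (\<lambda>r. r powr (\<alpha> - 1) / (\<alpha> - 1))" using False by (auto simp: ode_profile_def)
  ultimately show ?thesis using False by simp
qed

text \<open>The differential equation is solved with the integrating factor
  \<open>r powr \<alpha>\<close>. Once the primitives of the leading terms are subtracted, the
  derivative is integrable with a rate; the limit \<open>L\<close> is the still unknown constant of
  the homogeneous solution.\<close>

lemma bsum_avg_asymp:
  assumes \<alpha>: "0 < \<alpha>" "\<alpha> \<le> 1" and \<theta>: "1 < \<theta>" "\<theta> < 2" "\<theta> \<le> \<alpha> + 1"
  shows "\<exists>L. (\<lambda>r. bsum n (avg_pw \<alpha>) r - L * r powr (-\<alpha>) - cn n * (\<Sum>l. ode_rhs \<alpha> n l) / pi * (ode_profile \<alpha> r * r powr (-\<alpha>)))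
     \<in> O[at_top](\<lambda>r. r powr (-\<theta>))"
proof -
  define H B where "H = (\<Sum>l. ode_rhs \<alpha> n l)" and "B = (\<Sum>l. (-1) ^ l * ode_rhs \<alpha> n l)"
  define g where "g = avg_pw \<alpha>"
  define cs where "cs = (\<lambda>r. cos (2 * r - real n * pi / 2))"
  have f: "exp_bdd (\<lambda>l. 1 / 2 * pw \<alpha> l)" by (intro exp_bdd_cmult exp_bdd_pw)
  have rhs: "exp_bdd (ode_rhs \<alpha> n)"
    using bigo_exp_bdd[OF expand_bigo[OF ode_rhs_bigo[of \<alpha> n]]] \<alpha> by simp
  have g_deriv: "(bsum n g has_real_derivative (bsum n (ode_rhs \<alpha> n) r - \<alpha> * bsum n g r) / r) (at r)" if "r > 0" for r
  proof -
    have "(bsum n g has_real_derivative bsum n (\<lambda>l. (2 * real l + real n) * (1 / 2 * pw \<alpha> l - 1 / 2 * pw \<alpha> (l - 1))) r / r) (at r)"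
      using bsum_ode[OF f, of r n] that by (simp add: g_def avg_pw_def[abs_def])
    moreover have "bsum n (\<lambda>l. (2 * real l + real n) * (1 / 2 * pw \<alpha> l - 1 / 2 * pw \<alpha> (l - 1))) r = bsum n (ode_rhs \<alpha> n) r - \<alpha> * bsum n g r"
    proof -
      have "(\<lambda>l. (2 * real l + real n) * (1 / 2 * pw \<alpha> l - 1 / 2 * pw \<alpha> (l - 1))) = (\<lambda>l. ode_rhs \<alpha> n l - \<alpha> * g l)"
        by (simp add: ode_rhs_def g_def)
      thus ?thesis using bsum_diff[OF rhs exp_bdd_cmult[OF exp_bdd_avg_pw], of n \<alpha> \<alpha> r] bsum_cmult[OF exp_bdd_avg_pw, of n \<alpha> \<alpha> r]
        by (simp add: g_def)
    qed
    ultimately show ?thesis by (simp only:)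
  qed
  \<comment> \<open>The last summand removes the oscillating part of the right-hand side: one
    integration by parts of \<open>sn n r * r powr (\<alpha> - 2)\<close> leaves only
    \<open>r powr (\<alpha> - 3)\<close>.\<close>
  define Y where "Y = (\<lambda>r. r powr \<alpha> * bsum n g r - cn n * H / pi * ode_profile \<alpha> r + B / (2 * pi) * (r powr (\<alpha> - 2) * cs r))"
  define Y' where "Y' = (\<lambda>r. r powr (\<alpha> - 1) * berr n (ode_rhs \<alpha> n) r + B / (2 * pi) * ((\<alpha> - 2) * r powr (\<alpha> - 3) * cs r))"
  have Y: "(Y has_real_derivative Y' r) (at r)" if r: "r > 0" for r
  proof -
    have pr: "((\<lambda>r. r powr s) has_real_derivative s * r powr (s - 1)) (at r)" for s
      using r by (auto intro!: derivative_eq_intros)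
    have c: "(cs has_real_derivative - 2 * sn n r) (at r)"
      unfolding cs_def sn_def by (auto intro!: derivative_eq_intros)
    have "(Y has_real_derivative
        ((\<alpha> * r powr (\<alpha> - 1) * bsum n g r + (bsum n (ode_rhs \<alpha> n) r - \<alpha> * bsum n g r) / r * r powr \<alpha>)
          - cn n * H / pi * r powr (\<alpha> - 2)
          + B / (2 * pi) * (((\<alpha> - 2) * r powr (\<alpha> - 2 - 1)) * cs r + (- 2 * sn n r) * r powr (\<alpha> - 2)))) (at r)"
      unfolding Y_def by (intro DERIV_add DERIV_diff DERIV_mult DERIV_cmult pr c g_deriv[OF r] ode_profile_deriv[OF r])
    moreover have "\<alpha> * r powr (\<alpha> - 1) * bsum n g r + (bsum n (ode_rhs \<alpha> n) r - \<alpha> * bsum n g r) / r * r powr \<alpha>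
          - cn n * H / pi * r powr (\<alpha> - 2)
          + B / (2 * pi) * (((\<alpha> - 2) * r powr (\<alpha> - 2 - 1)) * cs r + (- 2 * sn n r) * r powr (\<alpha> - 2)) = Y' r"
    proof -
      define k q where "k = cn n * H / pi" and "q = B / (2 * pi)"
      have h0: "\<alpha> - 2 - 1 = \<alpha> - 3" by simp
      have h1: "(bsum n (ode_rhs \<alpha> n) r - \<alpha> * bsum n g r) / r * r powr \<alpha> = (bsum n (ode_rhs \<alpha> n) r - \<alpha> * bsum n g r) * r powr (\<alpha> - 1)"
        using r by (simp add: powr_diff)
      have "bsum n (ode_rhs \<alpha> n) r = berr n (ode_rhs \<alpha> n) r + (k + 2 * sn n r * q) / r"
        by (simp add: berr_def blead_def H_def B_def k_def q_def add_divide_distrib)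
      moreover have "r powr (\<alpha> - 2) = r powr (\<alpha> - 1) / r"
      proof -
        have "r powr (\<alpha> - 1 - 1) = r powr (\<alpha> - 1) / r" using r by (subst powr_diff) simp
        thus ?thesis by simp
      qed
      ultimately have h2: "r powr (\<alpha> - 1) * bsum n (ode_rhs \<alpha> n) r = r powr (\<alpha> - 1) * berr n (ode_rhs \<alpha> n) r + (k + 2 * sn n r * q) * r powr (\<alpha> - 2)"
        by (simp add: distrib_left) (simp add: algebra_simps)
      show ?thesis unfolding Y'_def h0 h1 k_def[symmetric] q_def[symmetric] using h2 by algebra
    qed
    ultimately show ?thesis by (simp only:)
  qed
  have "berr n (ode_rhs \<alpha> n) \<in> O[at_top](\<lambda>r. r powr (-\<theta>))"
    by (rule berr_expand[OF ode_rhs_bigo]) (use \<alpha> \<theta> in auto)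
  then obtain K where K: "K > 0" "\<forall>\<^sub>F r in at_top. norm (berr n (ode_rhs \<alpha> n) r) \<le> K * norm (r powr (-\<theta>))"
    using landau_o.bigE by blast
  then obtain R0 where R0: "\<And>r. r \<ge> R0 \<Longrightarrow> \<bar>berr n (ode_rhs \<alpha> n) r\<bar> \<le> K * r powr (-\<theta>)"
    unfolding eventually_at_top_linorder by auto
  define R where "R = max 1 R0"
  define p where "p = \<theta> - \<alpha>"
  have p: "p > 0" using \<alpha> \<theta> by (simp add: p_def)
  define K2 where "K2 = K + \<bar>B / (2 * pi) * (\<alpha> - 2)\<bar>"
  have bd: "\<bar>Y' r\<bar> \<le> K2 * r powr (- p - 1)" if r: "r \<ge> R" for r
  proof -
    have r1: "r \<ge> 1" "r \<ge> R0" using r by (auto simp: R_def)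
    have "\<bar>r powr (\<alpha> - 1) * berr n (ode_rhs \<alpha> n) r\<bar> \<le> r powr (\<alpha> - 1) * (K * r powr (-\<theta>))"
      unfolding abs_mult using R0[OF r1(2)] by (intro mult_mono) auto
    also have "\<dots> = K * r powr (- p - 1)"
    proof -
      have "- p - 1 = (\<alpha> - 1) + (-\<theta>)" by (simp add: p_def)
      thus ?thesis by (simp only: powr_add mult_ac)
    qed
    finally have 1: "\<bar>r powr (\<alpha> - 1) * berr n (ode_rhs \<alpha> n) r\<bar> \<le> K * r powr (- p - 1)" .
    have "\<bar>B / (2 * pi) * ((\<alpha> - 2) * r powr (\<alpha> - 3) * cs r)\<bar> = \<bar>B / (2 * pi) * (\<alpha> - 2)\<bar> * r powr (\<alpha> - 3) * \<bar>cs r\<bar>"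
      by (simp add: abs_mult)
    also have "\<dots> \<le> \<bar>B / (2 * pi) * (\<alpha> - 2)\<bar> * r powr (- p - 1) * 1"
      using r1 \<theta> by (intro mult_mono powr_mono) (auto simp: cs_def p_def)
    finally have 2: "\<bar>B / (2 * pi) * ((\<alpha> - 2) * r powr (\<alpha> - 3) * cs r)\<bar> \<le> \<bar>B / (2 * pi) * (\<alpha> - 2)\<bar> * r powr (- p - 1)" by simp
    show ?thesis unfolding Y'_def K2_def distrib_right
      by (rule order_trans[OF abs_triangle_ineq add_mono[OF 1 2]])
  qed
  obtain L where L: "\<And>r. r \<ge> R \<Longrightarrow> \<bar>Y r - L\<bar> \<le> K2 / p * r powr (- p)"
  proof (rule convergence_rate[of R p K2 Y Y'])
    show "(Y has_real_derivative Y' x) (at x)" if "x \<ge> R" for x using Y[of x] that by (simp add: R_def)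
    show "\<bar>Y' x\<bar> \<le> K2 * x powr (- p - 1)" if "x \<ge> R" for x by (rule bd[OF that])
  qed (use p K in \<open>auto simp: R_def K2_def\<close>)
  have "(\<lambda>r. Y r - L) \<in> O[at_top](\<lambda>r. r powr (-p))"
    by (rule landau_o.bigI[of "K2 / p + 1"])
       (use p K L in \<open>auto simp: K2_def add_pos_nonneg intro!: add_nonneg_pos eventually_mono[OF eventually_ge_at_top[of R]] order_trans[OF L] mult_right_mono\<close>)
  moreover have "(\<lambda>r::real. r powr (-\<alpha>)) \<in> O[at_top](\<lambda>r. r powr (-\<alpha>))" by simp
  ultimately have "(\<lambda>r. r powr (-\<alpha>) * (Y r - L)) \<in> O[at_top](\<lambda>r. r powr (-\<alpha>) * r powr (-p))" using landau_o.big.mult by blast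
  moreover have "r powr (-\<alpha>) * r powr (-p) = r powr (-\<theta>)" for r :: real
    unfolding powr_add[symmetric] by (simp add: p_def)
  ultimately have 1: "(\<lambda>r. r powr (-\<alpha>) * (Y r - L)) \<in> O[at_top](\<lambda>r. r powr (-\<theta>))" by simp
  have 2: "(\<lambda>r. B / (2 * pi) * (r powr (-2) * cs r)) \<in> O[at_top](\<lambda>r. r powr (-\<theta>))"
  proof (rule landau_o.bigI[of "\<bar>B / (2 * pi)\<bar> + 1"])
    show "\<forall>\<^sub>F r in at_top. norm (B / (2 * pi) * (r powr (-2) * cs r)) \<le> (\<bar>B / (2 * pi)\<bar> + 1) * norm (r powr (-\<theta>))"
      using eventually_ge_at_top[of "1::real"]
    proof eventually_elim
      case (elim r)
      have "norm (B / (2 * pi) * (r powr (-2) * cs r)) \<le> \<bar>B / (2 * pi)\<bar> * (r powr (-\<theta>) * 1)"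
      proof -
        have "r powr (-2) \<le> r powr (-\<theta>)" using elim \<theta> by (intro powr_mono) auto
        hence "\<bar>r powr (-2) * cs r\<bar> \<le> r powr (-\<theta>) * 1" unfolding abs_mult by (intro mult_mono) (auto simp: cs_def)
        thus ?thesis unfolding real_norm_def abs_mult[of "B / (2 * pi)"] by (rule mult_left_mono) simp
      qed
      also have "\<dots> \<le> (\<bar>B / (2 * pi)\<bar> + 1) * norm (r powr (-\<theta>))" unfolding distrib_right by simp
      finally show ?case .
    qed
  qed (intro add_nonneg_pos abs_ge_zero zero_less_one)
  have "(\<lambda>r. r powr (-\<alpha>) * (Y r - L) - B / (2 * pi) * (r powr (-2) * cs r)) \<in> O[at_top](\<lambda>r. r powr (-\<theta>))"
    by (rule sum_in_bigo(2)[OF 1 2])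
  moreover have "\<forall>\<^sub>F r in at_top. r powr (-\<alpha>) * (Y r - L) - B / (2 * pi) * (r powr (-2) * cs r)
     = bsum n (avg_pw \<alpha>) r - L * r powr (-\<alpha>) - cn n * H / pi * (ode_profile \<alpha> r * r powr (-\<alpha>))"
    using eventually_gt_at_top[of "0::real"]
  proof eventually_elim
    case (elim r)
    have "r powr (-\<alpha>) * r powr \<alpha> = 1" "r powr (-\<alpha>) * r powr (\<alpha> - 2) = r powr (-2)"
      using elim by (simp_all add: powr_add[symmetric])
    thus ?case unfolding Y_def g_def[symmetric] by algebra
  qed
  ultimately show ?thesis unfolding H_def[symmetric] by (intro exI[of _ L]) (rule bigo_ev_cong)
qed

text \<open>Averaging changes the weights by something that decays one power faster and is covered
  by \<open>berr_expand\<close>; its alternating sum is what reappears in the \<open>blead\<close>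
  term.\<close>

lemma bsum_pw_low:
  assumes \<alpha>: "0 < \<alpha>" "\<alpha> \<le> 1" and \<theta>: "1 < \<theta>" "\<theta> < 2" "\<theta> \<le> \<alpha> + 1"
  shows "\<exists>L. (\<lambda>r. bsum n (pw \<alpha>) r - L * r powr (-\<alpha>) - cn n * (\<Sum>l. ode_rhs \<alpha> n l) / pi * (ode_profile \<alpha> r * r powr (-\<alpha>))
       - blead n 0 (\<Sum>l. (-1) ^ l * pw \<alpha> l) r) \<in> O[at_top](\<lambda>r. r powr (-\<theta>))"
proof -
  define d where "d = (\<lambda>l. avg_pw \<alpha> l - pw \<alpha> l)"
  obtain L where L: "(\<lambda>r. bsum n (avg_pw \<alpha>) r - L * r powr (-\<alpha>) - cn n * (\<Sum>l. ode_rhs \<alpha> n l) / pi * (ode_profile \<alpha> r * r powr (-\<alpha>)))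
     \<in> O[at_top](\<lambda>r. r powr (-\<theta>))" using bsum_avg_asymp[OF assms] by blast
  have "berr n d \<in> O[at_top](\<lambda>r. r powr (-\<theta>))"
    unfolding d_def by (rule berr_expand[OF avg_diff_bigo]) (use \<alpha> \<theta> in auto)
  from sum_in_bigo(2)[OF L this]
  have "(\<lambda>r. bsum n (avg_pw \<alpha>) r - L * r powr (-\<alpha>) - cn n * (\<Sum>l. ode_rhs \<alpha> n l) / pi * (ode_profile \<alpha> r * r powr (-\<alpha>)) - berr n d r)
     \<in> O[at_top](\<lambda>r. r powr (-\<theta>))" .
  moreover have E: "bsum n (avg_pw \<alpha>) r - berr n d r = bsum n (pw \<alpha>) r - blead n 0 (\<Sum>l. (-1) ^ l * pw \<alpha> l) r" for r
  proof -
    have "(\<Sum>l. (-1) ^ l * pw \<alpha> l) = - (\<Sum>l. (-1) ^ l * d l)" using pw_alternating_sums(1)[OF \<alpha>(1)] by (simp add: sums_iff d_def)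
    moreover have "(\<Sum>l. d l) = 0" using pw_alternating_sums(2)[OF \<alpha>(1)] by (simp add: d_def)
    moreover have "bsum n d r = bsum n (avg_pw \<alpha>) r - bsum n (pw \<alpha>) r" unfolding d_def by (rule bsum_diff[OF exp_bdd_avg_pw exp_bdd_pw])
    ultimately show ?thesis by (simp add: berr_def blead_def)
  qed
  hence "bsum n (avg_pw \<alpha>) r - L * r powr (-\<alpha>) - cn n * (\<Sum>l. ode_rhs \<alpha> n l) / pi * (ode_profile \<alpha> r * r powr (-\<alpha>)) - berr n d r
     = bsum n (pw \<alpha>) r - L * r powr (-\<alpha>) - cn n * (\<Sum>l. ode_rhs \<alpha> n l) / pi * (ode_profile \<alpha> r * r powr (-\<alpha>)) - blead n 0 (\<Sum>l. (-1) ^ l * pw \<alpha> l) r" for r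
    using E[of r] by linarith
  ultimately have "(\<lambda>r. bsum n (pw \<alpha>) r - L * r powr (-\<alpha>) - cn n * (\<Sum>l. ode_rhs \<alpha> n l) / pi * (ode_profile \<alpha> r * r powr (-\<alpha>)) - blead n 0 (\<Sum>l. (-1) ^ l * pw \<alpha> l) r)
     \<in> O[at_top](\<lambda>r. r powr (-\<theta>))" by (simp only:)
  thus ?thesis by blast
qed

section \<open>The arcsine law\<close>

text \<open>Central factorials are the polynomials on which the second difference acts like a derivative,
  so their sums against \<open>J\<^sub>l\<^sup>2\<close> are exact powers of \<open>r\<close>.\<close>

fun cfact :: "nat \<Rightarrow> real \<Rightarrow> real" where
  "cfact 0 x = 1"
| "cfact (Suc p) x = cfact p x * (x ^ 2 - real p ^ 2)"

text \<open>The two identities need each other: multiplying by the next quadratic factor mixes the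
  second difference with \<open>x\<close> times the central difference, so they are proved in one
  induction.\<close>

lemma cfact_differences:
  "cfact (Suc p) (x + 1) - 2 * cfact (Suc p) x + cfact (Suc p) (x - 1) = 2 * (real p + 1) * (2 * real p + 1) * cfact p x
   \<and> x * (cfact (Suc p) (x + 1) - cfact (Suc p) (x - 1))
     = 4 * (real p + 1) * cfact (Suc p) x + 2 * (real p + 1) * (2 * real p + 1) * real p * cfact p x"
proof (induction p)
  case 0
  show ?case by (simp add: power2_eq_square algebra_simps)
next
  case (Suc p)
  define f g where "f = cfact (Suc p)" and "g = cfact p"
  define q where "q = real p"
  have A: "f (x + 1) - 2 * f x + f (x - 1) = 2 * (q + 1) * (2 * q + 1) * g x"
    and B: "x * (f (x + 1) - f (x - 1)) = 4 * (q + 1) * f x + 2 * (q + 1) * (2 * q + 1) * q * g x"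
    using Suc by (auto simp: f_def g_def q_def)
  have fg: "f x = g x * (x ^ 2 - q ^ 2)" by (simp add: f_def g_def q_def)
  have F: "cfact (Suc (Suc p)) y = f y * (y ^ 2 - (q + 1) ^ 2)" for y by (simp add: f_def q_def add.commute)
  have r: "real (Suc p) = q + 1" by (simp add: q_def)
  show ?case unfolding F r f_def[symmetric]
  proof
    show "f (x + 1) * ((x + 1) ^ 2 - (q + 1) ^ 2) - 2 * (f x * (x ^ 2 - (q + 1) ^ 2)) + f (x - 1) * ((x - 1) ^ 2 - (q + 1) ^ 2)
      = 2 * (q + 1 + 1) * (2 * (q + 1) + 1) * f x"
      using A B fg by algebra
    show "x * (f (x + 1) * ((x + 1) ^ 2 - (q + 1) ^ 2) - f (x - 1) * ((x - 1) ^ 2 - (q + 1) ^ 2))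
      = 4 * (q + 1 + 1) * (f x * (x ^ 2 - (q + 1) ^ 2)) + 2 * (q + 1 + 1) * (2 * (q + 1) + 1) * (q + 1) * f x"
      using A B fg by algebra
  qed
qed

lemma cfact_even: "cfact p (- x) = cfact p x"
  by (induction p) auto

lemma cfact_Suc_0: "cfact (Suc p) 0 = 0"
  by (induction p) auto

lemma exp_bdd_cfact: "exp_bdd (\<lambda>l. cfact p (real l))"
  by (induction p) (auto intro!: exp_bdd_intros)

text \<open>Expectation under the probability weights \<open>J_0^2\<close> at 0 and
  \<open>2 J_l^2\<close> at \<open>l > 0\<close>; halving at the origin reflects the symmetry of the
  squares in the order.\<close>

definition wsum :: "(nat \<Rightarrow> real) \<Rightarrow> real \<Rightarrow> real" where
  "wsum h r = 2 * bsum 0 h r - h 0 * bprod 0 0 r"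

lemma wsum_add: "exp_bdd f \<Longrightarrow> exp_bdd g \<Longrightarrow> wsum (\<lambda>l. f l + g l) r = wsum f r + wsum g r"
  by (simp add: wsum_def bsum_add algebra_simps)
lemma wsum_cmult: "exp_bdd f \<Longrightarrow> wsum (\<lambda>l. c * f l) r = c * wsum f r"
  by (simp add: wsum_def bsum_cmult algebra_simps)
lemma wsum_1: "wsum (\<lambda>_. 1) r = 1"
  using bessel_J_sum_squares[of r] by (simp add: wsum_def)

lemma wsum_nonneg:
  assumes "exp_bdd h" "\<And>l. h l \<ge> 0"
  shows "wsum h r \<ge> 0"
proof -
  have s: "summable (\<lambda>l. h l * bprod 0 l r)" by (rule summable_bprod[OF assms(1)])
  have nn: "h l * bprod 0 l r \<ge> 0" for l using assms(2)[of l] by (simp add: bprod_def)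
  have "(\<Sum>l\<in>{0}. h l * bprod 0 l r) \<le> bsum 0 h r"
    unfolding bsum_def by (rule sum_le_suminf[OF s]) (use nn in auto)
  thus ?thesis using nn[of 0] by (simp add: wsum_def)
qed

lemma wsum_mono:
  assumes "exp_bdd f" "exp_bdd g" "\<And>l. f l \<le> g l"
  shows "wsum f r \<le> wsum g r"
proof -
  have "wsum (\<lambda>l. g l + (- 1) * f l) r \<ge> 0" by (rule wsum_nonneg) (use assms in \<open>auto intro!: exp_bdd_intros\<close>)
  also have "wsum (\<lambda>l. g l + (- 1) * f l) r = wsum g r + (- 1) * wsum f r"
    using wsum_add[OF assms(2) exp_bdd_cmult[OF assms(1)], of "-1"] wsum_cmult[OF assms(1), of "-1"] by simp
  finally show ?thesis by simp
qed

text \<open>The moments of \<open>y = t^2\<close> when \<open>t\<close> follows the arcsine law,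
  that is for the density \<open>y powr (-1/2) * (1 - y) powr (-1/2) / pi\<close> on the unit
  interval.\<close>

definition arc_moment :: "nat \<Rightarrow> real" where
  "arc_moment p = Beta (real p + 1 / 2) (1 / 2) / pi"

lemma arc_moment_0: "arc_moment 0 = 1"
proof -
  have "sqrt pi * sqrt pi = pi" by simp
  thus ?thesis by (simp add: arc_moment_def Beta_def Gamma_one_half_real)
qed

lemma arc_moment_Suc: "arc_moment (Suc p) = (2 * real p + 1) / (2 * real p + 2) * arc_moment p"
proof -
  have "(real p + 1 / 2 + 1 / 2) * Beta (real p + 1 / 2 + 1) (1 / 2) = (real p + 1 / 2) * Beta (real p + 1 / 2) (1 / 2)"
    by (rule Beta_plus1_left) (auto elim!: nonpos_Ints_cases)
  moreover have "real (Suc p) + 1 / 2 = real p + 1 / 2 + 1" "real p + 1 / 2 + 1 / 2 = real p + 1" by simp_all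
  ultimately have "(real p + 1) * Beta (real (Suc p) + 1 / 2) (1 / 2) = (real p + 1 / 2) * Beta (real p + 1 / 2) (1 / 2)"
    by (simp only:)
  moreover have "b / pi = (2 * q + 1) / (2 * q + 2) * (a / pi)" if "(q + 1) * b = (q + 1 / 2) * a" "q \<ge> 0" for a b q :: real
  proof -
    have "(2 * q + 2) * b = (2 * q + 1) * a" "2 * q + 2 \<noteq> 0" using that by (algebra, simp)
    hence "b = (2 * q + 1) * a / (2 * q + 2)" using nonzero_eq_divide_eq[of "2 * q + 2" b "(2 * q + 1) * a"] by (metis mult.commute)
    thus ?thesis by simp
  qed
  ultimately show ?thesis unfolding arc_moment_def by simp
qed

lemma arc_moment_nonneg: "arc_moment p \<ge> 0"
  by (induction p) (auto simp: arc_moment_0 arc_moment_Suc)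

lemma arc_moment_le_1: "arc_moment p \<le> 1"
proof (induction p)
  case (Suc p)
  have "(2 * real p + 1) / (2 * real p + 2) * arc_moment p \<le> 1 * 1"
    using Suc arc_moment_nonneg by (intro mult_mono) auto
  thus ?case by (simp add: arc_moment_Suc)
qed (simp add: arc_moment_0)

lemma constant_on_pos:
  fixes f :: "real \<Rightarrow> real"
  assumes "\<And>x. isCont f x" "\<And>x. x > 0 \<Longrightarrow> (f has_real_derivative 0) (at x)" "r \<ge> 0"
  shows "f r = f 0"
proof (cases "r = 0")
  case False
  thus ?thesis using assms
    by (intro DERIV_isconst_end) (auto intro: continuous_at_imp_continuous_on)
qed simp

text \<open>Two derivatives in \<open>r\<close> turn the weight into its second difference, which
  for central factorials is a multiple of the previous one. Integrating twice from 0 gives an exact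
  power, and the factors reproduce the recursion of the arcsine moments.\<close>

lemma wsum_cfact: "r \<ge> 0 \<Longrightarrow> wsum (\<lambda>l. cfact p (real l)) r = arc_moment p * r ^ (2 * p)"
proof (induction p arbitrary: r)
  case 0
  show ?case by (simp add: wsum_1 arc_moment_0)
next
  case (Suc p)
  define f where "f = (\<lambda>l. cfact (Suc p) (real l))"
  define \<phi> where "\<phi> = (\<lambda>l. f (Suc l) - f l)"
  define c where "c = 2 * (real p + 1) * (2 * real p + 1)"
  have f: "exp_bdd f" "f 0 = 0" unfolding f_def using exp_bdd_cfact[of "Suc p"] cfact_Suc_0[of p] by simp_all
  have \<phi>: "exp_bdd \<phi>" unfolding \<phi>_def using f by (intro exp_bdd_diff exp_bdd_Suc)
  have g: "exp_bdd (\<lambda>l. cfact p (real l))" by (rule exp_bdd_cfact)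
  \<comment> \<open>At \<open>l = 0\<close> evenness makes the first difference half the second one.
    The resulting correction is the half weight at the origin, so \<open>wsum\<close> appears
    again.\<close>
  have dd: "(if l = 0 then \<phi> 0 else \<phi> l - \<phi> (l - 1)) = c * cfact p (real l) - (if l = 0 then c / 2 * cfact p 0 else 0)" for l
  proof (cases l)
    case 0
    have "cfact (Suc p) (0 + 1) - 2 * cfact (Suc p) 0 + cfact (Suc p) (0 - 1) = c * cfact p 0"
      using cfact_differences[of p 0] by (simp only: c_def)
    moreover have "cfact (Suc p) (0 - 1) = cfact (Suc p) 1" using cfact_even[of "Suc p" 1] by simp
    ultimately have "2 * cfact (Suc p) 1 = c * cfact p 0" using cfact_Suc_0[of p] by (simp del: cfact.simps)
    thus ?thesis using 0 cfact_Suc_0[of p] by (simp add: \<phi>_def f_def del: cfact.simps)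
  next
    case (Suc k)
    have "cfact (Suc p) (real l + 1) - 2 * cfact (Suc p) (real l) + cfact (Suc p) (real l - 1) = c * cfact p (real l)"
      using cfact_differences[of p "real l"] by (simp only: c_def)
    thus ?thesis using Suc by (simp add: \<phi>_def f_def add.commute del: cfact.simps)
  qed
  have single: "bsum 0 (\<lambda>l. if l = 0 then c / 2 * cfact p 0 else 0) x = c / 2 * cfact p 0 * bprod 0 0 x" for x
    unfolding bsum_def by (subst suminf_finite[of "{0}"]) auto
  have d1: "((\<lambda>x. x * bsum 1 \<phi> x) has_real_derivative c / 2 * arc_moment p * x ^ (2 * p + 1)) (at x)" if x: "x > 0" for x
  proof -
    have "((\<lambda>x. x * bsum 1 \<phi> x) has_real_derivative x * bsum 0 (\<lambda>l. c * cfact p (real l) - (if l = 0 then c / 2 * cfact p 0 else 0)) x) (at x)"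
      using bsum_1_deriv[OF \<phi>, of x] x unfolding dd by simp
    moreover have "bsum 0 (\<lambda>l. c * cfact p (real l) - (if l = 0 then c / 2 * cfact p 0 else 0)) x = c / 2 * wsum (\<lambda>l. cfact p (real l)) x"
      by (subst bsum_diff) (auto intro!: exp_bdd_intros g simp: bsum_cmult g single wsum_def algebra_simps)
    ultimately show ?thesis using Suc.IH[of x] x by (simp add: mult_ac)
  qed
  \<comment> \<open>Each of the two integrations divides by \<open>2 p + 2\<close>.\<close>
  define k where "k = c / 2 * arc_moment p / (2 * real p + 2)"
  have e1: "x * bsum 1 \<phi> x = k * x ^ (2 * p + 2)" if "x \<ge> 0" for x
  proof -
    have "(\<lambda>x. x * bsum 1 \<phi> x - k * x ^ (2 * p + 2)) x = (\<lambda>x. x * bsum 1 \<phi> x - k * x ^ (2 * p + 2)) 0"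
    proof (rule constant_on_pos[OF _ _ that])
      show "isCont (\<lambda>x. x * bsum 1 \<phi> x - k * x ^ (2 * p + 2)) y" for y
        by (intro continuous_intros DERIV_isCont[OF bsum_deriv[OF \<phi>]])
      show "((\<lambda>x. x * bsum 1 \<phi> x - k * x ^ (2 * p + 2)) has_real_derivative 0) (at y)" if "y > 0" for y
      proof -
        have "((\<lambda>x. k * x ^ (2 * p + 2)) has_real_derivative k * (real (2 * p + 2) * y ^ (2 * p + 2 - 1))) (at y)"
          unfolding One_nat_def by (rule DERIV_cmult[OF DERIV_pow])
        moreover have "k * (real (2 * p + 2) * y ^ (2 * p + 2 - 1)) = c / 2 * arc_moment p * y ^ (2 * p + 1)"
        proof -
          have "k * (2 * real p + 2) = c / 2 * arc_moment p" unfolding k_def by (rule nonzero_eq_divide_eq[THEN iffD1, OF _ refl]) linarith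
          moreover have "real (2 * p + 2) = 2 * real p + 2" "2 * p + 2 - 1 = 2 * p + 1" by simp_all
          ultimately show ?thesis by (simp only: mult.assoc[symmetric])
        qed
        ultimately have "((\<lambda>x. k * x ^ (2 * p + 2)) has_real_derivative c / 2 * arc_moment p * y ^ (2 * p + 1)) (at y)" by (simp only:)
        from DERIV_diff[OF d1[OF that] this] show ?thesis by (simp only: diff_self)
      qed
    qed
    thus ?thesis by simp
  qed
  define K where "K = k / (2 * real p + 2)"
  have "bsum 0 f r - K * r ^ (2 * p + 2) = bsum 0 f 0 - K * 0 ^ (2 * p + 2)"
  proof (rule constant_on_pos[OF _ _ Suc.prems])
    show "isCont (\<lambda>x. bsum 0 f x - K * x ^ (2 * p + 2)) y" for y
      by (intro continuous_intros DERIV_isCont[OF bsum_deriv[OF f(1)]])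
    show "((\<lambda>x. bsum 0 f x - K * x ^ (2 * p + 2)) has_real_derivative 0) (at y)" if "y > 0" for y
    proof -
      have 1: "(bsum 0 f has_real_derivative bsum 1 \<phi> y) (at y)"
        using bsum_0_deriv[OF f(1), of y] f(2) by (simp add: \<phi>_def)
      have "bsum 1 \<phi> y = k * y ^ (2 * p + 1)" using e1[of y] that by simp
      moreover have "((\<lambda>x. K * x ^ (2 * p + 2)) has_real_derivative K * (real (2 * p + 2) * y ^ (2 * p + 2 - 1))) (at y)"
        unfolding One_nat_def by (rule DERIV_cmult[OF DERIV_pow])
      moreover have "K * (real (2 * p + 2) * y ^ (2 * p + 2 - 1)) = k * y ^ (2 * p + 1)"
      proof -
        have "K * (2 * real p + 2) = k" unfolding K_def by (rule nonzero_eq_divide_eq[THEN iffD1, OF _ refl]) linarith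
        moreover have "real (2 * p + 2) = 2 * real p + 2" "2 * p + 2 - 1 = 2 * p + 1" by simp_all
        ultimately show ?thesis by (simp only: mult.assoc[symmetric])
      qed
      ultimately have "((\<lambda>x. K * x ^ (2 * p + 2)) has_real_derivative bsum 1 \<phi> y) (at y)" by (simp only:)
      from DERIV_diff[OF 1 this] show ?thesis by (simp only: diff_self)
    qed
  qed
  hence "bsum 0 f r = K * r ^ (2 * p + 2)" using f by (simp add: bsum_at_0)
  moreover have "2 * K = arc_moment (Suc p)"
  proof -
    define q where "q = real p + 1"
    have "q \<noteq> 0" by (simp add: q_def)
    moreover have "2 * real p + 2 = 2 * q" "c = 2 * q * (2 * real p + 1)" by (simp_all add: q_def c_def)
    ultimately show ?thesis by (simp add: K_def k_def arc_moment_Suc field_simps)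
  qed
  ultimately show ?case using f by (simp add: wsum_def f_def[symmetric] del: cfact.simps)
qed

text \<open>A factor \<open>l^2\<close> is exchanged for
  \<open>cfact (Suc j) + j^2 * cfact j\<close>; the second part has lower degree and disappears
  after scaling.\<close>

lemma wsum_power_cfact:
  "((\<lambda>r. wsum (\<lambda>l. real l ^ (2 * i) * cfact j (real l)) r / r ^ (2 * (i + j))) \<longlongrightarrow> arc_moment (i + j)) at_top"
proof (induction i arbitrary: j)
  case 0
  have "\<forall>\<^sub>F r in at_top. arc_moment j = wsum (\<lambda>l. real l ^ (2 * 0) * cfact j (real l)) r / r ^ (2 * (0 + j))"
    using eventually_gt_at_top[of "0::real"] by eventually_elim (simp add: wsum_cfact)
  thus ?case by (auto intro: Lim_transform_eventually[OF tendsto_const])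
next
  case (Suc i)
  have e: "exp_bdd (\<lambda>l. real l ^ (2 * i) * cfact j (real l))" for j
    by (intro exp_bdd_mult exp_bdd_power exp_bdd_of_nat exp_bdd_cfact)
  have eq: "(\<lambda>l. real l ^ (2 * Suc i) * cfact j (real l))
     = (\<lambda>l. real l ^ (2 * i) * cfact (Suc j) (real l) + real j ^ 2 * (real l ^ (2 * i) * cfact j (real l)))"
    by (simp add: algebra_simps power2_eq_square)
  have "((\<lambda>r. wsum (\<lambda>l. real l ^ (2 * i) * cfact (Suc j) (real l)) r / r ^ (2 * (i + Suc j))
      + real j ^ 2 * (wsum (\<lambda>l. real l ^ (2 * i) * cfact j (real l)) r / r ^ (2 * (i + j)) * (1 / r ^ 2)))
     \<longlongrightarrow> arc_moment (i + Suc j) + real j ^ 2 * (arc_moment (i + j) * 0)) at_top"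
  proof (intro tendsto_intros Suc.IH)
    show "((\<lambda>r::real. 1 / r ^ 2) \<longlongrightarrow> 0) at_top" by real_asymp
  qed
  moreover have "wsum (\<lambda>l. real l ^ (2 * i) * cfact (Suc j) (real l)) r / r ^ (2 * (i + Suc j))
      + real j ^ 2 * (wsum (\<lambda>l. real l ^ (2 * i) * cfact j (real l)) r / r ^ (2 * (i + j)) * (1 / r ^ 2))
     = wsum (\<lambda>l. real l ^ (2 * Suc i) * cfact j (real l)) r / r ^ (2 * (Suc i + j))" for r
    unfolding eq wsum_add[OF e exp_bdd_cmult[OF e]] wsum_cmult[OF e]
    by (simp add: add_divide_distrib power_add power2_eq_square power_mult_distrib)
  ultimately show ?case by simp
qed

lemma exp_bdd_scaled_power: "exp_bdd (\<lambda>l. ((real l / r) ^ 2) ^ p)"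
  by (intro exp_bdd_power exp_bdd_divide exp_bdd_of_nat)

lemma wsum_moment: "((\<lambda>r. wsum (\<lambda>l. ((real l / r) ^ 2) ^ p) r) \<longlongrightarrow> arc_moment p) at_top"
proof -
  have "wsum (\<lambda>l. ((real l / r) ^ 2) ^ p) r = wsum (\<lambda>l. real l ^ (2 * p) * cfact 0 (real l)) r / r ^ (2 * (p + 0))" for r
  proof -
    have "(\<lambda>l. ((real l / r) ^ 2) ^ p) = (\<lambda>l. (1 / r ^ (2 * p)) * real l ^ (2 * p))"
      by (simp add: power_divide power_mult[symmetric])
    thus ?thesis using wsum_cmult[of "\<lambda>l. real l ^ (2 * p)" "1 / r ^ (2 * p)" r]
      by (simp add: exp_bdd_power exp_bdd_of_nat)
  qed
  thus ?thesis using wsum_power_cfact[of p 0] by (simp del: cfact.simps)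
qed

definition arc_weight :: "real \<Rightarrow> real" where
  "arc_weight y = y powr (1 / 2 - 1) * (1 - y) powr (1 / 2 - 1)"

lemma arc_moment_has_integral:
  "((\<lambda>y. y ^ p * arc_weight y) has_integral pi * arc_moment p) {0..1}"
proof -
  have "((\<lambda>t. t powr (real p + 1 / 2 - 1) * (1 - t) powr (1 / 2 - 1)) has_integral Beta (real p + 1 / 2) (1 / 2)) {0..1}"
    by (rule has_integral_Beta_real) auto
  moreover have "t powr (real p + 1 / 2 - 1) * (1 - t) powr (1 / 2 - 1) = t ^ p * arc_weight t" if "t \<in> {0..1} - {0}" for t :: real
  proof -
    have "t powr (real p + 1 / 2 - 1) = t powr real p * t powr (1 / 2 - 1)" by (simp add: powr_add[symmetric])
    thus ?thesis using that by (simp add: arc_weight_def powr_realpow)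
  qed
  ultimately show ?thesis
    unfolding arc_moment_def by (subst has_integral_spike_eq[of "{0}", OF _ , symmetric]) (auto intro: negligible_sing)
qed

text \<open>Method of moments. On \<open>{0..4}\<close> the test function is approximated by a
  polynomial. Beyond 4 the difference is at most \<open>A (1/4)^k y^D\<close>, whose expectation is
  small because all limiting moments are at most 1, the limit law living on \<open>{0..1}\<close>;
  any cut above 1 would give such a geometric factor.\<close>

theorem wsum_limit:
  fixes H :: "real \<Rightarrow> real"
  assumes cont: "continuous_on {0..4} H" and bd: "\<And>y. y \<ge> 0 \<Longrightarrow> \<bar>H y\<bar> \<le> 1 + y"
    and int: "((\<lambda>y. H y * arc_weight y) has_integral pi * M) {0..1}"
  shows "((\<lambda>r. wsum (\<lambda>l. H ((real l / r) ^ 2)) r) \<longlongrightarrow> M) at_top"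
proof (rule tendstoI)
  fix \<epsilon>' :: real assume \<epsilon>': "\<epsilon>' > 0"
  \<comment> \<open>Four errors of this size add up at the end: one for the polynomial, one for its
    limit and two for the comparison function.\<close>
  define \<epsilon> where "\<epsilon> = \<epsilon>' / 5"
  have \<epsilon>: "\<epsilon> > 0" using \<epsilon>' by (simp add: \<epsilon>_def)
  obtain q where q: "real_polynomial_function q" "\<And>y. y \<in> {0..4} \<Longrightarrow> \<bar>H y - q y\<bar> < \<epsilon>"
    using Stone_Weierstrass_real_polynomial_function[OF compact_Icc cont \<epsilon>] by blast
  then obtain a n where qa: "q = (\<lambda>y. \<Sum>i\<le>n. a i * y ^ i)" using real_polynomial_function_iff_sum by blast
  define Q where "Q = (\<Sum>i\<le>n. a i * arc_moment i)"
  \<comment> \<open>For \<open>y \<ge> 1\<close> the test function is at most \<open>2 y^d\<close>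
    and the polynomial at most the sum of its absolute coefficients times
    \<open>y^d\<close>.\<close>
  define A where "A = 2 + (\<Sum>i\<le>n. \<bar>a i\<bar>)"
  have A: "A \<ge> 2" unfolding A_def by (simp add: sum_nonneg)
  obtain k where k: "A * (1 / 4) ^ k < \<epsilon> / 2"
  proof -
    have "(\<lambda>k. A * (1 / 4) ^ k) \<longlonglongrightarrow> A * 0" by (intro tendsto_intros LIMSEQ_realpow_zero) auto
    hence "\<forall>\<^sub>F k in sequentially. A * (1 / 4) ^ k < \<epsilon> / 2" using \<epsilon> by (intro order_tendstoD) auto
    thus ?thesis using that by (meson eventually_happens trivial_limit_sequentially)
  qed
  define d where "d = Suc n"
  define D where "D = d + k"
  have diff: "\<bar>H y - q y\<bar> \<le> \<epsilon> + A * (1 / 4) ^ k * y ^ D" if y: "y \<ge> 0" for y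
  proof (cases "y \<le> 4")
    case True
    have "A * (1 / 4) ^ k * y ^ D \<ge> 0" using A y by simp
    thus ?thesis using q(2)[of y] y True by simp
  next
    case False
    have y1: "y \<ge> 1" using False by simp
    have yd: "y \<le> y ^ d" "1 \<le> y ^ d" using y1 power_increasing[of 1 d y] one_le_power[of y d] by (simp_all add: d_def del: power_Suc)
    have "\<bar>q y\<bar> \<le> (\<Sum>i\<le>n. \<bar>a i\<bar> * y ^ d)"
      unfolding qa using y1 by (intro order_trans[OF sum_abs] sum_mono) (auto simp: abs_mult d_def intro!: mult_left_mono power_increasing simp del: power_Suc)
    moreover have "\<bar>H y\<bar> \<le> 2 * y ^ d" using bd[OF y] yd by linarith
    ultimately have "\<bar>H y - q y\<bar> \<le> A * y ^ d" by (simp add: A_def distrib_right sum_distrib_right)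
    also have "\<dots> \<le> A * (y ^ d * (y / 4) ^ k)"
      using A y1 False by (intro mult_left_mono) (auto intro!: mult_right_mono[of 1 _ "y ^ d", simplified mult.commute, simplified] one_le_power)
    also have "\<dots> = A * (1 / 4) ^ k * y ^ D" by (simp add: D_def power_add power_divide)
    finally show ?thesis using \<epsilon> by simp
  qed
  have qsum: "wsum (\<lambda>l. q ((real l / r) ^ 2)) r = (\<Sum>i\<le>n. a i * wsum (\<lambda>l. ((real l / r) ^ 2) ^ i) r)" for r
    unfolding qa
  proof (induction n)
    case 0
    show ?case using wsum_cmult[OF exp_bdd_scaled_power[of r 0], of "a 0" r] by simp
  next
    case (Suc n)
    have "exp_bdd (\<lambda>l. \<Sum>i\<le>n. a i * ((real l / r) ^ 2) ^ i)"
      by (induction n) (auto intro!: exp_bdd_add exp_bdd_cmult exp_bdd_scaled_power simp del: power_divide power_Suc)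
    thus ?case using Suc wsum_add[OF _ exp_bdd_cmult[OF exp_bdd_scaled_power[of r "Suc n"], of "a (Suc n)"]]
       wsum_cmult[OF exp_bdd_scaled_power[of r "Suc n"], of "a (Suc n)" r]
      by (simp only: sum.atMost_Suc)
  qed
  have qe: "exp_bdd (\<lambda>l. q ((real l / r) ^ 2))" for r
    unfolding qa by (induction n) (auto intro!: exp_bdd_add exp_bdd_cmult exp_bdd_scaled_power simp del: power_divide power_Suc)
  have He: "exp_bdd (\<lambda>l. H ((real l / r) ^ 2))" for r
    by (rule exp_bdd_mono[OF exp_bdd_add[OF exp_bdd_const[of 1] exp_bdd_power[OF exp_bdd_divide[OF exp_bdd_of_nat, of r], of 2]]])
       (use bd[of "(real _ / r) ^ 2"] in \<open>auto simp: abs_of_nonneg\<close>)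
  have lim1: "((\<lambda>r. wsum (\<lambda>l. q ((real l / r) ^ 2)) r) \<longlongrightarrow> Q) at_top"
    unfolding qsum Q_def by (intro tendsto_sum tendsto_mult tendsto_const wsum_moment)
  have lim2: "((\<lambda>r. wsum (\<lambda>l. ((real l / r) ^ 2) ^ D) r) \<longlongrightarrow> arc_moment D) at_top" by (rule wsum_moment)
  have QM: "\<bar>Q - M\<bar> \<le> \<epsilon>"
  proof -
    have "((\<lambda>y. \<Sum>i\<le>n. a i * (y ^ i * arc_weight y)) has_integral (\<Sum>i\<le>n. a i * (pi * arc_moment i))) {0..1}"
      by (intro has_integral_sum has_integral_mult_right arc_moment_has_integral) auto
    hence iq: "((\<lambda>y. q y * arc_weight y) has_integral pi * Q) {0..1}"
      by (simp add: qa Q_def sum_distrib_left sum_distrib_right mult_ac)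
    have iw: "((\<lambda>y. \<epsilon> * arc_weight y) has_integral \<epsilon> * pi) {0..1}"
      using has_integral_mult_right[OF arc_moment_has_integral[of 0], of \<epsilon>] by (simp add: arc_moment_0)
    have w: "arc_weight y \<ge> 0" for y by (simp add: arc_weight_def)
    have b: "\<bar>q y - H y\<bar> * arc_weight y \<le> \<epsilon> * arc_weight y" if "y \<in> {0..1}" for y
    proof -
      have "\<bar>H y - q y\<bar> \<le> \<epsilon>" using q(2)[of y] that by auto
      thus ?thesis using w by (intro mult_right_mono) (simp_all add: abs_minus_commute)
    qed
    have "pi * Q - pi * M \<le> \<epsilon> * pi"
    proof (rule has_integral_le[OF has_integral_diff[OF iq int] iw])
      show "q y * arc_weight y - H y * arc_weight y \<le> \<epsilon> * arc_weight y" if "y \<in> {0..1}" for y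
        using b[OF that] mult_right_mono[OF abs_ge_self[of "q y - H y"] w[of y]] by (simp add: left_diff_distrib)
    qed
    moreover have "pi * M - pi * Q \<le> \<epsilon> * pi"
    proof (rule has_integral_le[OF has_integral_diff[OF int iq] iw])
      show "H y * arc_weight y - q y * arc_weight y \<le> \<epsilon> * arc_weight y" if "y \<in> {0..1}" for y
        using b[OF that] mult_right_mono[OF abs_ge_minus_self[of "q y - H y"] w[of y]] by (simp add: left_diff_distrib)
    qed
    ultimately have "\<bar>pi * Q - pi * M\<bar> \<le> \<epsilon> * pi" by linarith
    moreover have "\<bar>pi * Q - pi * M\<bar> = pi * \<bar>Q - M\<bar>"
      unfolding right_diff_distrib[symmetric] by (simp only: abs_mult abs_of_pos[OF pi_gt_zero])
    ultimately have "pi * \<bar>Q - M\<bar> \<le> pi * \<epsilon>" by (simp only: mult.commute)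
    thus ?thesis by simp
  qed
  have ev1: "\<forall>\<^sub>F r in at_top. \<bar>wsum (\<lambda>l. q ((real l / r) ^ 2)) r - Q\<bar> < \<epsilon>"
    using tendstoD[OF lim1 \<epsilon>] by (simp add: dist_real_def)
  have ev2: "\<forall>\<^sub>F r in at_top. wsum (\<lambda>l. ((real l / r) ^ 2) ^ D) r < 2"
    using order_tendstoD(2)[OF lim2, of 2] arc_moment_le_1[of D] by simp
  show "\<forall>\<^sub>F r in at_top. dist (wsum (\<lambda>l. H ((real l / r) ^ 2)) r) M < \<epsilon>'"
    using ev1 ev2
  proof eventually_elim
    case (elim r)
    define c where "c = A * (1 / 4) ^ k"
    have c: "c \<ge> 0" "c < \<epsilon> / 2" using A k by (auto simp: c_def)
    have e: "exp_bdd (\<lambda>l. \<epsilon> + c * ((real l / r) ^ 2) ^ D)" by (intro exp_bdd_add exp_bdd_const exp_bdd_cmult exp_bdd_scaled_power)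
    have we: "wsum (\<lambda>l. \<epsilon> + c * ((real l / r) ^ 2) ^ D) r = \<epsilon> + c * wsum (\<lambda>l. ((real l / r) ^ 2) ^ D) r"
      using wsum_add[OF exp_bdd_const exp_bdd_cmult[OF exp_bdd_scaled_power], of \<epsilon> c r D r] wsum_cmult[OF exp_bdd_scaled_power, of c r D r]
        wsum_cmult[OF exp_bdd_const, of \<epsilon> 1 r] wsum_1[of r] by simp
    have "c * wsum (\<lambda>l. ((real l / r) ^ 2) ^ D) r \<le> \<epsilon> / 2 * 2"
    proof (rule mult_mono')
      show "c \<le> \<epsilon> / 2" "0 \<le> c" using c by auto
      show "wsum (\<lambda>l. ((real l / r) ^ 2) ^ D) r \<le> 2" using elim(2) by (rule less_imp_le)
      show "0 \<le> wsum (\<lambda>l. ((real l / r) ^ 2) ^ D) r" by (rule wsum_nonneg[OF exp_bdd_scaled_power]) (intro zero_le_power zero_le_power2)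
    qed
    hence we': "wsum (\<lambda>l. \<epsilon> + c * ((real l / r) ^ 2) ^ D) r \<le> 2 * \<epsilon>" unfolding we by simp
    have d: "\<bar>H ((real l / r) ^ 2) - q ((real l / r) ^ 2)\<bar> \<le> \<epsilon> + c * ((real l / r) ^ 2) ^ D" for l
      unfolding c_def by (rule diff) simp
    have u: "wsum (\<lambda>l. H ((real l / r) ^ 2)) r \<le> wsum (\<lambda>l. q ((real l / r) ^ 2) + (\<epsilon> + c * ((real l / r) ^ 2) ^ D)) r"
    proof (rule wsum_mono[OF He exp_bdd_add[OF qe e]])
      show "H ((real l / r) ^ 2) \<le> q ((real l / r) ^ 2) + (\<epsilon> + c * ((real l / r) ^ 2) ^ D)" for l using d[of l] by linarith
    qed
    have l: "wsum (\<lambda>l. q ((real l / r) ^ 2)) r \<le> wsum (\<lambda>l. H ((real l / r) ^ 2) + (\<epsilon> + c * ((real l / r) ^ 2) ^ D)) r"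
    proof (rule wsum_mono[OF qe exp_bdd_add[OF He e]])
      show "q ((real l / r) ^ 2) \<le> H ((real l / r) ^ 2) + (\<epsilon> + c * ((real l / r) ^ 2) ^ D)" for l using d[of l] by linarith
    qed
    show ?case using u[unfolded wsum_add[OF qe e]] l[unfolded wsum_add[OF He e]] we' QM elim(1)
      unfolding dist_real_def \<epsilon>_def by linarith
  qed
qed

text \<open>The test function is \<open>y powr (s/2)\<close> at \<open>y = (l/r)^2\<close>.
  \<open>s > 0\<close> makes it continuous with value 0 at the origin, and \<open>s \<le> 2\<close>
  keeps its growth linear.\<close>

lemma arcsine_limit:
  assumes "0 < s" "s \<le> 2"
  shows "((\<lambda>r. 2 * bsum 0 (pw (-s)) r * r powr (-s)) \<longlongrightarrow> Beta ((s + 1) / 2) (1 / 2) / pi) at_top"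
proof -
  define H where "H = (\<lambda>y::real. y powr (s / 2))"
  have "((\<lambda>r. wsum (\<lambda>l. H ((real l / r) ^ 2)) r) \<longlongrightarrow> Beta ((s + 1) / 2) (1 / 2) / pi) at_top"
  proof (rule wsum_limit)
    show "continuous_on {0..4} H" unfolding H_def using assms by (intro continuous_on_powr' continuous_intros) auto
    show "\<bar>H y\<bar> \<le> 1 + y" if "y \<ge> 0" for y
    proof (cases "y \<le> 1")
      case True
      have "y powr (s / 2) \<le> 1" using True that assms by (intro powr_le1) auto
      thus ?thesis using that by (simp add: H_def)
    next
      case False
      have "y powr (s / 2) \<le> y powr 1" using False assms by (intro powr_mono) auto
      thus ?thesis using that by (simp add: H_def)
    qed
    have "((\<lambda>t. t powr ((s + 1) / 2 - 1) * (1 - t) powr (1 / 2 - 1)) has_integral Beta ((s + 1) / 2) (1 / 2)) {0..1}"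
      using assms by (intro has_integral_Beta_real) auto
    moreover have "t powr ((s + 1) / 2 - 1) * (1 - t) powr (1 / 2 - 1) = H t * arc_weight t" for t :: real
    proof -
      have "(s + 1) / 2 - 1 = s / 2 + (1 / 2 - 1)" by (simp add: field_simps)
      thus ?thesis unfolding H_def arc_weight_def by (simp only: powr_add mult.assoc)
    qed
    ultimately show "((\<lambda>y. H y * arc_weight y) has_integral pi * (Beta ((s + 1) / 2) (1 / 2) / pi)) {0..1}" by simp
  qed
  moreover have "\<forall>\<^sub>F r in at_top. wsum (\<lambda>l. H ((real l / r) ^ 2)) r = 2 * bsum 0 (pw (-s)) r * r powr (-s)"
    using eventually_gt_at_top[of "0::real"]
  proof eventually_elim
    case (elim r)
    have "H ((real l / r) ^ 2) = r powr (-s) * pw (-s) l" for l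
    proof (cases "l = 0")
      case False
      have "(real l / r) ^ 2 = (real l / r) powr 2" using False elim by (simp add: powr_numeral)
      hence "H ((real l / r) ^ 2) = (real l / r) powr (2 * (s / 2))" unfolding H_def by (simp only: powr_powr)
      also have "2 * (s / 2) = s" by simp
      also have "(real l / r) powr s = real l powr s * r powr (-s)"
        using elim by (simp add: powr_divide powr_minus_divide)
      also have "\<dots> = r powr (-s) * pw (-s) l" by (simp add: pw_def)
      finally show ?thesis .
    qed (simp add: H_def)
    hence "wsum (\<lambda>l. H ((real l / r) ^ 2)) r = r powr (-s) * wsum (pw (-s)) r"
      by (simp only: wsum_cmult[OF exp_bdd_pw])
    thus ?case by (simp add: wsum_def mult_ac)
  qed
  ultimately show ?thesis by (rule Lim_transform_eventually)
qed

section \<open>The Hurwitz zeta function\<close>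

text \<open>The coefficients of the derivatives of \<open>z powr (1 - s)\<close>.\<close>

definition falling :: "nat \<Rightarrow> complex \<Rightarrow> complex" where
  "falling i s = (\<Prod>j<i. 1 - s - of_nat j)"

lemma falling_0 [simp]: "falling 0 s = 1" and falling_Suc: "falling (Suc i) s = falling i s * (1 - s - of_nat i)"
  by (simp_all add: falling_def)

lemma holomorphic_falling [holomorphic_intros]: "falling i holomorphic_on A"
  unfolding falling_def[abs_def] by (intro holomorphic_intros)

text \<open>The remainder of the Taylor expansion of \<open>x powr (1 - s)\<close> over the step
  from \<open>n + a\<close> to \<open>n + a + 1\<close>, of order
  \<open>n powr (- Re s - K)\<close>. Its sum over \<open>n\<close> converges further to the left
  than the zeta series.\<close>

definition hterm :: "real \<Rightarrow> nat \<Rightarrow> nat \<Rightarrow> complex \<Rightarrow> complex" where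
  "hterm a K n s = of_real (real n + a + 1) powr (1 - s)
     - (\<Sum>i\<le>K. falling i s / fact i * of_real (real n + a) powr (1 - s - of_nat i))"

lemma holomorphic_hterm [holomorphic_intros]:
  assumes "a > 0" shows "hterm a K n holomorphic_on A"
  unfolding hterm_def[abs_def] using assms by (intro holomorphic_intros) auto

lemma hterm_bound:
  assumes a: "a > 0" and s: "Re s + real K \<ge> 0"
  shows "cmod (hterm a K n s) \<le> cmod (falling (Suc K) s) * (real n + a) powr (- Re s - real K)"
proof -
  define x where "x = real n + a"
  have x: "x > 0" using a by (simp add: x_def)
  define S where "S = closed_segment (of_real x) (of_real (x + 1) :: complex)"
  have S: "S = of_real ` {x..x + 1}" unfolding S_def closed_segment_of_real by (simp add: closed_segment_eq_real_ivl)
  define f where "f = (\<lambda>i z. falling i s * z powr (1 - s - of_nat i))"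
  have "cmod (f 0 (of_real (x + 1)) - (\<Sum>i\<le>K. f i (of_real x) * (of_real (x + 1) - of_real x) ^ i / fact i))
     \<le> cmod (falling (Suc K) s) * x powr (- Re s - real K) * cmod (of_real (x + 1) - of_real x) ^ Suc K / fact K"
  proof (rule complex_Taylor[of S])
    show "convex S" unfolding S_def by (rule convex_closed_segment)
    show "of_real x \<in> S" "of_real (x + 1) \<in> S" by (auto simp: S_def)
  next
    fix i z assume "z \<in> S" "i \<le> K"
    then obtain t where t: "z = of_real t" "t \<ge> x" by (auto simp: S)
    have "z \<notin> \<real>\<^sub>\<le>\<^sub>0" using t x by auto
    hence "((\<lambda>z. z powr (1 - s - of_nat i)) has_field_derivative (1 - s - of_nat i) * z powr (1 - s - of_nat i - 1)) (at z)"
      by (rule has_field_derivative_powr)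
    hence "(f i has_field_derivative falling i s * ((1 - s - of_nat i) * z powr (1 - s - of_nat i - 1))) (at z)"
      unfolding f_def by (rule DERIV_cmult)
    moreover have "falling i s * ((1 - s - of_nat i) * z powr (1 - s - of_nat i - 1)) = f (Suc i) z"
      by (simp add: f_def falling_Suc algebra_simps)
    ultimately have "(f i has_field_derivative f (Suc i) z) (at z)" by (simp only:)
    thus "(f i has_field_derivative f (Suc i) z) (at z within S)" by (rule has_field_derivative_at_within)
  next
    fix z assume "z \<in> S"
    then obtain t where t: "z = of_real t" "t \<ge> x" by (auto simp: S)
    have "cmod (z powr (1 - s - of_nat (Suc K))) = t powr (- Re s - real K)"
      using t x by (subst norm_powr_real_powr) auto
    also have "\<dots> \<le> x powr (- Re s - real K)" using t x s by (intro powr_mono2') auto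
    finally show "cmod (f (Suc K) z) \<le> cmod (falling (Suc K) s) * x powr (- Re s - real K)"
      unfolding f_def norm_mult by (rule mult_left_mono) simp
  qed
  also have "f 0 (of_real (x + 1)) - (\<Sum>i\<le>K. f i (of_real x) * (of_real (x + 1) - of_real x) ^ i / fact i) = hterm a K n s"
    by (simp add: f_def hterm_def x_def)
  also have "cmod (falling (Suc K) s) * x powr (- Re s - real K) * cmod (of_real (x + 1) - of_real x) ^ Suc K / fact K
     \<le> cmod (falling (Suc K) s) * x powr (- Re s - real K)"
    using divide_left_mono[of 1 "fact K :: real" "cmod (falling (Suc K) s) * x powr (- Re s - real K)"] by (simp add: fact_ge_1)
  finally show ?thesis by (simp add: x_def)
qed

lemma hterm_sum_holomorphic:
  fixes K :: nat
  assumes a: "a > 0"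
  defines "S \<equiv> {s. Re s > 1 - real K}"
  shows "(\<lambda>s. \<Sum>n. hterm a K n s) holomorphic_on S" and "\<And>s. s \<in> S \<Longrightarrow> summable (\<lambda>n. hterm a K n s)"
proof -
  have S: "open S" unfolding S_def by (rule open_halfspace_Re_gt)
  have *: "\<exists>d>0. cball x d \<subseteq> S \<and> uniform_limit (cball x d) (\<lambda>N s. \<Sum>n<N. hterm a K n s) (\<lambda>s. \<Sum>n. hterm a K n s) sequentially"
    if x: "x \<in> S" for x
  proof -
    define d where "d = (Re x - (1 - real K)) / 2"
    have d: "d > 0" using x by (simp add: d_def S_def)
    define \<sigma> where "\<sigma> = Re x - d + real K"
    have \<sigma>: "\<sigma> > 1" using d unfolding \<sigma>_def by (simp add: d_def field_simps)
    have Re: "Re s + real K \<ge> \<sigma>" if "s \<in> cball x d" for s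
    proof -
      have "\<bar>Re (x - s)\<bar> \<le> d" using abs_Re_le_cmod[of "x - s"] that by (simp add: dist_norm)
      thus ?thesis by (auto simp: \<sigma>_def)
    qed
    have sub: "cball x d \<subseteq> S"
    proof
      fix s assume "s \<in> cball x d"
      from Re[OF this] show "s \<in> S" using \<sigma> by (simp add: S_def)
    qed
    have "compact (falling (Suc K) ` cball x d)"
      by (intro compact_continuous_image holomorphic_on_imp_continuous_on holomorphic_falling compact_cball)
    then obtain M where M: "\<And>s. s \<in> cball x d \<Longrightarrow> cmod (falling (Suc K) s) \<le> M"
      by (meson compact_imp_bounded bounded_iff imageI)
    have "uniform_limit (cball x d) (\<lambda>N s. \<Sum>n<N. hterm a K n s) (\<lambda>s. \<Sum>n. hterm a K n s) sequentially"
    proof (rule Weierstrass_m_test_ev)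
      show "summable (\<lambda>n. M * real n powr (- \<sigma>))" using \<sigma> by (intro summable_mult) (simp add: summable_real_powr_iff)
      show "\<forall>\<^sub>F n in sequentially. \<forall>s\<in>cball x d. cmod (hterm a K n s) \<le> M * real n powr (- \<sigma>)"
        using eventually_ge_at_top[of "1::nat"]
      proof eventually_elim
        case (elim n)
        show ?case
        proof
          fix s assume s: "s \<in> cball x d"
          have "cmod (hterm a K n s) \<le> cmod (falling (Suc K) s) * (real n + a) powr (- Re s - real K)"
            using Re[OF s] \<sigma> by (intro hterm_bound a) simp
          also have "(real n + a) powr (- Re s - real K) \<le> (real n + a) powr (- \<sigma>)"
            using Re[OF s] elim a by (intro powr_mono) auto
          also have "\<dots> \<le> real n powr (- \<sigma>)" using elim a \<sigma> by (intro powr_mono2') auto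
          finally show "cmod (hterm a K n s) \<le> M * real n powr (- \<sigma>)"
            using M[OF s] mult_right_mono[OF M[OF s], of "real n powr (- \<sigma>)"] by (meson mult_left_mono norm_ge_zero order_trans powr_ge_zero)
        qed
      qed
    qed
    thus ?thesis using d sub by blast
  qed
  show "(\<lambda>s. \<Sum>n. hterm a K n s) holomorphic_on S"
    by (rule holomorphic_uniform_sequence[OF S _ *]) (intro holomorphic_intros a)
  show "summable (\<lambda>n. hterm a K n s)" if "s \<in> S" for s
  proof -
    from *[OF that] obtain d where d: "d > 0" "uniform_limit (cball s d) (\<lambda>N s. \<Sum>n<N. hterm a K n s) (\<lambda>s. \<Sum>n. hterm a K n s) sequentially" by blast
    have "(\<lambda>N. \<Sum>n<N. hterm a K n s) \<longlonglongrightarrow> (\<Sum>n. hterm a K n s)" by (rule tendsto_uniform_limitI[OF d(2)]) (use d in auto)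
    thus ?thesis by (auto simp: summable_def sums_def)
  qed
qed

definition hzeta_series :: "real \<Rightarrow> complex \<Rightarrow> complex" where
  "hzeta_series a z = (\<Sum>n. 1 / complex_of_real (real n + a) powr z)"

lemma hzeta_series_sums:
  assumes a: "a > 0" and s: "Re s > 1"
  shows "(\<lambda>n. of_real (real n + a) powr (- s)) sums hzeta_series a s"
proof -
  have "summable (\<lambda>n. complex_of_real (real n + a) powr (- s))"
  proof (rule summable_comparison_test_ev)
    show "summable (\<lambda>n. real n powr (- Re s))" using s by (simp add: summable_real_powr_iff)
    show "\<forall>\<^sub>F n in sequentially. cmod (complex_of_real (real n + a) powr (- s)) \<le> real n powr (- Re s)"
      using eventually_ge_at_top[of "1::nat"]
    proof eventually_elim
      case (elim n)
      have "cmod (complex_of_real (real n + a) powr (- s)) = (real n + a) powr (- Re s)"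
        using a by (subst norm_powr_real_powr) (auto simp del: of_real_add)
      also have "\<dots> \<le> real n powr (- Re s)" using elim a s by (intro powr_mono2') auto
      finally show ?case .
    qed
  qed
  hence "(\<lambda>n. of_real (real n + a) powr (- s)) sums (\<Sum>n. of_real (real n + a) powr (- s))" by (rule summable_sums)
  thus ?thesis by (simp add: hzeta_series_def powr_minus divide_inverse del: of_real_add)
qed

lemma shifted_powr_tendsto_0:
  assumes "Re w < 0"
  shows "(\<lambda>n. complex_of_real (real n + a) powr w) \<longlonglongrightarrow> 0"
proof (rule tendsto_norm_zero_cancel, rule Lim_transform_eventually)
  show "(\<lambda>n. (real n + a) powr Re w) \<longlonglongrightarrow> 0" using assms by real_asymp
  have "\<forall>\<^sub>F n in sequentially. real n + a \<ge> 0" by real_asymp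
  thus "\<forall>\<^sub>F n in sequentially. (real n + a) powr Re w = cmod (complex_of_real (real n + a) powr w)"
    by eventually_elim (subst norm_powr_real_powr, auto simp del: of_real_add)
qed

text \<open>The difference of consecutive powers telescopes, and each Taylor term sums to a zeta
  value. The term \<open>i = 1\<close> carries \<open>s\<close> itself, the later ones arguments
  shifted to the right.\<close>

lemma hzeta_functional_sum:
  assumes a: "a > 0" and s: "Re s > 1"
  shows "(\<Sum>n. hterm a K n s) = - (of_real a powr (1 - s)) - (\<Sum>i=1..K. falling i s / fact i * hzeta_series a (s + of_nat i - 1))"
proof -
  have "(\<lambda>n. of_real (real (Suc n) + a) powr (1 - s) - of_real (real n + a) powr (1 - s)) sums (0 - of_real (real 0 + a) powr (1 - s))"
    by (rule telescope_sums[OF shifted_powr_tendsto_0]) (use s in auto)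
  moreover have "(\<lambda>n. \<Sum>i=1..K. falling i s / fact i * of_real (real n + a) powr (- (s + of_nat i - 1)))
     sums (\<Sum>i=1..K. falling i s / fact i * hzeta_series a (s + of_nat i - 1))"
    by (intro sums_sum sums_mult hzeta_series_sums a) (use s in auto)
  ultimately have "(\<lambda>n. of_real (real (Suc n) + a) powr (1 - s) - of_real (real n + a) powr (1 - s)
      - (\<Sum>i=1..K. falling i s / fact i * of_real (real n + a) powr (- (s + of_nat i - 1))))
     sums (0 - of_real (real 0 + a) powr (1 - s) - (\<Sum>i=1..K. falling i s / fact i * hzeta_series a (s + of_nat i - 1)))"
    by (rule sums_diff)
  moreover have "of_real (real (Suc n) + a) powr (1 - s) - of_real (real n + a) powr (1 - s)
      - (\<Sum>i=1..K. falling i s / fact i * of_real (real n + a) powr (- (s + of_nat i - 1))) = hterm a K n s" for n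
  proof -
    have "(\<Sum>i\<le>K. falling i s / fact i * of_real (real n + a) powr (1 - s - of_nat i))
      = of_real (real n + a) powr (1 - s) + (\<Sum>i=1..K. falling i s / fact i * of_real (real n + a) powr (1 - s - of_nat i))"
    proof -
      have "{..K} = insert 0 {1..K}" by auto
      thus ?thesis by simp
    qed
    moreover have "- (s + of_nat i - 1) = 1 - s - of_nat i" for i by simp
    moreover have "real (Suc n) + a = real n + a + 1" by simp
    ultimately show ?thesis unfolding hterm_def by (simp only: diff_diff_eq)
  qed
  ultimately show ?thesis by (simp add: sums_iff)
qed

text \<open>Solved for the term \<open>i = 1\<close>, and written with \<open>s - 1\<close> times
  the series throughout, so that the pole never enters the continuation.\<close>

lemma hzeta_step:
  assumes a: "a > 0" and s: "Re s > 1" and K: "K \<ge> 1"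
  shows "(s - 1) * hzeta_series a s = of_real a powr (1 - s) + (\<Sum>n. hterm a K n s)
    - (\<Sum>i=2..K. falling (i - 1) s / fact i * ((s + of_nat i - 1 - 1) * hzeta_series a (s + of_nat i - 1)))"
proof -
  have "falling i s / fact i * hzeta_series a (s + of_nat i - 1)
     = - (falling (i - 1) s / fact i * ((s + of_nat i - 1 - 1) * hzeta_series a (s + of_nat i - 1)))" if "i \<ge> 1" for i
  proof -
    have "falling i s = - (falling (i - 1) s * (s + of_nat i - 1 - 1))"
      using that falling_Suc[of "i - 1" s] by (simp add: of_nat_diff algebra_simps)
    thus ?thesis by simp
  qed
  hence "(\<Sum>i=1..K. falling i s / fact i * hzeta_series a (s + of_nat i - 1))
     = - (\<Sum>i=1..K. falling (i - 1) s / fact i * ((s + of_nat i - 1 - 1) * hzeta_series a (s + of_nat i - 1)))"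
    unfolding sum_negf[symmetric] by (intro sum.cong) auto
  also have "(\<Sum>i=1..K. falling (i - 1) s / fact i * ((s + of_nat i - 1 - 1) * hzeta_series a (s + of_nat i - 1)))
     = (s - 1) * hzeta_series a s + (\<Sum>i=2..K. falling (i - 1) s / fact i * ((s + of_nat i - 1 - 1) * hzeta_series a (s + of_nat i - 1)))"
    using K by (subst sum.atLeast_Suc_atMost) (auto simp: numeral_2_eq_2)
  finally show ?thesis using hzeta_functional_sum[OF a s, of K] by simp
qed

text \<open>\<open>hzeta_step\<close> expresses the continued function at \<open>s\<close> through
  its values at \<open>s + 1\<close>, \<open>s + 2\<close> and so on; each induction step moves the
  boundary one unit to the left.\<close>

lemma hzeta_continuation_halfplane:
  assumes a: "a > 0"
  shows "\<exists>G. G holomorphic_on {s. Re s > - real m} \<and> (\<forall>s. Re s > 1 \<longrightarrow> G s = (s - 1) * hzeta_series a s)"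
proof (induction m)
  case 0
  have "(\<lambda>s. of_real a powr (1 - s) + (\<Sum>n. hterm a 1 n s)) holomorphic_on {s. Re s > - real 0}"
    using hterm_sum_holomorphic(1)[OF a, of 1] a by (intro holomorphic_intros) auto
  moreover have "of_real a powr (1 - s) + (\<Sum>n. hterm a 1 n s) = (s - 1) * hzeta_series a s" if "Re s > 1" for s
    using hzeta_step[OF a that, of 1] by simp
  ultimately show ?case by blast
next
  case (Suc m)
  then obtain G where G: "G holomorphic_on {s. Re s > - real m}" "\<And>s. Re s > 1 \<Longrightarrow> G s = (s - 1) * hzeta_series a s" by blast
  \<comment> \<open>The sum of the remainders is holomorphic for \<open>Re s > 1 - K\<close>, which
    is the new half-plane.\<close>
  define K where "K = m + 2"
  define G' where "G' = (\<lambda>s. of_real a powr (1 - s) + (\<Sum>n. hterm a K n s)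
    - (\<Sum>i=2..K. falling (i - 1) s / fact i * G (s + of_nat i - 1)))"
  have Gi: "(\<lambda>s. G (s + of_nat i - 1)) holomorphic_on {s. Re s > - real (Suc m)}" if "i \<in> {2..K}" for i
    by (rule holomorphic_on_compose_gen[OF _ G(1), unfolded o_def]) (use that in \<open>auto intro!: holomorphic_intros\<close>)
  have "G' holomorphic_on {s. Re s > - real (Suc m)}"
    unfolding G'_def using hterm_sum_holomorphic(1)[OF a, of K] a
    by (intro holomorphic_intros Gi) (auto simp: K_def)
  moreover have "G' s = (s - 1) * hzeta_series a s" if s: "Re s > 1" for s
  proof -
    have "(\<Sum>i=2..K. falling (i - 1) s / fact i * G (s + of_nat i - 1))
      = (\<Sum>i=2..K. falling (i - 1) s / fact i * ((s + of_nat i - 1 - 1) * hzeta_series a (s + of_nat i - 1)))"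
      by (intro sum.cong refl) (subst G(2), use s in auto)
    thus ?thesis unfolding G'_def by (simp only:) (rule hzeta_step[OF a s, symmetric], simp add: K_def)
  qed
  ultimately show ?case by blast
qed

text \<open>The pieces agree by the identity theorem and are glued by selecting, at each point, a
  half-plane that contains it. Existence on the whole punctured plane gives the choice operator in
  \<open>hurwitz_zeta\<close> its meaning.\<close>

lemma hzeta_continuation:
  assumes a: "a > 0"
  obtains f where "f holomorphic_on (- {1})" "\<And>z. Re z > 1 \<Longrightarrow> f z = hzeta_series a z"
proof -
  obtain G where G: "\<And>m. G m holomorphic_on {s. Re s > - real m}" "\<And>m s. Re s > 1 \<Longrightarrow> G m s = (s - 1) * hzeta_series a s"
    using hzeta_continuation_halfplane[OF a] by metis
  have agree: "G m s = G m' s" if "Re s > - real m" "m \<le> m'" for m m' s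
  proof (rule analytic_continuation_open[of "{s. Re s > 1}" "{s. Re s > - real m}" "G m" "G m'"])
    show "open {s. Re s > 1}" "open {s. Re s > - real m}" by (rule open_halfspace_Re_gt)+
    show "connected {s. Re s > - real m}" by (intro convex_connected convex_halfspace_Re_gt)
    show "{s. Re s > 1} \<noteq> {}" by (auto intro: exI[of _ 2])
    show "G m' holomorphic_on {s. Re s > - real m}" by (rule holomorphic_on_subset[OF G(1)]) (use that in auto)
  qed (use that G in auto)
  define F where "F s = G (nat \<lceil>- Re s\<rceil> + 1) s" for s
  have idx: "Re s > - real (nat \<lceil>- Re s\<rceil> + 1)" for s by linarith
  have F: "F s = G m s" if "Re s > - real m" for m s
    using agree[OF that, of "nat \<lceil>- Re s\<rceil> + 1"] agree[OF idx[of s], of m] unfolding F_def by (metis nat_le_linear)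
  have "F holomorphic_on (\<Union>m. {s. Re s > - real m})"
  proof (rule holomorphic_on_UN_open)
    show "F holomorphic_on {s. Re s > - real m}" for m
      using F[of m] by (intro holomorphic_transform[OF G(1)]) auto
    show "open {s. Re s > - real m}" for m by (rule open_halfspace_Re_gt)
  qed
  hence F': "F holomorphic_on - {1}" by (rule holomorphic_on_subset) (use idx in blast)
  show ?thesis
  proof (rule that[of "\<lambda>s. F s / (s - 1)"])
    show "(\<lambda>s. F s / (s - 1)) holomorphic_on - {1}" using F' by (intro holomorphic_intros) auto
    show "F z / (z - 1) = hzeta_series a z" if "Re z > 1" for z
      using F[of 0 z] G(2)[of z 0] that by auto
  qed
qed

lemma powr_shift_tendsto_0:
  fixes \<alpha> a :: real
  assumes "\<alpha> > 0"
  shows "(\<lambda>L. (real L + a) powr (1 - \<alpha>) - real L powr (1 - \<alpha>)) \<longlonglongrightarrow> 0"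
proof -
  have "(\<lambda>L. (real L + a) powr (1 - \<alpha>) - real L powr (1 - \<alpha>)) \<in> O(\<lambda>L. real L powr (1 - \<alpha> - 1))" by real_asymp
  moreover have "(\<lambda>L. real L powr (1 - \<alpha> - 1)) \<in> o(\<lambda>_. 1)" using assms by real_asymp
  ultimately have "(\<lambda>L. (real L + a) powr (1 - \<alpha>) - real L powr (1 - \<alpha>)) \<in> o(\<lambda>_. 1)" by (rule landau_o.big_small_trans)
  from smalloD_tendsto[OF this] show ?thesis by simp
qed

text \<open>For \<open>Re s > 0\<close> the case \<open>K = 1\<close> of \<open>hzeta_step\<close>
  already represents the continuation, and its partial sums telescope to the sums on the left. The
  difference between \<open>L + a\<close> and \<open>L\<close> in the correction vanishes in the
  limit.\<close>

lemma hurwitz_zeta_real_LIMSEQ: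
  assumes a: "a > 0" and \<alpha>: "\<alpha> > 0" "\<alpha> \<noteq> 1"
  shows "(\<lambda>L. (\<Sum>n<L. (real n + a) powr (- \<alpha>)) - real L powr (1 - \<alpha>) / (1 - \<alpha>)) \<longlonglongrightarrow> hurwitz_zeta_real \<alpha> a"
proof -
  define P where "P = (\<lambda>f. f holomorphic_on (- {1}) \<and> (\<forall>z. Re z > 1 \<longrightarrow> f z = (\<Sum>n. 1 / complex_of_real (real n + a) powr z)))"
  define f where "f = (SOME f. P f)"
  have "\<exists>f. P f" using hzeta_continuation[OF a] unfolding P_def hzeta_series_def by metis
  hence "P f" unfolding f_def by (rule someI_ex)
  hence f: "f holomorphic_on (- {1})" "\<And>z. Re z > 1 \<Longrightarrow> f z = hzeta_series a z" by (auto simp: P_def hzeta_series_def)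
  have fz: "hurwitz_zeta s a = f s" for s unfolding hurwitz_zeta_def f_def P_def ..
  \<comment> \<open>The chosen function is only known to be holomorphic off 1, so the identity
    theorem is used on the punctured half-plane, which is still connected.\<close>
  define S where "S = {s. Re s > 0} - {1::complex}"
  have "(s - 1) * f s = of_real a powr (1 - s) + (\<Sum>n. hterm a 1 n s)" if "s \<in> S" for s
  proof (rule analytic_continuation_open[of "{s. Re s > 1}" S "\<lambda>s. (s - 1) * f s" "\<lambda>s. of_real a powr (1 - s) + (\<Sum>n. hterm a 1 n s)"])
    show "open {s. Re s > 1}" by (rule open_halfspace_Re_gt)
    show "open S" unfolding S_def by (intro open_Diff open_halfspace_Re_gt) auto
    show "connected S" unfolding S_def
      by (intro connected_open_delete open_halfspace_Re_gt convex_connected convex_halfspace_Re_gt) auto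
    show "{s. Re s > 1} \<noteq> {}" by (auto intro: exI[of _ 2])
    show "{s. Re s > 1} \<subseteq> S" by (auto simp: S_def)
    show "(\<lambda>s. (s - 1) * f s) holomorphic_on S"
      by (intro holomorphic_intros holomorphic_on_subset[OF f(1)]) (auto simp: S_def)
    show "(\<lambda>s. of_real a powr (1 - s) + (\<Sum>n. hterm a 1 n s)) holomorphic_on S"
      using a by (intro holomorphic_intros holomorphic_on_subset[OF hterm_sum_holomorphic(1)[OF a, of 1]]) (auto simp: S_def)
    show "(z - 1) * f z = of_real a powr (1 - z) + (\<Sum>n. hterm a 1 n z)" if "z \<in> {s. Re s > 1}" for z
      using hzeta_step[OF a, of z 1] that f(2)[of z] by simp
  qed (use that in auto)
  moreover define s where "s = complex_of_real \<alpha>"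
  ultimately have fs: "(s - 1) * f s = of_real a powr (1 - s) + (\<Sum>n. hterm a 1 n s)" using \<alpha> by (auto simp: S_def s_def)
  have "(\<lambda>n. hterm a 1 n s) sums (\<Sum>n. hterm a 1 n s)"
    using hterm_sum_holomorphic(2)[OF a, of s 1] \<alpha> by (intro summable_sums) (auto simp: s_def)
  hence "(\<lambda>L. of_real a powr (1 - s) + (\<Sum>n<L. hterm a 1 n s)) \<longlonglongrightarrow> (s - 1) * f s"
    unfolding fs sums_def by (intro tendsto_intros)
  moreover have "of_real a powr (1 - s) + (\<Sum>n<L. hterm a 1 n s)
     = of_real ((real L + a) powr (1 - \<alpha>) + (\<alpha> - 1) * (\<Sum>n<L. (real n + a) powr (- \<alpha>)))" for L
  proof (induction L)
    case 0
    show ?case using a by (simp add: s_def powr_of_real[symmetric])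
  next
    case (Suc L)
    define x where "x = real L + a"
    have x: "x \<ge> 0" "x + 1 \<ge> 0" using a by (auto simp: x_def)
    have e: "1 - s = of_real (1 - \<alpha>)" "of_real (1 - \<alpha>) - 1 = complex_of_real (- \<alpha>)" by (simp_all add: s_def)
    have "hterm a 1 L s = of_real (x + 1) powr (1 - s) - (of_real x powr (1 - s) + (1 - s) * of_real x powr (1 - s - 1))"
      by (simp add: hterm_def falling_Suc x_def)
    also have "\<dots> = of_real ((x + 1) powr (1 - \<alpha>) - (x powr (1 - \<alpha>) + (1 - \<alpha>) * x powr (- \<alpha>)))"
      unfolding e by (simp only: powr_of_real[OF x(1)] powr_of_real[OF x(2)] of_real_diff[symmetric] of_real_add[symmetric] of_real_mult[symmetric])
    finally have h: "hterm a 1 L s = of_real ((real L + a + 1) powr (1 - \<alpha>) - ((real L + a) powr (1 - \<alpha>) + (1 - \<alpha>) * (real L + a) powr (- \<alpha>)))"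
      by (simp only: x_def)
    have "of_real a powr (1 - s) + (\<Sum>n<Suc L. hterm a 1 n s) = (of_real a powr (1 - s) + (\<Sum>n<L. hterm a 1 n s)) + hterm a 1 L s"
      by simp
    also have "\<dots> = of_real ((real L + a) powr (1 - \<alpha>) + (\<alpha> - 1) * (\<Sum>n<L. (real n + a) powr (- \<alpha>))
       + ((real L + a + 1) powr (1 - \<alpha>) - ((real L + a) powr (1 - \<alpha>) + (1 - \<alpha>) * (real L + a) powr (- \<alpha>))))"
      unfolding Suc.IH h by (simp only: of_real_add)
    also have "(real L + a) powr (1 - \<alpha>) + (\<alpha> - 1) * (\<Sum>n<L. (real n + a) powr (- \<alpha>))
       + ((real L + a + 1) powr (1 - \<alpha>) - ((real L + a) powr (1 - \<alpha>) + (1 - \<alpha>) * (real L + a) powr (- \<alpha>)))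
      = (real (Suc L) + a) powr (1 - \<alpha>) + (\<alpha> - 1) * (\<Sum>n<Suc L. (real n + a) powr (- \<alpha>))"
      by (simp add: algebra_simps)
    finally show ?case .
  qed
  ultimately have "(\<lambda>L. complex_of_real ((real L + a) powr (1 - \<alpha>) + (\<alpha> - 1) * (\<Sum>n<L. (real n + a) powr (- \<alpha>)))) \<longlonglongrightarrow> (s - 1) * f s"
    by simp
  from tendsto_Re[OF this]
  have 1: "(\<lambda>L. (real L + a) powr (1 - \<alpha>) + (\<alpha> - 1) * (\<Sum>n<L. (real n + a) powr (- \<alpha>))) \<longlonglongrightarrow> Re ((s - 1) * f s)"
    by (simp only: Re_complex_of_real)
  have "Re ((s - 1) * f s) = (\<alpha> - 1) * Re (f s)" by (simp add: s_def)
  also have "Re (f s) = hurwitz_zeta_real \<alpha> a" by (simp add: hurwitz_zeta_real_def fz s_def)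
  finally have 2: "Re ((s - 1) * f s) = (\<alpha> - 1) * hurwitz_zeta_real \<alpha> a" .
  from tendsto_diff[OF 1[unfolded 2] powr_shift_tendsto_0[OF \<alpha>(1), of a]]
  have "(\<lambda>L. ((real L + a) powr (1 - \<alpha>) + (\<alpha> - 1) * (\<Sum>n<L. (real n + a) powr (- \<alpha>)) - ((real L + a) powr (1 - \<alpha>) - real L powr (1 - \<alpha>))) / (\<alpha> - 1))
     \<longlonglongrightarrow> ((\<alpha> - 1) * hurwitz_zeta_real \<alpha> a - 0) / (\<alpha> - 1)"
    using \<alpha> by (intro tendsto_divide tendsto_const) auto
  also have "((\<alpha> - 1) * hurwitz_zeta_real \<alpha> a - 0) / (\<alpha> - 1) = hurwitz_zeta_real \<alpha> a" using \<alpha> by simp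
  also have "(\<lambda>L. ((real L + a) powr (1 - \<alpha>) + (\<alpha> - 1) * (\<Sum>n<L. (real n + a) powr (- \<alpha>)) - ((real L + a) powr (1 - \<alpha>) - real L powr (1 - \<alpha>))) / (\<alpha> - 1))
     = (\<lambda>L. (\<Sum>n<L. (real n + a) powr (- \<alpha>)) - real L powr (1 - \<alpha>) / (1 - \<alpha>))"
  proof
    fix L
    have e: "1 - \<alpha> = - (\<alpha> - 1)" by simp
    have "x / (1 - \<alpha>) = - (x / (\<alpha> - 1))" for x unfolding e by (simp only: divide_minus_right)
    thus "((real L + a) powr (1 - \<alpha>) + (\<alpha> - 1) * (\<Sum>n<L. (real n + a) powr (- \<alpha>)) - ((real L + a) powr (1 - \<alpha>) - real L powr (1 - \<alpha>))) / (\<alpha> - 1)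
      = (\<Sum>n<L. (real n + a) powr (- \<alpha>)) - real L powr (1 - \<alpha>) / (1 - \<alpha>)"
      using \<alpha> by (simp add: add_divide_distrib)
  qed
  finally show ?thesis .
qed

section \<open>The constant of the homogeneous solution\<close>

text \<open>The recurrence applied to one factor of \<open>J_l^2\<close>. It links sums of squares,
  where the arcsine law applies, to sums of order 1.\<close>

lemma bsum_0_of_nat_mult:
  assumes F: "exp_bdd F" "F 0 = 0" and r: "r \<noteq> 0"
  shows "2 / r * bsum 0 (\<lambda>l. real l * F l) r = bsum 1 F r + bsum 1 (\<lambda>l. F (Suc l)) r"
proof -
  have e: "2 / r * (real (Suc l) * F (Suc l) * bprod 0 (Suc l) r) = F (Suc l) * bprod 1 (Suc l) r + F (Suc l) * bprod 1 l r" for l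
  proof -
    have "2 / r * real (Suc l) * bessel_J (Suc l) r = bessel_J l r + bessel_J (Suc (Suc l)) r"
      using bessel_J_rec[of r l] r by (simp add: field_simps)
    moreover have "bprod 0 (Suc l) r = bessel_J (Suc l) r * bessel_J (Suc l) r" "bprod 1 l r = bessel_J l r * bessel_J (Suc l) r"
      "bprod 1 (Suc l) r = bessel_J (Suc l) r * bessel_J (Suc (Suc l)) r" by (simp_all add: bprod_def)
    moreover define q where "q = 2 / r"
    moreover define k where "k = real (Suc l)"
    ultimately show ?thesis by algebra
  qed
  have s1: "summable (\<lambda>l. F (Suc l) * bprod 1 (Suc l) r)" "summable (\<lambda>l. F (Suc l) * bprod 1 l r)"
    by (rule summable_Suc_iff[of "\<lambda>l. F l * bprod 1 l r", THEN iffD2, OF summable_bprod(1)[OF F(1)]],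
        rule summable_bprod(1)[OF exp_bdd_Suc[OF F(1)]])
  have s0: "summable (\<lambda>l. real l * F l * bprod 0 l r)"
    by (rule summable_bprod(1)) (intro exp_bdd_mult exp_bdd_of_nat F)
  have "bsum 0 (\<lambda>l. real l * F l) r = (\<Sum>l. real (Suc l) * F (Suc l) * bprod 0 (Suc l) r)"
    unfolding bsum_def using suminf_split_head[OF s0] by simp
  hence "2 / r * bsum 0 (\<lambda>l. real l * F l) r = (\<Sum>l. 2 / r * (real (Suc l) * F (Suc l) * bprod 0 (Suc l) r))"
    using suminf_mult[of "\<lambda>l. real (Suc l) * F (Suc l) * bprod 0 (Suc l) r" "2 / r"] s0
    by (simp only: summable_Suc_iff[of "\<lambda>l. real l * F l * bprod 0 l r"])
  also have "\<dots> = (\<Sum>l. F (Suc l) * bprod 1 (Suc l) r) + (\<Sum>l. F (Suc l) * bprod 1 l r)"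
    unfolding e by (rule suminf_add[OF s1, symmetric])
  also have "(\<Sum>l. F (Suc l) * bprod 1 (Suc l) r) = bsum 1 F r"
    unfolding bsum_def using suminf_split_head[OF summable_bprod(1)[OF F(1)], of 1 r] F(2) by simp
  finally show ?thesis by (simp add: bsum_def)
qed

section \<open>Limits extracted from the error terms\<close>

lemma bigo_times_powr_tendsto:
  assumes "f \<in> O[at_top](\<lambda>r::real. r powr (-\<theta>))" "a < \<theta>"
  shows "((\<lambda>r. f r * r powr a) \<longlongrightarrow> (0::real)) at_top"
proof -
  have "(\<lambda>r. f r * r powr a) \<in> O[at_top](\<lambda>r. r powr (-\<theta>) * r powr a)"
    by (intro landau_o.big.mult assms(1)) simp
  moreover have "(\<lambda>r::real. r powr (-\<theta>) * r powr a) \<in> o[at_top](\<lambda>_. 1)" using assms(2) by real_asymp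
  ultimately have "(\<lambda>r. f r * r powr a) \<in> o[at_top](\<lambda>_. 1)" by (rule landau_o.big_small_trans)
  from smalloD_tendsto[OF this] show ?thesis by simp
qed

lemma tendsto_at_top_cong:
  fixes f g :: "real \<Rightarrow> real"
  assumes "(f \<longlongrightarrow> a) at_top" "\<And>r. r > 0 \<Longrightarrow> f r = g r" "a = b"
  shows "(g \<longlongrightarrow> b) at_top"
proof -
  have "\<forall>\<^sub>F r in at_top. f r = g r"
    using eventually_gt_at_top[of "0::real"] by eventually_elim (rule assms(2))
  thus ?thesis using Lim_transform_eventually[OF assms(1)] assms(3) by simp
qed

lemma blead_powr_tendsto:
  assumes "a < 1" shows "((\<lambda>r. blead n A B r * r powr a) \<longlongrightarrow> 0) at_top"
proof (rule Lim_null_comparison)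
  show "((\<lambda>r. (\<bar>A\<bar> + \<bar>B\<bar>) / pi * (r powr a / r)) \<longlongrightarrow> 0) at_top"
    by (intro tendsto_mult_right_zero) (use assms in real_asymp)
  show "\<forall>\<^sub>F r in at_top. norm (blead n A B r * r powr a) \<le> (\<bar>A\<bar> + \<bar>B\<bar>) / pi * (r powr a / r)"
    using eventually_gt_at_top[of "0::real"]
  proof eventually_elim
    case (elim r)
    have "\<bar>cn n * A + sn n r * B\<bar> \<le> 1 * \<bar>A\<bar> + 1 * \<bar>B\<bar>"
      using abs_cn_le_1[of n] abs_sn_le_1[of n r]
      by (intro order_trans[OF abs_triangle_ineq] add_mono) (simp_all add: abs_mult mult_left_le_one_le)
    hence "\<bar>cn n * A + sn n r * B\<bar> * (r powr a / (pi * r)) \<le> (\<bar>A\<bar> + \<bar>B\<bar>) * (r powr a / (pi * r))"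
      using elim by (intro mult_right_mono) auto
    thus ?case using elim by (simp add: blead_def abs_mult)
  qed
qed

lemma ode_profile_powr_tendsto:
  assumes "0 < \<alpha>" "\<alpha> < 1"
  shows "(ode_profile \<alpha> \<longlongrightarrow> 0) at_top"
proof -
  have "((\<lambda>r. r powr (\<alpha> - 1) / (\<alpha> - 1)) \<longlongrightarrow> 0 / (\<alpha> - 1)) at_top"
    by (intro tendsto_divide tendsto_const) (use assms in \<open>real_asymp, simp\<close>)
  thus ?thesis using assms by (simp add: ode_profile_def[abs_def])
qed

lemma pw_Suc_diff_bigo:
  "(\<lambda>l. (pw \<alpha> (Suc l) - pw \<alpha> l) - (- \<alpha>) * pw (\<alpha> + 1) l) \<in> O(\<lambda>l. real l powr (-(\<alpha> + 1 + 1)))"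
  "(\<lambda>l. pw \<alpha> (Suc l) - pw \<alpha> l) \<in> O(\<lambda>l. real l powr (-(\<alpha> + 1)))"
proof -
  show "(\<lambda>l. (pw \<alpha> (Suc l) - pw \<alpha> l) - (- \<alpha>) * pw (\<alpha> + 1) l) \<in> O(\<lambda>l. real l powr (-(\<alpha> + 1 + 1)))"
    unfolding pw_def of_nat_Suc by real_asymp
  thus "(\<lambda>l. pw \<alpha> (Suc l) - pw \<alpha> l) \<in> O(\<lambda>l. real l powr (-(\<alpha> + 1)))" by (rule expand_bigo)
qed

text \<open>For \<open>\<alpha> < 1\<close> the terms of order \<open>1/r\<close> are negligible
  against \<open>r powr (-\<alpha>)\<close>, so the unknown constant of each order is an honest
  limit and can be computed by other means.\<close>

lemma bsum_pw_low_limit: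
  assumes \<alpha>: "0 < \<alpha>" "\<alpha> < 1"
  obtains L where "\<And>n. ((\<lambda>r. bsum n (pw \<alpha>) r * r powr \<alpha>) \<longlongrightarrow> L n) at_top"
    "\<And>n. (\<lambda>r. bsum n (pw \<alpha>) r - L n * r powr (-\<alpha>) - cn n * (\<Sum>l. ode_rhs \<alpha> n l) / pi * (ode_profile \<alpha> r * r powr (-\<alpha>))
       - blead n 0 (\<Sum>l. (-1) ^ l * pw \<alpha> l) r) \<in> O[at_top](\<lambda>r. r powr (-(\<alpha> + 1)))"
proof -
  have "\<exists>L. (\<lambda>r. bsum n (pw \<alpha>) r - L * r powr (-\<alpha>) - cn n * (\<Sum>l. ode_rhs \<alpha> n l) / pi * (ode_profile \<alpha> r * r powr (-\<alpha>))
       - blead n 0 (\<Sum>l. (-1) ^ l * pw \<alpha> l) r) \<in> O[at_top](\<lambda>r. r powr (-(\<alpha> + 1)))" for n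
    by (rule bsum_pw_low) (use \<alpha> in auto)
  from choice[OF allI[OF this]] obtain L where
    "\<forall>n. (\<lambda>r. bsum n (pw \<alpha>) r - L n * r powr (-\<alpha>) - cn n * (\<Sum>l. ode_rhs \<alpha> n l) / pi * (ode_profile \<alpha> r * r powr (-\<alpha>))
       - blead n 0 (\<Sum>l. (-1) ^ l * pw \<alpha> l) r) \<in> O[at_top](\<lambda>r. r powr (-(\<alpha> + 1)))" by (rule exE)
  note L = this[rule_format]
  have "((\<lambda>r. bsum n (pw \<alpha>) r * r powr \<alpha>) \<longlongrightarrow> L n) at_top" for n
  proof -
    define c where "c = cn n * (\<Sum>l. ode_rhs \<alpha> n l) / pi"
    define b where "b = blead n 0 (\<Sum>l. (-1) ^ l * pw \<alpha> l)"
    have 1: "((\<lambda>r. (bsum n (pw \<alpha>) r - L n * r powr (-\<alpha>) - c * (ode_profile \<alpha> r * r powr (-\<alpha>)) - b r) * r powr \<alpha>) \<longlongrightarrow> 0) at_top"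
      unfolding c_def b_def by (rule bigo_times_powr_tendsto[OF L]) simp
    have 2: "((\<lambda>r. b r * r powr \<alpha>) \<longlongrightarrow> 0) at_top" unfolding b_def by (rule blead_powr_tendsto) (rule \<alpha>)
    have 3: "((\<lambda>r. c * ode_profile \<alpha> r) \<longlongrightarrow> c * 0) at_top" by (intro tendsto_intros ode_profile_powr_tendsto \<alpha>)
    have "((\<lambda>r. (bsum n (pw \<alpha>) r - L n * r powr (-\<alpha>) - c * (ode_profile \<alpha> r * r powr (-\<alpha>)) - b r) * r powr \<alpha>
        + b r * r powr \<alpha> + c * ode_profile \<alpha> r + L n) \<longlongrightarrow> 0 + 0 + c * 0 + L n) at_top"
      by (intro tendsto_add 1 2 3 tendsto_const)
    thus ?thesis
    proof (rule tendsto_at_top_cong)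
      fix r :: real assume "r > 0"
      hence "r powr (-\<alpha>) * r powr \<alpha> = 1" by (simp add: powr_add[symmetric])
      thus "(bsum n (pw \<alpha>) r - L n * r powr (-\<alpha>) - c * (ode_profile \<alpha> r * r powr (-\<alpha>)) - b r) * r powr \<alpha>
        + b r * r powr \<alpha> + c * ode_profile \<alpha> r + L n = bsum n (pw \<alpha>) r * r powr \<alpha>" by algebra
    qed simp
  qed
  thus ?thesis using L by (rule that)
qed

text \<open>By the recurrence, twice the sum of order 1 is asymptotically \<open>2/r\<close> times
  the sum of \<open>l powr (1 - \<alpha>) * J_l^2\<close>, a positive moment. Shifting the weight by
  one index costs only a faster decaying term.\<close>

lemma arc_limit_1:
  assumes \<alpha>: "0 < \<alpha>" "\<alpha> < 1" and L: "((\<lambda>r. bsum 1 (pw \<alpha>) r * r powr \<alpha>) \<longlongrightarrow> L) at_top"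
  shows "2 * L = Beta (1 - \<alpha> / 2) (1 / 2) / pi"
proof -
  have h: "exp_bdd (\<lambda>l. pw \<alpha> (Suc l) - pw \<alpha> l)" by (intro exp_bdd_diff exp_bdd_Suc exp_bdd_pw)
  have "(\<lambda>r. bsum 1 (\<lambda>l. pw \<alpha> (Suc l) - pw \<alpha> l) r) \<in> O[at_top](\<lambda>r. r powr (- 1))"
    by (rule bsum_bigo[OF pw_Suc_diff_bigo(2)]) (use \<alpha> in auto)
  hence 1: "((\<lambda>r. bsum 1 (\<lambda>l. pw \<alpha> (Suc l) - pw \<alpha> l) r * r powr \<alpha>) \<longlongrightarrow> 0) at_top"
    by (rule bigo_times_powr_tendsto) (rule \<alpha>)
  have "((\<lambda>r. 2 * (bsum 1 (pw \<alpha>) r * r powr \<alpha>) + bsum 1 (\<lambda>l. pw \<alpha> (Suc l) - pw \<alpha> l) r * r powr \<alpha>) \<longlongrightarrow> 2 * L + 0) at_top"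
    by (intro tendsto_intros L 1)
  hence "((\<lambda>r. 2 * bsum 0 (pw (-(1 - \<alpha>))) r * r powr (-(1 - \<alpha>))) \<longlongrightarrow> 2 * L + 0) at_top"
  proof (rule tendsto_at_top_cong)
    fix r :: real assume r: "r > 0"
    have "2 / r * bsum 0 (\<lambda>l. real l * pw \<alpha> l) r = bsum 1 (pw \<alpha>) r + bsum 1 (\<lambda>l. pw \<alpha> (Suc l)) r"
      by (rule bsum_0_of_nat_mult) (use r in auto)
    moreover have "bsum 1 (\<lambda>l. pw \<alpha> (Suc l) - pw \<alpha> l) r = bsum 1 (\<lambda>l. pw \<alpha> (Suc l)) r - bsum 1 (pw \<alpha>) r"
      by (rule bsum_diff) (intro exp_bdd_Suc exp_bdd_pw)+
    moreover have "(\<lambda>l. real l * pw \<alpha> l) = pw (-(1 - \<alpha>))" by (simp add: pw_mult fun_eq_iff)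
    moreover have "r powr (-(1 - \<alpha>)) = r powr \<alpha> * (1 / r)"
      using r powr_add[of r \<alpha> "-1"] by (simp add: powr_minus_divide algebra_simps)
    moreover define q where "q = 1 / r"
    ultimately have "2 * q * bsum 0 (pw (-(1 - \<alpha>))) r = bsum 1 (pw \<alpha>) r + bsum 1 (\<lambda>l. pw \<alpha> (Suc l)) r"
      "bsum 1 (\<lambda>l. pw \<alpha> (Suc l) - pw \<alpha> l) r = bsum 1 (\<lambda>l. pw \<alpha> (Suc l)) r - bsum 1 (pw \<alpha>) r"
      "r powr (-(1 - \<alpha>)) = r powr \<alpha> * q" by simp_all
    thus "2 * (bsum 1 (pw \<alpha>) r * r powr \<alpha>) + bsum 1 (\<lambda>l. pw \<alpha> (Suc l) - pw \<alpha> l) r * r powr \<alpha>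
      = 2 * bsum 0 (pw (-(1 - \<alpha>))) r * r powr (-(1 - \<alpha>))" by algebra
  qed simp
  moreover have "((\<lambda>r. 2 * bsum 0 (pw (-(1 - \<alpha>))) r * r powr (-(1 - \<alpha>))) \<longlongrightarrow> Beta ((1 - \<alpha> + 1) / 2) (1 / 2) / pi) at_top"
    by (rule arcsine_limit) (use \<alpha> in auto)
  ultimately have "2 * L + 0 = Beta ((1 - \<alpha> + 1) / 2) (1 / 2) / pi" by (rule tendsto_unique[OF trivial_limit_at_top_linorder])
  moreover have "(1 - \<alpha> + 1) / 2 = 1 - \<alpha> / 2" by (simp add: field_simps)
  ultimately show ?thesis by (simp only: add_0_right)
qed

text \<open>The sum of the orders 0 and 2 leads by the recurrence to order 1 with weight
  \<open>l powr (1 - \<alpha>)\<close>, and a second application to squares with weight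
  \<open>l powr (2 - \<alpha>)\<close>, again a positive moment.\<close>

lemma arc_limit_0:
  assumes \<alpha>: "0 < \<alpha>" "\<alpha> < 1"
    and L: "((\<lambda>r. bsum 0 (pw \<alpha>) r * r powr \<alpha>) \<longlongrightarrow> L) at_top" "((\<lambda>r. bsum 2 (pw \<alpha>) r * r powr \<alpha>) \<longlongrightarrow> L') at_top"
  shows "L + L' = Beta ((3 - \<alpha>) / 2) (1 / 2) / pi"
proof -
  define s where "s = 2 - \<alpha>"
  have s: "0 < s" "s \<le> 2" using \<alpha> by (auto simp: s_def)
  have dz: "((\<lambda>r. 2 / r * bsum 1 h r * r powr \<alpha>) \<longlongrightarrow> 0) at_top" if "h \<in> O(\<lambda>l. real l powr (-\<alpha>))" for h
  proof -
    have "bsum 1 h \<in> O[at_top](\<lambda>r. r powr (-\<alpha>))" by (rule bsum_bigo[OF that]) (use \<alpha> in auto)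
    hence "(\<lambda>r. 2 / r * bsum 1 h r) \<in> O[at_top](\<lambda>r. r powr (-(\<alpha> + 1)))" by (rule bigo_at_top_div)
    thus ?thesis by (rule bigo_times_powr_tendsto) simp
  qed
  define h where "h = (\<lambda>l. pw (\<alpha> - 1) (Suc l) - pw (\<alpha> - 1) l)"
  have "h \<in> O(\<lambda>l. real l powr (-(\<alpha> - 1 + 1)))" unfolding h_def by (rule pw_Suc_diff_bigo(2))
  hence 1: "((\<lambda>r. 2 / r * bsum 1 h r * r powr \<alpha>) \<longlongrightarrow> 0) at_top" by (intro dz) simp
  have 2: "((\<lambda>r. 2 / r * bsum 1 (pw \<alpha>) r * r powr \<alpha>) \<longlongrightarrow> 0) at_top" by (rule dz[OF pw_bigo])
  have "((\<lambda>r. bsum 0 (pw \<alpha>) r * r powr \<alpha> + bsum 2 (pw \<alpha>) r * r powr \<alpha> - 2 / r * bsum 1 (pw \<alpha>) r * r powr \<alpha>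
      + 1 / 2 * (2 / r * bsum 1 h r * r powr \<alpha>)) \<longlongrightarrow> L + L' - 0 + 1 / 2 * 0) at_top"
    by (intro tendsto_intros L 1 2)
  hence "((\<lambda>r. 2 * bsum 0 (pw (-s)) r * r powr (-s)) \<longlongrightarrow> L + L') at_top"
  proof (rule tendsto_at_top_cong)
    fix r :: real assume r: "r > 0"
    have "bsum 2 (pw \<alpha>) r + bsum 0 (pw \<alpha>) r = 2 / r * (bsum 1 (pw (\<alpha> - 1)) r + bsum 1 (pw \<alpha>) r)"
      using bsum_pw_sum[of r 0 \<alpha>] r by (simp add: numeral_2_eq_2)
    moreover have "2 / r * bsum 0 (\<lambda>l. real l * pw (\<alpha> - 1) l) r = bsum 1 (pw (\<alpha> - 1)) r + bsum 1 (\<lambda>l. pw (\<alpha> - 1) (Suc l)) r"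
      by (rule bsum_0_of_nat_mult) (use r in auto)
    moreover have "bsum 1 h r = bsum 1 (\<lambda>l. pw (\<alpha> - 1) (Suc l)) r - bsum 1 (pw (\<alpha> - 1)) r"
      unfolding h_def by (rule bsum_diff) (intro exp_bdd_Suc exp_bdd_pw)+
    moreover have "(\<lambda>l. real l * pw (\<alpha> - 1) l) = pw (-s)" by (simp add: pw_mult fun_eq_iff s_def)
    moreover have "r powr (-s) = r powr \<alpha> * (1 / r * (1 / r))"
      using r powr_add[of r \<alpha> "-2"] by (simp add: s_def powr_minus_divide power2_eq_square add.commute)
    moreover define q where "q = 1 / r"
    ultimately have "bsum 2 (pw \<alpha>) r + bsum 0 (pw \<alpha>) r = 2 * q * (bsum 1 (pw (\<alpha> - 1)) r + bsum 1 (pw \<alpha>) r)"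
      "2 * q * bsum 0 (pw (-s)) r = bsum 1 (pw (\<alpha> - 1)) r + bsum 1 (\<lambda>l. pw (\<alpha> - 1) (Suc l)) r"
      "bsum 1 h r = bsum 1 (\<lambda>l. pw (\<alpha> - 1) (Suc l)) r - bsum 1 (pw (\<alpha> - 1)) r" "r powr (-s) = r powr \<alpha> * (q * q)" "2 / r = 2 * q" by simp_all
    thus "bsum 0 (pw \<alpha>) r * r powr \<alpha> + bsum 2 (pw \<alpha>) r * r powr \<alpha> - 2 / r * bsum 1 (pw \<alpha>) r * r powr \<alpha>
      + 1 / 2 * (2 / r * bsum 1 h r * r powr \<alpha>) = 2 * bsum 0 (pw (-s)) r * r powr (-s)" by algebra
  qed simp
  moreover have "((\<lambda>r. 2 * bsum 0 (pw (-s)) r * r powr (-s)) \<longlongrightarrow> Beta ((s + 1) / 2) (1 / 2) / pi) at_top"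
    by (rule arcsine_limit[OF s])
  ultimately have "L + L' = Beta ((s + 1) / 2) (1 / 2) / pi" by (rule tendsto_unique[OF trivial_limit_at_top_linorder])
  moreover have "(s + 1) / 2 = (3 - \<alpha>) / 2" by (simp add: s_def)
  ultimately show ?thesis by simp
qed

text \<open>The remainders in \<open>bsum_pw_rel_order\<close> are \<open>O(1/r)\<close> or smaller
  and vanish after multiplication by \<open>r powr \<alpha>\<close>, as
  \<open>\<alpha> < 1\<close>.\<close>

lemma arc_limit_rec:
  assumes \<alpha>: "0 < \<alpha>" "\<alpha> < 1"
    and L: "((\<lambda>r. bsum n (pw \<alpha>) r * r powr \<alpha>) \<longlongrightarrow> L) at_top" "((\<lambda>r. bsum (n + 2) (pw \<alpha>) r * r powr \<alpha>) \<longlongrightarrow> L') at_top"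
  shows "(real n + 2 - \<alpha>) * L' + (real n + \<alpha>) * L = 0"
proof -
  have b: "((\<lambda>r. bsum m h r * r powr \<alpha>) \<longlongrightarrow> 0) at_top" if "h \<in> O(\<lambda>l. real l powr (-(\<alpha> + 1)))" for m h
  proof -
    have "bsum m h \<in> O[at_top](\<lambda>r. r powr (-1))" by (rule bsum_bigo[OF that]) (use \<alpha> in auto)
    thus ?thesis by (rule bigo_times_powr_tendsto) (rule \<alpha>)
  qed
  have "bsum (n + 1) (pw \<alpha>) \<in> O[at_top](\<lambda>r. r powr (-\<alpha>))" by (rule bsum_bigo[OF pw_bigo]) (use \<alpha> in auto)
  hence "(\<lambda>r. 2 * (real n + 1) ^ 2 / r * bsum (n + 1) (pw \<alpha>) r) \<in> O[at_top](\<lambda>r. r powr (-(\<alpha> + 1)))" by (rule bigo_at_top_div)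
  hence 3: "((\<lambda>r. 2 * (real n + 1) ^ 2 / r * bsum (n + 1) (pw \<alpha>) r * r powr \<alpha>) \<longlongrightarrow> 0) at_top"
    by (rule bigo_times_powr_tendsto) simp
  have "((\<lambda>r. (real n + 2 - \<alpha>) * (bsum (n + 2) (pw \<alpha>) r * r powr \<alpha>) + (real n + \<alpha>) * (bsum n (pw \<alpha>) r * r powr \<alpha>)
     - (bsum (n + 2) (kp \<alpha>) r * r powr \<alpha> - bsum n (km \<alpha>) r * r powr \<alpha> + 2 * (real n + 1) ^ 2 / r * bsum (n + 1) (pw \<alpha>) r * r powr \<alpha>))
     \<longlongrightarrow> (real n + 2 - \<alpha>) * L' + (real n + \<alpha>) * L - (0 - 0 + 0)) at_top"
    by (intro tendsto_diff tendsto_add tendsto_mult tendsto_const L 3 b kp_bigo km_bigo)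
  hence "((\<lambda>_::real. 0) \<longlongrightarrow> (real n + 2 - \<alpha>) * L' + (real n + \<alpha>) * L) at_top"
  proof (rule tendsto_at_top_cong)
    fix r :: real assume "r > 0"
    hence "(real n + 2 - \<alpha>) * bsum (n + 2) (pw \<alpha>) r + (real n + \<alpha>) * bsum n (pw \<alpha>) r
     = bsum (n + 2) (kp \<alpha>) r - bsum n (km \<alpha>) r + 2 * (real n + 1) ^ 2 / r * bsum (n + 1) (pw \<alpha>) r"
      by (intro bsum_pw_rel_order) simp
    thus "(real n + 2 - \<alpha>) * (bsum (n + 2) (pw \<alpha>) r * r powr \<alpha>) + (real n + \<alpha>) * (bsum n (pw \<alpha>) r * r powr \<alpha>)
     - (bsum (n + 2) (kp \<alpha>) r * r powr \<alpha> - bsum n (km \<alpha>) r * r powr \<alpha> + 2 * (real n + 1) ^ 2 / r * bsum (n + 1) (pw \<alpha>) r * r powr \<alpha>) = 0"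
      by algebra
  qed simp
  thus ?thesis using tendsto_unique[OF trivial_limit_at_top_linorder _ tendsto_const] by metis
qed

text \<open>Both reciprocal Gamma factors move by one, in opposite directions, and
  \<open>z * rGamma (z + 1) = rGamma z\<close> holds for all real \<open>z\<close>, poles of Gamma
  included. The recursion therefore matches \<open>arc_limit_rec\<close> for every order.\<close>

lemma c1_rec: "(\<nu> + 2 - \<alpha>) * c1 \<alpha> (\<nu> + 2) + (\<nu> + \<alpha>) * c1 \<alpha> \<nu> = 0"
proof -
  define z where "z = (\<nu> - \<alpha> + 2) / 2"
  define w where "w = (- \<nu> - \<alpha>) / 2"
  have e: "(\<nu> + 2 - \<alpha> + 2) / 2 = z + 1" "(- (\<nu> + 2) - \<alpha> + 2) / 2 = w" "(- \<nu> - \<alpha> + 2) / 2 = w + 1" "\<nu> + 2 - \<alpha> = 2 * z" "\<nu> + \<alpha> = - (2 * w)"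
    by (simp_all add: z_def w_def field_simps)
  show ?thesis
  proof -
    have "X * (T * G * a * b) + Y * (T * G * c * d) = 0" if "z * a = c" "w * d = b" "X = 2 * z" "Y = - (2 * w)" for X Y T G a b c d :: real
      unfolding that(3,4) that(1,2)[symmetric] by (simp add: algebra_simps)
    thus "(\<nu> + 2 - \<alpha>) * c1 \<alpha> (\<nu> + 2) + (\<nu> + \<alpha>) * c1 \<alpha> \<nu> = 0"
      unfolding c1_def e(1-3) z_def[symmetric] using e(4,5) rGamma_plus1[of z] rGamma_plus1[of w] by blast
  qed
qed

text \<open>The factor is the coefficient of the explicit term in \<open>berr_pw_strong\<close>, so
  the constant for exponent \<open>\<delta>\<close> is inherited from exponent
  \<open>\<delta> - 1\<close> and order one higher. The hypothesis on Gamma says that the functional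
  equation holds at \<open>1 - \<delta>\<close>.\<close>

lemma c1_down:
  assumes "\<delta> \<noteq> 1" "Gamma (2 - \<delta>) = (1 - \<delta>) * Gamma (1 - \<delta>)"
  shows "c1 \<delta> \<nu> = (1 - (\<nu> + 1) / (\<delta> - 1)) * c1 (\<delta> - 1) (\<nu> + 1)"
proof -
  define z where "z = (\<nu> - \<delta> + 2) / 2"
  have e: "(\<nu> + 1 - (\<delta> - 1) + 2) / 2 = z + 1" "(- (\<nu> + 1) - (\<delta> - 1) + 2) / 2 = (- \<nu> - \<delta> + 2) / 2" "1 - (\<delta> - 1) = 2 - \<delta>"
    by (simp_all add: z_def field_simps)
  have g: "z * rGamma (z + 1) = rGamma z" by (rule rGamma_plus1)
  have "\<delta> - 1 = (\<delta> - 1 - 1) + 1" by simp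
  hence p: "(2::real) powr (\<delta> - 1) = 2 powr (\<delta> - 1 - 1) * 2" by (metis powr_add powr_one zero_le_numeral)
  have "1 - (\<nu> + 1) / (\<delta> - 1) = - (2 * z) / (\<delta> - 1)" using assms(1) by (simp add: z_def field_simps)
  moreover have "- (2 * z) / (\<delta> - 1) * (1 - \<delta>) = 2 * z" using assms(1) by (simp add: field_simps)
  ultimately have q: "(1 - (\<nu> + 1) / (\<delta> - 1)) * (1 - \<delta>) = 2 * z" by simp
  define t where "t = 1 - (\<nu> + 1) / (\<delta> - 1)"
  show ?thesis unfolding c1_def e z_def[symmetric] p assms(2) t_def[symmetric]
  proof -
    have "t * (1 - \<delta>) * rGamma (z + 1) = 2 * rGamma z" using q[folded t_def] g by simp
    hence "t * (1 - \<delta>) * rGamma (z + 1) * (2 powr (\<delta> - 1 - 1) * Gamma (1 - \<delta>) * rGamma ((- \<nu> - \<delta> + 2) / 2))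
       = 2 * rGamma z * (2 powr (\<delta> - 1 - 1) * Gamma (1 - \<delta>) * rGamma ((- \<nu> - \<delta> + 2) / 2))" by (simp only:)
    thus "2 powr (\<delta> - 1 - 1) * 2 * Gamma (1 - \<delta>) * rGamma z * rGamma ((- \<nu> - \<delta> + 2) / 2)
      = t * (2 powr (\<delta> - 1 - 1) * ((1 - \<delta>) * Gamma (1 - \<delta>)) * rGamma (z + 1) * rGamma ((- \<nu> - \<delta> + 2) / 2))"
      by (simp only: mult_ac)
  qed
qed

lemma Gamma_duplication_real:
  assumes "0 < \<alpha>" "\<alpha> < (1::real)"
  shows "Gamma ((1 - \<alpha>) / 2) * Gamma (1 - \<alpha> / 2) = 2 powr \<alpha> * sqrt pi * Gamma (1 - \<alpha>)"
proof -
  define z where "z = (1 - \<alpha>) / 2"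
  have z: "z > 0" using assms by (simp add: z_def)
  have "complex_of_real z \<notin> \<int>\<^sub>\<le>\<^sub>0" "complex_of_real z + 1 / 2 \<notin> \<int>\<^sub>\<le>\<^sub>0"
    using z by (auto elim!: nonpos_Ints_cases simp: complex_eq_iff)
  hence "Gamma (complex_of_real z) * Gamma (complex_of_real z + 1 / 2) =
             exp ((1 - 2*complex_of_real z) * of_real (ln 2)) * of_real (sqrt pi) * Gamma (2*complex_of_real z)"
    by (rule Gamma_legendre_duplication)
  also have "complex_of_real z + 1 / 2 = of_real (z + 1 / 2)" by simp
  also have "2 * complex_of_real z = of_real (2 * z)" by simp
  also have "(1 - of_real (2 * z)) * complex_of_real (ln 2) = of_real ((1 - 2 * z) * ln 2)" by simp
  finally have "complex_of_real (Gamma z * Gamma (z + 1 / 2)) = of_real (exp ((1 - 2 * z) * ln 2) * sqrt pi * Gamma (2 * z))"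
    by (simp only: Gamma_complex_of_real exp_of_real of_real_mult[symmetric])
  hence "Gamma z * Gamma (z + 1 / 2) = exp ((1 - 2 * z) * ln 2) * sqrt pi * Gamma (2 * z)" by (simp only: of_real_eq_iff)
  moreover have "z + 1 / 2 = 1 - \<alpha> / 2" "1 - 2 * z = \<alpha>" "2 * z = 1 - \<alpha>" by (simp_all add: z_def field_simps)
  ultimately have "Gamma z * Gamma (1 - \<alpha> / 2) = exp (\<alpha> * ln 2) * sqrt pi * Gamma (1 - \<alpha>)" by (simp only:)
  thus ?thesis by (simp add: powr_def z_def)
qed

text \<open>Duplication turns \<open>Gamma (1 - \<alpha>)\<close> into the product of the two
  half-step values, after which both sides are rational in \<open>x\<close>, \<open>y\<close> and
  \<open>sqrt pi\<close>.\<close>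

lemma c1_initial:
  assumes "0 < \<alpha>" "\<alpha> < (1::real)"
  shows "2 * c1 \<alpha> 1 = Beta (1 - \<alpha> / 2) (1 / 2) / pi" "c1 \<alpha> 0 + c1 \<alpha> 2 = Beta ((3 - \<alpha>) / 2) (1 / 2) / pi"
proof -
  define x where "x = Gamma ((1 - \<alpha>) / 2)"
  define y where "y = Gamma (1 - \<alpha> / 2)"
  define g where "g = Gamma (1 - \<alpha>)"
  define T where "T = (2::real) powr (\<alpha> - 1)"
  have xy: "x > 0" "y > 0" unfolding x_def y_def using assms by auto
  have T: "2 powr \<alpha> = 2 * T" unfolding T_def using powr_add[of 2 "\<alpha> - 1" 1] by simp
  have d: "x * y = 2 * T * sqrt pi * g" using Gamma_duplication_real[OF assms] unfolding T by (simp add: x_def y_def g_def)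
  have X: "Gamma ((3 - \<alpha>) / 2) = (1 - \<alpha>) / 2 * x"
    unfolding x_def 
  proof -
    have "(1 - \<alpha>) / 2 \<notin> \<int>\<^sub>\<le>\<^sub>0" using nonpos_Ints_nonpos[of "(1 - \<alpha>) / 2"] assms by auto
    moreover have "(3 - \<alpha>) / 2 = (1 - \<alpha>) / 2 + 1" by (simp add: field_simps)
    ultimately show "Gamma ((3 - \<alpha>) / 2) = (1 - \<alpha>) / 2 * Gamma ((1 - \<alpha>) / 2)" by (simp only: Gamma_plus1 simp_thms)
  qed
  have Y: "Gamma (2 - \<alpha> / 2) = (1 - \<alpha> / 2) * y"
    unfolding y_def 
  proof -
    have "1 - \<alpha> / 2 \<notin> \<int>\<^sub>\<le>\<^sub>0" using nonpos_Ints_nonpos[of "1 - \<alpha> / 2"] assms by auto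
    moreover have "2 - \<alpha> / 2 = 1 - \<alpha> / 2 + 1" by (simp add: field_simps)
    ultimately show "Gamma (2 - \<alpha> / 2) = (1 - \<alpha> / 2) * Gamma (1 - \<alpha> / 2)" by (simp only: Gamma_plus1 simp_thms)
  qed
  have sp: "sqrt pi * sqrt pi = pi" "sqrt pi > 0" by simp_all
  have "c1 \<alpha> 1 = T * g * (2 / ((1 - \<alpha>) * x)) * (1 / x)"
  proof -
    have "(1 - \<alpha> + 2) / 2 = (3 - \<alpha>) / 2" "(- 1 - \<alpha> + 2) / 2 = (1 - \<alpha>) / 2" by simp_all
    thus ?thesis unfolding c1_def rGamma_inverse_Gamma by (simp only: X T_def[symmetric] g_def[symmetric] x_def[symmetric]) (simp add: field_simps)
  qed
  moreover have "Beta (1 - \<alpha> / 2) (1 / 2) = y * sqrt pi / ((1 - \<alpha>) / 2 * x)"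
  proof -
    have "1 - \<alpha> / 2 + 1 / 2 = (3 - \<alpha>) / 2" by (simp add: field_simps)
    thus ?thesis unfolding Beta_def by (simp only: X y_def[symmetric] Gamma_one_half_real)
  qed
  moreover have "2 * (T * g * (2 / ((1 - \<alpha>) * x)) * (1 / x)) = y * sqrt pi / ((1 - \<alpha>) / 2 * x) / pi"
  proof -
    have "2 * T * g = x * y / sqrt pi" using d sp by (simp add: field_simps)
    moreover have "2 * (T * g * (2 / (b * x)) * (1 / x)) = y * sqrt pi / (b / 2 * x) / (sqrt pi * sqrt pi)"
      if "2 * T * g = x * y / sqrt pi" "b \<noteq> 0" for b
    proof -
      have "2 * (T * g * (2 / (b * x)) * (1 / x)) = (2 * T * g) * (2 / (b * x)) * (1 / x)" by simp
      also have "\<dots> = y * sqrt pi / (b / 2 * x) / (sqrt pi * sqrt pi)" unfolding that(1) using that(2) xy sp(2) by (simp add: divide_simps)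
      finally show ?thesis .
    qed
    ultimately show ?thesis unfolding sp(1) using assms by auto
  qed
  ultimately show "2 * c1 \<alpha> 1 = Beta (1 - \<alpha> / 2) (1 / 2) / pi" by simp
  have c0: "c1 \<alpha> 0 = T * g * (1 / y) * (1 / y)"
  proof -
    have "(0 - \<alpha> + 2) / 2 = 1 - \<alpha> / 2" "(- 0 - \<alpha> + 2) / 2 = 1 - \<alpha> / 2" by (simp_all add: field_simps)
    thus ?thesis unfolding c1_def rGamma_inverse_Gamma by (simp only: T_def[symmetric] g_def[symmetric] y_def[symmetric]) (simp add: field_simps)
  qed
  have "(2 - \<alpha>) * c1 \<alpha> 2 + \<alpha> * c1 \<alpha> 0 = 0" using c1_rec[of 0 \<alpha>] by simp
  hence "(2 - \<alpha>) * (c1 \<alpha> 0 + c1 \<alpha> 2) = 2 * (1 - \<alpha>) * c1 \<alpha> 0" by (simp add: algebra_simps)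
  hence s: "c1 \<alpha> 0 + c1 \<alpha> 2 = 2 * (1 - \<alpha>) * c1 \<alpha> 0 / (2 - \<alpha>)" using assms by (simp add: field_simps)
  have B: "Beta ((3 - \<alpha>) / 2) (1 / 2) = (1 - \<alpha>) / 2 * x * sqrt pi / ((1 - \<alpha> / 2) * y)"
  proof -
    have "(3 - \<alpha>) / 2 + 1 / 2 = 2 - \<alpha> / 2" by (simp add: field_simps)
    thus ?thesis unfolding Beta_def by (simp only: X Y Gamma_one_half_real)
  qed
  have "2 * T * g = x * y / sqrt pi" using d sp by (simp add: field_simps)
  hence "2 * c1 \<alpha> 0 = x / (y * sqrt pi)" unfolding c0 using xy by (simp add: field_simps)
  hence "2 * (1 - \<alpha>) * c1 \<alpha> 0 / (2 - \<alpha>) = (1 - \<alpha>) * (x / (y * sqrt pi)) / (2 - \<alpha>)" by (metis mult.assoc mult.commute)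
  also have "\<dots> = (1 - \<alpha>) / 2 * x * sqrt pi / ((1 - \<alpha> / 2) * y) / pi"
  proof -
    have "a * (x / (y * sqrt pi)) / (2 * c) = a / 2 * x * sqrt pi / (c * y) / (sqrt pi * sqrt pi)" if "c \<noteq> 0" for a c
      using that xy sp(2) by (simp add: divide_simps)
    from this[of "1 - \<alpha> / 2" "1 - \<alpha>"] show ?thesis unfolding sp(1) using assms by simp
  qed
  finally show "c1 \<alpha> 0 + c1 \<alpha> 2 = Beta ((3 - \<alpha>) / 2) (1 / 2) / pi" unfolding s B .
qed

text \<open>Orders 0 and 2 are determined together: their sum and the recursion form a linear system
  with determinant \<open>2 - 2 \<alpha>\<close>, nonzero because
  \<open>\<alpha> < 1\<close>.\<close>

lemma bsum_pw_limit_c1: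
  assumes \<alpha>: "0 < \<alpha>" "\<alpha> < 1" and L: "\<And>n. ((\<lambda>r. bsum n (pw \<alpha>) r * r powr \<alpha>) \<longlongrightarrow> L n) at_top"
  shows "L n = c1 \<alpha> (real n)"
proof (induction n rule: induct_nat_012)
  case 0
  have "L 0 + L 2 = c1 \<alpha> 0 + c1 \<alpha> 2" using arc_limit_0[OF \<alpha> L L] c1_initial(2)[OF \<alpha>] by simp
  moreover have "(2 - \<alpha>) * L 2 + \<alpha> * L 0 = 0" using arc_limit_rec[OF \<alpha> L[of 0] L[of "0 + 2"]] by (simp add: numeral_2_eq_2)
  moreover have "(2 - \<alpha>) * c1 \<alpha> 2 + \<alpha> * c1 \<alpha> 0 = 0" using c1_rec[of 0 \<alpha>] by simp
  ultimately have "(2 - 2 * \<alpha>) * (L 0 - c1 \<alpha> 0) = 0" by algebra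
  thus ?case using \<alpha> by simp
next
  case 1
  show ?case using arc_limit_1[OF \<alpha> L] c1_initial(1)[OF \<alpha>] by simp
next
  case (ge2 n)
  have "(real n + 2 - \<alpha>) * L (n + 2) + (real n + \<alpha>) * L n = 0" by (rule arc_limit_rec[OF \<alpha> L L])
  moreover have "(real n + 2 - \<alpha>) * c1 \<alpha> (real n + 2) + (real n + \<alpha>) * c1 \<alpha> (real n) = 0" by (rule c1_rec)
  ultimately have "(real n + 2 - \<alpha>) * (L (n + 2) - c1 \<alpha> (real n + 2)) = 0" unfolding ge2(1) by algebra
  moreover have "real n + 2 - \<alpha> \<noteq> 0" using \<alpha> by linarith
  ultimately show ?case by (simp add: add.commute)
qed

lemma bsum_pw_low_c1:
  assumes \<alpha>: "0 < \<alpha>" "\<alpha> < 1"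
  shows "(\<lambda>r. bsum n (pw \<alpha>) r - c1 \<alpha> (real n) * r powr (-\<alpha>) - blead n ((\<Sum>l. ode_rhs \<alpha> n l) / (\<alpha> - 1)) (\<Sum>l. (-1) ^ l * pw \<alpha> l) r)
     \<in> O[at_top](\<lambda>r. r powr (-(\<alpha> + 1)))"
proof -
  obtain L where L: "\<And>n. ((\<lambda>r. bsum n (pw \<alpha>) r * r powr \<alpha>) \<longlongrightarrow> L n) at_top"
    "\<And>n. (\<lambda>r. bsum n (pw \<alpha>) r - L n * r powr (-\<alpha>) - cn n * (\<Sum>l. ode_rhs \<alpha> n l) / pi * (ode_profile \<alpha> r * r powr (-\<alpha>))
       - blead n 0 (\<Sum>l. (-1) ^ l * pw \<alpha> l) r) \<in> O[at_top](\<lambda>r. r powr (-(\<alpha> + 1)))"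
    by (rule bsum_pw_low_limit[OF \<alpha>]) (rule that)
  have "L n = c1 \<alpha> (real n)" by (rule bsum_pw_limit_c1[OF \<alpha> L(1)])
  with L(2)[of n] have "(\<lambda>r. bsum n (pw \<alpha>) r - c1 \<alpha> (real n) * r powr (-\<alpha>) - cn n * (\<Sum>l. ode_rhs \<alpha> n l) / pi * (ode_profile \<alpha> r * r powr (-\<alpha>))
       - blead n 0 (\<Sum>l. (-1) ^ l * pw \<alpha> l) r) \<in> O[at_top](\<lambda>r. r powr (-(\<alpha> + 1)))" by simp
  thus ?thesis
  proof (rule bigo_ev_cong)
    show "\<forall>\<^sub>F r in at_top. bsum n (pw \<alpha>) r - c1 \<alpha> (real n) * r powr (-\<alpha>) - cn n * (\<Sum>l. ode_rhs \<alpha> n l) / pi * (ode_profile \<alpha> r * r powr (-\<alpha>))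
       - blead n 0 (\<Sum>l. (-1) ^ l * pw \<alpha> l) r
      = bsum n (pw \<alpha>) r - c1 \<alpha> (real n) * r powr (-\<alpha>) - blead n ((\<Sum>l. ode_rhs \<alpha> n l) / (\<alpha> - 1)) (\<Sum>l. (-1) ^ l * pw \<alpha> l) r"
      using eventually_gt_at_top[of "0::real"]
    proof eventually_elim
      case (elim r)
      have "r powr (\<alpha> - 1) * r powr (-\<alpha>) = r powr (-1)" unfolding powr_add[symmetric] by simp
      hence "r powr (\<alpha> - 1) * r powr (-\<alpha>) = 1 / r" using elim by (simp only: powr_minus_divide powr_one less_imp_le)
      \<comment> \<open>The particular solution of the differential equation is exactly of order
        \<open>1/r\<close>, so it merges with the alternating part into one
        \<open>blead\<close>.\<close>
      hence p: "ode_profile \<alpha> r * r powr (-\<alpha>) = 1 / (r * (\<alpha> - 1))" using \<alpha> by (simp add: ode_profile_def)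
      show ?case unfolding p blead_def by (simp add: add_divide_distrib)
    qed
  qed
qed

text \<open>The explicit term of \<open>berr_pw_strong\<close> is expanded by the result for
  \<open>\<alpha> = \<delta> - 1\<close>. After division by \<open>r\<close> its leading term
  \<open>r powr (-\<alpha>)\<close> becomes \<open>r powr (-\<delta>)\<close>, and its
  \<open>blead\<close> term is absorbed in the error.\<close>

lemma bsum_pw_mid_c1:
  assumes \<delta>: "1 < \<delta>" "\<delta> < 2"
  shows "(\<lambda>r. bsum n (pw \<delta>) r - c1 \<delta> (real n) * r powr (-\<delta>) - blead n (\<Sum>l. pw \<delta> l) (\<Sum>l. (-1) ^ l * pw \<delta> l) r)
     \<in> O[at_top](\<lambda>r. r powr (-2))"
proof -
  define \<alpha> where "\<alpha> = \<delta> - 1"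
  have \<alpha>: "0 < \<alpha>" "\<alpha> < 1" using \<delta> by (auto simp: \<alpha>_def)
  define t where "t = 1 - (real n + 1) / (\<delta> - 1)"
  define A B where "A = (\<Sum>l. ode_rhs \<alpha> (n + 1) l) / (\<alpha> - 1)" and "B = (\<Sum>l. (-1) ^ l * pw \<alpha> l)"
  have 1: "(\<lambda>r. bsum (n + 1) (pw \<alpha>) r - c1 \<alpha> (real (n + 1)) * r powr (-\<alpha>) - blead (n + 1) A B r) \<in> O[at_top](\<lambda>r. r powr (-1))"
    unfolding A_def B_def by (rule bigo_at_top_weaken[OF bsum_pw_low_c1[OF \<alpha>]]) (use \<alpha> in simp)
  have 2: "blead (n + 1) A B \<in> O[at_top](\<lambda>r. r powr (-1))"
  proof (rule landau_o.bigI[of "\<bar>A\<bar> + \<bar>B\<bar> + 1"])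
    show "\<forall>\<^sub>F r in at_top. norm (blead (n + 1) A B r) \<le> (\<bar>A\<bar> + \<bar>B\<bar> + 1) * norm (r powr (-1))"
      using eventually_gt_at_top[of "0::real"]
    proof eventually_elim
      case (elim r)
      have "\<bar>cn (n + 1) * A + sn (n + 1) r * B\<bar> \<le> 1 * \<bar>A\<bar> + 1 * \<bar>B\<bar>"
        using abs_cn_le_1[of "n + 1"] abs_sn_le_1[of "n + 1" r]
        by (intro order_trans[OF abs_triangle_ineq] add_mono) (simp_all add: abs_mult mult_left_le_one_le)
      hence "\<bar>cn (n + 1) * A + sn (n + 1) r * B\<bar> / (pi * r) \<le> (\<bar>A\<bar> + \<bar>B\<bar> + 1) / (1 * r)"
        using elim pi_ge_two by (intro frac_le mult_right_mono) auto
      thus ?case using elim by (simp add: blead_def abs_mult powr_minus_divide)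
    qed
  qed (intro add_nonneg_pos add_nonneg_nonneg abs_ge_zero zero_less_one)
  have "(\<lambda>r. t / r * ((bsum (n + 1) (pw \<alpha>) r - c1 \<alpha> (real (n + 1)) * r powr (-\<alpha>) - blead (n + 1) A B r) + blead (n + 1) A B r))
     \<in> O[at_top](\<lambda>r. r powr (-(1 + 1)))"
    by (rule bigo_at_top_div[OF sum_in_bigo(1)[OF 1 2]])
  moreover have "(\<lambda>r. berr n (pw \<delta>) r - t / r * bsum (n + 1) (pw \<alpha>) r) \<in> O[at_top](\<lambda>r. r powr (-2))"
    unfolding t_def \<alpha>_def by (rule berr_pw_strong[OF \<delta>(1)])
  ultimately have "(\<lambda>r. (berr n (pw \<delta>) r - t / r * bsum (n + 1) (pw \<alpha>) r)
      + t / r * ((bsum (n + 1) (pw \<alpha>) r - c1 \<alpha> (real (n + 1)) * r powr (-\<alpha>) - blead (n + 1) A B r) + blead (n + 1) A B r))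
     \<in> O[at_top](\<lambda>r. r powr (-2))" by (intro sum_in_bigo(1)) simp_all
  thus ?thesis
  proof (rule bigo_ev_cong)
    have c: "c1 \<delta> (real n) = t * c1 \<alpha> (real (n + 1))"
    proof -
      have "1 - \<delta> \<notin> \<int>\<^sub>\<le>\<^sub>0"
      proof
        assume "1 - \<delta> \<in> \<int>\<^sub>\<le>\<^sub>0"
        then obtain i :: int where i: "1 - \<delta> = of_int i" "i \<le> 0" by (auto elim: nonpos_Ints_cases)
        have "real_of_int (-1) < real_of_int i" "real_of_int i < real_of_int 0" using i(1) \<delta> by simp_all
        thus False by (simp only: of_int_less_iff)
      qed
      hence "Gamma (1 - \<delta> + 1) = (1 - \<delta>) * Gamma (1 - \<delta>)" by (rule Gamma_plus1)
      thus ?thesis unfolding t_def \<alpha>_def using c1_down[of \<delta> "real n"] \<delta> by (simp add: add.commute)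
    qed
    show "\<forall>\<^sub>F r in at_top. (berr n (pw \<delta>) r - t / r * bsum (n + 1) (pw \<alpha>) r)
      + t / r * ((bsum (n + 1) (pw \<alpha>) r - c1 \<alpha> (real (n + 1)) * r powr (-\<alpha>) - blead (n + 1) A B r) + blead (n + 1) A B r)
      = bsum n (pw \<delta>) r - c1 \<delta> (real n) * r powr (-\<delta>) - blead n (\<Sum>l. pw \<delta> l) (\<Sum>l. (-1) ^ l * pw \<delta> l) r"
      using eventually_gt_at_top[of "0::real"]
    proof eventually_elim
      case (elim r)
      have "r powr (-\<delta>) = 1 / r * r powr (-\<alpha>)"
        using elim powr_add[of r "-1" "-\<alpha>"] by (simp add: \<alpha>_def powr_minus_divide)
      thus ?case unfolding berr_def c by (simp add: algebra_simps)
    qed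
  qed
qed

section \<open>The logarithmic case\<close>

lemma bprod_limit: "((\<lambda>r. r * bprod n l r - (cn n + (-1) ^ l * sn n r) / pi) \<longlongrightarrow> 0) at_top"
proof -
  obtain C where C: "C > 0"
    "\<And>l r. r \<ge> 1 \<Longrightarrow> \<bar>bprod n l r - (cn n + (-1) ^ l * sn n r) / (pi * r)\<bar> \<le> C * (real l + 1) ^ 2 / r ^ 2"
    "\<And>l r. r \<ge> 1 \<Longrightarrow> r \<ge> 2 * real (l + n) \<Longrightarrow> \<bar>bprod n l r\<bar> \<le> C / r" by (rule bprod_uniform[of n]) (rule that)
  show ?thesis
  proof (rule Lim_null_comparison)
    show "((\<lambda>r::real. C * (real l + 1) ^ 2 / r) \<longlongrightarrow> 0) at_top" using C(1) by real_asymp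
    show "\<forall>\<^sub>F r in at_top. norm (r * bprod n l r - (cn n + (-1) ^ l * sn n r) / pi) \<le> C * (real l + 1) ^ 2 / r"
      using eventually_ge_at_top[of "1::real"]
    proof eventually_elim
      case (elim r)
      define x where "x = (cn n + (-1) ^ l * sn n r) / pi"
      have x: "(cn n + (-1) ^ l * sn n r) / (pi * r) = x / r" by (simp add: x_def)
      have "r * bprod n l r - x = r * (bprod n l r - x / r)" using elim by (simp add: right_diff_distrib)
      hence "\<bar>r * bprod n l r - x\<bar> = r * \<bar>bprod n l r - x / r\<bar>" using elim by (simp add: abs_mult)
      also have "\<dots> \<le> r * (C * (real l + 1) ^ 2 / r ^ 2)"
        using C(2)[OF elim, of l] elim unfolding x by (intro mult_left_mono) auto
      also have "\<dots> = C * (real l + 1) ^ 2 / r" using elim by (simp add: power2_eq_square)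
      finally show ?case by (simp add: x_def)
    qed
  qed
qed

lemma bounded_div_tendsto_0:
  fixes f :: "real \<Rightarrow> real"
  assumes "\<And>r. \<bar>f r\<bar> \<le> B"
  shows "((\<lambda>r. f r / r) \<longlongrightarrow> 0) at_top"
proof -
  have "((\<lambda>r::real. 1 / r) \<longlongrightarrow> 0) at_top" by real_asymp
  from tendsto_zero_mult_bounded[OF this assms] show ?thesis by simp
qed

lemma bprod_tendsto_0: "((\<lambda>r. bprod n l r) \<longlongrightarrow> 0) at_top"
proof -
  have "((\<lambda>r. 1 / r * (r * bprod n l r - (cn n + (-1) ^ l * sn n r) / pi)) \<longlongrightarrow> 0 * 0) at_top"
    by (intro tendsto_mult bprod_limit) real_asymp
  moreover have "((\<lambda>r. ((cn n + (-1) ^ l * sn n r) / pi) / r) \<longlongrightarrow> 0) at_top"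
  proof (rule bounded_div_tendsto_0[of _ 2])
    fix r
    have "\<bar>(-1) ^ l * sn n r\<bar> \<le> 1" using abs_sn_le_1[of n r] by (simp add: abs_mult)
    hence "\<bar>cn n + (-1) ^ l * sn n r\<bar> \<le> 2" using abs_cn_le_1[of n] by linarith
    hence "\<bar>cn n + (-1) ^ l * sn n r\<bar> / pi \<le> 2 / 1" using pi_ge_two by (intro frac_le) auto
    thus "\<bar>(cn n + (-1) ^ l * sn n r) / pi\<bar> \<le> 2" by simp
  qed
  ultimately have "((\<lambda>r. 1 / r * (r * bprod n l r - (cn n + (-1) ^ l * sn n r) / pi) + ((cn n + (-1) ^ l * sn n r) / pi) / r) \<longlongrightarrow> 0 * 0 + 0) at_top"
    by (rule tendsto_add)
  thus ?thesis by (rule tendsto_at_top_cong) (simp_all add: right_diff_distrib)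
qed

text \<open>Any error exponent above 1 suffices here; the minimum with \<open>3/2\<close> keeps it
  inside the range of \<open>berr_expand\<close>.\<close>

lemma berr_times_r_tendsto:
  assumes "(\<lambda>l. h l - c * pw \<epsilon> l) \<in> O(\<lambda>l. real l powr (-(\<epsilon> + 1)))" "\<epsilon> > 1"
  shows "((\<lambda>r. r * bsum n h r - (cn n * (\<Sum>l. h l) + sn n r * (\<Sum>l. (-1) ^ l * h l)) / pi) \<longlongrightarrow> 0) at_top"
proof -
  have "berr n h \<in> O[at_top](\<lambda>r. r powr (-(min (3/2) \<epsilon>)))"
    by (rule berr_expand[OF assms(1)]) (use assms(2) in auto)
  hence "((\<lambda>r. berr n h r * r powr 1) \<longlongrightarrow> 0) at_top" by (rule bigo_times_powr_tendsto) (use assms(2) in auto)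
  thus ?thesis by (rule tendsto_at_top_cong) (simp_all add: berr_def blead_def field_simps)
qed

text \<open>At \<open>\<alpha> = 1\<close> the profile is \<open>ln r\<close> with coefficient
  \<open>cn n / pi\<close>, and the homogeneous solution has the same order \<open>1/r\<close> as
  the leading terms. Its constant \<open>K n\<close> is what the following lemmas compute.\<close>

lemma bsum_pw_one_limit:
  obtains K where "\<And>n. ((\<lambda>r. r * bsum n (pw 1) r - cn n / pi * ln r - sn n r * (\<Sum>l. (-1) ^ l * pw 1 l) / pi) \<longlongrightarrow> K n) at_top"
proof -
  have "\<exists>L. (\<lambda>r. bsum n (pw 1) r - L * r powr (-1) - cn n * (\<Sum>l. ode_rhs 1 n l) / pi * (ode_profile 1 r * r powr (-1))
       - blead n 0 (\<Sum>l. (-1) ^ l * pw 1 l) r) \<in> O[at_top](\<lambda>r. r powr (-(3/2)))" for n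
    by (rule bsum_pw_low) auto
  from choice[OF allI[OF this]] obtain K where
    "\<forall>n. (\<lambda>r. bsum n (pw 1) r - K n * r powr (-1) - cn n * (\<Sum>l. ode_rhs 1 n l) / pi * (ode_profile 1 r * r powr (-1))
       - blead n 0 (\<Sum>l. (-1) ^ l * pw 1 l) r) \<in> O[at_top](\<lambda>r. r powr (-(3/2)))" by (rule exE)
  note K = this[rule_format]
  show ?thesis
  proof (rule that)
    fix n
    have "((\<lambda>r. (bsum n (pw 1) r - K n * r powr (-1) - cn n * (\<Sum>l. ode_rhs 1 n l) / pi * (ode_profile 1 r * r powr (-1))
       - blead n 0 (\<Sum>l. (-1) ^ l * pw 1 l) r) * r powr 1 + K n) \<longlongrightarrow> 0 + K n) at_top"
      by (intro tendsto_add tendsto_const bigo_times_powr_tendsto[OF K]) simp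
    thus "((\<lambda>r. r * bsum n (pw 1) r - cn n / pi * ln r - sn n r * (\<Sum>l. (-1) ^ l * pw 1 l) / pi) \<longlongrightarrow> K n) at_top"
    proof (rule tendsto_at_top_cong)
      fix r :: real assume r: "r > 0"
      define A where "A = (\<Sum>l. (-1) ^ l * pw 1 l)"
      have b: "blead n 0 A r * r = sn n r * A / pi" using r by (simp add: blead_def)
      have p: "r powr (-1) * r = 1" using r by (simp add: powr_minus_divide)
      have o: "(\<Sum>l. ode_rhs 1 n l) = 1" by (rule ode_rhs_sum(1)) auto
      have "(bsum n (pw 1) r - K n * r powr (-1) - cn n * 1 / pi * (ode_profile 1 r * r powr (-1)) - blead n 0 A r) * r powr 1 + K n
        = r * bsum n (pw 1) r - K n * (r powr (-1) * r) - cn n / pi * ode_profile 1 r * (r powr (-1) * r) - blead n 0 A r * r + K n"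
        using r by (simp add: algebra_simps)
      also have "\<dots> = r * bsum n (pw 1) r - cn n / pi * ln r - sn n r * A / pi" unfolding b p by (simp add: ode_profile_def)
      finally show "(bsum n (pw 1) r - K n * r powr (-1) - cn n * (\<Sum>l. ode_rhs 1 n l) / pi * (ode_profile 1 r * r powr (-1))
       - blead n 0 (\<Sum>l. (-1) ^ l * pw 1 l) r) * r powr 1 + K n
       = r * bsum n (pw 1) r - cn n / pi * ln r - sn n r * (\<Sum>l. (-1) ^ l * pw 1 l) / pi" unfolding o A_def .
    qed simp
  qed
qed

lemma cn_Suc_Suc: "cn (n + 2) = - cn n" and sn_Suc_Suc: "sn (n + 2) r = - sn n r"
proof -
  have "real (n + 2) * pi / 2 = real n * pi / 2 + pi" by (simp add: field_simps)
  thus "cn (n + 2) = - cn n" "sn (n + 2) r = - sn n r"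
    unfolding cn_def sn_def by (simp_all only: diff_add_eq_diff_diff_swap) (simp_all add: cos_add sin_diff)
qed

text \<open>The relation between orders \<open>n\<close> and \<open>n + 2\<close> now has an
  inhomogeneity: at exponent 1 the remainders \<open>kp\<close> and \<open>km\<close> reduce to
  single products of order \<open>1/r\<close>, with explicit limits.\<close>

lemma log_limit_rec:
  assumes K: "\<And>n. ((\<lambda>r. r * bsum n (pw 1) r - cn n / pi * ln r - sn n r * A / pi) \<longlongrightarrow> K n) at_top"
  shows "(real n + 1) * (K (n + 2) + K n) = 2 * cn n / pi"
proof -
  \<comment> \<open>\<open>pw 0\<close> is 0 at \<open>l = 0\<close> and 1 elsewhere, so its
    differences live at one index: \<open>l = 0\<close> for \<open>kp\<close> and
    \<open>l = 1\<close> for \<open>km\<close>.\<close>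
  have kp: "bsum (n + 2) (kp 1) r = - bprod (n + 2) 0 r" for r
    unfolding bsum_def by (subst suminf_finite[of "{0}"]) (auto simp: kp_def pw_def)
  have km: "bsum n (km 1) r = - bprod n 1 r" for r
    unfolding bsum_def by (subst suminf_finite[of "{1}"]) (auto simp: km_def pw_def)
  have "bsum (n + 1) (pw 1) \<in> O[at_top](\<lambda>r. r powr (-(1/2)))" by (rule bsum_bigo[OF pw_bigo]) auto
  hence "((\<lambda>r. bsum (n + 1) (pw 1) r * r powr 0) \<longlongrightarrow> 0) at_top" by (rule bigo_times_powr_tendsto) simp
  hence 3: "((\<lambda>r. bsum (n + 1) (pw 1) r) \<longlongrightarrow> 0) at_top" by (rule tendsto_at_top_cong) auto
  have "((\<lambda>r. (real n + 1) * ((r * bsum (n + 2) (pw 1) r - cn (n + 2) / pi * ln r - sn (n + 2) r * A / pi)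
           + (r * bsum n (pw 1) r - cn n / pi * ln r - sn n r * A / pi))
       + (r * bprod (n + 2) 0 r - (cn (n + 2) + (-1) ^ 0 * sn (n + 2) r) / pi)
       - (r * bprod n 1 r - (cn n + (-1) ^ 1 * sn n r) / pi)
       - 2 * (real n + 1) ^ 2 * bsum (n + 1) (pw 1) r)
     \<longlongrightarrow> (real n + 1) * (K (n + 2) + K n) + 0 - 0 - 2 * (real n + 1) ^ 2 * 0) at_top"
    by (intro tendsto_add tendsto_diff tendsto_mult tendsto_const K bprod_limit 3)
  hence "((\<lambda>_::real. 2 * cn n / pi) \<longlongrightarrow> (real n + 1) * (K (n + 2) + K n)) at_top"
  proof (rule tendsto_at_top_cong)
    fix r :: real assume r: "r > 0"
    have "(real n + 2 - 1) * bsum (n + 2) (pw 1) r + (real n + 1) * bsum n (pw 1) r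
     = bsum (n + 2) (kp 1) r - bsum n (km 1) r + 2 * (real n + 1) ^ 2 / r * bsum (n + 1) (pw 1) r"
      by (rule bsum_pw_rel_order) (use r in simp)
    hence "((real n + 2 - 1) * bsum (n + 2) (pw 1) r + (real n + 1) * bsum n (pw 1) r) * r
     = (bsum (n + 2) (kp 1) r - bsum n (km 1) r + 2 * (real n + 1) ^ 2 / r * bsum (n + 1) (pw 1) r) * r" by (simp only:)
    also have "\<dots> = - bprod (n + 2) 0 r * r + bprod n 1 r * r + 2 * (real n + 1) ^ 2 * bsum (n + 1) (pw 1) r"
      unfolding kp km using r by (simp add: algebra_simps)
    finally have e: "((real n + 2 - 1) * bsum (n + 2) (pw 1) r + (real n + 1) * bsum n (pw 1) r) * r
      = - bprod (n + 2) 0 r * r + bprod n 1 r * r + 2 * (real n + 1) ^ 2 * bsum (n + 1) (pw 1) r" .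
    define x where "x = cn n / pi"
    define y where "y = sn n r / pi"
    have "(real n + 1) * ((r * bsum (n + 2) (pw 1) r + x * ln r + y * A)
           + (r * bsum n (pw 1) r - x * ln r - y * A))
       + (r * bprod (n + 2) 0 r + x + y) - (r * bprod n 1 r - x + y)
       - 2 * (real n + 1) ^ 2 * bsum (n + 1) (pw 1) r = 2 * x" using e by algebra
    thus "(real n + 1) * ((r * bsum (n + 2) (pw 1) r - cn (n + 2) / pi * ln r - sn (n + 2) r * A / pi)
           + (r * bsum n (pw 1) r - cn n / pi * ln r - sn n r * A / pi))
       + (r * bprod (n + 2) 0 r - (cn (n + 2) + (-1) ^ 0 * sn (n + 2) r) / pi)
       - (r * bprod n 1 r - (cn n + (-1) ^ 1 * sn n r) / pi)
       - 2 * (real n + 1) ^ 2 * bsum (n + 1) (pw 1) r = 2 * cn n / pi"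
      unfolding cn_Suc_Suc sn_Suc_Suc x_def y_def by (simp add: add_divide_distrib diff_divide_distrib)
  qed simp
  thus ?thesis using tendsto_unique[OF trivial_limit_at_top_linorder _ tendsto_const] by metis
qed

lemma cn_0: "cn 0 = 1" and cn_1: "cn (Suc 0) = 0" and sn_0: "sn 0 r = sin (2 * r)"
  by (simp_all add: cn_def sn_def)

lemma pw_0_eq: "pw 0 l = (if l = 0 then 0 else 1)"
  by (simp add: pw_def)

text \<open>With weight \<open>1/l\<close> the linking recurrence gives the sum of
  \<open>J_l^2\<close> over \<open>l > 0\<close>, known exactly from the normalisation, so the
  constant needs no limit theorem for the squares.\<close>

lemma log_limit_1:
  assumes K: "((\<lambda>r. r * bsum 1 (pw 1) r - cn 1 / pi * ln r - sn 1 r * (\<Sum>l. (-1) ^ l * pw 1 l) / pi) \<longlongrightarrow> K) at_top"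
  shows "K = 1 / 2"
proof -
  define A where "A = (\<Sum>l. (-1) ^ l * pw 1 l)"
  define h where "h = (\<lambda>l. pw 1 (Suc l) - pw 1 l)"
  have sA: "(\<lambda>l. (-1) ^ l * pw 1 l) sums A" using pw_alternating_sums(1)[of 1] by (simp add: A_def sums_iff)
  have "(\<lambda>l. (-1) ^ Suc l * pw 1 (Suc l)) sums A" using sA by (subst sums_Suc_iff) simp
  hence "(\<lambda>l. - ((-1) ^ Suc l * pw 1 (Suc l)) - (-1) ^ l * pw 1 l) sums (- A - A)" by (intro sums_diff sums_minus sA)
  hence "(\<lambda>l. (-1) ^ l * h l) sums (- A - A)" by (simp add: h_def right_diff_distrib)
  hence hs: "(\<Sum>l. (-1) ^ l * h l) = - 2 * A" by (simp add: sums_iff)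
  have "((\<lambda>r. r * bsum 1 h r - (cn 1 * (\<Sum>l. h l) + sn 1 r * (\<Sum>l. (-1) ^ l * h l)) / pi) \<longlongrightarrow> 0) at_top"
    unfolding h_def by (rule berr_times_r_tendsto[OF pw_Suc_diff_bigo(1)]) simp
  hence 1: "((\<lambda>r. r * bsum 1 h r + 2 * (sn 1 r * A / pi)) \<longlongrightarrow> 0) at_top"
    by (rule tendsto_at_top_cong) (simp_all add: hs cn_1)
  have 2: "((\<lambda>r. r * bsum 1 (pw 1) r - sn 1 r * A / pi) \<longlongrightarrow> K) at_top"
    using K by (simp add: cn_1 A_def)
  have "((\<lambda>r. 2 * (r * bsum 1 (pw 1) r - sn 1 r * A / pi) + (r * bsum 1 h r + 2 * (sn 1 r * A / pi)) + bprod 0 0 r) \<longlongrightarrow> 2 * K + 0 + 0) at_top"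
    by (intro tendsto_add tendsto_mult tendsto_const 1 2 bprod_tendsto_0)
  hence "((\<lambda>_::real. 1) \<longlongrightarrow> 2 * K) at_top"
  proof (rule tendsto_at_top_cong)
    fix r :: real assume r: "r > 0"
    have a: "2 / r * bsum 0 (\<lambda>l. real l * pw 1 l) r = bsum 1 (pw 1) r + bsum 1 (\<lambda>l. pw 1 (Suc l)) r"
      by (rule bsum_0_of_nat_mult) (use r in auto)
    have p: "real l * pw 1 l = 1 - (if l = 0 then 1 else 0)" for l by (simp add: pw_mult pw_0_eq)
    have "bsum 0 (\<lambda>l. real l * pw 1 l) r = bsum 0 (\<lambda>_. 1) r - bsum 0 (\<lambda>l. if l = 0 then 1 else 0) r"
      unfolding p by (rule bsum_diff) (auto intro!: exp_bdd_intros)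
    also have "bsum 0 (\<lambda>l. if l = 0 then 1 else 0) r = bprod 0 0 r"
      unfolding bsum_def by (subst suminf_finite[of "{0}"]) auto
    finally have b: "2 * bsum 0 (\<lambda>l. real l * pw 1 l) r = 1 - bprod 0 0 r" using bessel_J_sum_squares[of r] by simp
    have c: "bsum 1 h r = bsum 1 (\<lambda>l. pw 1 (Suc l)) r - bsum 1 (pw 1) r"
      unfolding h_def by (rule bsum_diff) (intro exp_bdd_Suc exp_bdd_pw)+
    have "r * (bsum 1 (pw 1) r + bsum 1 (\<lambda>l. pw 1 (Suc l)) r) = 1 - bprod 0 0 r"
      unfolding a[symmetric] using r b by simp
    thus "2 * (r * bsum 1 (pw 1) r - sn 1 r * A / pi) + (r * bsum 1 h r + 2 * (sn 1 r * A / pi)) + bprod 0 0 r = 1"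
      unfolding c by (simp add: algebra_simps)
  qed simp
  hence "2 * K = 1" using tendsto_unique[OF trivial_limit_at_top_linorder _ tendsto_const] by metis
  thus ?thesis by simp
qed

section \<open>The logarithmic moment of the arcsine law\<close>

lemma continuous_on_mult_ln: "continuous_on {0..} (\<lambda>x::real. x * ln x)"
  unfolding continuous_on_eq_continuous_within
proof
  fix x :: real assume x: "x \<in> {0..}"
  show "continuous (at x within {0..}) (\<lambda>x. x * ln x)"
  proof (cases "x = 0")
    case True
    have "((\<lambda>x::real. x * ln x) \<longlongrightarrow> 0) (at_right 0)" by real_asymp
    thus ?thesis using True by (simp add: continuous_within at_within_Ici_at_right)
  next
    case False
    thus ?thesis using x by (intro continuous_intros) auto
  qed
qed

lemma log_moment_has_integral:
  "((\<lambda>y. (sqrt y * ln (sqrt y)) * arc_weight y) has_integral pi * (2 / pi * (ln 2 - 1))) {0..1}"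
proof -
  \<comment> \<open>The integrand is \<open>ln y / (2 sqrt (1 - y))\<close>; with
    \<open>u = sqrt (1 - y)\<close> and \<open>y = (1 - u) (1 + u)\<close> a primitive comes from
    the primitives of the two logarithms.\<close>
  define F where "F = (\<lambda>u::real. (1 - u) * ln (1 - u) - (1 + u) * ln (1 + u) + 2 * u)"
  have F: "continuous_on {0..1} F" unfolding F_def
    by (intro continuous_intros continuous_on_compose2[OF continuous_on_mult_ln]) auto
  have dF: "(F has_real_derivative - (ln (1 - u) + ln (1 + u))) (at u)" if "0 < u" "u < 1" for u
  proof -
    have x: "((\<lambda>x. x * ln x) has_real_derivative ln x + 1) (at x)" if "x > 0" for x :: real
      using that by (auto intro!: derivative_eq_intros)
    have 1: "((\<lambda>u. (1 - u) * ln (1 - u)) has_real_derivative (ln (1 - u) + 1) * (- 1)) (at u)"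
      by (rule DERIV_chain2[OF x]) (use that in \<open>auto intro!: derivative_eq_intros\<close>)
    have 2: "((\<lambda>u. (1 + u) * ln (1 + u)) has_real_derivative (ln (1 + u) + 1) * 1) (at u)"
      by (rule DERIV_chain2[OF x]) (use that in \<open>auto intro!: derivative_eq_intros\<close>)
    have 3: "((\<lambda>u. 2 * u) has_real_derivative 2) (at u)" by (auto intro!: derivative_eq_intros)
    from DERIV_add[OF DERIV_diff[OF 1 2] 3] show ?thesis unfolding F_def by (simp add: algebra_simps)
  qed
  have "((\<lambda>y. (sqrt y * ln (sqrt y)) * arc_weight y) has_integral F (sqrt (1 - 1)) - F (sqrt (1 - 0))) {0..1}"
  proof (rule fundamental_theorem_of_calculus_interior)
    show "continuous_on {0..1} (\<lambda>y. F (sqrt (1 - y)))"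
      by (rule continuous_on_compose2[OF F]) (auto intro!: continuous_intros)
    fix y :: real assume y: "y \<in> {0<..<1}"
    define u where "u = sqrt (1 - y)"
    have u: "0 < u" "u < 1" "u ^ 2 = 1 - y" using y by (auto simp: u_def)
    have du: "((\<lambda>y. sqrt (1 - y)) has_real_derivative - (1 / (2 * u))) (at y)"
      using y unfolding u_def by (auto intro!: derivative_eq_intros simp: field_simps)
    have "ln (1 - u) + ln (1 + u) = ln ((1 - u) * (1 + u))" using u by (subst ln_mult) auto
    also have "(1 - u) * (1 + u) = y" using u(3) by (simp add: algebra_simps power2_eq_square)
    finally have l: "ln (1 - u) + ln (1 + u) = ln y" .
    have "(sqrt y * ln (sqrt y)) * arc_weight y = ln y / (2 * u)"
    proof -
      have "arc_weight y = 1 / sqrt y * (1 / u)"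
        using y by (simp add: arc_weight_def u_def powr_minus_divide powr_half_sqrt)
      thus ?thesis using y by (simp add: ln_sqrt)
    qed
    moreover have "((\<lambda>y. F (sqrt (1 - y))) has_real_derivative - (ln (1 - u) + ln (1 + u)) * (- (1 / (2 * u)))) (at y)"
      by (rule DERIV_chain2[OF _ du]) (use dF[OF u(1,2)] in \<open>simp add: u_def\<close>)
    ultimately show "((\<lambda>y. F (sqrt (1 - y))) has_vector_derivative (sqrt y * ln (sqrt y)) * arc_weight y) (at y)"
      unfolding l has_real_derivative_iff_has_vector_derivative by simp
  qed simp
  thus ?thesis by (simp add: F_def)
qed

lemma abs_mult_ln_le:
  assumes "t \<ge> (0::real)" shows "\<bar>t * ln t\<bar> \<le> 1 + t ^ 2"
proof (cases "t = 0")
  case False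
  hence t: "t > 0" using assms by simp
  have "t * ln t \<le> t * (t - 1)" using t ln_le_minus_one[OF t] by (intro mult_left_mono) auto
  moreover have "t * ln (1 / t) \<le> t * (1 / t - 1)" using t ln_le_minus_one[of "1 / t"] by (intro mult_left_mono) auto
  hence "- (t * ln t) \<le> 1 - t" using t by (simp add: ln_div right_diff_distrib)
  moreover have "t * (t - 1) = t ^ 2 - t" by (simp add: power2_eq_square algebra_simps)
  moreover have "t ^ 2 \<ge> 0" by simp
  ultimately show ?thesis using t by linarith
qed simp

text \<open>Both sides have the same derivative and vanish at 0. The closed form expresses the first
  absolute moment through two products only, and so gives it with a rate.\<close>

lemma bsum_1_const:
  assumes "r \<ge> 0"
  shows "r * bsum 1 (\<lambda>_. 1) r = r ^ 2 / 2 * (bprod 0 0 r + bprod 0 1 r)"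
proof -
  define D where "D = (\<lambda>r. r * bsum 1 (\<lambda>_. 1) r - r ^ 2 / 2 * (bprod 0 0 r + bprod 0 1 r))"
  have "D r = D 0"
  proof (rule constant_on_pos[OF _ _ assms])
    show "isCont D x" for x unfolding D_def
      by (intro continuous_intros DERIV_isCont[OF bsum_deriv[OF exp_bdd_const]] DERIV_isCont[OF bprod_deriv]) auto
    fix x :: real assume x: "x > 0"
    have "bsum 0 (\<lambda>l. if l = 0 then 1 else 1 - 1) x = bprod 0 0 x"
      unfolding bsum_def by (subst suminf_finite[of "{0}"]) auto
    hence 1: "((\<lambda>r. r * bsum 1 (\<lambda>_. 1) r) has_real_derivative x * bprod 0 0 x) (at x)"
      using bsum_1_deriv[OF exp_bdd_const[of 1], of x] x by simp
    have 2: "((\<lambda>r. r ^ 2 / 2 * (bprod 0 0 r + bprod 0 1 r)) has_real_derivative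
        x * (bprod 0 0 x + bprod 0 1 x) + x ^ 2 / 2 * (bprod' 0 0 x + bprod' 0 1 x)) (at x)"
      by (rule derivative_eq_intros bprod_deriv refl | simp add: algebra_simps)+
    have j: "bessel_J' 0 x = - bessel_J 1 x" "x * bessel_J' 1 x = x * bessel_J 0 x - bessel_J 1 x"
      unfolding One_nat_def bessel_J'_eq(2)[OF less_imp_neq[OF x, symmetric]] using x by (simp_all add: bessel_J'_def right_diff_distrib)
    have "x ^ 2 / 2 * (bprod' 0 0 x + bprod' 0 1 x) = x * (x * (bessel_J 0 x * bessel_J' 0 x)) + x * (bessel_J 1 x * (x * bessel_J' 1 x))"
      by (simp add: bprod'_def power2_eq_square algebra_simps)
    also have "\<dots> = - x * bprod 0 1 x" unfolding j by (simp add: bprod_def algebra_simps)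
    finally have "x * bprod 0 0 x - (x * (bprod 0 0 x + bprod 0 1 x) + x ^ 2 / 2 * (bprod' 0 0 x + bprod' 0 1 x)) = 0"
      by (simp add: algebra_simps)
    thus "(D has_real_derivative 0) (at x)" unfolding D_def using DERIV_diff[OF 1 2] by (simp only:)
  qed
  thus ?thesis by (simp add: D_def)
qed

text \<open>Writing \<open>ln (l/r)\<close> as \<open>ln l - ln r\<close> multiplies the first
  moment by \<open>ln r\<close>. The arcsine law alone gives its limit without a rate; the closed
  form of the order-1 sum supplies the error \<open>O(1/r)\<close>, which beats the
  logarithm.\<close>

lemma first_moment_limit:
  "((\<lambda>r. ln r * (2 / r * bsum 0 (\<lambda>l. real l) r - 2 / pi)) \<longlongrightarrow> 0) at_top"
proof -
  obtain C where C: "C > 0"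
    "\<And>l r. r \<ge> 1 \<Longrightarrow> \<bar>bprod 0 l r - (cn 0 + (-1) ^ l * sn 0 r) / (pi * r)\<bar> \<le> C * (real l + 1) ^ 2 / r ^ 2"
    "\<And>l r. r \<ge> 1 \<Longrightarrow> r \<ge> 2 * real (l + 0) \<Longrightarrow> \<bar>bprod 0 l r\<bar> \<le> C / r" by (rule bprod_uniform[of 0]) (rule that)
  obtain C' where C': "C' > 0"
    "\<And>l r. r \<ge> 1 \<Longrightarrow> \<bar>bprod 1 l r - (cn 1 + (-1) ^ l * sn 1 r) / (pi * r)\<bar> \<le> C' * (real l + 1) ^ 2 / r ^ 2"
    "\<And>l r. r \<ge> 1 \<Longrightarrow> r \<ge> 2 * real (l + 1) \<Longrightarrow> \<bar>bprod 1 l r\<bar> \<le> C' / r" by (rule bprod_uniform[of 1]) (rule that)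
  show ?thesis
  proof (rule Lim_null_comparison)
    show "((\<lambda>r::real. ln r * ((5 * C + C') / r)) \<longlongrightarrow> 0) at_top" using C(1) C'(1) by real_asymp
    show "\<forall>\<^sub>F r in at_top. norm (ln r * (2 / r * bsum 0 (\<lambda>l. real l) r - 2 / pi)) \<le> ln r * ((5 * C + C') / r)"
      using eventually_ge_at_top[of "2::real"]
    proof eventually_elim
      case (elim r)
      have r: "r \<ge> 1" "r > 0" using elim by auto
      have "2 / r * bsum 0 (\<lambda>l. real l * pw 0 l) r = bsum 1 (pw 0) r + bsum 1 (\<lambda>l. pw 0 (Suc l)) r"
        by (rule bsum_0_of_nat_mult) (use r in auto)
      moreover have "(\<lambda>l. real l * pw 0 l) = (\<lambda>l. real l)" "(\<lambda>l. pw 0 (Suc l)) = (\<lambda>_. 1)" by (auto simp: pw_0_eq fun_eq_iff)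
      moreover have "bsum 1 (pw 0) r = bsum 1 (\<lambda>_. 1) r - bprod 1 0 r"
      proof -
        have "bsum 1 (\<lambda>l. 1 - (if l = 0 then 1 else 0)) r = bsum 1 (\<lambda>_. 1) r - bsum 1 (\<lambda>l. if l = 0 then 1 else 0) r"
          by (rule bsum_diff) (auto intro!: exp_bdd_intros)
        also have "bsum 1 (\<lambda>l. if l = 0 then 1 else 0) r = bprod 1 0 r"
          unfolding bsum_def by (subst suminf_finite[of "{0}"]) auto
        also have "(\<lambda>l::nat. 1 - (if l = 0 then 1 else 0)) = pw 0" by (auto simp: pw_0_eq fun_eq_iff)
        finally show ?thesis .
      qed
      moreover have "2 * bsum 1 (\<lambda>_. 1) r = r * (bprod 0 0 r + bprod 0 1 r)"
        using bsum_1_const[of r] r by (simp add: power2_eq_square)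
      ultimately have e: "2 / r * bsum 0 (\<lambda>l. real l) r = r * (bprod 0 0 r + bprod 0 1 r) - bprod 1 0 r" by simp
      define x y where "x = bprod 0 0 r - (cn 0 + (-1) ^ 0 * sn 0 r) / (pi * r)" and "y = bprod 0 1 r - (cn 0 + (-1) ^ 1 * sn 0 r) / (pi * r)"
      have "\<bar>x\<bar> \<le> C * (real 0 + 1) ^ 2 / r ^ 2" unfolding x_def by (rule C(2)[OF r(1)])
      moreover have "\<bar>y\<bar> \<le> C * (real 1 + 1) ^ 2 / r ^ 2" unfolding y_def by (rule C(2)[OF r(1)])
      ultimately have "\<bar>x + y\<bar> \<le> 5 * C / r ^ 2" by (simp add: power2_eq_square add_divide_distrib[symmetric]) 
      hence "r * \<bar>x + y\<bar> \<le> r * (5 * C / r ^ 2)" using r by (intro mult_left_mono) auto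
      hence 1: "\<bar>r * (x + y)\<bar> \<le> 5 * C / r" using r by (simp add: abs_mult power2_eq_square)
      have "bprod 0 0 r + bprod 0 1 r = x + y + 2 / (pi * r)" by (simp add: x_def y_def cn_0 add_divide_distrib diff_divide_distrib)
      hence "r * (bprod 0 0 r + bprod 0 1 r) = r * (x + y) + 2 / pi" using r by (simp add: distrib_left)
      hence "2 / r * bsum 0 (\<lambda>l. real l) r - 2 / pi = r * (x + y) - bprod 1 0 r" unfolding e by simp
      also have "\<bar>\<dots>\<bar> \<le> 5 * C / r + C' / r" 
      proof -
        have "\<bar>bprod 1 0 r\<bar> \<le> C' / r" by (rule C'(3)[OF r(1)]) (use elim in simp)
        thus ?thesis using 1 by linarith
      qed
      finally have "\<bar>2 / r * bsum 0 (\<lambda>l. real l) r - 2 / pi\<bar> \<le> (5 * C + C') / r" by (simp add: add_divide_distrib)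
      hence "ln r * \<bar>2 / r * bsum 0 (\<lambda>l. real l) r - 2 / pi\<bar> \<le> ln r * ((5 * C + C') / r)" using r by (intro mult_left_mono) auto
      thus ?case using r by (simp add: abs_mult)
    qed
  qed
qed

lemma ln_pred_diff_bigo:
  "(\<lambda>l. (if l = 0 then ln (real 0) else ln (real l) - ln (real (l - 1))) - pw 1 l - 1 / 2 * pw 2 l) \<in> O(\<lambda>l. real l powr (-(2 + 1)))"
proof -
  have "(\<lambda>l. ln (real l) - ln (real l - 1) - real l powr (-1) - 1 / 2 * real l powr (-2)) \<in> O(\<lambda>l. real l powr (-(2 + 1)))"
    by real_asymp
  hence "(\<lambda>l. ln (real l) - ln (real (l - 1)) - real l powr (-1) - 1 / 2 * real l powr (-2)) \<in> O(\<lambda>l. real l powr (-(2 + 1)))"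
    by (rule bigo_pred_transform)
  thus ?thesis
    by (rule bigo_ev_cong) (use eventually_gt_at_top[of "0::nat"] in \<open>eventually_elim, simp add: pw_def\<close>)
qed

text \<open>The weight \<open>1/l\<close> is the difference of \<open>ln l\<close> up to a summable
  error, so the sum of squares is a derivative of an order-1 sum with weight \<open>ln l\<close>.
  The latter is tied by the recurrence to the sum of \<open>l ln l J_l^2\<close>, whose scaled form
  the arcsine law evaluates with \<open>t ln t\<close>.\<close>

lemma log_limit_0:
  assumes K: "((\<lambda>r. r * bsum 0 (pw 1) r - cn 0 / pi * ln r - sn 0 r * A / pi) \<longlongrightarrow> K) at_top"
  shows "K = (euler_mascheroni + ln 2) / pi"
proof -
  define \<gamma> where "\<gamma> = (euler_mascheroni :: real)"
  define f where "f = (\<lambda>l. ln (real l))"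
  define g where "g = (\<lambda>l. if l = 0 then f 0 else f l - f (l - 1))"
  define e where "e = (\<lambda>l. g l - pw 1 l)"
  have f: "exp_bdd f" "f 0 = 0" unfolding f_def by (auto intro!: exp_bdd_intros)
  have g: "exp_bdd g" unfolding g_def by (intro exp_bdd_if exp_bdd_const exp_bdd_diff f exp_bdd_pred)
  have e: "(\<lambda>l. e l - 1 / 2 * pw 2 l) \<in> O(\<lambda>l. real l powr (-(2 + 1)))"
    unfolding e_def g_def f_def by (rule ln_pred_diff_bigo)
  define B where "B = (\<Sum>l. (-1) ^ l * e l)"
  \<comment> \<open>The defining limit of the Euler-Mascheroni constant, which enters the final
    constant here.\<close>
  have es: "(\<Sum>l. e l) = - \<gamma>"
  proof -
    have "summable e" by (rule bigo_summable(2)[OF expand_bigo[OF e]]) simp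
    hence "(\<lambda>N. \<Sum>l\<le>N. e l) \<longlonglongrightarrow> (\<Sum>l. e l)" by (rule summable_LIMSEQ')
    moreover have "(\<Sum>l\<le>N. e l) = - (harm N - ln (of_nat N))" for N
    proof (induction N)
      case 0
      show ?case by (simp add: e_def g_def f_def harm_def)
    next
      case (Suc N)
      have "e (Suc N) = ln (real (Suc N)) - ln (real N) - inverse (real (Suc N))"
        by (simp add: e_def g_def f_def pw_def powr_minus)
      thus ?case using Suc by (simp add: harm_Suc)
    qed
    ultimately have "(\<lambda>N. - (harm N - ln (of_nat N))) \<longlonglongrightarrow> (\<Sum>l. e l)" by simp
    moreover have "(\<lambda>N. - (harm N - ln (of_nat N))) \<longlonglongrightarrow> - \<gamma>" unfolding \<gamma>_def by (intro tendsto_minus euler_mascheroni_LIMSEQ)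
    ultimately show ?thesis by (rule LIMSEQ_unique)
  qed
  have el: "((\<lambda>r. r * bsum 0 e r - (cn 0 * (\<Sum>l. e l) + sn 0 r * B) / pi) \<longlongrightarrow> 0) at_top"
    unfolding B_def by (rule berr_times_r_tendsto[OF e]) simp
  have ge: "bsum 0 g r = bsum 0 (pw 1) r + bsum 0 e r" for r
  proof -
    have "bsum 0 e r = bsum 0 g r - bsum 0 (pw 1) r" unfolding e_def by (rule bsum_diff[OF g exp_bdd_pw])
    thus ?thesis by simp
  qed
  \<comment> \<open>L'Hospital's rule. The primitives of \<open>ln r / pi\<close> and of the
    oscillating \<open>sin (2 r)\<close> are subtracted beforehand; otherwise the quotient of
    derivatives would not converge.\<close>
  have "((\<lambda>r. (r * bsum 1 f r - (r * ln r - r) / pi + (A + B) / pi * (cos (2 * r) / 2)) / r) \<longlongrightarrow> K - \<gamma> / pi) at_top"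
  proof (rule lhospital_at_top_at_top)
    show "LIM r at_top. (r::real) :> at_top" by (rule filterlim_ident)
    show "\<forall>\<^sub>F r::real in at_top. (1::real) \<noteq> 0" by simp
    show "\<forall>\<^sub>F r::real in at_top. ((\<lambda>r. r) has_real_derivative 1) (at r)" by simp
    show "\<forall>\<^sub>F r in at_top. ((\<lambda>r. r * bsum 1 f r - (r * ln r - r) / pi + (A + B) / pi * (cos (2 * r) / 2)) has_real_derivative
       r * bsum 0 g r - ln r / pi - (A + B) / pi * sin (2 * r)) (at r)"
      using eventually_gt_at_top[of "0::real"]
    proof eventually_elim
      case (elim r)
      have 1: "((\<lambda>r. r * bsum 1 f r) has_real_derivative r * bsum 0 g r) (at r)"
        unfolding g_def by (rule bsum_1_deriv[OF f(1)]) (use elim in simp)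
      have 2: "((\<lambda>r. (r * ln r - r) / pi) has_real_derivative ln r / pi) (at r)"
        using elim by (auto intro!: derivative_eq_intros simp: field_simps)
      have 3: "((\<lambda>r. (A + B) / pi * (cos (2 * r) / 2)) has_real_derivative (A + B) / pi * (- sin (2 * r))) (at r)"
        by (rule DERIV_cmult) (auto intro!: derivative_eq_intros)
      from DERIV_add[OF DERIV_diff[OF 1 2] 3] show ?case by simp
    qed
    have "((\<lambda>r. (r * bsum 0 (pw 1) r - cn 0 / pi * ln r - sn 0 r * A / pi) + (r * bsum 0 e r - (cn 0 * (\<Sum>l. e l) + sn 0 r * B) / pi) - \<gamma> / pi)
      \<longlongrightarrow> K + 0 - \<gamma> / pi) at_top" by (intro tendsto_add tendsto_diff tendsto_const K el)
    thus "((\<lambda>r. (r * bsum 0 g r - ln r / pi - (A + B) / pi * sin (2 * r)) / 1) \<longlongrightarrow> K - \<gamma> / pi) at_top"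
      by (rule tendsto_at_top_cong) (simp_all add: ge es cn_0 sn_0 add_divide_distrib diff_divide_distrib algebra_simps)
  qed
  moreover have "((\<lambda>r. ((A + B) / pi * (cos (2 * r) / 2)) / r) \<longlongrightarrow> 0) at_top"
  proof (rule bounded_div_tendsto_0)
    show "\<bar>(A + B) / pi * (cos (2 * r) / 2)\<bar> \<le> \<bar>(A + B) / pi\<bar> * (1 / 2)" for r
      unfolding abs_mult by (intro mult_left_mono) auto
  qed
  ultimately have "((\<lambda>r. (r * bsum 1 f r - (r * ln r - r) / pi + (A + B) / pi * (cos (2 * r) / 2)) / r - ((A + B) / pi * (cos (2 * r) / 2)) / r)
    \<longlongrightarrow> K - \<gamma> / pi - 0) at_top" by (rule tendsto_diff)
  hence L1: "((\<lambda>r. bsum 1 f r - (ln r - 1) / pi) \<longlongrightarrow> K - \<gamma> / pi) at_top"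
  proof (rule tendsto_at_top_cong)
    fix r :: real assume r: "r > 0"
    have "(r * b - (r * ln r - r) / pi + c) / r - c / r = b - (ln r - 1) / pi" for b c
      using r by (simp add: field_simps)
    thus "(r * bsum 1 f r - (r * ln r - r) / pi + (A + B) / pi * (cos (2 * r) / 2)) / r - ((A + B) / pi * (cos (2 * r) / 2)) / r
      = bsum 1 f r - (ln r - 1) / pi" .
  qed simp
  define d where "d = (\<lambda>l. f (Suc l) - f l)"
  have "d \<in> O(\<lambda>l. real l powr (-1))" unfolding d_def f_def of_nat_Suc by real_asymp
  hence "bsum 1 d \<in> O[at_top](\<lambda>r. r powr (-(1/2)))" by (rule bsum_bigo) auto
  hence "((\<lambda>r. bsum 1 d r * r powr 0) \<longlongrightarrow> 0) at_top" by (rule bigo_times_powr_tendsto) simp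
  hence L2: "(bsum 1 d \<longlongrightarrow> 0) at_top" by (rule tendsto_at_top_cong) auto
  \<comment> \<open>The logarithms cancel between the order-1 sum and the first moment; what is left
    is the expectation of \<open>t ln t\<close> at \<open>t = l/r\<close>.\<close>
  have "((\<lambda>r. 2 * (bsum 1 f r - (ln r - 1) / pi) + bsum 1 d r - ln r * (2 / r * bsum 0 (\<lambda>l. real l) r - 2 / pi) - 2 / pi)
     \<longlongrightarrow> 2 * (K - \<gamma> / pi) + 0 - 0 - 2 / pi) at_top"
    by (intro tendsto_add tendsto_diff tendsto_mult tendsto_const L1 L2 first_moment_limit)
  hence "((\<lambda>r. wsum (\<lambda>l. sqrt ((real l / r) ^ 2) * ln (sqrt ((real l / r) ^ 2))) r) \<longlongrightarrow> 2 * (K - \<gamma> / pi) - 2 / pi) at_top"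
  proof (rule tendsto_at_top_cong)
    fix r :: real assume r: "r > 0"
    have h: "sqrt ((real l / r) ^ 2) * ln (sqrt ((real l / r) ^ 2)) = 1 / r * (real l * f l) - ln r / r * real l" for l
    proof -
      have s: "sqrt ((real l / r) ^ 2) = real l / r" using r by (simp only: real_sqrt_abs) simp
      show ?thesis unfolding s using r by (cases "l = 0") (simp_all add: f_def ln_div field_simps)
    qed
    have x: "exp_bdd (\<lambda>l. real l * f l)" by (intro exp_bdd_mult exp_bdd_of_nat f)
    have "wsum (\<lambda>l. sqrt ((real l / r) ^ 2) * ln (sqrt ((real l / r) ^ 2))) r = 2 * bsum 0 (\<lambda>l. 1 / r * (real l * f l) - ln r / r * real l) r"
      unfolding wsum_def h by simp
    also have "\<dots> = 2 / r * bsum 0 (\<lambda>l. real l * f l) r - ln r * (2 / r * bsum 0 (\<lambda>l. real l) r)"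
      by (simp only: bsum_diff[OF exp_bdd_cmult[OF x] exp_bdd_cmult[OF exp_bdd_of_nat]] bsum_cmult[OF x] bsum_cmult[OF exp_bdd_of_nat])
         (simp add: right_diff_distrib)
    also have "2 / r * bsum 0 (\<lambda>l. real l * f l) r = bsum 1 f r + bsum 1 (\<lambda>l. f (Suc l)) r"
      by (rule bsum_0_of_nat_mult[OF f]) (use r in simp)
    also have "bsum 1 (\<lambda>l. f (Suc l)) r = bsum 1 d r + bsum 1 f r"
      using bsum_diff[OF exp_bdd_Suc[OF f(1)] f(1), of 1 r] by (simp add: d_def)
    finally show "2 * (bsum 1 f r - (ln r - 1) / pi) + bsum 1 d r - ln r * (2 / r * bsum 0 (\<lambda>l. real l) r - 2 / pi) - 2 / pi
      = wsum (\<lambda>l. sqrt ((real l / r) ^ 2) * ln (sqrt ((real l / r) ^ 2))) r"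
      by (simp add: right_diff_distrib diff_divide_distrib)
  qed simp
  moreover have "((\<lambda>r. wsum (\<lambda>l. (\<lambda>y. sqrt y * ln (sqrt y)) ((real l / r) ^ 2)) r) \<longlongrightarrow> 2 / pi * (ln 2 - 1)) at_top"
  proof (rule wsum_limit)
    show "continuous_on {0..4} (\<lambda>y::real. sqrt y * ln (sqrt y))"
      by (rule continuous_on_compose2[OF continuous_on_mult_ln]) (auto intro!: continuous_intros)
    show "\<bar>sqrt y * ln (sqrt y)\<bar> \<le> 1 + y" if "y \<ge> 0" for y
      using abs_mult_ln_le[of "sqrt y"] that by simp
  qed (rule log_moment_has_integral)
  ultimately have "2 * (K - \<gamma> / pi) - 2 / pi = 2 / pi * (ln 2 - 1)"
    using tendsto_unique[OF trivial_limit_at_top_linorder] by blast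
  hence "K = \<gamma> / pi + ln 2 / pi" by (simp add: right_diff_distrib)
  thus ?thesis by (simp add: \<gamma>_def add_divide_distrib)
qed

text \<open>The recursion in the order is that of \<open>Digamma\<close> at half steps:
  \<open>(n + 1) / 2\<close> grows by 1, which adds \<open>2 / (n + 1)\<close>, while
  \<open>cn\<close> and the sine change sign.\<close>

lemma log_limit:
  assumes K: "\<And>n. ((\<lambda>r. r * bsum n (pw 1) r - cn n / pi * ln r - sn n r * (\<Sum>l. (-1) ^ l * pw 1 l) / pi) \<longlongrightarrow> K n) at_top"
  shows "K n = 1 / pi * (- cn n * (Digamma ((real n + 1) / 2) + ln 2) + pi / 2 * sin (real n * pi / 2))"
proof (induction n rule: induct_nat_012)
  case 0
  show ?case using log_limit_0[OF K] Digamma_one_half[where 'a = real] by (simp add: cn_0)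
next
  case 1
  show ?case using log_limit_1[OF K[of 1]] by (simp add: cn_1)
next
  case (ge2 n)
  have m: "x = y / m" if "m * x = y" "m \<noteq> 0" for x y m :: real using that by auto
  have "K (n + 2) + K n = 2 * cn n / pi / (real n + 1)" by (rule m[OF log_limit_rec[OF K]]) linarith
  hence k: "K (n + 2) = 2 * cn n / pi / (real n + 1) - K n" by simp
  have d: "Digamma ((real (n + 2) + 1) / 2) = Digamma ((real n + 1) / 2) + 2 / (real n + 1)"
  proof -
    have "(real (n + 2) + 1) / 2 = (real n + 1) / 2 + 1" by simp
    moreover have "(real n + 1) / 2 > 0" by simp
    hence "(real n + 1) / 2 \<noteq> 0" by (rule less_imp_neq[symmetric])
    hence "Digamma ((real n + 1) / 2 + 1) = Digamma ((real n + 1) / 2) + 1 / ((real n + 1) / 2)" by (rule Digamma_plus1)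
    ultimately show ?thesis by (simp only: divide_divide_eq_right mult_1_left)
  qed
  have s: "sin (real (n + 2) * pi / 2) = - sin (real n * pi / 2)"
  proof -
    have "real (n + 2) * pi / 2 = real n * pi / 2 + pi" by (simp add: field_simps)
    thus ?thesis by (simp only: sin_periodic_pi)
  qed
  define m where "m = real n + 1"
  have "m \<noteq> 0" by (simp add: m_def)
  have "K (n + 2) = 1 / pi * (- cn (n + 2) * (Digamma ((real (n + 2) + 1) / 2) + ln 2) + pi / 2 * sin (real (n + 2) * pi / 2))"
    unfolding k ge2(1) d cn_Suc_Suc s m_def[symmetric] using \<open>m \<noteq> 0\<close> by (simp add: field_simps)
  thus ?case by simp
qed

section \<open>Assembling the expansion\<close>

text \<open>The original weights after renaming the smaller of the two Bessel orders to
  \<open>l\<close>. The renaming starts the series at \<open>l = k + 1\<close>, hence the zeros up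
  to \<open>k\<close>.\<close>

definition shifted_pw :: "nat \<Rightarrow> real \<Rightarrow> real \<Rightarrow> nat \<Rightarrow> real" where
  "shifted_pw k \<beta> \<alpha> l = (if k < l then (real l - real k + \<beta>) powr (-\<alpha>) else 0)"

text \<open>The influence of \<open>\<beta>\<close> and \<open>k\<close>. It decays one power faster
  than \<open>pw \<alpha>\<close>, so it affects the constants of order \<open>1/r\<close> but not
  the term \<open>r powr (-\<alpha>)\<close>.\<close>

definition shift_diff :: "nat \<Rightarrow> real \<Rightarrow> real \<Rightarrow> nat \<Rightarrow> real" where
  "shift_diff k \<beta> \<alpha> l = shifted_pw k \<beta> \<alpha> l - pw \<alpha> l"

lemma shift_diff_bigo:
  "(\<lambda>l. shift_diff k \<beta> \<alpha> l - (- \<alpha> * (\<beta> - real k)) * pw (\<alpha> + 1) l) \<in> O(\<lambda>l. real l powr (-(\<alpha> + 1 + 1)))"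
proof -
  define s where "s = - \<alpha>"
  define c where "c = \<beta> - real k"
  have "(\<lambda>l. (real l + c) powr s - real l powr s - s * c * real l powr (s - 1)) \<in> O(\<lambda>l. real l powr (s - 2))"
    by real_asymp
  moreover have "\<forall>\<^sub>F l in sequentially. (real l + c) powr s - real l powr s - s * c * real l powr (s - 1)
    = shift_diff k \<beta> \<alpha> l - (- \<alpha> * (\<beta> - real k)) * pw (\<alpha> + 1) l"
    using eventually_gt_at_top[of k]
  proof eventually_elim
    case (elim l)
    have "real l - real k + \<beta> = real l + c" "- (\<alpha> + 1) = s - 1" by (simp_all add: c_def s_def)
    thus ?case using elim by (simp only: shift_diff_def shifted_pw_def pw_def if_True) (simp add: s_def c_def)
  qed
  ultimately have "(\<lambda>l. shift_diff k \<beta> \<alpha> l - (- \<alpha> * (\<beta> - real k)) * pw (\<alpha> + 1) l) \<in> O(\<lambda>l. real l powr (s - 2))"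
    by (rule bigo_ev_cong)
  moreover have "s - 2 = -(\<alpha> + 1 + 1)" by (simp add: s_def)
  ultimately show ?thesis by (simp only:)
qed

lemma summable_shift_diff:
  assumes "\<alpha> > 0"
  shows "summable (shift_diff k \<beta> \<alpha>)" "summable (\<lambda>l. (-1) ^ l * shift_diff k \<beta> \<alpha> l)" "exp_bdd (shift_diff k \<beta> \<alpha>)"
  using bigo_summable[OF expand_bigo[OF shift_diff_bigo]] bigo_exp_bdd[OF expand_bigo[OF shift_diff_bigo]] assms by simp_all

lemma shifted_pw_eq: "shifted_pw k \<beta> \<alpha> l = pw \<alpha> l + shift_diff k \<beta> \<alpha> l"
  by (simp add: shift_diff_def)

lemma bessel_sum_eq:
  assumes "\<alpha> > 0" "\<beta> > -1"
  shows "bessel_sum \<alpha> \<beta> (k + n) k r = bsum n (pw \<alpha>) r + bsum n (shift_diff k \<beta> \<alpha>) r"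
proof -
  have e: "exp_bdd (shifted_pw k \<beta> \<alpha>)"
    unfolding shifted_pw_eq[abs_def] by (intro exp_bdd_add exp_bdd_pw summable_shift_diff assms)
  have "bsum n (shifted_pw k \<beta> \<alpha>) r = (\<Sum>i. shifted_pw k \<beta> \<alpha> (i + Suc k) * bprod n (i + Suc k) r)
     + (\<Sum>l<Suc k. shifted_pw k \<beta> \<alpha> l * bprod n l r)"
    unfolding bsum_def by (rule suminf_split_initial_segment[OF summable_bprod(1)[OF e]])
  also have "(\<Sum>l<Suc k. shifted_pw k \<beta> \<alpha> l * bprod n l r) = 0"
    by (intro sum.neutral) (auto simp: shifted_pw_def)
  also have "(\<Sum>i. shifted_pw k \<beta> \<alpha> (i + Suc k) * bprod n (i + Suc k) r) = bessel_sum \<alpha> \<beta> (k + n) k r"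
    unfolding bessel_sum_def
  proof (intro suminf_cong)
    fix i
    have "real (i + Suc k) - real k + \<beta> = real (Suc i) + \<beta>" by simp
    moreover have "(real (Suc i) + \<beta>) powr (-\<alpha>) = 1 / (real (Suc i) + \<beta>) powr \<alpha>" by (rule powr_minus_divide)
    moreover have "i + Suc k = Suc i + k" "i + Suc k + n = Suc i + (k + n)" by simp_all
    ultimately show "shifted_pw k \<beta> \<alpha> (i + Suc k) * bprod n (i + Suc k) r
      = (let l = Suc i in bessel_J (l + k) r * bessel_J (l + (k + n)) r / (real l + \<beta>) powr \<alpha>)"
      by (simp add: shifted_pw_def bprod_def Let_def add_ac)
  qed
  finally show ?thesis
    unfolding shifted_pw_eq[abs_def] using bsum_add[OF exp_bdd_pw summable_shift_diff(3)[OF assms(1)], of n \<alpha> k \<beta> r] by simp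
qed

lemma shifted_pw_partial_sum:
  "(\<Sum>l<M + Suc k. shifted_pw k \<beta> \<alpha> l) = (\<Sum>i<M. (real i + (\<beta> + 1)) powr (-\<alpha>))"
  "(\<Sum>l<M + Suc k. (-1) ^ l * shifted_pw k \<beta> \<alpha> l) = - ((-1) ^ k) * (\<Sum>i<M. (-1) ^ i * (real i + (\<beta> + 1)) powr (-\<alpha>))"
proof -
  have z: "(\<Sum>l<Suc k. shifted_pw k \<beta> \<alpha> l) = 0" "(\<Sum>l<Suc k. (-1) ^ l * shifted_pw k \<beta> \<alpha> l) = 0"
    by (intro sum.neutral, auto simp: shifted_pw_def)+
  have s: "shifted_pw k \<beta> \<alpha> (M + Suc k) = (real M + (\<beta> + 1)) powr (-\<alpha>)" for M
    by (simp add: shifted_pw_def add_ac)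
  show "(\<Sum>l<M + Suc k. shifted_pw k \<beta> \<alpha> l) = (\<Sum>i<M. (real i + (\<beta> + 1)) powr (-\<alpha>))"
  proof (induction M)
    case 0
    show ?case using z by simp
  next
    case (Suc M)
    have "(\<Sum>l<Suc M + Suc k. shifted_pw k \<beta> \<alpha> l) = (\<Sum>l<M + Suc k. shifted_pw k \<beta> \<alpha> l) + shifted_pw k \<beta> \<alpha> (M + Suc k)"
      by simp
    thus ?case unfolding Suc s by simp
  qed
  show "(\<Sum>l<M + Suc k. (-1) ^ l * shifted_pw k \<beta> \<alpha> l) = - ((-1) ^ k) * (\<Sum>i<M. (-1) ^ i * (real i + (\<beta> + 1)) powr (-\<alpha>))"
  proof (induction M)
    case 0
    show ?case using z by simp
  next
    case (Suc M)
    have "(\<Sum>l<Suc M + Suc k. (-1) ^ l * shifted_pw k \<beta> \<alpha> l)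
       = (\<Sum>l<M + Suc k. (-1) ^ l * shifted_pw k \<beta> \<alpha> l) + (-1) ^ (M + Suc k) * shifted_pw k \<beta> \<alpha> (M + Suc k)"
      by simp
    thus ?case unfolding Suc s by (simp add: power_add algebra_simps)
  qed
qed

text \<open>Reindexing the partial sums by \<open>k + 1\<close> changes the correction term by an
  amount that tends to 0; what remains is the limit formula for the Hurwitz zeta function.\<close>

lemma shifted_zeta:
  assumes \<alpha>: "\<alpha> > 0" "\<alpha> \<noteq> 1" and \<beta>: "\<beta> > -1"
    and A: "(\<lambda>M. (\<Sum>l<M. pw \<alpha> l) - real M powr (1 - \<alpha>) / (1 - \<alpha>)) \<longlonglongrightarrow> A"
  shows "A + (\<Sum>l. shift_diff k \<beta> \<alpha> l) = hurwitz_zeta_real \<alpha> (\<beta> + 1)"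
proof -
  have "(\<lambda>M. ((\<Sum>l<M. pw \<alpha> l) - real M powr (1 - \<alpha>) / (1 - \<alpha>)) + (\<Sum>l<M. shift_diff k \<beta> \<alpha> l))
    \<longlonglongrightarrow> A + (\<Sum>l. shift_diff k \<beta> \<alpha> l)"
    by (intro tendsto_add A summable_LIMSEQ summable_shift_diff \<alpha>)
  from LIMSEQ_ignore_initial_segment[OF this, of "Suc k"]
  have 1: "(\<lambda>M. ((\<Sum>l<M + Suc k. pw \<alpha> l) - real (M + Suc k) powr (1 - \<alpha>) / (1 - \<alpha>)) + (\<Sum>l<M + Suc k. shift_diff k \<beta> \<alpha> l))
    \<longlonglongrightarrow> A + (\<Sum>l. shift_diff k \<beta> \<alpha> l)" .
  have 2: "((\<Sum>l<M + Suc k. pw \<alpha> l) - real (M + Suc k) powr (1 - \<alpha>) / (1 - \<alpha>)) + (\<Sum>l<M + Suc k. shift_diff k \<beta> \<alpha> l)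
     = ((\<Sum>i<M. (real i + (\<beta> + 1)) powr (-\<alpha>)) - real M powr (1 - \<alpha>) / (1 - \<alpha>))
       - ((real M + real (Suc k)) powr (1 - \<alpha>) - real M powr (1 - \<alpha>)) / (1 - \<alpha>)" for M
    unfolding shifted_pw_partial_sum(1)[of k \<beta> \<alpha> M, symmetric] shifted_pw_eq sum.distrib by (simp add: diff_divide_distrib add_ac)
  have "(\<lambda>M. ((\<Sum>i<M. (real i + (\<beta> + 1)) powr (-\<alpha>)) - real M powr (1 - \<alpha>) / (1 - \<alpha>))
       - ((real M + real (Suc k)) powr (1 - \<alpha>) - real M powr (1 - \<alpha>)) / (1 - \<alpha>)) \<longlonglongrightarrow> hurwitz_zeta_real \<alpha> (\<beta> + 1) - 0 / (1 - \<alpha>)"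
    using \<alpha> \<beta> by (intro tendsto_diff tendsto_divide tendsto_const hurwitz_zeta_real_LIMSEQ powr_shift_tendsto_0) auto
  with 1 show ?thesis unfolding 2 using LIMSEQ_unique by fastforce
qed

text \<open>The sign \<open>- (-1)^k\<close> comes from the index shift by \<open>k + 1\<close>; the
  same power of \<open>-1\<close> appears in \<open>sin_shift\<close> and cancels against
  it.\<close>

lemma alternating_total:
  assumes \<alpha>: "\<alpha> > 0"
  shows "(\<lambda>M. \<Sum>i<M. (-1) ^ i * (real i + (\<beta> + 1)) powr (-\<alpha>))
     \<longlonglongrightarrow> - ((-1) ^ k * ((\<Sum>l. (-1) ^ l * pw \<alpha> l) + (\<Sum>l. (-1) ^ l * shift_diff k \<beta> \<alpha> l)))"
proof -
  have "(\<lambda>l. (-1) ^ l * pw \<alpha> l) sums (\<Sum>l. (-1) ^ l * pw \<alpha> l)" using pw_alternating_sums(1)[OF \<alpha>] by (simp add: sums_iff)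
  from sums_add[OF this summable_sums[OF summable_shift_diff(2)[OF \<alpha>, of k \<beta>]]]
  have "(\<lambda>l. (-1) ^ l * shifted_pw k \<beta> \<alpha> l) sums ((\<Sum>l. (-1) ^ l * pw \<alpha> l) + (\<Sum>l. (-1) ^ l * shift_diff k \<beta> \<alpha> l))"
    unfolding shifted_pw_eq distrib_left .
  hence "(\<lambda>M. \<Sum>l<M. (-1) ^ l * shifted_pw k \<beta> \<alpha> l) \<longlonglongrightarrow> ((\<Sum>l. (-1) ^ l * pw \<alpha> l) + (\<Sum>l. (-1) ^ l * shift_diff k \<beta> \<alpha> l))"
    by (simp add: sums_def)
  from LIMSEQ_ignore_initial_segment[OF this, of "Suc k"]
  have "(\<lambda>M. - ((-1) ^ k * (- ((-1) ^ k) * (\<Sum>i<M. (-1) ^ i * (real i + (\<beta> + 1)) powr (-\<alpha>)))))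
     \<longlonglongrightarrow> - ((-1) ^ k * ((\<Sum>l. (-1) ^ l * pw \<alpha> l) + (\<Sum>l. (-1) ^ l * shift_diff k \<beta> \<alpha> l)))"
    unfolding shifted_pw_partial_sum(2) by (intro tendsto_intros)
  moreover have "- ((-1) ^ k * (- ((-1) ^ k) * x)) = x" for x :: real
  proof -
    have "(-1) ^ k * (-1) ^ k = (1::real)" by (simp add: power_mult_distrib[symmetric])
    thus ?thesis by (simp add: mult.assoc[symmetric])
  qed
  ultimately show ?thesis by (simp only:)
qed

text \<open>For \<open>\<alpha> \<noteq> 1\<close> the alternating series is split into even and odd
  indices; halving the indices pulls out \<open>2 powr (-\<alpha>)\<close> and gives two Hurwitz
  series. For \<open>\<alpha> = 1\<close> it is the Lerch series itself.\<close>

lemma c3_eq: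
  assumes \<alpha>: "\<alpha> > 0" and \<beta>: "\<beta> > -1"
  shows "c3 \<alpha> \<beta> = (-1) ^ k * ((\<Sum>l. (-1) ^ l * pw \<alpha> l) + (\<Sum>l. (-1) ^ l * shift_diff k \<beta> \<alpha> l)) / pi"
proof -
  define B where "B = (-1) ^ k * ((\<Sum>l. (-1) ^ l * pw \<alpha> l) + (\<Sum>l. (-1) ^ l * shift_diff k \<beta> \<alpha> l))"
  have B: "(\<lambda>M. \<Sum>i<M. (-1) ^ i * (real i + (\<beta> + 1)) powr (-\<alpha>)) \<longlonglongrightarrow> - B"
    unfolding B_def by (rule alternating_total[OF \<alpha>])
  have "c3 \<alpha> \<beta> = B / pi"
  proof (cases "\<alpha> = 1")
    case True
    have "(\<lambda>i. (-1) ^ i / (real i + (\<beta> + 1)) powr 1) sums (- B)"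
      using B unfolding sums_def True by (simp add: powr_minus_divide)
    hence "lerch_phi (-1) 1 (\<beta> + 1) = - B" by (simp add: lerch_phi_def sums_iff)
    thus ?thesis using True by (simp add: c3_def)
  next
    case False
    define u where "u = 2 powr (-\<alpha>)"
    have u: "u > 0" by (simp add: u_def)
    have scale: "u * (real n + (x + 1) / 2) powr (-\<alpha>) = (real (2 * n) + (x + 1)) powr (-\<alpha>)" if "x > -1" for n x
    proof -
      have "real (2 * n) + (x + 1) = 2 * (real n + (x + 1) / 2)" by (simp add: field_simps)
      thus ?thesis using that by (simp only: u_def) (subst powr_mult, auto)
    qed
    \<comment> \<open>Both Hurwitz limits carry the same correction, so it drops out and partial
      sums of even length \<open>2 L\<close> remain.\<close>
    have "(\<lambda>L. u * (((\<Sum>n<L. (real n + (\<beta> + 1 + 1) / 2) powr (-\<alpha>)) - real L powr (1 - \<alpha>) / (1 - \<alpha>))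
       - ((\<Sum>n<L. (real n + (\<beta> + 1) / 2) powr (-\<alpha>)) - real L powr (1 - \<alpha>) / (1 - \<alpha>))))
      \<longlonglongrightarrow> u * (hurwitz_zeta_real \<alpha> ((\<beta> + 1 + 1) / 2) - hurwitz_zeta_real \<alpha> ((\<beta> + 1) / 2))"
      using \<alpha> \<beta> False by (intro tendsto_mult tendsto_diff tendsto_const hurwitz_zeta_real_LIMSEQ) auto
    moreover have "u * (((\<Sum>n<L. (real n + (\<beta> + 1 + 1) / 2) powr (-\<alpha>)) - real L powr (1 - \<alpha>) / (1 - \<alpha>))
       - ((\<Sum>n<L. (real n + (\<beta> + 1) / 2) powr (-\<alpha>)) - real L powr (1 - \<alpha>) / (1 - \<alpha>)))
      = - (\<Sum>i<2 * L. (-1) ^ i * (real i + (\<beta> + 1)) powr (-\<alpha>))" for L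
    proof (induction L)
      case (Suc L)
      have "2 * Suc L = Suc (Suc (2 * L))" by simp
      hence "- (\<Sum>i<2 * Suc L. (-1) ^ i * (real i + (\<beta> + 1)) powr (-\<alpha>))
        = - (\<Sum>i<2 * L. (-1) ^ i * (real i + (\<beta> + 1)) powr (-\<alpha>)) - (real (2 * L) + (\<beta> + 1)) powr (-\<alpha>)
          + (real (2 * L) + (\<beta> + 1 + 1)) powr (-\<alpha>)" by (simp add: add_ac)
      also have "\<dots> = u * ((\<Sum>n<L. (real n + (\<beta> + 1 + 1) / 2) powr (-\<alpha>)) - (\<Sum>n<L. (real n + (\<beta> + 1) / 2) powr (-\<alpha>)))
        - u * (real L + (\<beta> + 1) / 2) powr (-\<alpha>) + u * (real L + (\<beta> + 1 + 1) / 2) powr (-\<alpha>)"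
        using \<beta> Suc by (subst scale, simp, subst scale, simp) simp
      finally show ?case by (simp add: algebra_simps)
    qed simp
    ultimately have "(\<lambda>L. - (\<Sum>i<2 * L. (-1) ^ i * (real i + (\<beta> + 1)) powr (-\<alpha>)))
      \<longlonglongrightarrow> u * (hurwitz_zeta_real \<alpha> ((\<beta> + 1 + 1) / 2) - hurwitz_zeta_real \<alpha> ((\<beta> + 1) / 2))" by (simp only:)
    moreover have "(\<lambda>L. - (\<Sum>i<2 * L. (-1) ^ i * (real i + (\<beta> + 1)) powr (-\<alpha>))) \<longlonglongrightarrow> - (- B)"
      using LIMSEQ_subseq_LIMSEQ[OF B, of "\<lambda>L. 2 * L"] by (intro tendsto_minus) (simp add: o_def strict_mono_def)
    ultimately have "u * (hurwitz_zeta_real \<alpha> ((\<beta> + 1 + 1) / 2) - hurwitz_zeta_real \<alpha> ((\<beta> + 1) / 2)) = - (- B)"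
      by (rule LIMSEQ_unique)
    moreover have "\<beta> + 1 + 1 = \<beta> + 2" by simp
    ultimately show ?thesis using False unfolding c3_def u_def by (simp only: if_False minus_minus times_divide_eq_left)
  qed
  thus ?thesis by (simp add: B_def)
qed

text \<open>Partial sums of the shifted series compare with \<open>ln M\<close> through the digamma
  limit, and the harmonic numbers through the Euler-Mascheroni limit; the logarithms cancel.\<close>

lemma shift_diff_harmonic:
  assumes \<beta>: "\<beta> > -1"
  shows "(\<Sum>l. shift_diff k \<beta> 1 l) = - ext_harm \<beta>"
proof -
  have "(\<lambda>M. \<Sum>l<M. shift_diff k \<beta> 1 l) \<longlonglongrightarrow> (\<Sum>l. shift_diff k \<beta> 1 l)"
    by (intro summable_LIMSEQ summable_shift_diff) simp
  from LIMSEQ_ignore_initial_segment[OF this, of "Suc k"]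
  have 1: "(\<lambda>M. \<Sum>l<M + Suc k. shift_diff k \<beta> 1 l) \<longlonglongrightarrow> (\<Sum>l. shift_diff k \<beta> 1 l)" .
  have h: "(\<Sum>l<Suc M. pw 1 l) = harm M" for M
    by (induction M) (simp_all add: harm_def pw_def powr_minus)
  have "(\<lambda>M. ln (real M) - (\<Sum>n<M. inverse (\<beta> + 1 + real n))) \<longlonglongrightarrow> Digamma (\<beta> + 1)"
    using Digamma_LIMSEQ[of "\<beta> + 1"] \<beta> by simp
  moreover have "(\<lambda>M. harm (M + k) - ln (real (M + k))) \<longlonglongrightarrow> euler_mascheroni"
    using LIMSEQ_ignore_initial_segment[OF euler_mascheroni_LIMSEQ, of k] by simp
  moreover have "(\<lambda>M. ln (real (M + k)) - ln (real M)) \<longlonglongrightarrow> 0" by real_asymp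
  ultimately have "(\<lambda>M. - (ln (real M) - (\<Sum>n<M. inverse (\<beta> + 1 + real n))) - (harm (M + k) - ln (real (M + k))) - (ln (real (M + k)) - ln (real M)))
    \<longlonglongrightarrow> - Digamma (\<beta> + 1) - euler_mascheroni - 0" by (intro tendsto_diff tendsto_minus)
  moreover have "- (ln (real M) - (\<Sum>n<M. inverse (\<beta> + 1 + real n))) - (harm (M + k) - ln (real (M + k))) - (ln (real (M + k)) - ln (real M))
    = (\<Sum>l<M + Suc k. shift_diff k \<beta> 1 l)" for M
  proof -
    have "(real i + (\<beta> + 1)) powr (-1) = inverse (\<beta> + 1 + real i)" for i
      using \<beta> by (simp add: powr_minus add_ac)
    hence "(\<Sum>l<M + Suc k. shifted_pw k \<beta> 1 l) = (\<Sum>n<M. inverse (\<beta> + 1 + real n))"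
      unfolding shifted_pw_partial_sum(1) by simp
    thus ?thesis unfolding shift_diff_def sum_subtractf using h[of "M + k"] by simp
  qed
  ultimately have "(\<lambda>M. \<Sum>l<M + Suc k. shift_diff k \<beta> 1 l) \<longlonglongrightarrow> - Digamma (\<beta> + 1) - euler_mascheroni - 0" by (simp only:)
  from LIMSEQ_unique[OF 1 this] show ?thesis by (simp add: ext_harm_def)
qed

lemma sin_shift: "sin (2 * r - pi * (real (k + n) + real k) / 2) = (-1) ^ k * sn n r"
proof -
  have "2 * r - pi * (real (k + n) + real k) / 2 = (2 * r - real n * pi / 2) - real k * pi" by (simp add: field_simps)
  hence "sin (2 * r - pi * (real (k + n) + real k) / 2) = sin (2 * r - real n * pi / 2) * cos (real k * pi) - cos (2 * r - real n * pi / 2) * sin (real k * pi)"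
    by (simp only: sin_diff)
  thus ?thesis by (simp add: sn_def cos_npi sin_npi)
qed

lemma neg_one_power_mult_self: "(-1) ^ k * ((-1) ^ k * x) = (x :: real)"
  by (simp add: mult.assoc[symmetric] power_mult_distrib[symmetric])

section \<open>The expansion for the different ranges of the exponent\<close>

lemma bessel_sum_leading_terms:
  assumes \<alpha>: "\<alpha> > 0" "\<alpha> \<noteq> 1" and \<beta>: "\<beta> > -1"
    and A: "(\<lambda>M. (\<Sum>l<M. pw \<alpha> l) - real M powr (1 - \<alpha>) / (1 - \<alpha>)) \<longlonglongrightarrow> A"
  shows "(c2 \<alpha> \<beta> (real n) + c3 \<alpha> \<beta> * sin (2 * r - pi * (real (k + n) + real k) / 2)) / r
    = blead n A (\<Sum>l. (-1) ^ l * pw \<alpha> l) r + blead n (\<Sum>l. shift_diff k \<beta> \<alpha> l) (\<Sum>l. (-1) ^ l * shift_diff k \<beta> \<alpha> l) r"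
proof -
  define B where "B = (\<Sum>l. (-1) ^ l * pw \<alpha> l) + (\<Sum>l. (-1) ^ l * shift_diff k \<beta> \<alpha> l)"
  have "c3 \<alpha> \<beta> * sin (2 * r - pi * (real (k + n) + real k) / 2) = sn n r * B / pi"
  proof -
    have "c3 \<alpha> \<beta> * sin (2 * r - pi * (real (k + n) + real k) / 2) = ((-1) ^ k * ((-1) ^ k * (sn n r * B))) / pi"
      unfolding c3_eq[OF \<alpha>(1) \<beta>, of k] sin_shift B_def by simp
    thus ?thesis unfolding neg_one_power_mult_self .
  qed
  moreover have "c2 \<alpha> \<beta> (real n) = cn n * (A + (\<Sum>l. shift_diff k \<beta> \<alpha> l)) / pi"
    unfolding shifted_zeta[OF \<alpha> \<beta> A] by (simp add: c2_def cn_def mult.commute)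
  ultimately show ?thesis unfolding blead_add[symmetric] B_def[symmetric] by (simp add: blead_def add_divide_distrib)
qed

text \<open>Common to all exponents other than 1: the pure power enters through the hypothesis
  \<open>E\<close> and the shift through \<open>berr_expand\<close>, whose exponent
  \<open>\<alpha> + 1\<close> explains the conditions on \<open>\<theta>\<close>.\<close>

lemma bessel_sum_error:
  assumes \<alpha>: "\<alpha> > 0" "\<alpha> \<noteq> 1" and \<beta>: "\<beta> > -1"
    and A: "(\<lambda>M. (\<Sum>l<M. pw \<alpha> l) - real M powr (1 - \<alpha>) / (1 - \<alpha>)) \<longlonglongrightarrow> A"
    and E: "(\<lambda>r. bsum n (pw \<alpha>) r - c * r powr (-\<alpha>) - blead n A (\<Sum>l. (-1) ^ l * pw \<alpha> l) r) \<in> O[at_top](\<lambda>r. r powr (-\<theta>))"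
    and \<theta>: "1 < \<theta>" "\<theta> \<le> 2" "\<theta> \<le> \<alpha> + 1" "\<theta> = 2 \<Longrightarrow> \<alpha> > 1"
  shows "(\<lambda>r. bessel_sum \<alpha> \<beta> (k + n) k r
      - (c / r powr \<alpha> + (c2 \<alpha> \<beta> (real n) + c3 \<alpha> \<beta> * sin (2 * r - pi * (real (k + n) + real k) / 2)) / r))
    \<in> O[at_top](\<lambda>r. 1 / r powr \<theta>)"
proof -
  have "berr n (shift_diff k \<beta> \<alpha>) \<in> O[at_top](\<lambda>r. r powr (-\<theta>))"
    by (rule berr_expand[OF shift_diff_bigo]) (use \<theta> in auto)
  from sum_in_bigo(1)[OF E this]
  have "(\<lambda>r. bsum n (pw \<alpha>) r - c * r powr (-\<alpha>) - blead n A (\<Sum>l. (-1) ^ l * pw \<alpha> l) r + berr n (shift_diff k \<beta> \<alpha>) r)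
    \<in> O[at_top](\<lambda>r. r powr (-\<theta>))" .
  thus ?thesis
    unfolding bessel_sum_leading_terms[OF \<alpha> \<beta> A] bessel_sum_eq[OF \<alpha>(1) \<beta>] berr_def powr_minus_divide
    by (simp add: algebra_simps)
qed

lemma pw_sum_limit:
  assumes "\<alpha> > 1"
  shows "(\<lambda>M. (\<Sum>l<M. pw \<alpha> l) - real M powr (1 - \<alpha>) / (1 - \<alpha>)) \<longlonglongrightarrow> (\<Sum>l. pw \<alpha> l)"
proof -
  have "(\<lambda>M. real M powr (1 - \<alpha>)) \<longlonglongrightarrow> 0" using assms by real_asymp
  hence "(\<lambda>M. (\<Sum>l<M. pw \<alpha> l) - real M powr (1 - \<alpha>) / (1 - \<alpha>)) \<longlonglongrightarrow> (\<Sum>l. pw \<alpha> l) - 0 / (1 - \<alpha>)"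
    using assms by (intro tendsto_intros summable_LIMSEQ bigo_summable(2)[OF pw_bigo]) auto
  thus ?thesis by simp
qed

text \<open>Below 1 the differential equation is used, between 1 and 2 one descent to it. Beyond 2
  the term with \<open>c1\<close> is itself \<open>O(r powr (-2))\<close> and may be inserted
  freely.\<close>

lemma bessel_sum_asymp_nonint:
  assumes \<alpha>: "\<alpha> > 0" "\<alpha> \<notin> \<nat>" and \<beta>: "\<beta> > -1"
  shows "(\<lambda>r. bessel_sum \<alpha> \<beta> (k + n) k r
      - (c1 \<alpha> (real n) / r powr \<alpha> + (c2 \<alpha> \<beta> (real n) + c3 \<alpha> \<beta> * sin (2 * r - pi * (real (k + n) + real k) / 2)) / r))
    \<in> O[at_top](\<lambda>r. 1 / r powr (min (\<alpha> + 1) 2))"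
proof -
  have ne: "\<alpha> \<noteq> 1" "\<alpha> \<noteq> 2" using \<alpha>(2) by auto
  consider "\<alpha> < 1" | "1 < \<alpha>" "\<alpha> < 2" | "\<alpha> > 2" using ne by linarith
  thus ?thesis
  proof cases
    case 1
    have "min (\<alpha> + 1) 2 = \<alpha> + 1" using 1 by simp
    thus ?thesis using 1 \<alpha>(1) ne
      by (simp only:) (rule bessel_sum_error[OF \<alpha>(1) ne(1) \<beta> ode_rhs_sum(2)[OF \<alpha>(1) ne(1)] bsum_pw_low_c1], auto)
  next
    case 2
    have "min (\<alpha> + 1) 2 = 2" using 2 by simp
    thus ?thesis using 2
      by (simp only:) (rule bessel_sum_error[OF \<alpha>(1) ne(1) \<beta> pw_sum_limit bsum_pw_mid_c1], auto)
  next
    case 3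
    have "berr n (pw \<alpha>) \<in> O[at_top](\<lambda>r. r powr (-2))" by (rule berr_pw) (use 3 in auto)
    moreover have "(\<lambda>r::real. c1 \<alpha> (real n) * r powr (-\<alpha>)) \<in> O[at_top](\<lambda>r. r powr (-2))"
    proof -
      have "(\<lambda>r::real. r powr (-\<alpha>)) \<in> O[at_top](\<lambda>r. r powr (-2))"
        by (rule bigo_at_top_weaken[of _ \<alpha>]) (use 3 in auto)
      thus ?thesis by simp
    qed
    ultimately have "(\<lambda>r. berr n (pw \<alpha>) r - c1 \<alpha> (real n) * r powr (-\<alpha>)) \<in> O[at_top](\<lambda>r. r powr (-2))" by (rule sum_in_bigo(2))
    hence E: "(\<lambda>r. bsum n (pw \<alpha>) r - c1 \<alpha> (real n) * r powr (-\<alpha>) - blead n (\<Sum>l. pw \<alpha> l) (\<Sum>l. (-1) ^ l * pw \<alpha> l) r) \<in> O[at_top](\<lambda>r. r powr (-2))"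
      by (simp add: berr_def algebra_simps)
    have "min (\<alpha> + 1) 2 = 2" using 3 by simp
    thus ?thesis using 3
      by (simp only:) (rule bessel_sum_error[OF \<alpha>(1) ne(1) \<beta> pw_sum_limit E], auto)
  qed
qed

lemma bessel_sum_asymp_int:
  assumes \<alpha>: "\<alpha> \<in> \<nat>" "\<alpha> > 1" and \<beta>: "\<beta> > -1" and \<gamma>: "\<gamma> > 0"
  shows "(\<lambda>r. bessel_sum \<alpha> \<beta> (k + n) k r
      - (c2 \<alpha> \<beta> (real n) + c3 \<alpha> \<beta> * sin (2 * r - pi * (real (k + n) + real k) / 2)) / r)
    \<in> O[at_top](\<lambda>r. 1 / r powr (2 - \<gamma>))"
proof -
  obtain a :: nat where "\<alpha> = real a" using \<alpha>(1) by (auto elim: Nats_cases)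
  hence a2: "\<alpha> \<ge> 2" using \<alpha>(2) by simp
  \<comment> \<open>\<open>\<gamma>\<close> may be large, so the exponent is kept above 1; it stays
    below 2 to avoid the borderline \<open>\<alpha> = 2\<close>.\<close>
  define \<theta> where "\<theta> = max (3 / 2) (2 - \<gamma>)"
  have \<theta>: "1 < \<theta>" "\<theta> < 2" "2 - \<gamma> \<le> \<theta>" using \<gamma> by (auto simp: \<theta>_def)
  have "berr n (pw \<alpha>) \<in> O[at_top](\<lambda>r. r powr (-\<theta>))" by (rule berr_pw) (use \<theta> a2 in auto)
  hence E: "(\<lambda>r. bsum n (pw \<alpha>) r - 0 * r powr (-\<alpha>) - blead n (\<Sum>l. pw \<alpha> l) (\<Sum>l. (-1) ^ l * pw \<alpha> l) r) \<in> O[at_top](\<lambda>r. r powr (-\<theta>))"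
    by (simp add: berr_def[abs_def])
  have "(\<lambda>r. bessel_sum \<alpha> \<beta> (k + n) k r
      - (0 / r powr \<alpha> + (c2 \<alpha> \<beta> (real n) + c3 \<alpha> \<beta> * sin (2 * r - pi * (real (k + n) + real k) / 2)) / r))
    \<in> O[at_top](\<lambda>r. 1 / r powr \<theta>)"
    by (rule bessel_sum_error[OF _ _ \<beta> pw_sum_limit[OF \<alpha>(2)] E]) (use \<theta> a2 in auto)
  hence "(\<lambda>r. bessel_sum \<alpha> \<beta> (k + n) k r
      - (c2 \<alpha> \<beta> (real n) + c3 \<alpha> \<beta> * sin (2 * r - pi * (real (k + n) + real k) / 2)) / r)
    \<in> O[at_top](\<lambda>r. r powr (-\<theta>))" by (simp add: powr_minus_divide)
  from bigo_at_top_weaken[OF this \<theta>(3)] show ?thesis by (simp only: powr_minus_divide)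
qed

lemma bessel_sum_asymp_one:
  assumes \<beta>: "\<beta> > -1"
  shows "(\<lambda>r. bessel_sum 1 \<beta> (k + n) k r
      - (c4 (real n) * ln r / r + (c5 \<beta> (real n) + c3 1 \<beta> * sin (2 * r - pi * (real (k + n) + real k) / 2)) / r))
    \<in> o[at_top](\<lambda>r. 1 / r)"
proof (rule smalloI_tendsto)
  define A where "A = (\<Sum>l. (-1) ^ l * pw 1 l)"
  define D where "D = (\<Sum>l. (-1) ^ l * shift_diff k \<beta> 1 l)"
  obtain K where K: "\<And>n. ((\<lambda>r. r * bsum n (pw 1) r - cn n / pi * ln r - sn n r * (\<Sum>l. (-1) ^ l * pw 1 l) / pi) \<longlongrightarrow> K n) at_top"
    by (rule bsum_pw_one_limit) (rule that)
  have Kn: "K n = 1 / pi * (- cn n * (Digamma ((real n + 1) / 2) + ln 2) + pi / 2 * sin (real n * pi / 2))"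
    by (rule log_limit[OF K])
  have 1: "((\<lambda>r. r * bsum n (shift_diff k \<beta> 1) r - (cn n * (\<Sum>l. shift_diff k \<beta> 1 l) + sn n r * D) / pi) \<longlongrightarrow> 0) at_top"
    unfolding D_def by (rule berr_times_r_tendsto[OF shift_diff_bigo]) simp
  have "((\<lambda>r. (r * bsum n (pw 1) r - cn n / pi * ln r - sn n r * A / pi)
      + (r * bsum n (shift_diff k \<beta> 1) r - (cn n * (\<Sum>l. shift_diff k \<beta> 1 l) + sn n r * D) / pi) - K n) \<longlongrightarrow> K n + 0 - K n) at_top"
    unfolding A_def by (intro tendsto_add tendsto_diff tendsto_const K 1)
  thus "((\<lambda>r. (bessel_sum 1 \<beta> (k + n) k r
      - (c4 (real n) * ln r / r + (c5 \<beta> (real n) + c3 1 \<beta> * sin (2 * r - pi * (real (k + n) + real k) / 2)) / r)) / (1 / r)) \<longlongrightarrow> 0) at_top"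
  proof (rule tendsto_at_top_cong)
    fix r :: real assume r: "r > 0"
    have c3: "c3 1 \<beta> * sin (2 * r - pi * (real (k + n) + real k) / 2) = sn n r * (A + D) / pi"
    proof -
      have "c3 1 \<beta> * sin (2 * r - pi * (real (k + n) + real k) / 2) = ((-1) ^ k * ((-1) ^ k * (sn n r * (A + D)))) / pi"
        unfolding c3_eq[OF zero_less_one \<beta>, of k] sin_shift A_def D_def by simp
      thus ?thesis unfolding neg_one_power_mult_self .
    qed
    \<comment> \<open>The limit \<open>K n\<close> supplies the digamma and sine terms, the shift
      supplies the extended harmonic number.\<close>
    have c5: "c5 \<beta> (real n) = K n + cn n * (\<Sum>l. shift_diff k \<beta> 1 l) / pi"
    proof -
      have t: "cos (pi * real n / 2) = cn n" "sin (pi * real n / 2) = sin (real n * pi / 2)" "\<bar>real n\<bar> = real n"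
        by (simp_all add: cn_def mult.commute)
      have "1 / pi * (- c * (e + d + l) + s) = 1 / pi * (- c * (d + l) + s) + c * (- e) / pi" for c d e l s :: real
        by (simp add: field_simps)
      thus ?thesis unfolding Kn shift_diff_harmonic[OF \<beta>] c5_def t .
    qed
    have c4: "c4 (real n) = cn n / pi" by (simp add: c4_def cn_def mult.commute)
    have e: "(x - (a * l / r + b / r)) / (1 / r) = r * x - a * l - b" for x a l b
      using r by (simp add: field_simps)
    show "(r * bsum n (pw 1) r - cn n / pi * ln r - sn n r * A / pi)
      + (r * bsum n (shift_diff k \<beta> 1) r - (cn n * (\<Sum>l. shift_diff k \<beta> 1 l) + sn n r * D) / pi) - K n
      = (bessel_sum 1 \<beta> (k + n) k r
      - (c4 (real n) * ln r / r + (c5 \<beta> (real n) + c3 1 \<beta> * sin (2 * r - pi * (real (k + n) + real k) / 2)) / r)) / (1 / r)"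
      unfolding c3 c4 c5 bessel_sum_eq[OF zero_less_one \<beta>] e by (simp add: algebra_simps add_divide_distrib)
  qed simp
  show "\<forall>\<^sub>F r::real in at_top. 1 / r \<noteq> 0" using eventually_gt_at_top[of "0::real"] by eventually_elim simp
qed

lemma bessel_sum_commute: "bessel_sum \<alpha> \<beta> m m' r = bessel_sum \<alpha> \<beta> m' m r"
  unfolding bessel_sum_def by (simp add: mult.commute)

theorem theorem1p2:
  fixes \<beta> \<mu> \<nu> :: real and m m' :: nat
  assumes "\<beta> > -1"
    and "\<mu> = real m + real m'"
    and "\<nu> = real m - real m'"
  shows "(\<forall>\<alpha>::real. \<alpha> > 0 \<and> \<alpha> \<notin> \<nat> \<longrightarrow>
            (\<lambda>r::real. bessel_sum \<alpha> \<beta> m m' r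
               - (c1 \<alpha> \<nu> / r powr \<alpha> + (c2 \<alpha> \<beta> \<nu> + c3 \<alpha> \<beta> * sin (2 * r - pi * \<mu> / 2)) / r))
            \<in> O[at_top](\<lambda>r. 1 / r powr (min (\<alpha> + 1) 2)))
       \<and> (\<lambda>r::real. bessel_sum 1 \<beta> m m' r
               - (c4 \<nu> * ln r / r + (c5 \<beta> \<nu> + c3 1 \<beta> * sin (2 * r - pi * \<mu> / 2)) / r))
            \<in> o[at_top](\<lambda>r. 1 / r)
       \<and> (\<forall>\<alpha>::real. \<alpha> \<in> \<nat> \<and> \<alpha> > 1 \<longrightarrow> (\<forall>\<gamma>::real. \<gamma> > 0 \<longrightarrow>
            (\<lambda>r::real. bessel_sum \<alpha> \<beta> m m' r
               - (c2 \<alpha> \<beta> \<nu> + c3 \<alpha> \<beta> * sin (2 * r - pi * \<mu> / 2)) / r)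
            \<in> O[at_top](\<lambda>r. 1 / r powr (2 - \<gamma>))))"
proof -
  \<comment> \<open>The series is symmetric in \<open>m\<close> and \<open>m'\<close>, so the
    smaller one becomes the shift \<open>k\<close> and the distance becomes the order
    \<open>n\<close>.\<close>
  define k where "k = min m m'"
  define n where "n = max m m' - k"
  have b: "bessel_sum \<alpha> \<beta> m m' r = bessel_sum \<alpha> \<beta> (k + n) k r" for \<alpha> r
  proof (cases "m' \<le> m")
    case False
    thus ?thesis unfolding bessel_sum_commute[of \<alpha> \<beta> m m' r] by (simp add: k_def n_def)
  qed (simp add: k_def n_def)
  have mu: "\<mu> = real (k + n) + real k" using assms(2) by (auto simp: k_def n_def)
  \<comment> \<open>All constants are even in \<open>\<nu>\<close>, so the sign of
    \<open>m - m'\<close> is immaterial.\<close>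
  have "\<nu> = real n \<or> \<nu> = - real n" using assms(3) by (auto simp: k_def n_def)
  hence c: "c1 \<alpha> \<nu> = c1 \<alpha> (real n)" "c2 \<alpha> \<beta> \<nu> = c2 \<alpha> \<beta> (real n)" "c4 \<nu> = c4 (real n)" "c5 \<beta> \<nu> = c5 \<beta> (real n)" for \<alpha>
    by (auto simp: c1_def c2_def c4_def c5_def mult_ac)
  show ?thesis unfolding b mu c
    using bessel_sum_asymp_nonint[OF _ _ assms(1)] bessel_sum_asymp_one[OF assms(1)] bessel_sum_asymp_int[OF _ _ assms(1)] by blast
qed

end
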